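(* Let $\Omega$ be a domain in the complex plane $\mathbb{C}$, let $p$ be a real number with $p>0$, and let $K\ge 1$. Let $\mathcal{F}$ be a family of $K$-quasiregular mappings $f:\Omega\to\mathbb{C}$ which is uniformly bounded in $L^p(\Omega)$, i.e. there is $M<\infty$ such that $\left(\int_\Omega |f(z)|^p\,dm(z)\right)^{1/p}\le M$ for all $f\in\mathcal{F}$. Then the family $\mathcal{F}$ is precompact: every sequence in $\mathcal{F}$ contains a subsequence converging locally uniformly in $\Omega$, and each limit function is $K$-quasiregular (possibly constant) with values in $\mathbb{C}$.
   Context: $m$ denotes Lebesgue area measure on $\mathbb{C}$. For $K\ge1$, a mapping $f:\Omega\to\mathbb{C}$ of a domain $\Omega\subset\mathbb{C}$ is $K$-quasiregular if it is continuous, belongs to $W^{1,2}_{\mathrm{loc}}(\Omega)$, and satisfies $|f_{\bar z}|\le \frac{K-1}{K+1}|f_z|$ almost everywhere in $\Omega$, where $f_z=\frac12(f_x-if_y)$ and $f_{\bar z}=\frac12(f_x+if_y)$; constant maps are allowed. For $0<p<1$ the quantity $\left(\int_\Omega|f|^p\,dm\right)^{1/p}$ is still used although it is not a norm. *)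

theory Defs
  imports "HOL-Analysis.Analysis"
begin

definition dir_deriv :: "complex \<Rightarrow> (complex \<Rightarrow> real) \<Rightarrow> complex \<Rightarrow> real" where
  "dir_deriv e \<phi> = (\<lambda>z. frechet_derivative \<phi> (at z) e)"

text \<open>
  All iterated partial derivatives exist and are totally differentiable (hence continuous),
  i.e. \<open>\<phi>\<close> is infinitely often continuously differentiable as a function of two real variables.
\<close>
definition smooth :: "(complex \<Rightarrow> real) \<Rightarrow> bool" where
  "smooth \<phi> \<longleftrightarrow>
     (\<forall>es. set es \<subseteq> {1, \<i>} \<longrightarrow> (\<forall>z. foldr dir_deriv es \<phi> differentiable (at z)))"

text \<open>
  Real-valued test functions suffice: by linearity they give the same weak derivatives as
  complex-valued ones.
\<close>
definition test_function :: "complex set \<Rightarrow> (complex \<Rightarrow> real) \<Rightarrow> bool" where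
  "test_function \<Omega> \<phi> \<longleftrightarrow>
     smooth \<phi> \<and> compact (closure {z. \<phi> z \<noteq> 0}) \<and> closure {z. \<phi> z \<noteq> 0} \<subseteq> \<Omega>"

definition L2_loc :: "complex set \<Rightarrow> (complex \<Rightarrow> complex) \<Rightarrow> bool" where
  "L2_loc \<Omega> g \<longleftrightarrow> set_borel_measurable lebesgue \<Omega> g \<and>
     (\<forall>C. compact C \<and> C \<subseteq> \<Omega> \<longrightarrow> set_integrable lebesgue C (\<lambda>z. (cmod (g z))\<^sup>2))"

text \<open>
  For \<open>f\<close> and \<open>g\<close> in \<open>L2_loc \<Omega>\<close> both integrands below are integrable, so the equation is
  not affected by the convention that non-integrable functions have integral zero.
\<close>
definition weak_deriv ::
  "complex set \<Rightarrow> complex \<Rightarrow> (complex \<Rightarrow> complex) \<Rightarrow> (complex \<Rightarrow> complex) \<Rightarrow> bool" where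
  "weak_deriv \<Omega> e f g \<longleftrightarrow> (\<forall>\<phi>. test_function \<Omega> \<phi> \<longrightarrow>
     (LINT z:\<Omega>|lebesgue. dir_deriv e \<phi> z *\<^sub>R f z) = - (LINT z:\<Omega>|lebesgue. \<phi> z *\<^sub>R g z))"

text \<open>
  Membership of \<open>f\<close> in the local Sobolev space \<open>W\<^sup>1\<^sup>,\<^sup>2\<close> of \<open>\<Omega>\<close>, with \<open>fx\<close> and \<open>fy\<close> as
  representatives of its weak partial derivatives.
\<close>
definition W12_loc_partials ::
  "complex set \<Rightarrow> (complex \<Rightarrow> complex) \<Rightarrow> (complex \<Rightarrow> complex) \<Rightarrow> (complex \<Rightarrow> complex) \<Rightarrow> bool"
where
  "W12_loc_partials \<Omega> f fx fy \<longleftrightarrow>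
     L2_loc \<Omega> f \<and> L2_loc \<Omega> fx \<and> L2_loc \<Omega> fy \<and> weak_deriv \<Omega> 1 f fx \<and> weak_deriv \<Omega> \<i> f fy"

text \<open>
  Weak derivatives are unique almost everywhere, so it does not matter which representatives
  are chosen. Values of \<open>f\<close> outside \<open>\<Omega>\<close> are irrelevant.
\<close>
definition quasiregular_on :: "real \<Rightarrow> complex set \<Rightarrow> (complex \<Rightarrow> complex) \<Rightarrow> bool" where
  "quasiregular_on K \<Omega> f \<longleftrightarrow> continuous_on \<Omega> f \<and>
     (\<exists>fx fy. W12_loc_partials \<Omega> f fx fy \<and>
        (AE z in lebesgue. z \<in> \<Omega> \<longrightarrow>
           cmod ((fx z + \<i> * fy z) / 2) \<le> (K - 1) / (K + 1) * cmod ((fx z - \<i> * fy z) / 2)))"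

definition loc_uniform_limit ::
  "complex set \<Rightarrow> (nat \<Rightarrow> complex \<Rightarrow> complex) \<Rightarrow> (complex \<Rightarrow> complex) \<Rightarrow> bool" where
  "loc_uniform_limit \<Omega> s g \<longleftrightarrow>
     (\<forall>z\<in>\<Omega>. \<exists>U. open U \<and> z \<in> U \<and> U \<subseteq> \<Omega> \<and> uniform_limit U s g sequentially)"

end

theory Submission
  imports Defs "HOL-Complex_Analysis.Great_Picard"
begin

text \<open>With \<open>\<kappa> = K + 1 / K\<close>, \<open>K\<close>-quasiregularity means \<open>|f_x|^2 + |f_y|^2 \<le> \<kappa> J\<close> almost everywhere, where
  the Jacobian \<open>J = Re f_x Im f_y - Im f_x Re f_y\<close> is a null Lagrangian: against a test function it
  integrates by parts to a term linear in the derivatives of \<open>f\<close>. Green's formula on a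
  rectangle between two concentric squares, its sides chosen by averaging so that they carry little energy,
  yields a hole-filling inequality, hence geometric decay of the energy; a polynomial cut-off yields the
  Caccioppoli inequality. Telescoping mollifications at dyadic scales (Morrey's argument) turns
  energy decay into a modulus of continuity and an \<open>L^2\<close> sup bound, which extends to every
  \<open>L^p\<close>. So the family is locally bounded and equicontinuous, and Arzela--Ascoli gives the subsequence.

  For closedness under locally uniform limits, the midpoint hulls of the tails of the gradients, which
  are bounded in \<open>L^2\<close> locally, contain a strongly convergent sequence (parallelogram law). Its limit
  is the weak gradient of the limit map. The energy is convex and \<open>J\<close> passes to the limit when it is
  integrated by parts against a test function, so the distortion inequality survives.\<close>

section \<open>Smooth functions of one variable and tensor products\<close>

text \<open>A test function here is one whose iterated partial derivatives are all totally
  differentiable, so an explicit class is needed for which this can be verified: products of a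
  smooth function of the real part and one of the imaginary part. Their supports are rectangles.
  Hence mollifiers are tensor products, integration by parts is Fubini plus the one-variable
  fundamental theorem, and squares replace discs throughout. Inequalities for Sobolev maps are
  reached by mollification: energy and Jacobian are quadratic in the gradient, so L^2 closeness of
  gradients gives L^1 closeness of both. Averages at consecutive scales are compared through the
  definition of the weak derivative itself, because the difference of the two kernels is a sum of
  first derivatives of test functions. The obstacle in the closing step is that the Jacobian is not
  convex in the gradient, so an inequality for each gradient says nothing about averages of
  gradients; the coefficients of its integrated form must first be frozen at the limit map.
  Constants are always fixed before the domain and the map are, since uniformity over the family is
  the point.\<close>

primrec Cn :: "nat \<Rightarrow> (real \<Rightarrow> real) \<Rightarrow> bool" where
  "Cn 0 h = True"
| "Cn (Suc n) h = (\<exists>h'. (\<forall>t. (h has_real_derivative h' t) (at t)) \<and> Cn n h')"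

text \<open>\<open>Cn 0\<close> asks nothing, not even continuity; smoothness comes from the
  quantifier over all orders. The finite levels are there for induction: the product rule at order n
  + 1 uses the undifferentiated factors at order n, hence \<open>Cn_Suc_D\<close>.\<close>

definition smooth1 :: "(real \<Rightarrow> real) \<Rightarrow> bool" where
  "smooth1 h \<longleftrightarrow> (\<forall>n. Cn n h)"

lemma smooth1_derivE:
  assumes "smooth1 h"
  obtains h' where "\<And>t. (h has_real_derivative h' t) (at t)" "smooth1 h'"
proof -
  have "Cn (Suc 0) h" using assms by (simp only: smooth1_def)
  then obtain h' where h': "\<And>t. (h has_real_derivative h' t) (at t)" by auto
  have "Cn n h'" for n
  proof -
    have "Cn (Suc n) h" using assms by (simp only: smooth1_def)
    then obtain k where k: "\<And>t. (h has_real_derivative k t) (at t)" "Cn n k" by auto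
    have "k = h'" using DERIV_unique[OF k(1) h'] by blast
    with k show ?thesis by simp
  qed
  with h' that show ?thesis by (auto simp: smooth1_def)
qed

lemma smooth1I:
  assumes "\<And>t. (h has_real_derivative h' t) (at t)" "smooth1 h'"
  shows "smooth1 h"
proof -
  have "Cn n h" for n
    using assms by (cases n) (auto simp: smooth1_def)
  then show ?thesis by (simp add: smooth1_def)
qed

lemma smooth1_deriv:
  assumes "smooth1 h" "\<And>t. (h has_real_derivative h' t) (at t)"
  shows "smooth1 h'"
proof -
  obtain k where k: "\<And>t. (h has_real_derivative k t) (at t)" "smooth1 k"
    using smooth1_derivE[OF assms(1)] by blast
  have "k = h'" using DERIV_unique[OF k(1) assms(2)] by blast
  with k show ?thesis by simp
qed

lemma Cn_Suc_D: "Cn (Suc n) h \<Longrightarrow> Cn n h"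
proof (induction n arbitrary: h)
  case (Suc n)
  from Suc.prems obtain h' where "\<And>t. (h has_real_derivative h' t) (at t)" "Cn (Suc n) h'"
    unfolding Cn.simps(2)[of "Suc n"] by blast
  with Suc.IH[of h'] show ?case unfolding Cn.simps(2)[of n] by blast
qed simp

lemma Cn_add: "Cn n h \<Longrightarrow> Cn n k \<Longrightarrow> Cn n (\<lambda>t. h t + k t)"
proof (induction n arbitrary: h k)
  case (Suc n)
  from Suc.prems(1) obtain h' where h': "\<And>t. (h has_real_derivative h' t) (at t)" "Cn n h'" by auto
  from Suc.prems(2) obtain k' where k': "\<And>t. (k has_real_derivative k' t) (at t)" "Cn n k'" by auto
  have "((\<lambda>t. h t + k t) has_real_derivative h' t + k' t) (at t)" for t
    by (intro DERIV_add h' k')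
  with Suc.IH[OF h'(2) k'(2)] show ?case by (auto intro!: exI[of _ "\<lambda>t. h' t + k' t"])
qed simp

lemma Cn_mult: "Cn n h \<Longrightarrow> Cn n k \<Longrightarrow> Cn n (\<lambda>t. h t * k t)"
proof (induction n arbitrary: h k)
  case (Suc n)
  from Suc.prems(1) obtain h' where h': "\<And>t. (h has_real_derivative h' t) (at t)" "Cn n h'" by auto
  from Suc.prems(2) obtain k' where k': "\<And>t. (k has_real_derivative k' t) (at t)" "Cn n k'" by auto
  have hk: "Cn n h" "Cn n k"
    using Suc.prems Cn_Suc_D by blast+
  have "Cn n (\<lambda>t. h' t * k t + h t * k' t)"
    by (intro Cn_add Suc.IH h' k' hk)
  moreover have "((\<lambda>t. h t * k t) has_real_derivative h' t * k t + h t * k' t) (at t)" for t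
    by (auto intro!: derivative_eq_intros h'(1) k'(1))
  ultimately show ?case by (auto intro!: exI[of _ "\<lambda>t. h' t * k t + h t * k' t"])
qed simp

lemma Cn_affine: "Cn n h \<Longrightarrow> Cn n (\<lambda>t. h (c * t + d))"
proof (induction n arbitrary: h)
  case (Suc n)
  from Suc.prems(1) obtain h' where h': "\<And>t. (h has_real_derivative h' t) (at t)" "Cn n h'" by auto
  have const: "Cn n (\<lambda>_. c)" for n and c :: real
    by (induction n arbitrary: c) (auto intro!: exI[of _ "\<lambda>_. 0"])
  have "Cn n (\<lambda>t. h' (c * t + d) * c)"
    by (rule Cn_mult[OF Suc.IH[OF h'(2)] const])
  moreover have "((\<lambda>t. h (c * t + d)) has_real_derivative h' (c * t + d) * c) (at t)" for t
    by (rule DERIV_chain2[OF h'(1)]) (auto intro!: derivative_eq_intros)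
  ultimately show ?case by (auto intro!: exI[of _ "\<lambda>t. h' (c * t + d) * c"])
qed simp

lemma smooth1_const: "smooth1 (\<lambda>_. c)"
proof -
  have "Cn n (\<lambda>_. c)" for n
    by (induction n arbitrary: c) (auto intro!: exI[of _ "\<lambda>_. 0"])
  then show ?thesis by (simp add: smooth1_def)
qed

lemma smooth1_mult: "smooth1 h \<Longrightarrow> smooth1 k \<Longrightarrow> smooth1 (\<lambda>t. h t * k t)"
  by (simp add: smooth1_def Cn_mult)

lemma smooth1_add: "smooth1 h \<Longrightarrow> smooth1 k \<Longrightarrow> smooth1 (\<lambda>t. h t + k t)"
  by (simp add: smooth1_def Cn_add)

lemma smooth1_affine: "smooth1 h \<Longrightarrow> smooth1 (\<lambda>t. h (c * t + d))"
  by (simp add: smooth1_def Cn_affine)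

lemma smooth1_isCont: "smooth1 h \<Longrightarrow> isCont h t"
  using smooth1_derivE DERIV_isCont by metis

lemma smooth1_continuous_on: "smooth1 h \<Longrightarrow> continuous_on S h"
  by (simp add: continuous_at_imp_continuous_on smooth1_isCont)

section \<open>Flat functions and a smooth step\<close>

definition flat :: "real poly \<Rightarrow> real \<Rightarrow> real" where
  "flat p t = (if t > 0 then poly p (1 / t) * exp (- (1 / t)) else 0)"

lemma poly_times_exp_tendsto_0:
  fixes p :: "real poly"
  shows "((\<lambda>s. poly p s * exp (- s)) \<longlongrightarrow> 0) at_top"
proof -
  have "((\<lambda>s. \<Sum>i\<le>degree p. coeff p i * (s ^ i / exp s)) \<longlongrightarrow> (\<Sum>i\<le>degree p. coeff p i * 0)) at_top"
    by (intro tendsto_sum tendsto_mult tendsto_const tendsto_power_div_exp_0)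
  then show ?thesis
    by (simp add: poly_altdef sum_distrib_right exp_minus divide_inverse mult.assoc)
qed

lemma flat_tendsto_0: "((\<lambda>t. flat p t) \<longlongrightarrow> 0) (at 0)"
proof -
  have "((\<lambda>t. poly p (inverse t) * exp (- inverse t)) \<longlongrightarrow> 0) (at_right 0)"
    using poly_times_exp_tendsto_0 filterlim_inverse_at_top_right by (rule filterlim_compose)
  then have "(flat p \<longlongrightarrow> 0) (at_right 0)"
    by (rule Lim_transform_eventually)
       (auto simp: flat_def eventually_at_filter inverse_eq_divide)
  moreover have "(flat p \<longlongrightarrow> 0) (at_left 0)"
    by (rule Lim_transform_eventually[OF tendsto_const])
       (auto simp: flat_def eventually_at_filter)
  ultimately show ?thesis
    using filterlim_split_at_real by blast
qed

text \<open>With s = 1/t the derivative of p(s) exp(-s) is s^2 (p(s) - p'(s)) exp(-s), again of the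
  form \<open>flat\<close>. This closure is why a polynomial factor is carried along: smoothness
  then follows by induction over all polynomials at once.\<close>

lemma flat_deriv:
  "(flat p has_real_derivative flat ([:0, 0, 1:] * (p - pderiv p)) t) (at t)"
proof -
  consider "t > 0" | "t < 0" | "t = 0" by linarith
  then show ?thesis
  proof cases
    case 1
    have ev: "\<forall>\<^sub>F s in nhds t. flat p s = poly p (1 / s) * exp (- (1 / s))"
      using eventually_nhds_in_open[of "{0<..}" t] 1
      by (auto elim!: eventually_mono simp: flat_def)
    have "((\<lambda>s. poly p (1 / s) * exp (- (1 / s))) has_real_derivative
        flat ([:0, 0, 1:] * (p - pderiv p)) t) (at t)"
      using 1
      by (auto intro!: derivative_eq_intros DERIV_chain2[OF poly_DERIV]
          simp: flat_def power2_eq_square field_simps)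
    then show ?thesis by (rule DERIV_cong_ev[OF refl ev refl, THEN iffD2])
  next
    case 2
    have ev: "\<forall>\<^sub>F s in nhds t. flat p s = 0"
      using eventually_nhds_in_open[of "{..<0}" t] 2
      by (auto elim!: eventually_mono simp: flat_def)
    have "((\<lambda>s. 0) has_real_derivative flat ([:0, 0, 1:] * (p - pderiv p)) t) (at t)"
      using 2 by (simp add: flat_def)
    then show ?thesis by (rule DERIV_cong_ev[OF refl ev refl, THEN iffD2])
  next
    case 3
    \<comment> \<open>The difference quotient at 0 is itself flat, with one more factor 1/t.\<close>
    have eq: "flat ([:0, 1:] * p) h = (flat p (0 + h) - flat p 0) / h" for h
      by (cases "h > 0") (simp_all add: flat_def)
    have "((\<lambda>h. flat ([:0, 1:] * p) h) \<longlongrightarrow> 0) (at 0)"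
      using flat_tendsto_0[of "[:0, 1:] * p"] .
    then have "((\<lambda>h. (flat p (0 + h) - flat p 0) / h) \<longlongrightarrow> 0) (at 0)"
      using eq by simp
    then show ?thesis
      unfolding 3 DERIV_def by (simp add: flat_def)
  qed
qed

lemma smooth1_flat: "smooth1 (flat p)"
proof -
  have "Cn n (flat p)" for n
    by (induction n arbitrary: p) (use flat_deriv in auto)
  then show ?thesis by (simp add: smooth1_def)
qed

text \<open>The bump is a product of two flat functions, positive exactly between -1 and 1, and the
  step is its normalised antiderivative. Both are kept: the end values of the step give the mass of
  the mollifiers, and the step supplies the antiderivatives used in
  \<open>Morrey_step\<close>.\<close>

lemma smooth_step_exists:
  "\<exists>P h :: real \<Rightarrow> real. smooth1 P \<and> smooth1 h \<and> (\<forall>t. (P has_real_derivative h t) (at t)) \<and>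
     (\<forall>t. h t \<ge> 0) \<and> (\<forall>t. \<bar>t\<bar> \<ge> 1 \<longrightarrow> h t = 0) \<and> (\<forall>t\<le>-1. P t = 0) \<and> (\<forall>t\<ge>1. P t = 1)"
proof -
  define B where "B = (\<lambda>t. flat 1 (1 * t + 1) * flat 1 ((-1) * t + 1))"
  have sB: "smooth1 B"
    unfolding B_def by (rule smooth1_mult[OF smooth1_affine[OF smooth1_flat] smooth1_affine[OF smooth1_flat]])
  have B0: "B t \<ge> 0" for t by (simp add: B_def flat_def)
  have Bout: "B t = 0" if "\<bar>t\<bar> \<ge> 1" for t using that by (auto simp: B_def flat_def)
  obtain G where G: "\<And>t. (G has_real_derivative B t) (at t)"
  proof -
    have "\<exists>F. \<forall>x. -\<infinity> < ereal x \<longrightarrow> ereal x < \<infinity> \<longrightarrow> (F has_vector_derivative B x) (at x)"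
      using einterval_antiderivative[of "-\<infinity>" "\<infinity>" B] smooth1_isCont[OF sB] by auto
    then show ?thesis using that by (auto simp: has_real_derivative_iff_has_vector_derivative)
  qed
  have mono: "G s \<le> G t" if "s \<le> t" for s t
    using DERIV_nonneg_imp_nondecreasing[OF that] G B0 by blast
  have lt: "G (-1) < G 1"
  proof -
    have "\<exists>z>-1. z < 1 \<and> G 1 - G (-1) = (1 - (-1)) * B z"
      using MVT2[of "-1" 1 G B] G by auto
    then obtain z where z: "-1 < z" "z < 1" "G 1 - G (-1) = 2 * B z" by auto
    have "B z > 0" using z by (simp add: B_def flat_def)
    then show ?thesis using z by simp
  qed
  define c where "c = 1 / (G 1 - G (-1))"
  have c: "c > 0" using lt by (simp add: c_def)
  define P where "P = (\<lambda>t. c * (G t - G (-1)))"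
  define h where "h = (\<lambda>t. c * B t)"
  have Ph: "(P has_real_derivative h t) (at t)" for t
    unfolding P_def h_def by (auto intro!: derivative_eq_intros G)
  have sh: "smooth1 h" unfolding h_def by (rule smooth1_mult[OF smooth1_const sB])
  have "P t = 0" if "t \<le> -1" for t
  proof -
    have "G t = G (-1)"
    proof (cases "t = -1")
      case False
      then have "t < -1" using that by simp
      have "\<exists>z>t. z < -1 \<and> G (-1) - G t = (-1 - t) * B z"
        using MVT2[of t "-1" G B] G \<open>t < -1\<close> by auto
      then show ?thesis using Bout by auto
    qed simp
    then show ?thesis by (simp add: P_def)
  qed
  moreover have "P t = 1" if "t \<ge> 1" for t
  proof -
    have "G t = G 1"
    proof (cases "t = 1")
      case False
      then have "1 < t" using that by simp
      have "\<exists>z>1. z < t \<and> G t - G 1 = (t - 1) * B z"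
        using MVT2[of 1 t G B] G \<open>1 < t\<close> by auto
      then show ?thesis using Bout by auto
    qed simp
    then show ?thesis using lt by (simp add: P_def c_def)
  qed
  ultimately show ?thesis
    using sh Ph smooth1I[OF Ph sh] B0 Bout c
    by (intro exI[of _ P] exI[of _ h]) (auto simp: h_def)
qed

definition step_bump :: "(real \<Rightarrow> real) \<times> (real \<Rightarrow> real)" where
  "step_bump = (SOME (P, h). smooth1 P \<and> smooth1 h \<and> (\<forall>t. (P has_real_derivative h t) (at t)) \<and>
     (\<forall>t. h t \<ge> 0) \<and> (\<forall>t. \<bar>t\<bar> \<ge> 1 \<longrightarrow> h t = 0) \<and> (\<forall>t\<le>-1. P t = 0) \<and> (\<forall>t\<ge>1. P t = 1))"

definition step :: "real \<Rightarrow> real" where "step = fst step_bump"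
definition bump :: "real \<Rightarrow> real" where "bump = snd step_bump"

lemma
  shows smooth1_step: "smooth1 step" and smooth1_bump: "smooth1 bump"
    and step_deriv: "(step has_real_derivative bump t) (at t)"
    and bump_nonneg: "bump t \<ge> 0"
    and bump_out: "\<bar>t\<bar> \<ge> 1 \<Longrightarrow> bump t = 0"
    and step_left: "t \<le> -1 \<Longrightarrow> step t = 0"
    and step_right: "t \<ge> 1 \<Longrightarrow> step t = 1"
proof -
  define Q where "Q = (\<lambda>(P, h). smooth1 P \<and> smooth1 h \<and> (\<forall>t. (P has_real_derivative h t) (at t)) \<and>
     (\<forall>t. h t \<ge> 0) \<and> (\<forall>t. \<bar>t\<bar> \<ge> 1 \<longrightarrow> h t = 0) \<and> (\<forall>t\<le>-1. P t = 0) \<and> (\<forall>t\<ge>1. P t = (1::real)))"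
  have "\<exists>x. Q x" using smooth_step_exists unfolding Q_def by simp
  then have "Q (step, bump)"
    unfolding step_def bump_def step_bump_def Q_def prod.collapse by (rule someI_ex)
  then have Q: "smooth1 step \<and> smooth1 bump \<and> (\<forall>t. (step has_real_derivative bump t) (at t)) \<and>
     (\<forall>t. bump t \<ge> 0) \<and> (\<forall>t. \<bar>t\<bar> \<ge> 1 \<longrightarrow> bump t = 0) \<and> (\<forall>t\<le>-1. step t = 0) \<and> (\<forall>t\<ge>1. step t = 1)"
    unfolding Q_def prod.case .
  show "smooth1 step" using Q by blast
  show "smooth1 bump" using Q by blast
  show "(step has_real_derivative bump t) (at t)" using Q by blast
  show "bump t \<ge> 0" using Q by blast
  show "\<bar>t\<bar> \<ge> 1 \<Longrightarrow> bump t = 0" using Q by blast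
  show "t \<le> -1 \<Longrightarrow> step t = 0" using Q by blast
  show "t \<ge> 1 \<Longrightarrow> step t = 1" using Q by blast
qed

lemma step_bounds: "0 \<le> step t" "step t \<le> 1"
proof -
  have mono: "step s \<le> step t" if "s \<le> t" for s t
    using DERIV_nonneg_imp_nondecreasing[OF that] step_deriv bump_nonneg by blast
  show "0 \<le> step t"
    using mono[of "min t (-1)" t] step_left[of "min t (-1)"] by auto
  show "step t \<le> 1"
    using mono[of t "max t 1"] step_right[of "max t 1"] by auto
qed

section \<open>Tensor products as test functions\<close>

definition tens :: "(real \<Rightarrow> real) \<Rightarrow> (real \<Rightarrow> real) \<Rightarrow> complex \<Rightarrow> real" where
  "tens H K z = H (Re z) * K (Im z)"

lemma tens_has_derivative:
  assumes "\<And>t. (H has_real_derivative H' t) (at t)" "\<And>t. (K has_real_derivative K' t) (at t)"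
  shows "(tens H K has_derivative (\<lambda>v. H' (Re z) * Re v * K (Im z) + H (Re z) * (K' (Im z) * Im v))) (at z)"
proof -
  have 1: "((\<lambda>z. H (Re z)) has_derivative (\<lambda>v. H' (Re z) * Re v)) (at z)"
    by (rule has_derivative_compose[of Re Re z _ H "\<lambda>v. H' (Re z) * v"])
       (use assms(1)[of "Re z"] in \<open>auto intro!: derivative_eq_intros simp: has_field_derivative_def\<close>)
  have 2: "((\<lambda>z. K (Im z)) has_derivative (\<lambda>v. K' (Im z) * Im v)) (at z)"
    by (rule has_derivative_compose[of Im Im z _ K "\<lambda>v. K' (Im z) * v"])
       (use assms(2)[of "Im z"] in \<open>auto intro!: derivative_eq_intros simp: has_field_derivative_def\<close>)
  show ?thesis
    unfolding tens_def[abs_def] by (rule derivative_eq_intros 1 2 refl)+ (auto simp: algebra_simps)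
qed

lemma dir_deriv_tens:
  assumes "\<And>t. (H has_real_derivative H' t) (at t)" "\<And>t. (K has_real_derivative K' t) (at t)"
  shows "dir_deriv 1 (tens H K) = tens H' K" "dir_deriv \<i> (tens H K) = tens H K'"
  using frechet_derivative_at[OF tens_has_derivative[OF assms], symmetric]
  by (auto simp: dir_deriv_def tens_def fun_eq_iff)

text \<open>Tensor products are closed under both partial derivatives, so by induction every
  iterated partial derivative is again a tensor product of smooth factors, hence totally
  differentiable. All explicit test functions of the proof come from here.\<close>

lemma smooth_tens:
  assumes "smooth1 H" "smooth1 K"
  shows "smooth (tens H K)"
proof -
  have *: "\<exists>H2 K2. smooth1 H2 \<and> smooth1 K2 \<and> foldr dir_deriv es (tens H K) = tens H2 K2"
    if "set es \<subseteq> {1, \<i>}" for es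
    using that
  proof (induction es)
    case Nil
    then show ?case using assms by auto
  next
    case (Cons e es)
    then obtain H2 K2 where 1: "smooth1 H2" "smooth1 K2" "foldr dir_deriv es (tens H K) = tens H2 K2"
      by auto
    obtain H3 where H3: "\<And>t. (H2 has_real_derivative H3 t) (at t)" "smooth1 H3"
      using smooth1_derivE[OF 1(1)] by blast
    obtain K3 where K3: "\<And>t. (K2 has_real_derivative K3 t) (at t)" "smooth1 K3"
      using smooth1_derivE[OF 1(2)] by blast
    from Cons.prems have "e = 1 \<or> e = \<i>" by auto
    then show ?case
      using dir_deriv_tens[OF H3(1) K3(1)] 1 H3(2) K3(2) by auto
  qed
  have **: "tens H K differentiable (at z)" if HK: "smooth1 H" "smooth1 K" for H K z
  proof -
    obtain H3 where H3: "\<And>t. (H has_real_derivative H3 t) (at t)"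
      using smooth1_derivE[OF HK(1)] by blast
    obtain K3 where K3: "\<And>t. (K has_real_derivative K3 t) (at t)"
      using smooth1_derivE[OF HK(2)] by blast
    show ?thesis by (rule differentiableI[OF tens_has_derivative[OF H3 K3]])
  qed
  show ?thesis
    unfolding smooth_def
  proof (intro allI impI)
    fix es z assume "set es \<subseteq> {1, \<i>}"
    from *[OF this] obtain H2 K2 where 3: "smooth1 H2" "smooth1 K2" "foldr dir_deriv es (tens H K) = tens H2 K2"
      by blast
    show "foldr dir_deriv es (tens H K) differentiable (at z)"
      unfolding 3(3) by (rule **[OF 3(1,2)])
  qed
qed

lemma test_function_tens:
  assumes "smooth1 H" "smooth1 K"
    and "\<And>t. t \<notin> {a..b} \<Longrightarrow> H t = 0" "\<And>t. t \<notin> {c..d} \<Longrightarrow> K t = 0"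
    and "cbox (Complex a c) (Complex b d) \<subseteq> \<Omega>"
  shows "test_function \<Omega> (tens H K)"
proof -
  have "{z. tens H K z \<noteq> 0} \<subseteq> cbox (Complex a c) (Complex b d)"
    using assms(3,4) by (auto simp: tens_def in_cbox_complex_iff) (meson atLeastAtMost_iff)+
  then have sub: "closure {z. tens H K z \<noteq> 0} \<subseteq> cbox (Complex a c) (Complex b d)"
    by (rule closure_minimal) (simp add: closed_cbox)
  moreover have "compact (closure {z. tens H K z \<noteq> 0})"
    by (metis bounded_cbox bounded_subset compact_closure closure_subset order_trans sub)
  ultimately show ?thesis
    using assms smooth_tens by (auto simp: test_function_def)
qed

lemma continuous_on_tens:
  assumes "smooth1 H" "smooth1 K"
  shows "continuous_on S (tens H K)"
proof -
  have "continuous_on S Re" "continuous_on S Im"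
    by (rule continuous_on_Re[OF continuous_on_id], rule continuous_on_Im[OF continuous_on_id])
  then have "continuous_on S (\<lambda>z. H (Re z))" "continuous_on S (\<lambda>z. K (Im z))"
    using continuous_on_compose2[OF smooth1_continuous_on[OF assms(1), of UNIV], of S Re]
      continuous_on_compose2[OF smooth1_continuous_on[OF assms(2), of UNIV], of S Im]
    by auto
  then show ?thesis
    unfolding tens_def[abs_def] by (rule continuous_on_mult)
qed

section \<open>Integration over the complex plane\<close>

lemma Complex_eq_scale: "Complex x y = x *\<^sub>R 1 + y *\<^sub>R \<i>"
  by (simp add: complex_eq_iff)

lemma continuous_on_Complex [continuous_intros]:
  "continuous_on S f \<Longrightarrow> continuous_on S g \<Longrightarrow> continuous_on S (\<lambda>x. Complex (f x) (g x))"
  unfolding Complex_eq_scale by (intro continuous_intros)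

lemma borel_measurable_Complex [measurable]:
  "(\<lambda>p. Complex (fst p) (snd p)) \<in> borel_measurable (borel :: (real \<times> real) measure)"
  by (intro borel_measurable_continuous_onI continuous_intros)

text \<open>Lebesgue measure is determined by its values on boxes, and boxes of complex numbers
  correspond to boxes of pairs. This carries Fubini for pairs of reals over to the plane.\<close>

lemma lborel_complex:
  "(lborel :: complex measure) = distr lborel borel (\<lambda>p. Complex (fst p) (snd p))"
proof (rule lborel_eqI)
  fix l u :: complex
  assume le: "\<And>b. b \<in> Basis \<Longrightarrow> l \<bullet> b \<le> u \<bullet> b"
  have le': "Re l \<le> Re u" "Im l \<le> Im u"
    using le[of 1] le[of \<i>] by (auto simp: Basis_complex_def)
  have "(\<lambda>p. Complex (fst p) (snd p)) -` box l u \<inter> space lborel = box (Re l, Im l) (Re u, Im u)"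
    by (auto simp: in_box_complex_iff box_prod mem_box Basis_prod_def)
  then have "emeasure (distr lborel borel (\<lambda>p. Complex (fst p) (snd p))) (box l u)
      = emeasure lborel (box (Re l, Im l) (Re u, Im u))"
    by (subst emeasure_distr) auto
  also have "\<dots> = ennreal ((Re u - Re l) * (Im u - Im l))"
    using le' by (subst emeasure_lborel_box) (auto simp: Basis_prod_def prod.union_disjoint 
        inner_prod_def image_iff prod.reindex inj_on_def)
  finally show "emeasure (distr lborel borel (\<lambda>p. Complex (fst p) (snd p))) (box l u)
      = ennreal (\<Prod>b\<in>Basis. (u - l) \<bullet> b)"
    by (simp add: Basis_complex_def)
qed auto

lemma set_integral_cbox_complex:
  fixes F :: "complex \<Rightarrow> 'b :: euclidean_space"
  assumes "continuous_on (cbox (Complex a c) (Complex b d)) F"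
  shows "(LINT z:cbox (Complex a c) (Complex b d)|lborel. F z)
      = integral {a..b} (\<lambda>x. integral {c..d} (\<lambda>y. F (Complex x y)))"
proof -
  let ?C = "cbox (Complex a c) (Complex b d)"
  have cont: "continuous_on (cbox (a, c) (b, d)) (\<lambda>(x, y). F (Complex x y))"
    unfolding case_prod_beta
    by (rule continuous_on_compose2[OF assms]) (auto intro!: continuous_intros simp: in_cbox_complex_iff)
  have si: "set_integrable lborel ?C F"
    unfolding set_integrable_def by (rule borel_integrable_compact[OF compact_cbox assms])
  then have "(\<lambda>z. indicator ?C z *\<^sub>R F z) \<in> borel_measurable borel"
    unfolding set_integrable_def by (simp add: borel_measurable_integrable)
  then have "(LINT z:?C|lborel. F z) = (LINT p|lborel. indicator ?C (Complex (fst p) (snd p)) *\<^sub>R F (Complex (fst p) (snd p)))"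
    unfolding set_lebesgue_integral_def by (subst lborel_complex) (subst integral_distr, auto)
  also have "\<dots> = (LINT p:cbox (a, c) (b, d)|lborel. F (Complex (fst p) (snd p)))"
    unfolding set_lebesgue_integral_def
    by (rule Bochner_Integration.integral_cong) (auto simp: in_cbox_complex_iff indicator_def)
  also have "\<dots> = integral (cbox (a, c) (b, d)) (\<lambda>(x, y). F (Complex x y))"
    using set_borel_integral_eq_integral(2)[of "cbox (a, c) (b, d)" "\<lambda>p. F (Complex (fst p) (snd p))"]
      borel_integrable_compact[OF compact_cbox cont]
    by (simp add: case_prod_beta' set_integrable_def)
  also have "\<dots> = integral {a..b} (\<lambda>x. integral {c..d} (\<lambda>y. F (Complex x y)))"
    using integral_prod_continuous[OF cont] by simp
  finally show ?thesis .
qed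

lemma integral_swap_complex:
  fixes F :: "complex \<Rightarrow> 'b :: euclidean_space"
  assumes "continuous_on (cbox (Complex a c) (Complex b d)) F"
  shows "integral {a..b} (\<lambda>x. integral {c..d} (\<lambda>y. F (Complex x y)))
      = integral {c..d} (\<lambda>y. integral {a..b} (\<lambda>x. F (Complex x y)))"
proof -
  have "continuous_on (cbox (a, c) (b, d)) (\<lambda>(x, y). F (Complex x y))"
    unfolding case_prod_beta
    by (rule continuous_on_compose2[OF assms]) (auto intro!: continuous_intros simp: in_cbox_complex_iff)
  from integral_swap_continuous[OF this] show ?thesis by simp
qed

definition sq :: "complex \<Rightarrow> real \<Rightarrow> complex set" where
  "sq z r = cbox (z - Complex r r) (z + Complex r r)"

lemma mem_sq: "w \<in> sq z r \<longleftrightarrow> \<bar>Re w - Re z\<bar> \<le> r \<and> \<bar>Im w - Im z\<bar> \<le> r"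
  by (auto simp: sq_def in_cbox_complex_iff)

lemma sq_alt: "sq z r = cbox (Complex (Re z - r) (Im z - r)) (Complex (Re z + r) (Im z + r))"
  by (auto simp: mem_sq in_cbox_complex_iff)

lemma compact_sq [simp]: "compact (sq z r)"
  by (simp add: sq_def)

lemma sets_sq [measurable, simp]: "sq z r \<in> sets borel"
  by (simp add: sq_def)

lemma sq_mono: "r \<le> s \<Longrightarrow> sq z r \<subseteq> sq z s"
  by (auto simp: mem_sq)

lemma sq_subset: "\<bar>Re w - Re z\<bar> + r \<le> s \<Longrightarrow> \<bar>Im w - Im z\<bar> + r \<le> s \<Longrightarrow> sq w r \<subseteq> sq z s"
  by (auto simp: mem_sq)

lemma measure_sq: "r \<ge> 0 \<Longrightarrow> measure lborel (sq z r) = 4 * r\<^sup>2"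
  by (simp add: sq_def measure_lborel_cbox_eq Basis_complex_def power2_eq_square)

lemma emeasure_sq_finite: "emeasure lborel (sq z r) < \<infinity>"
  unfolding sq_def by (rule emeasure_lborel_cbox_finite)

text \<open>Fubini separates the variables and each factor is evaluated by its antiderivative, so
  the mass of a mollifier reduces to the end values of \<open>step\<close>.\<close>

lemma tens_integral:
  assumes "smooth1 H" "smooth1 K"
    and A: "\<And>t. (A has_real_derivative H t) (at t)" and B: "\<And>t. (B has_real_derivative K t) (at t)"
    and out: "\<And>t. t \<notin> {a..b} \<Longrightarrow> H t = 0" "\<And>t. t \<notin> {c..d} \<Longrightarrow> K t = 0"
    and "a \<le> b" "c \<le> d"
  shows "integrable lborel (tens H K)" "(LINT z|lborel. tens H K z) = (A b - A a) * (B d - B c)"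
proof -
  let ?C = "cbox (Complex a c) (Complex b d)"
  have eq: "tens H K = (\<lambda>z. indicator ?C z *\<^sub>R tens H K z)"
    using out by (auto simp: fun_eq_iff indicator_def in_cbox_complex_iff tens_def)
  have cont: "continuous_on ?C (tens H K)" by (rule continuous_on_tens[OF assms(1,2)])
  show "integrable lborel (tens H K)"
    by (subst eq) (rule borel_integrable_compact[OF compact_cbox cont])
  have "(LINT z|lborel. tens H K z) = (LINT z:?C|lborel. tens H K z)"
    unfolding set_lebesgue_integral_def using eq by metis
  also have "\<dots> = integral {a..b} (\<lambda>x. integral {c..d} (\<lambda>y. H x * K y))"
    using set_integral_cbox_complex[OF cont] by (simp add: tens_def)
  also have "\<dots> = integral {a..b} (\<lambda>x. H x * (B d - B c))"
  proof -
    have "(K has_integral (B d - B c)) {c..d}"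
      by (rule fundamental_theorem_of_calculus[OF \<open>c \<le> d\<close>])
         (use B in \<open>auto intro: has_vector_derivative_at_within simp: has_real_derivative_iff_has_vector_derivative\<close>)
    then show ?thesis by (simp add: integral_unique)
  qed
  also have "\<dots> = (A b - A a) * (B d - B c)"
  proof -
    have "(H has_integral (A b - A a)) {a..b}"
      by (rule fundamental_theorem_of_calculus[OF \<open>a \<le> b\<close>])
         (use A in \<open>auto intro: has_vector_derivative_at_within simp: has_real_derivative_iff_has_vector_derivative\<close>)
    then show ?thesis by (simp add: integral_unique)
  qed
  finally show "(LINT z|lborel. tens H K z) = (A b - A a) * (B d - B c)" .
qed

section \<open>Mollification\<close>

definition bmp :: "real \<Rightarrow> real \<Rightarrow> real" where "bmp e t = bump (t / e) / e"

definition moll :: "real \<Rightarrow> complex \<Rightarrow> real" where "moll e = tens (bmp e) (bmp e)"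

lemma smooth1_bmp: "smooth1 (bmp e)"
proof -
  have "smooth1 (\<lambda>t. (1 / e) * bump ((1 / e) * t + 0))"
    by (rule smooth1_mult[OF smooth1_const smooth1_affine[OF smooth1_bump]])
  then show ?thesis by (simp add: bmp_def[abs_def])
qed

lemma bmp_nonneg: "e > 0 \<Longrightarrow> bmp e t \<ge> 0"
  by (simp add: bmp_def bump_nonneg)

lemma bmp_out: "e > 0 \<Longrightarrow> \<bar>t\<bar> \<ge> e \<Longrightarrow> bmp e t = 0"
  by (simp add: bmp_def bump_out)

lemma bmp_antideriv:
  assumes "e > 0" shows "((\<lambda>t. step (t / e)) has_real_derivative bmp e t) (at t)"
proof -
  have "((\<lambda>t. t / e) has_real_derivative 1 / e) (at t)"
    using assms by (auto intro!: derivative_eq_intros)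
  from DERIV_chain2[OF step_deriv this] show ?thesis by (simp add: bmp_def)
qed

lemma bmp_out_refl: "e > 0 \<Longrightarrow> t \<notin> {x - e..x + e} \<Longrightarrow> bmp e (x - t) = 0"
  by (rule bmp_out) auto

lemma bmp_out': "e > 0 \<Longrightarrow> t \<notin> {- e..e} \<Longrightarrow> bmp e t = 0"
  by (rule bmp_out) auto

lemma smooth1_bmp_refl: "smooth1 (\<lambda>t. bmp e (x - t))"
  using smooth1_affine[OF smooth1_bmp, of e "-1" x] by simp

lemma bmp_refl_antideriv:
  assumes "e > 0" shows "((\<lambda>t. - step ((x - t) / e)) has_real_derivative bmp e (x - t)) (at t)"
proof -
  have "((\<lambda>t. (x - t) / e) has_real_derivative - (1 / e)) (at t)"
    using assms by (auto intro!: derivative_eq_intros)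
  from DERIV_minus[OF DERIV_chain2[OF step_deriv this]] show ?thesis by (simp add: bmp_def)
qed

lemma bmp_refl_tens: "moll e (z - w) = tens (\<lambda>t. bmp e (Re z - t)) (\<lambda>t. bmp e (Im z - t)) w"
  by (simp add: moll_def tens_def)

lemma moll_nonneg: "e > 0 \<Longrightarrow> moll e z \<ge> 0"
  by (simp add: moll_def tens_def bmp_nonneg)

lemma moll_out: "e > 0 \<Longrightarrow> w \<notin> sq z e \<Longrightarrow> moll e (z - w) = 0"
  by (auto simp: moll_def tens_def mem_sq bmp_out)

lemma continuous_on_moll: "continuous_on S (moll e)"
  unfolding moll_def by (rule continuous_on_tens[OF smooth1_bmp smooth1_bmp])

lemma measurable_moll [measurable]: "moll e \<in> borel_measurable borel"
  by (rule borel_measurable_continuous_onI[OF continuous_on_moll])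

lemma moll_integral:
  assumes "e > 0"
  shows "integrable lborel (\<lambda>w. moll e (z - w))" "(LINT w|lborel. moll e (z - w)) = 1"
    "integrable lborel (\<lambda>z. moll e (z - w))" "(LINT z|lborel. moll e (z - w)) = 1"
proof -
  note I = tens_integral[OF smooth1_bmp_refl smooth1_bmp_refl bmp_refl_antideriv[OF assms]
      bmp_refl_antideriv[OF assms] bmp_out_refl[OF assms, of _ "Re z"] bmp_out_refl[OF assms, of _ "Im z"]]
  have "integrable lborel (tens (\<lambda>t. bmp e (Re z - t)) (\<lambda>t. bmp e (Im z - t)))"
     "(LINT w|lborel. tens (\<lambda>t. bmp e (Re z - t)) (\<lambda>t. bmp e (Im z - t)) w) = 1"
    using I assms by (auto simp: step_left step_right)
  then show "integrable lborel (\<lambda>w. moll e (z - w))" "(LINT w|lborel. moll e (z - w)) = 1"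
    unfolding bmp_refl_tens by auto
  note J = tens_integral[OF smooth1_bmp smooth1_bmp bmp_antideriv[OF assms] bmp_antideriv[OF assms]
      bmp_out'[OF assms] bmp_out'[OF assms]]
  have J: "integrable lborel (moll e)" "(LINT z|lborel. moll e z) = 1"
    unfolding moll_def using J assms by (auto simp: step_left step_right)
  have d: "distr lborel borel ((+) (- w)) = (lborel :: complex measure)"
    by (rule lborel_distr_plus)
  have m: "(+) (- w) \<in> lborel \<rightarrow>\<^sub>M borel" by simp
  show "integrable lborel (\<lambda>z. moll e (z - w))"
    using J(1) integrable_distr_eq[OF m measurable_moll, of e] unfolding d by simp
  show "(LINT z|lborel. moll e (z - w)) = 1"
    using J(2) integral_distr[OF m measurable_moll, of e] unfolding d by simp
qed

lemma moll_bounded: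
  assumes "e > 0"
  obtains B where "B > 0" "\<And>z. \<bar>moll e z\<bar> \<le> B"
proof -
  have "compact (moll e ` sq 0 e)"
    by (intro compact_continuous_image continuous_on_moll compact_sq)
  then obtain B where B: "B > 0" "\<And>z. z \<in> sq 0 e \<Longrightarrow> \<bar>moll e z\<bar> \<le> B"
    using compact_imp_bounded bounded_pos by (metis imageI real_norm_def)
  have "\<bar>moll e z\<bar> \<le> B" for z
  proof (cases "z \<in> sq 0 e")
    case False
    then have "moll e z = 0"
      using assms by (auto simp: mem_sq moll_def tens_def bmp_out)
    then show ?thesis using B(1) by simp
  qed (rule B(2))
  with B(1) that show ?thesis by blast
qed

definition conv :: "real \<Rightarrow> (complex \<Rightarrow> complex) \<Rightarrow> complex \<Rightarrow> complex" where
  "conv e v z = (LINT w|lborel. moll e (z - w) *\<^sub>R v w)"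

text \<open>Two exponents are treated together: q = 2 for gradients, and q = 1 for the integrable
  defect of the distortion inequality in \<open>qr_from_weighted_energy\<close>.\<close>

abbreviation pw :: "nat \<Rightarrow> complex \<Rightarrow> ennreal" where "pw q x \<equiv> ennreal (norm x ^ q)"

definition Lp :: "nat \<Rightarrow> (complex \<Rightarrow> complex) \<Rightarrow> bool" where
  "Lp q v \<longleftrightarrow> v \<in> borel_measurable borel \<and> (\<integral>\<^sup>+z. pw q (v z) \<partial>lborel) < \<infinity>"

lemma pw_add:
  assumes "q \<in> {1, 2}" shows "pw q (x + y) \<le> 2 * (pw q x + pw q y)"
proof -
  have "norm (x + y) ^ q \<le> 2 * (norm x ^ q + norm y ^ q)"
  proof (cases "q = 1")
    case False
    then have q: "q = 2" using assms by auto
    have "(norm (x + y))\<^sup>2 \<le> (norm x + norm y)\<^sup>2"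
      by (intro power_mono norm_triangle_ineq) auto
    also have "\<dots> \<le> 2 * ((norm x)\<^sup>2 + (norm y)\<^sup>2)"
      using sum_squares_bound[of "norm x" "norm y"] by (simp add: power2_sum)
    finally show ?thesis by (simp add: q)
  qed (use norm_triangle_ineq[of x y] norm_ge_zero[of x] norm_ge_zero[of y] in \<open>simp, linarith\<close>)
  then show ?thesis
    by (simp add: ennreal_plus[symmetric] ennreal_mult'[symmetric] ennreal_numeral[symmetric]
        del: ennreal_plus ennreal_numeral)
qed

lemma Lp_locally_integrable:
  assumes "Lp q v" "q \<in> {1, 2}"
  shows "set_integrable lborel (sq z r) v"
proof -
  have [measurable]: "v \<in> borel_measurable borel" using assms by (simp add: Lp_def)
  have "(\<integral>\<^sup>+w. ennreal (norm (indicator (sq z r) w *\<^sub>R v w)) \<partial>lborel)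
      \<le> (\<integral>\<^sup>+w. indicator (sq z r) w + pw q (v w) \<partial>lborel)"
  proof (rule nn_integral_mono)
    fix w
    have "norm (v w) \<le> 1 + norm (v w) ^ q"
    proof (cases "q = 1")
      case False
      then have q: "q = 2" using assms by auto
      have "norm (v w) \<le> 2 * 1 * norm (v w)" by simp
      also have "\<dots> \<le> 1 + (norm (v w))\<^sup>2" using sum_squares_bound[of 1 "norm (v w)"] by simp
      finally show ?thesis unfolding q .
    qed simp
    then have "ennreal (norm (v w)) \<le> ennreal 1 + pw q (v w)"
      by (subst ennreal_plus[symmetric]) (auto intro!: ennreal_leI simp del: ennreal_plus ennreal_1)
    then show "ennreal (norm (indicator (sq z r) w *\<^sub>R v w)) \<le> indicator (sq z r) w + pw q (v w)"
      by (simp add: indicator_def)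
  qed
  also have "\<dots> = emeasure lborel (sq z r) + (\<integral>\<^sup>+w. pw q (v w) \<partial>lborel)"
    by (subst nn_integral_add) auto
  also have "\<dots> < \<infinity>"
    using emeasure_sq_finite[of z r] assms(1) by (simp add: Lp_def)
  finally show ?thesis
    unfolding set_integrable_def by (intro integrableI_bounded) auto
qed

lemma moll_mult_integrable:
  assumes "e > 0" "set_integrable lborel (sq z e) v"
  shows "integrable lborel (\<lambda>w. moll e (z - w) *\<^sub>R (v w :: complex))"
proof -
  obtain B where B: "B > 0" "\<And>z. \<bar>moll e z\<bar> \<le> B" using moll_bounded[OF assms(1)] by blast
  have "integrable lborel (\<lambda>w. moll e (z - w) *\<^sub>R (indicator (sq z e) w *\<^sub>R v w))"
  proof (rule Bochner_Integration.integrable_bound)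
    show "integrable lborel (\<lambda>w. B *\<^sub>R (indicator (sq z e) w *\<^sub>R v w))"
      using assms(2) by (auto simp: set_integrable_def simp del: scaleR_scaleR)
    show "(\<lambda>w. moll e (z - w) *\<^sub>R (indicator (sq z e) w *\<^sub>R v w)) \<in> borel_measurable lborel"
    proof -
      have [measurable]: "(\<lambda>w. indicator (sq z e) w *\<^sub>R v w) \<in> borel_measurable lborel"
        using assms(2)[unfolded set_integrable_def, THEN borel_measurable_integrable] .
      have [measurable]: "(\<lambda>w. moll e (z - w)) \<in> borel_measurable lborel" by simp
      show ?thesis by (rule borel_measurable_scaleR) fact+
    qed
    show "AE w in lborel. norm (moll e (z - w) *\<^sub>R (indicator (sq z e) w *\<^sub>R v w)) \<le> norm (B *\<^sub>R (indicator (sq z e) w *\<^sub>R v w))"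
      using B by (auto intro!: AE_I2 mult_mono simp: norm_mult abs_mult)
  qed
  also have "(\<lambda>w. moll e (z - w) *\<^sub>R (indicator (sq z e) w *\<^sub>R v w)) = (\<lambda>w. moll e (z - w) *\<^sub>R v w)"
    using moll_out[OF assms(1)] by (auto simp: fun_eq_iff indicator_def)
  finally show ?thesis .
qed

lemma measurable_conv [measurable]:
  assumes [measurable]: "v \<in> borel_measurable borel"
  shows "conv e v \<in> borel_measurable borel"
proof -
  have "(\<lambda>z. LINT w|lborel. moll e (z - w) *\<^sub>R v w) \<in> borel_measurable lborel"
    by (rule lborel.borel_measurable_lebesgue_integral) measurable
  then show ?thesis by (simp add: conv_def[abs_def])
qed

text \<open>Jensen's inequality for the probability density \<open>moll e\<close>; for q = 2 it is
  Cauchy-Schwarz with the kernel split into two square roots.\<close>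

lemma conv_pointwise:
  assumes e: "e > 0" and [measurable]: "v \<in> borel_measurable borel" and q: "q \<in> {1, 2}"
  shows "pw q (conv e v z) \<le> (\<integral>\<^sup>+w. ennreal (moll e (z - w)) * pw q (v w) \<partial>lborel)"
proof -
  have one: "(\<integral>\<^sup>+w. ennreal (moll e (z - w)) \<partial>lborel) = 1"
    using moll_integral(1,2)[OF e] moll_nonneg[OF e] by (subst nn_integral_eq_integral) auto
  have le: "ennreal (norm (conv e v z)) \<le> (\<integral>\<^sup>+w. ennreal (moll e (z - w)) * ennreal (norm (v w)) \<partial>lborel)"
  proof (cases "integrable lborel (\<lambda>w. moll e (z - w) *\<^sub>R v w)")
    case True
    from integral_norm_bound_ennreal[OF this] show ?thesis
      using moll_nonneg[OF e] by (simp add: conv_def ennreal_mult)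
  \<comment> \<open>Without integrability \<open>conv\<close> is 0 by convention and the bound is
    trivial.\<close>
  qed (simp add: conv_def not_integrable_integral_eq)
  show ?thesis
  proof (cases "q = 1")
    case True then show ?thesis using le by simp
  next
    case False
    then have q: "q = 2" using q by auto
    have "pw 2 (conv e v z) = (ennreal (norm (conv e v z)))\<^sup>2"
      by (simp add: ennreal_power)
    also have "\<dots> \<le> (\<integral>\<^sup>+w. ennreal (moll e (z - w)) * ennreal (norm (v w)) \<partial>lborel)\<^sup>2"
      by (intro power_mono le) auto
    also have "(\<integral>\<^sup>+w. ennreal (moll e (z - w)) * ennreal (norm (v w)) \<partial>lborel)
       = (\<integral>\<^sup>+w. ennreal (sqrt (moll e (z - w))) * ennreal (sqrt (moll e (z - w)) * norm (v w)) \<partial>lborel)"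
      using moll_nonneg[OF e] by (intro nn_integral_cong) (simp add: ennreal_mult'[symmetric] mult.assoc[symmetric])
    also have "(\<dots>)\<^sup>2 \<le> (\<integral>\<^sup>+w. (ennreal (sqrt (moll e (z - w))))\<^sup>2 \<partial>lborel) *
        (\<integral>\<^sup>+w. (ennreal (sqrt (moll e (z - w)) * norm (v w)))\<^sup>2 \<partial>lborel)"
      by (rule Cauchy_Schwarz_nn_integral) auto
    also have "\<dots> = (\<integral>\<^sup>+w. ennreal (moll e (z - w)) * pw 2 (v w) \<partial>lborel)"
      using moll_nonneg[OF e] by (simp add: ennreal_power power_mult_distrib one ennreal_mult)
    finally show ?thesis by (simp add: q)
  qed
qed

text \<open>After Tonelli the pointwise bound is integrated over z first, and the kernel has mass
  one in that variable as well.\<close>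

lemma conv_contraction:
  assumes e: "e > 0" and [measurable]: "v \<in> borel_measurable borel" and q: "q \<in> {1, 2}"
  shows "(\<integral>\<^sup>+z. pw q (conv e v z) \<partial>lborel) \<le> (\<integral>\<^sup>+z. pw q (v z) \<partial>lborel)"
proof -
  have one: "(\<integral>\<^sup>+z. ennreal (moll e (z - w)) \<partial>lborel) = 1" for w
    using moll_integral(3,4)[OF e] moll_nonneg[OF e] by (subst nn_integral_eq_integral) auto
  have "(\<integral>\<^sup>+z. pw q (conv e v z) \<partial>lborel) \<le> (\<integral>\<^sup>+z. (\<integral>\<^sup>+w. ennreal (moll e (z - w)) * pw q (v w) \<partial>lborel) \<partial>lborel)"
    by (intro nn_integral_mono conv_pointwise assms)
  also have "\<dots> = (\<integral>\<^sup>+w. (\<integral>\<^sup>+z. ennreal (moll e (z - w)) * pw q (v w) \<partial>lborel) \<partial>lborel)"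
    by (rule lborel_pair.Fubini') measurable
  also have "\<dots> = (\<integral>\<^sup>+z. pw q (v z) \<partial>lborel)"
    by (simp add: nn_integral_multc one)
  finally show ?thesis .
qed

lemma conv_diff:
  assumes "e > 0" "set_integrable lborel (sq z e) u" "set_integrable lborel (sq z e) v"
  shows "conv e (\<lambda>w. u w - v w) z = conv e u z - conv e v z"
  using moll_mult_integrable[OF assms(1,2)] moll_mult_integrable[OF assms(1,3)]
  by (simp add: conv_def scaleR_diff_right)

lemma conv_close:
  assumes e: "e > 0" and "set_integrable lborel (sq z e) v" and d: "d \<ge> 0"
    and close: "\<And>w. w \<in> sq z e \<Longrightarrow> norm (v w - c) \<le> d"
  shows "norm (conv e v z - c) \<le> d"
proof -
  have c: "set_integrable lborel (sq z e) (\<lambda>_. c)"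
    unfolding set_integrable_def sq_def by (intro borel_integrable_compact) auto
  have "conv e (\<lambda>_. c) z = c"
    using moll_integral(1,2)[OF e] by (simp add: conv_def)
  then have "norm (conv e v z - c) = norm (LINT w|lborel. moll e (z - w) *\<^sub>R (v w - c))"
    using conv_diff[OF e assms(2) c] by (simp add: conv_def)
  also have "\<dots> \<le> (LINT w|lborel. moll e (z - w) * d)"
  proof (rule Bochner_Integration.integral_norm_bound_integral)
    show "integrable lborel (\<lambda>w. moll e (z - w) *\<^sub>R (v w - c))"
      using moll_mult_integrable[OF e assms(2)] moll_mult_integrable[OF e c] by (simp add: scaleR_diff_right)
    show "integrable lborel (\<lambda>w. moll e (z - w) * d)"
      using moll_integral(1)[OF e] by simp
    fix w show "norm (moll e (z - w) *\<^sub>R (v w - c)) \<le> moll e (z - w) * d"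
      using close moll_out[OF e] moll_nonneg[OF e] by (cases "w \<in> sq z e") (auto intro: mult_left_mono)
  qed
  also have "\<dots> = d" using moll_integral(2)[OF e] by simp
  finally show ?thesis .
qed

section \<open>Density of compactly supported continuous functions\<close>

definition clip :: "real \<Rightarrow> complex \<Rightarrow> complex" where
  "clip B x = (B / max B (norm x)) *\<^sub>R x"

lemma clip:
  assumes "B > 0"
  shows "norm (clip B x) \<le> B" "norm x \<le> B \<Longrightarrow> clip B x = x" "continuous_on S (clip B)"
proof -
  show "norm (clip B x) \<le> B"
  proof (cases "norm x \<le> B")
    case False
    then have "x \<noteq> 0" "max B (norm x) = norm x" using assms(1) by auto
    then show ?thesis using assms(1) unfolding clip_def by simp
  next
    case True
    then show ?thesis using assms(1) unfolding clip_def max_absorb1[OF True] by simp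
  qed
  show "norm x \<le> B \<Longrightarrow> clip B x = x" using assms(1) unfolding clip_def by (simp add: max_absorb1)
  have "max B (norm x) \<noteq> 0" for x :: complex
    using less_max_iff_disj[of 0 B "norm x"] assms(1) by simp
  then show "continuous_on S (clip B)" unfolding clip_def[abs_def] by (intro continuous_intros) auto
qed

text \<open>First v is truncated in size and support. The truncation is measurable, hence an almost
  everywhere limit of continuous functions; these carry no bound, so they are clipped to radius
  \<open>B\<close> and cut off by \<open>cu\<close>, which makes a constant on a ball a majorant.
  Dominated convergence applies at both stages.\<close>

lemma Lp_dense:
  assumes v: "Lp q v" and q: "q \<in> {1, 2}" and d: "(d::real) > 0"
  obtains g R where "continuous_on UNIV g" "\<And>z. norm z > R \<Longrightarrow> g z = (0::complex)"
    "(\<integral>\<^sup>+z. pw q (v z - g z) \<partial>lborel) \<le> ennreal d"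
proof -
  have q0: "q > 0" using q by auto
  have pc: "((\<lambda>n. pw q (f n)) \<longlongrightarrow> 0) F" if "(f \<longlongrightarrow> 0) F" for f :: "nat \<Rightarrow> complex" and F
  proof -
    have "((\<lambda>n. norm (f n) ^ q) \<longlongrightarrow> 0 ^ q) F"
      using that by (intro tendsto_power) (simp add: tendsto_norm_zero)
    then show ?thesis using q0 tendsto_ennrealI by (fastforce simp: zero_power)
  qed
  have vm [measurable]: "v \<in> borel_measurable borel" and vf: "(\<integral>\<^sup>+z. pw q (v z) \<partial>lborel) < \<infinity>"
    using v by (auto simp: Lp_def)
  define A where "A n = {z. norm z \<le> real n \<and> norm (v z) \<le> real n}" for n
  have [measurable]: "A n \<in> sets borel" for n unfolding A_def by measurable
  define vn where "vn n z = indicator (A n) z *\<^sub>R v z" for n z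
  have [measurable]: "vn n \<in> borel_measurable borel" for n unfolding vn_def by measurable
  have "(\<lambda>n. \<integral>\<^sup>+z. pw q (v z - vn n z) \<partial>lborel) \<longlonglongrightarrow> (\<integral>\<^sup>+z. 0 \<partial>(lborel::complex measure))"
  proof (rule nn_integral_dominated_convergence)
    show "(\<integral>\<^sup>+z. pw q (v z) \<partial>lborel) < \<infinity>" by (rule vf)
    show "AE z in lborel. pw q (v z - vn n z) \<le> pw q (v z)" for n
      using q0 by (auto simp: vn_def indicator_def)
    have "(\<lambda>n. pw q (v z - vn n z)) \<longlonglongrightarrow> 0" for z
    proof (rule tendsto_eventually)
      obtain N where N: "max (norm z) (norm (v z)) \<le> real N" using real_arch_simple by blast
      show "\<forall>\<^sub>F n in sequentially. pw q (v z - vn n z) = 0"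
        using eventually_ge_at_top[of N]
      proof eventually_elim
        case (elim n)
        then have "real N \<le> real n" by simp
        then have "z \<in> A n" using N unfolding A_def by simp
        then show ?case using q0 by (simp add: vn_def)
      qed
    qed
    then show "AE z in lborel. (\<lambda>n. pw q (v z - vn n z)) \<longlonglongrightarrow> 0" by simp
  qed measurable
  then have "\<forall>\<^sub>F n in sequentially. (\<integral>\<^sup>+z. pw q (v z - vn n z) \<partial>lborel) < ennreal (d / 4)"
    by (rule order_tendstoD) (use d in simp)
  then obtain n where n: "n \<ge> 1" "(\<integral>\<^sup>+z. pw q (v z - vn n z) \<partial>lborel) < ennreal (d / 4)"
    using eventually_happens'[OF _ eventually_conj[OF _ eventually_ge_at_top[of 1]]] by force
  define B where "B = real n"
  have B: "B > 0" using n by (simp add: B_def)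
  have vnB: "norm (vn n z) \<le> B" "norm z > B \<Longrightarrow> vn n z = 0" for z
    using B by (auto simp: vn_def A_def B_def indicator_def)
  have "vn n measurable_on UNIV"
    by (subst measurable_on_iff_borel_measurable) (auto intro: measurable_completion simp: lebesgue_on_UNIV_eq)
  then obtain N g where N: "negligible N" and g: "\<And>k. continuous_on UNIV (g k)"
    and gl: "\<And>z. z \<notin> N \<Longrightarrow> (\<lambda>k. g k z) \<longlonglongrightarrow> vn n z"
    unfolding measurable_on_def by auto
  define c where "c = clip B"
  note clip = clip[OF B, folded c_def]
  define cu where "cu z = max 0 (min 1 (B + 1 - norm z))" for z :: complex
  have cuc: "continuous_on S cu" for S unfolding cu_def[abs_def] by (intro continuous_intros)
  define G where "G k z = cu z *\<^sub>R c (g k z)" for k z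
  have Gc: "continuous_on UNIV (G k)" for k
    unfolding G_def by (intro continuous_intros cuc continuous_on_compose2[OF clip(3)[of UNIV] g]) auto
  have [measurable]: "G k \<in> borel_measurable borel" for k
    by (rule borel_measurable_continuous_onI[OF Gc])
  have Gout: "G k z = 0" if "norm z > B + 1" for k z using that by (simp add: G_def cu_def)
  have cu1: "0 \<le> cu z" "cu z \<le> 1" for z by (auto simp: cu_def)
  have GB: "norm (G k z) \<le> B" for k z
  proof -
    have "norm (G k z) = cu z * norm (c (g k z))" using cu1 by (simp add: G_def)
    also have "\<dots> \<le> 1 * B" using clip(1) cu1 B by (intro mult_mono) auto
    finally show ?thesis by simp
  qed
  have [measurable]: "cball (0::complex) (B + 1) \<in> sets borel" by simp
  have "(\<lambda>k. \<integral>\<^sup>+z. pw q (vn n z - G k z) \<partial>lborel) \<longlonglongrightarrow> (\<integral>\<^sup>+z. 0 \<partial>(lborel::complex measure))"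
  proof (rule nn_integral_dominated_convergence)
    show "(\<integral>\<^sup>+z. ennreal ((2 * B) ^ q) * indicator (cball 0 (B + 1)) z \<partial>(lborel::complex measure)) < \<infinity>"
      using emeasure_lborel_cball_finite[of "0::complex" "B + 1"]
      by (subst nn_integral_cmult_indicator) (auto simp: ennreal_mult_less_top)
    have "pw q (vn n z - G k z) \<le> ennreal ((2 * B) ^ q) * indicator (cball 0 (B + 1)) z" for k z
    proof (cases "norm z \<le> B + 1")
      case True
      have "norm (vn n z - G k z) \<le> 2 * B"
        using norm_triangle_ineq4[of "vn n z" "G k z"] GB[of k z] vnB(1)[of z] by linarith
      then have "norm (vn n z - G k z) ^ q \<le> (2 * B) ^ q" by (intro power_mono) auto
      then show ?thesis using True by (auto intro!: ennreal_leI simp del: power_mult_distrib)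
    next
      case False
      then show ?thesis using Gout vnB(2) q0 by simp
    qed
    then show "AE z in lborel. pw q (vn n z - G k z) \<le> ennreal ((2 * B) ^ q) * indicator (cball 0 (B + 1)) z" for k
      by simp
    have lim: "(\<lambda>k. pw q (vn n z - G k z)) \<longlonglongrightarrow> 0" if "z \<notin> N" for z
    proof -
      have "isCont c (vn n z)"
        using clip(3)[of UNIV] by (simp add: continuous_on_eq_continuous_at)
      from isCont_tendsto_compose[OF this gl[OF that]] have "(\<lambda>k. c (g k z)) \<longlonglongrightarrow> vn n z"
        using clip(2) vnB(1) by simp
      then have "(\<lambda>k. G k z) \<longlonglongrightarrow> cu z *\<^sub>R vn n z"
        unfolding G_def by (intro tendsto_intros)
      also have "cu z *\<^sub>R vn n z = vn n z"
        using vnB(2)[of z] by (cases "norm z > B") (auto simp: cu_def)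
      finally have "(\<lambda>k. vn n z - G k z) \<longlonglongrightarrow> 0"
        using tendsto_diff[OF tendsto_const[of "vn n z"]] by fastforce
      then show ?thesis by (rule pc)
    qed
    have "AE z in lebesgue. z \<notin> N"
      using AE_not_in[of N lebesgue] N by (simp add: negligible_iff_null_sets)
    then have "AE z in lborel. z \<notin> N" by (simp add: AE_completion_iff)
    then show "AE z in lborel. (\<lambda>k. pw q (vn n z - G k z)) \<longlonglongrightarrow> 0"
      by eventually_elim (rule lim)
  qed measurable
  then have "\<forall>\<^sub>F k in sequentially. (\<integral>\<^sup>+z. pw q (vn n z - G k z) \<partial>lborel) < ennreal (d / 4)"
    by (rule order_tendstoD) (use d in simp)
  then obtain k where k: "(\<integral>\<^sup>+z. pw q (vn n z - G k z) \<partial>lborel) < ennreal (d / 4)"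
    using eventually_happens' sequentially_bot by blast
  have "(\<integral>\<^sup>+z. pw q (v z - G k z) \<partial>lborel) \<le> (\<integral>\<^sup>+z. 2 * (pw q (v z - vn n z) + pw q (vn n z - G k z)) \<partial>lborel)"
    using pw_add[OF q, of "v z - vn n z" "vn n z - G k z" for z] by (intro nn_integral_mono) simp
  also have "\<dots> = 2 * ((\<integral>\<^sup>+z. pw q (v z - vn n z) \<partial>lborel) + (\<integral>\<^sup>+z. pw q (vn n z - G k z) \<partial>lborel))"
    by (subst nn_integral_cmult, measurable, subst nn_integral_add, auto)
  also have "\<dots> \<le> 2 * (ennreal (d / 4) + ennreal (d / 4))"
    using n(2) k by (intro mult_left_mono add_mono) auto
  also have "\<dots> = ennreal d"
    using d by (simp add: ennreal_plus[symmetric] ennreal_mult'[symmetric] ennreal_numeral[symmetric]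
        del: ennreal_plus ennreal_numeral)
  finally show ?thesis using that[OF Gc Gout] by blast
qed

text \<open>Density plus contraction: v - g is small before and after mollification, while for
  continuous g of bounded support the convergence is uniform and takes place inside a fixed
  ball.\<close>

theorem conv_tendsto:
  assumes v: "Lp q v" and q: "q \<in> {1, 2}" and d: "(d::real) > 0"
  shows "\<exists>e0>0. \<forall>e. 0 < e \<and> e < e0 \<longrightarrow> (\<integral>\<^sup>+z. pw q (conv e v z - v z) \<partial>lborel) \<le> ennreal d"
proof -
  have q0: "q > 0" using q by auto
  obtain g R where g: "continuous_on UNIV g" and gout: "\<And>z. norm z > R \<Longrightarrow> g z = 0"
    and gd: "(\<integral>\<^sup>+z. pw q (v z - g z) \<partial>lborel) \<le> ennreal (d / 16)"
    using Lp_dense[OF v q, of "d / 16"] d by auto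
  have [measurable]: "v \<in> borel_measurable borel" using v by (simp add: Lp_def)
  have [measurable]: "g \<in> borel_measurable borel" by (rule borel_measurable_continuous_onI[OF g])
  have gint: "set_integrable lborel (sq z e) g" for z e
    unfolding set_integrable_def by (intro borel_integrable_compact compact_sq continuous_on_subset[OF g]) auto
  define V where "V = measure lborel (cball (0::complex) (R + 2)) + 1"
  have V: "V > 0" by (simp add: V_def add_nonneg_pos)
  \<comment> \<open>Capping at 1 gives \<open>\<eta> ^ q\<close> \<le> \<open>\<eta>\<close>, so one
    choice serves both exponents; \<open>V\<close> bounds the area of the ball outside of which
    \<open>conv e g - g\<close> vanishes.\<close>
  define \<eta> where "\<eta> = min 1 (d / (16 * V))"
  have \<eta>: "\<eta> > 0" using d V by (simp add: \<eta>_def)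
  have \<eta>q: "\<eta> ^ q * V \<le> d / 16"
  proof -
    have "\<eta> ^ q \<le> \<eta>" using q \<eta> power_decreasing[of 1 q \<eta>] by (auto simp: \<eta>_def)
    also have "\<eta> \<le> d / (16 * V)" by (simp add: \<eta>_def)
    finally show ?thesis using V by (simp add: field_simps)
  qed
  have "uniformly_continuous_on (cball 0 (R + 2)) g"
    by (intro compact_uniformly_continuous continuous_on_subset[OF g]) auto
  then obtain \<delta> where \<delta>: "\<delta> > 0" 
    and u: "\<And>x y. x \<in> cball 0 (R + 2) \<Longrightarrow> y \<in> cball 0 (R + 2) \<Longrightarrow> dist y x < \<delta> \<Longrightarrow> dist (g y) (g x) < \<eta>"
    using \<eta> unfolding uniformly_continuous_on_def by metis
  \<comment> \<open>Points of \<open>sq z e\<close> lie within 2 e of z. This is less than 1, which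
    keeps the comparison inside the ball of radius R + 2, and less than \<open>\<delta>\<close>, as
    uniform continuity asks.\<close>
  define e0 where "e0 = min (1 / 2) (\<delta> / 2)"
  have "(\<integral>\<^sup>+z. pw q (conv e v z - v z) \<partial>lborel) \<le> ennreal d" if e: "0 < e" "e < e0" for e
  proof -
    have e1: "e < 1 / 2" "2 * e < \<delta>" using e by (auto simp: e0_def)
    have near: "norm (w - z) \<le> 2 * e" if "w \<in> sq z e" for w z
      using cmod_le[of "w - z"] that by (simp add: mem_sq)
    have cg: "norm (conv e g z - g z) \<le> \<eta>" for z
    proof (rule conv_close[OF e(1) gint])
      fix w assume w: "w \<in> sq z e"
      note n = near[OF w]
      show "norm (g w - g z) \<le> \<eta>"
      proof (cases "norm z \<le> R + 1")
        case True
        then have "norm w \<le> R + 2" using n e1 norm_triangle_sub[of w z] by linarith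
        then show ?thesis using u[of z w] True n e1 by (force simp: dist_norm)
      next
        case False
        then have "norm w > R" using n e1 norm_triangle_sub[of z w] by (simp add: norm_minus_commute)
        then show ?thesis using False gout \<eta> by simp
      qed
    qed (use \<eta> in simp)
    have cg0: "conv e g z - g z = 0" if "norm z > R + 2" for z
    proof -
      have "norm (conv e g z - g z) \<le> 0"
      proof (rule conv_close[OF e(1) gint])
        fix w assume w: "w \<in> sq z e"
        have "norm w > R" using near[OF w] e1 norm_triangle_sub[of z w] that by (simp add: norm_minus_commute)
        then show "norm (g w - g z) \<le> 0" using that gout by simp
      qed simp
      then show ?thesis by simp
    qed
    have I1: "(\<integral>\<^sup>+z. pw q (conv e g z - g z) \<partial>lborel) \<le> ennreal (d / 16)"
    proof -
      have "(\<integral>\<^sup>+z. pw q (conv e g z - g z) \<partial>lborel) \<le> (\<integral>\<^sup>+z. ennreal (\<eta> ^ q) * indicator (cball 0 (R + 2)) z \<partial>(lborel::complex measure))"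
      proof (rule nn_integral_mono)
        fix z show "pw q (conv e g z - g z) \<le> ennreal (\<eta> ^ q) * indicator (cball 0 (R + 2)) z"
          using cg[of z] cg0[of z] q0 by (cases "norm z \<le> R + 2") (auto intro!: ennreal_leI power_mono)
      qed
      also have "\<dots> = ennreal (\<eta> ^ q) * emeasure lborel (cball (0::complex) (R + 2))"
        by (subst nn_integral_cmult_indicator) auto
      also have "\<dots> \<le> ennreal (\<eta> ^ q) * ennreal V"
        using emeasure_lborel_cball_finite[of "0::complex" "R + 2"]
        by (intro mult_left_mono) (auto simp: V_def emeasure_eq_ennreal_measure intro!: ennreal_leI)
      also have "\<dots> \<le> ennreal (d / 16)"
        using \<eta>q \<eta> by (subst ennreal_mult'[symmetric]) (auto intro: ennreal_leI)
      finally show ?thesis .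
    qed
    have I2: "(\<integral>\<^sup>+z. pw q (conv e (\<lambda>w. v w - g w) z) \<partial>lborel) \<le> ennreal (d / 16)"
      by (rule order_trans[OF conv_contraction[OF e(1) _ q] gd]) measurable
    have "(\<integral>\<^sup>+z. pw q (conv e v z - v z) \<partial>lborel)
       \<le> (\<integral>\<^sup>+z. 4 * (pw q (conv e (\<lambda>w. v w - g w) z) + pw q (conv e g z - g z) + pw q (v z - g z)) \<partial>lborel)"
    proof (rule nn_integral_mono)
      fix z
      have eq: "conv e v z - v z = (conv e (\<lambda>w. v w - g w) z + (conv e g z - g z)) + (- (v z - g z))"
        using conv_diff[OF e(1) Lp_locally_integrable[OF v q] gint] by simp
      have "pw q (conv e v z - v z) \<le> 2 * (pw q (conv e (\<lambda>w. v w - g w) z + (conv e g z - g z)) + pw q (- (v z - g z)))"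
        unfolding eq by (rule pw_add[OF q])
      also have "\<dots> \<le> 2 * (2 * (pw q (conv e (\<lambda>w. v w - g w) z) + pw q (conv e g z - g z)) + pw q (v z - g z))"
        by (intro mult_left_mono add_mono pw_add[OF q]) (auto simp: norm_minus_commute)
      also have "\<dots> \<le> 2 * (2 * (pw q (conv e (\<lambda>w. v w - g w) z) + pw q (conv e g z - g z)) + 2 * pw q (v z - g z))"
        by (intro mult_left_mono add_mono) (auto simp: mult_2)
      also have "\<dots> = 4 * (pw q (conv e (\<lambda>w. v w - g w) z) + pw q (conv e g z - g z) + pw q (v z - g z))"
        by (simp add: distrib_left mult.assoc[symmetric])
      finally show "pw q (conv e v z - v z) \<le> \<dots>" .
    qed
    also have "\<dots> = 4 * ((\<integral>\<^sup>+z. pw q (conv e (\<lambda>w. v w - g w) z) \<partial>lborel) + (\<integral>\<^sup>+z. pw q (conv e g z - g z) \<partial>lborel)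
       + (\<integral>\<^sup>+z. pw q (v z - g z) \<partial>lborel))"
      by (subst nn_integral_cmult, measurable, subst nn_integral_add, measurable, subst nn_integral_add, auto)
    also have "\<dots> \<le> 4 * (ennreal (d / 16) + ennreal (d / 16) + ennreal (d / 16))"
      by (intro mult_left_mono add_mono I1 I2 gd) auto
    also have "\<dots> \<le> ennreal d"
      using d by (simp add: ennreal_plus[symmetric] ennreal_mult'[symmetric] ennreal_numeral[symmetric] ennreal_leI
          del: ennreal_plus ennreal_numeral)
    finally show ?thesis .
  qed
  moreover have "e0 > 0" using \<delta> by (simp add: e0_def)
  ultimately show ?thesis by blast
qed

section \<open>Green's formula on rectangles\<close>

definition c1 :: "(complex \<Rightarrow> complex) \<Rightarrow> (complex \<Rightarrow> complex) \<Rightarrow> (complex \<Rightarrow> complex) \<Rightarrow> bool" where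
  "c1 U Ux Uy \<longleftrightarrow> continuous_on UNIV U \<and> continuous_on UNIV Ux \<and> continuous_on UNIV Uy \<and>
     (\<forall>x y. ((\<lambda>x. U (Complex x y)) has_vector_derivative Ux (Complex x y)) (at x)) \<and>
     (\<forall>x y. ((\<lambda>y. U (Complex x y)) has_vector_derivative Uy (Complex x y)) (at y))"

text \<open>The mixed second derivative, with a common value in both orders, is the term that
  cancels in Green's formula; that is what this class has to provide for V.\<close>

definition c2 :: "(complex \<Rightarrow> complex) \<Rightarrow> (complex \<Rightarrow> complex) \<Rightarrow> (complex \<Rightarrow> complex) \<Rightarrow> (complex \<Rightarrow> complex) \<Rightarrow> bool" where
  "c2 V Vx Vy Vxy \<longleftrightarrow> c1 V Vx Vy \<and> continuous_on UNIV Vxy \<and>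
     (\<forall>x y. ((\<lambda>x. Vy (Complex x y)) has_vector_derivative Vxy (Complex x y)) (at x)) \<and>
     (\<forall>x y. ((\<lambda>y. Vx (Complex x y)) has_vector_derivative Vxy (Complex x y)) (at y))"

lemma set_integrable_continuous:
  fixes F :: "complex \<Rightarrow> 'b :: euclidean_space"
  assumes "continuous_on UNIV F" "compact C"
  shows "set_integrable lborel C F"
  unfolding set_integrable_def
  by (rule borel_integrable_compact[OF assms(2) continuous_on_subset[OF assms(1)]]) simp

lemma set_integral_subset_le_AE:
  fixes f :: "'a \<Rightarrow> real"
  assumes "set_integrable M B f" "A \<in> sets M" "A \<subseteq> B" "AE x in M. x \<in> B \<longrightarrow> 0 \<le> f x"
  shows "(LINT x:A|M. f x) \<le> (LINT x:B|M. f x)"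
proof -
  have "set_integrable M A f" by (rule set_integrable_subset[OF assms(1-3)])
  then show ?thesis
    using assms(1,3) unfolding set_lebesgue_integral_def set_integrable_def
    by (intro integral_mono_AE) (use assms(4) in \<open>auto simp: indicator_def elim!: eventually_mono\<close>)
qed

lemma set_integral_subset_le:
  fixes f :: "'a \<Rightarrow> real"
  assumes "set_integrable M B f" "A \<in> sets M" "A \<subseteq> B" "\<And>x. x \<in> B \<Longrightarrow> 0 \<le> f x"
  shows "(LINT x:A|M. f x) \<le> (LINT x:B|M. f x)"
  by (rule set_integral_subset_le_AE[OF assms(1-3)]) (use assms(4) in auto)

lemma continuous_on_line:
  assumes "continuous_on UNIV F"
  shows "continuous_on S (\<lambda>x. F (Complex x y))" "continuous_on S (\<lambda>y. F (Complex x y))"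
  by (rule continuous_on_compose2[OF assms]; auto intro!: continuous_intros)+

text \<open>The integrand is the x-derivative of U V_y minus the y-derivative of U V_x, the mixed
  derivatives cancelling. Each half is continuous, so it may be integrated along its own variable
  first, where the fundamental theorem leaves boundary values.\<close>

lemma Green_rectangle:
  assumes U: "c1 U Ux Uy" and V: "c2 V Vx Vy Vxy" and "a \<le> b" "c \<le> d"
  shows "(LINT z:cbox (Complex a c) (Complex b d)|lborel. Ux z * Vy z - Uy z * Vx z) =
    integral {c..d} (\<lambda>y. U (Complex b y) * Vy (Complex b y) - U (Complex a y) * Vy (Complex a y))
    - integral {a..b} (\<lambda>x. U (Complex x d) * Vx (Complex x d) - U (Complex x c) * Vx (Complex x c))"
proof -
  let ?C = "cbox (Complex a c) (Complex b d)"
  have cont: "continuous_on UNIV U" "continuous_on UNIV Ux" "continuous_on UNIV Uy"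
    "continuous_on UNIV Vx" "continuous_on UNIV Vy" "continuous_on UNIV Vxy"
    using U V by (auto simp: c1_def c2_def)
  define P where "P z = Ux z * Vy z + U z * Vxy z" for z
  define Q where "Q z = Uy z * Vx z + U z * Vxy z" for z
  have Pc: "continuous_on UNIV P" and Qc: "continuous_on UNIV Q"
    unfolding P_def Q_def by (intro continuous_intros cont)+
  have Pd: "((\<lambda>x. U (Complex x y) * Vy (Complex x y)) has_vector_derivative P (Complex x y)) (at x)" for x y
    unfolding P_def using U V
    by (auto intro!: derivative_eq_intros simp: c1_def c2_def algebra_simps)
  have Qd: "((\<lambda>y. U (Complex x y) * Vx (Complex x y)) has_vector_derivative Q (Complex x y)) (at y)" for x y
    unfolding Q_def using U V
    by (auto intro!: derivative_eq_intros simp: c1_def c2_def algebra_simps)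
  have "(LINT z:?C|lborel. Ux z * Vy z - Uy z * Vx z) = (LINT z:?C|lborel. P z - Q z)"
    by (simp add: P_def Q_def)
  also have "\<dots> = (LINT z:?C|lborel. P z) - (LINT z:?C|lborel. Q z)"
    by (intro set_integral_diff set_integrable_continuous Pc Qc compact_cbox)
  also have "(LINT z:?C|lborel. P z) = integral {c..d} (\<lambda>y. integral {a..b} (\<lambda>x. P (Complex x y)))"
    using set_integral_cbox_complex[OF continuous_on_subset[OF Pc]] integral_swap_complex[OF continuous_on_subset[OF Pc]]
    by simp
  also have "(\<lambda>y. integral {a..b} (\<lambda>x. P (Complex x y))) = 
      (\<lambda>y. U (Complex b y) * Vy (Complex b y) - U (Complex a y) * Vy (Complex a y))"
    by (intro ext integral_unique fundamental_theorem_of_calculus[OF \<open>a \<le> b\<close>] has_vector_derivative_at_within[OF Pd])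
  also have "(LINT z:?C|lborel. Q z) = integral {a..b} (\<lambda>x. integral {c..d} (\<lambda>y. Q (Complex x y)))"
    using set_integral_cbox_complex[OF continuous_on_subset[OF Qc]] by simp
  also have "(\<lambda>x. integral {c..d} (\<lambda>y. Q (Complex x y))) = 
      (\<lambda>x. U (Complex x d) * Vx (Complex x d) - U (Complex x c) * Vx (Complex x c))"
    by (intro ext integral_unique fundamental_theorem_of_calculus[OF \<open>c \<le> d\<close>] has_vector_derivative_at_within[OF Qd])
  finally show ?thesis .
qed

text \<open>The minimum of a continuous function is at most its mean, here over length r /
  2.\<close>

lemma good_line:
  fixes A :: "real \<Rightarrow> real"
  assumes "continuous_on {p..q} A" "q - p = r / 2" "r > 0" "integral {p..q} A \<le> T"
  obtains a where "a \<in> {p..q}" "A a \<le> 2 * T / r"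
proof -
  have "p \<le> q" using assms by simp
  then obtain a where a: "a \<in> {p..q}" "\<And>x. x \<in> {p..q} \<Longrightarrow> A a \<le> A x"
    using continuous_attains_inf[of "{p..q}" A] assms(1) by auto
  have "(q - p) * A a = integral {p..q} (\<lambda>x. A a)" using \<open>p \<le> q\<close> by simp
  also have "\<dots> \<le> integral {p..q} A"
    by (intro integral_le integrable_continuous_real assms(1) continuous_intros a(2))
  finally have "r / 2 * A a \<le> T" using assms by simp
  then have "A a \<le> 2 * T / r" using \<open>r > 0\<close> by (simp add: field_simps)
  with a(1) that show ?thesis by blast
qed

text \<open>Instead of Cauchy-Schwarz, the arithmetic-geometric mean inequality with weight
  \<open>\<tau> / r\<close>: the constant part contributes 2 \<tau> over length 4 r, the energy part
  T / \<tau> \<le> \<tau>. The oscillation along the segment is at most the length of its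
  image.\<close>

lemma line_bound:
  fixes \<gamma> :: "real \<Rightarrow> complex"
  assumes \<gamma>: "\<And>t. (\<gamma> has_vector_derivative \<gamma>' t) (at t)" and c: "continuous_on UNIV \<gamma>'" "continuous_on UNIV n"
    and n: "\<And>t. (norm (\<gamma>' t))\<^sup>2 \<le> n t" and s: "t - s = 4 * r" "r > 0" and I: "integral {s..t} n \<le> 2 * T / r"
    and \<tau>: "T \<le> \<tau>\<^sup>2" "\<tau> > 0"
  shows "integral {s..t} (\<lambda>u. norm (\<gamma>' u)) \<le> 3 * \<tau>"
    "u \<in> {s..t} \<Longrightarrow> v \<in> {s..t} \<Longrightarrow> norm (\<gamma> u - \<gamma> v) \<le> 3 * \<tau>"
proof -
  have st: "s \<le> t" using s by simp
  have ci: "(\<lambda>u. norm (\<gamma>' u)) integrable_on {x..y}" for x y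
    by (intro integrable_continuous_real continuous_intros continuous_on_subset[OF c(1)]) simp
  have le: "norm (\<gamma>' u) \<le> \<tau> / (2 * r) + r / (2 * \<tau>) * n u" for u
  proof -
    have "0 \<le> (norm (\<gamma>' u) - \<tau> / r)\<^sup>2" by simp
    also have "\<dots> = (norm (\<gamma>' u))\<^sup>2 - 2 * (\<tau> / r) * norm (\<gamma>' u) + (\<tau> / r)\<^sup>2"
      by (simp add: power2_diff algebra_simps)
    finally have "2 * (\<tau> / r) * norm (\<gamma>' u) \<le> n u + (\<tau> / r)\<^sup>2"
      using n[of u] by linarith
    then have "norm (\<gamma>' u) * (2 * (\<tau> / r)) * (r / (2 * \<tau>)) \<le> (n u + (\<tau> / r)\<^sup>2) * (r / (2 * \<tau>))"
      using s \<tau> by (intro mult_right_mono) (auto simp: mult.commute)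
    moreover have "norm (\<gamma>' u) * (2 * (\<tau> / r)) * (r / (2 * \<tau>)) = norm (\<gamma>' u)"
      using s \<tau> by simp
    moreover have "(n u + (\<tau> / r)\<^sup>2) * (r / (2 * \<tau>)) = \<tau> / (2 * r) + r / (2 * \<tau>) * n u"
      using s \<tau> by (simp add: field_simps power2_eq_square)
    ultimately show ?thesis by simp
  qed
  have "integral {s..t} (\<lambda>u. norm (\<gamma>' u)) \<le> integral {s..t} (\<lambda>u. \<tau> / (2 * r) + r / (2 * \<tau>) * n u)"
    by (intro integral_le ci le integrable_continuous_real continuous_intros continuous_on_subset[OF c(2)]) simp
  also have "\<dots> = integral {s..t} (\<lambda>u. \<tau> / (2 * r)) + integral {s..t} (\<lambda>u. r / (2 * \<tau>) * n u)"
    by (intro integral_add integrable_continuous_real continuous_intros continuous_on_subset[OF c(2)]) simp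
  also have "\<dots> = 2 * \<tau> + r / (2 * \<tau>) * integral {s..t} n"
    using s st by simp
  also have "\<dots> \<le> 2 * \<tau> + r / (2 * \<tau>) * (2 * T / r)"
    using I s \<tau> by (intro add_left_mono mult_left_mono) auto
  also have "\<dots> \<le> 3 * \<tau>"
    using s \<tau> by (simp add: field_simps power2_eq_square)
  finally show 1: "integral {s..t} (\<lambda>u. norm (\<gamma>' u)) \<le> 3 * \<tau>" .
  have 2: "norm (\<gamma> v - \<gamma> u) \<le> 3 * \<tau>" if uv: "u \<in> {s..t}" "v \<in> {s..t}" "u \<le> v" for u v
  proof -
    have "(\<gamma>' has_integral (\<gamma> v - \<gamma> u)) {u..v}"
      by (intro fundamental_theorem_of_calculus uv has_vector_derivative_at_within[OF \<gamma>])
    then have "norm (\<gamma> v - \<gamma> u) \<le> integral {u..v} (\<lambda>u. norm (\<gamma>' u))"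
      using integral_norm_bound_integral[of \<gamma>' "{u..v}" "\<lambda>u. norm (\<gamma>' u)"] ci[of u v]
      by (auto simp: integral_unique has_integral_integrable)
    also have "\<dots> \<le> integral {s..t} (\<lambda>u. norm (\<gamma>' u))"
      using uv ci by (intro integral_subset_le) auto
    finally show ?thesis using 1 by simp
  qed
  show "u \<in> {s..t} \<Longrightarrow> v \<in> {s..t} \<Longrightarrow> norm (\<gamma> u - \<gamma> v) \<le> 3 * \<tau>"
    using 2[of u v] 2[of v u] by (cases "u \<le> v") (auto simp: norm_minus_commute)
qed

lemma boundary_term:
  fixes U D :: "real \<Rightarrow> complex"
  assumes "continuous_on UNIV U" "continuous_on UNIV D" "{u..v} \<subseteq> {s..t}"
    and "\<And>x. x \<in> {u..v} \<Longrightarrow> norm (U x) \<le> B" "integral {s..t} (\<lambda>x. norm (D x)) \<le> L" "B \<ge> 0"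
  shows "norm (integral {u..v} (\<lambda>x. U x * D x)) \<le> B * L"
proof -
  have ci: "(\<lambda>x. norm (D x)) integrable_on {x..y}" for x y
    by (intro integrable_continuous_real continuous_intros continuous_on_subset[OF assms(2)]) simp
  have "norm (integral {u..v} (\<lambda>x. U x * D x)) \<le> integral {u..v} (\<lambda>x. B * norm (D x))"
    by (intro integral_norm_bound_integral integrable_continuous_real continuous_intros
        continuous_on_subset[OF assms(1)] continuous_on_subset[OF assms(2)])
       (auto simp: norm_mult intro!: mult_right_mono assms(4))
  also have "\<dots> = B * integral {u..v} (\<lambda>x. norm (D x))" by simp
  also have "\<dots> \<le> B * L"
    using assms(3,6) ci by (intro mult_left_mono order_trans[OF integral_subset_le assms(5)]) auto
  finally show ?thesis .
qed

definition en :: "complex \<Rightarrow> complex \<Rightarrow> real" where "en a b = (norm a)\<^sup>2 + (norm b)\<^sup>2"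
definition jac :: "complex \<Rightarrow> complex \<Rightarrow> real" where "jac a b = Im (cnj a * b)"

text \<open>The left side is Green's integrand for U = cnj g and V = g, which exhibits the Jacobian
  as a null Lagrangian.\<close>

lemma cnj_jac: "cnj a * b - cnj b * a = 2 * \<i> * jac a b"
  by (simp add: jac_def complex_eq_iff)

lemma set_integral_mult_of_real:
  "(LINT z:C|M. c * complex_of_real (j z)) = c * complex_of_real (LINT z:C|M. j z)"
proof -
  have "(\<lambda>z. indicator C z *\<^sub>R (c * complex_of_real (j z))) = (\<lambda>z. c * complex_of_real (indicator C z *\<^sub>R j z))"
    by (auto simp: fun_eq_iff indicator_def)
  then show ?thesis
    unfolding set_lebesgue_integral_def by (simp only: integral_mult_right_zero integral_complex_of_real)
qed

text \<open>On sides of small energy g oscillates by at most 3 \<tau>, where \<open>\<tau>\<close>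
  is the root of T. Minus its value at a corner, g is at most 6 \<tau> on the whole boundary, so
  each of the four boundary integrals is at most 6 \<tau> times 3 \<tau>, that is 18 T. The sum 72 T
  bounds twice the absolute Jacobian integral.\<close>

lemma smooth_hole_filling:
  assumes g: "c2 g gx gy gxy" and r: "r > 0" and T: "T > 0"
    and le: "(LINT z:sq z0 (2 * r) - sq z0 r|lborel. en (gx z) (gy z)) \<le> T"
  obtains a b c d where "sq z0 r \<subseteq> cbox (Complex a c) (Complex b d)" "cbox (Complex a c) (Complex b d) \<subseteq> sq z0 (2 * r)"
    "\<bar>LINT z:cbox (Complex a c) (Complex b d)|lborel. jac (gx z) (gy z)\<bar> \<le> 36 * T"
proof -
  define x0 where "x0 = Re z0"
  define y0 where "y0 = Im z0"
  have cont: "continuous_on UNIV g" "continuous_on UNIV gx" "continuous_on UNIV gy"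
    and dx: "\<And>x y. ((\<lambda>x. g (Complex x y)) has_vector_derivative gx (Complex x y)) (at x)"
    and dy: "\<And>x y. ((\<lambda>y. g (Complex x y)) has_vector_derivative gy (Complex x y)) (at y)"
    using g by (auto simp: c1_def c2_def)
  define n where "n z = en (gx z) (gy z)" for z
  have n0: "n z \<ge> 0" for z by (simp add: n_def en_def)
  have nc: "continuous_on S n" for S
    unfolding n_def en_def by (intro continuous_intros continuous_on_subset[OF cont(2)] continuous_on_subset[OF cont(3)]) auto
  have strip: "(LINT z:cbox (Complex a c) (Complex b d)|lborel. n z) \<le> T"
    if "cbox (Complex a c) (Complex b d) \<subseteq> sq z0 (2 * r) - sq z0 r" for a b c d
  proof -
    have i: "set_integrable lborel (sq z0 (2 * r)) n" by (rule set_integrable_continuous[OF nc]) simp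
    have "(LINT z:cbox (Complex a c) (Complex b d)|lborel. n z) \<le> (LINT z:sq z0 (2 * r) - sq z0 r|lborel. n z)"
      by (rule set_integral_subset_le) (use that n0 in \<open>auto intro!: set_integrable_subset[OF i]\<close>)
    then show ?thesis using le by (simp add: n_def)
  qed
  define Av where "Av x = integral {y0 - 2 * r..y0 + 2 * r} (\<lambda>y. n (Complex x y))" for x
  define Ah where "Ah y = integral {x0 - 2 * r..x0 + 2 * r} (\<lambda>x. n (Complex x y))" for y
  have Avc: "continuous_on S Av" for S
  proof -
    have "continuous_on (S \<times> cbox (y0 - 2 * r) (y0 + 2 * r)) (\<lambda>(x, y). n (Complex x y))"
      unfolding case_prod_beta' by (rule continuous_on_compose2[OF nc[of UNIV]]) (auto intro!: continuous_intros)
    from integral_continuous_on_param[OF this] show ?thesis unfolding Av_def by simp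
  qed
  have Ahc: "continuous_on S Ah" for S
  proof -
    have "continuous_on (S \<times> cbox (x0 - 2 * r) (x0 + 2 * r)) (\<lambda>(y, x). n (Complex x y))"
      unfolding case_prod_beta' by (rule continuous_on_compose2[OF nc[of UNIV]]) (auto intro!: continuous_intros)
    from integral_continuous_on_param[OF this] show ?thesis unfolding Ah_def by simp
  qed
  have Avi: "integral {p..q} Av \<le> T" if "{p..q} \<subseteq> {x0 - 2 * r..x0 + 2 * r}" "{p..q} \<inter> {x0 - r..x0 + r} = {}" for p q
  proof -
    have "integral {p..q} Av = (LINT z:cbox (Complex p (y0 - 2 * r)) (Complex q (y0 + 2 * r))|lborel. n z)"
      unfolding Av_def by (rule set_integral_cbox_complex[OF nc, symmetric])
    also have "\<dots> \<le> T"
    proof (rule strip, rule subsetI)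
      fix w assume w: "w \<in> cbox (Complex p (y0 - 2 * r)) (Complex q (y0 + 2 * r))"
      then have 1: "Re w \<in> {p..q}" by (simp add: in_cbox_complex_iff)
      then have "Re w \<notin> {x0 - r..x0 + r}" "Re w \<in> {x0 - 2 * r..x0 + 2 * r}" using that by blast+
      then show "w \<in> sq z0 (2 * r) - sq z0 r" using w
        by (auto simp: mem_sq in_cbox_complex_iff x0_def[symmetric] y0_def[symmetric] abs_le_iff)
    qed
    finally show ?thesis .
  qed
  have Ahi: "integral {p..q} Ah \<le> T" if "{p..q} \<subseteq> {y0 - 2 * r..y0 + 2 * r}" "{p..q} \<inter> {y0 - r..y0 + r} = {}" for p q
  proof -
    have "integral {p..q} Ah = (LINT z:cbox (Complex (x0 - 2 * r) p) (Complex (x0 + 2 * r) q)|lborel. n z)"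
      unfolding Ah_def using set_integral_cbox_complex[OF nc] integral_swap_complex[OF nc] by simp
    also have "\<dots> \<le> T"
    proof (rule strip, rule subsetI)
      fix w assume w: "w \<in> cbox (Complex (x0 - 2 * r) p) (Complex (x0 + 2 * r) q)"
      then have 1: "Im w \<in> {p..q}" by (simp add: in_cbox_complex_iff)
      then have "Im w \<notin> {y0 - r..y0 + r}" "Im w \<in> {y0 - 2 * r..y0 + 2 * r}" using that by blast+
      then show "w \<in> sq z0 (2 * r) - sq z0 r" using w
        by (auto simp: mem_sq in_cbox_complex_iff x0_def[symmetric] y0_def[symmetric] abs_le_iff)
    qed
    finally show ?thesis .
  qed
  \<comment> \<open>Each side is chosen in the outer half of its strip: that interval has length r /
    2 and avoids the inner square, so the part of the strip over it lies in the annulus, where the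
    energy is at most T.\<close>
  obtain a where a: "a \<in> {x0 - 2 * r..x0 - 3 / 2 * r}" "Av a \<le> 2 * T / r"
    by (rule good_line[where p = "x0 - 2 * r" and q = "x0 - 3 / 2 * r", OF Avc _ r Avi]) (use r in auto)
  obtain b where b: "b \<in> {x0 + 3 / 2 * r..x0 + 2 * r}" "Av b \<le> 2 * T / r"
    by (rule good_line[where p = "x0 + 3 / 2 * r" and q = "x0 + 2 * r", OF Avc _ r Avi]) (use r in auto)
  obtain c where c: "c \<in> {y0 - 2 * r..y0 - 3 / 2 * r}" "Ah c \<le> 2 * T / r"
    by (rule good_line[where p = "y0 - 2 * r" and q = "y0 - 3 / 2 * r", OF Ahc _ r Ahi]) (use r in auto)
  obtain d where d: "d \<in> {y0 + 3 / 2 * r..y0 + 2 * r}" "Ah d \<le> 2 * T / r"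
    by (rule good_line[where p = "y0 + 3 / 2 * r" and q = "y0 + 2 * r", OF Ahc _ r Ahi]) (use r in auto)
  define \<tau> where "\<tau> = sqrt T"
  have \<tau>: "T \<le> \<tau>\<^sup>2" "\<tau> > 0" "\<tau> * \<tau> = T" using T by (auto simp: \<tau>_def)
  have nb: "(norm (gx z))\<^sup>2 \<le> n z" "(norm (gy z))\<^sup>2 \<le> n z" for z by (auto simp: n_def en_def)
  note lv = line_bound[OF dy continuous_on_line(2)[OF cont(3)] continuous_on_line(2)[OF nc] nb(2) _ r _ \<tau>(1,2),
      of "y0 + 2 * r" "y0 - 2 * r", folded Av_def]
  note lh = line_bound[OF dx continuous_on_line(1)[OF cont(2)] continuous_on_line(1)[OF nc] nb(1) _ r _ \<tau>(1,2),
      of "x0 + 2 * r" "x0 - 2 * r", folded Ah_def]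
  have osc_a: "norm (g (Complex a u) - g (Complex a v)) \<le> 3 * \<tau>" if "u \<in> {c..d}" "v \<in> {c..d}" for u v
    by (rule lv(2)[OF _ a(2)]) (use that c d r in auto)
  have osc_b: "norm (g (Complex b u) - g (Complex b v)) \<le> 3 * \<tau>" if "u \<in> {c..d}" "v \<in> {c..d}" for u v
    by (rule lv(2)[OF _ b(2)]) (use that c d r in auto)
  have osc_c: "norm (g (Complex u c) - g (Complex v c)) \<le> 3 * \<tau>" if "u \<in> {a..b}" "v \<in> {a..b}" for u v
    by (rule lh(2)[OF _ c(2)]) (use that a b r in auto)
  have osc_d: "norm (g (Complex u d) - g (Complex v d)) \<le> 3 * \<tau>" if "u \<in> {a..b}" "v \<in> {a..b}" for u v
    by (rule lh(2)[OF _ d(2)]) (use that a b r in auto)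
  have ab: "a \<le> b" "c \<le> d" using a b c d r by auto
  \<comment> \<open>The area term contains only derivatives of U, so a constant may be subtracted
    from g. With the value at a corner, the two adjacent sides are controlled directly and each
    opposite side through one further corner.\<close>
  define g0 where "g0 = g (Complex a c)"
  define U where "U z = cnj (g z - g0)" for z
  have Uc: "continuous_on UNIV U" unfolding U_def by (intro continuous_intros cont)
  have U1: "c1 U (\<lambda>z. cnj (gx z)) (\<lambda>z. cnj (gy z))"
    unfolding c1_def U_def
    by (intro conjI allI continuous_intros cont)
       (auto intro!: derivative_eq_intros bounded_linear.has_vector_derivative[OF bounded_linear_cnj] dx dy)
  have Ua: "norm (U (Complex a y)) \<le> 6 * \<tau>" if "y \<in> {c..d}" for y
    using osc_a[of y c] that ab \<tau>(2) by (simp add: U_def g0_def flip: complex_cnj_diff)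
  have Uc': "norm (U (Complex x c)) \<le> 6 * \<tau>" if "x \<in> {a..b}" for x
    using osc_c[of x a] that ab \<tau>(2) by (simp add: U_def g0_def flip: complex_cnj_diff)
  have Ub: "norm (U (Complex b y)) \<le> 6 * \<tau>" if "y \<in> {c..d}" for y
    using osc_b[of y c] osc_c[of b a] that ab norm_triangle_ineq[of "g (Complex b y) - g (Complex b c)" "g (Complex b c) - g0"]
    by (simp add: U_def g0_def flip: complex_cnj_diff)
  have Ud: "norm (U (Complex x d)) \<le> 6 * \<tau>" if "x \<in> {a..b}" for x
    using osc_d[of x a] osc_a[of d c] that ab norm_triangle_ineq[of "g (Complex x d) - g (Complex a d)" "g (Complex a d) - g0"]
    by (simp add: U_def g0_def flip: complex_cnj_diff)
  let ?C = "cbox (Complex a c) (Complex b d)"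
  have cd_sub: "{c..d} \<subseteq> {y0 - 2 * r..y0 + 2 * r}" and ab_sub: "{a..b} \<subseteq> {x0 - 2 * r..x0 + 2 * r}"
    using a b c d by auto
  have Bv: "norm (integral {c..d} (\<lambda>y. U (Complex x y) * gy (Complex x y))) \<le> 6 * \<tau> * (3 * \<tau>)"
    if "Av x \<le> 2 * T / r" "\<And>y. y \<in> {c..d} \<Longrightarrow> norm (U (Complex x y)) \<le> 6 * \<tau>" for x
    by (rule boundary_term[OF continuous_on_line(2)[OF Uc] continuous_on_line(2)[OF cont(3)] cd_sub that(2) lv(1)[OF _ that(1)]])
       (use \<tau> in auto)
  have Bh: "norm (integral {a..b} (\<lambda>x. U (Complex x y) * gx (Complex x y))) \<le> 6 * \<tau> * (3 * \<tau>)"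
    if "Ah y \<le> 2 * T / r" "\<And>x. x \<in> {a..b} \<Longrightarrow> norm (U (Complex x y)) \<le> 6 * \<tau>" for y
    by (rule boundary_term[OF continuous_on_line(1)[OF Uc] continuous_on_line(1)[OF cont(2)] ab_sub that(2) lh(1)[OF _ that(1)]])
       (use \<tau> in auto)
  have "2 * \<bar>LINT z:?C|lborel. jac (gx z) (gy z)\<bar> = norm (2 * \<i> * complex_of_real (LINT z:?C|lborel. jac (gx z) (gy z)))"
    by (simp add: norm_mult)
  also have "2 * \<i> * complex_of_real (LINT z:?C|lborel. jac (gx z) (gy z)) = (LINT z:?C|lborel. 2 * \<i> * complex_of_real (jac (gx z) (gy z)))"
    by (simp only: set_integral_mult_of_real)
  also have "\<dots> = (LINT z:?C|lborel. cnj (gx z) * gy z - cnj (gy z) * gx z)"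
    by (simp only: cnj_jac)
  also have "\<dots> = integral {c..d} (\<lambda>y. U (Complex b y) * gy (Complex b y) - U (Complex a y) * gy (Complex a y))
    - integral {a..b} (\<lambda>x. U (Complex x d) * gx (Complex x d) - U (Complex x c) * gx (Complex x c))"
    by (rule Green_rectangle[OF U1 g ab])
  also have "\<dots> = (integral {c..d} (\<lambda>y. U (Complex b y) * gy (Complex b y)) - integral {c..d} (\<lambda>y. U (Complex a y) * gy (Complex a y)))
    - (integral {a..b} (\<lambda>x. U (Complex x d) * gx (Complex x d)) - integral {a..b} (\<lambda>x. U (Complex x c) * gx (Complex x c)))"
    by (intro arg_cong2[of _ _ _ _ minus] integral_diff integrable_continuous_real continuous_intros
        continuous_on_line[OF Uc] continuous_on_line[OF cont(2)] continuous_on_line[OF cont(3)])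
  also have "norm \<dots> \<le> (6 * \<tau> * (3 * \<tau>) + 6 * \<tau> * (3 * \<tau>)) + (6 * \<tau> * (3 * \<tau>) + 6 * \<tau> * (3 * \<tau>))"
    by (intro order_trans[OF norm_triangle_ineq4] add_mono Bv[OF b(2) Ub] Bv[OF a(2) Ua] Bh[OF d(2) Ud] Bh[OF c(2) Uc'])
  also have "\<dots> = 72 * T" using \<tau>(3) by simp
  finally have fin: "\<bar>LINT z:?C|lborel. jac (gx z) (gy z)\<bar> \<le> 36 * T" by simp
  show ?thesis
  proof (rule that[OF _ _ fin])
    show "sq z0 r \<subseteq> ?C" "?C \<subseteq> sq z0 (2 * r)"
      using a b c d r by (auto simp: mem_sq in_cbox_complex_iff x0_def y0_def abs_le_iff)
  qed
qed

section \<open>Smooth approximation of Sobolev functions\<close>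

text \<open>Borel functions on the whole plane with \<open>lborel\<close>, in place of functions on
  the domain with \<open>lebesgue\<close>: Fubini and convolution then work without passing through
  completions. Continuity of f is built in.\<close>

definition sob :: "complex set \<Rightarrow> (complex \<Rightarrow> complex) \<Rightarrow> (complex \<Rightarrow> complex) \<Rightarrow> (complex \<Rightarrow> complex) \<Rightarrow> bool" where
  "sob \<Omega> f a b \<longleftrightarrow> open \<Omega> \<and> continuous_on \<Omega> f \<and> f \<in> borel_measurable borel \<and>
     a \<in> borel_measurable borel \<and> b \<in> borel_measurable borel \<and>
     (\<forall>C. compact C \<and> C \<subseteq> \<Omega> \<longrightarrow> set_integrable lborel C (\<lambda>z. en (a z) (b z))) \<and>
     (\<forall>\<phi>. test_function \<Omega> \<phi> \<longrightarrow>
        (LINT z:\<Omega>|lborel. dir_deriv 1 \<phi> z *\<^sub>R f z) = - (LINT z:\<Omega>|lborel. \<phi> z *\<^sub>R a z) \<and>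
        (LINT z:\<Omega>|lborel. dir_deriv \<i> \<phi> z *\<^sub>R f z) = - (LINT z:\<Omega>|lborel. \<phi> z *\<^sub>R b z))"

section \<open>Pointwise estimates for energy and Jacobian\<close>

lemma en_nonneg [simp]: "en a b \<ge> 0" by (simp add: en_def)

lemma borel_measurable_en [measurable (raw)]:
  assumes [measurable]: "f \<in> borel_measurable M" "g \<in> borel_measurable M"
  shows "(\<lambda>x. en (f x) (g x)) \<in> borel_measurable M"
  unfolding en_def by measurable

lemma borel_measurable_jac [measurable (raw)]:
  assumes f: "f \<in> borel_measurable M" and [measurable]: "g \<in> borel_measurable M"
  shows "(\<lambda>x. jac (f x) (g x)) \<in> borel_measurable M"
proof -
  have [measurable]: "(\<lambda>x. cnj (f x)) \<in> borel_measurable M"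
    by (rule measurable_compose[OF f]) (intro borel_measurable_continuous_onI continuous_intros)
  show ?thesis unfolding jac_def by measurable
qed

lemma abs_jac_le_mult: "\<bar>jac a b\<bar> \<le> norm a * norm b"
  unfolding jac_def using abs_Im_le_cmod[of "cnj a * b"] by (simp add: norm_mult)

lemma abs_jac_le: "\<bar>jac a b\<bar> \<le> en a b"
proof -
  have "2 * norm a * norm b \<le> en a b" unfolding en_def by (rule sum_squares_bound)
  moreover have "0 \<le> norm a * norm b" by simp
  ultimately show ?thesis using abs_jac_le_mult[of a b] by linarith
qed

lemma le_en: assumes "s > 0" shows "norm a + norm b \<le> s + en a b / s"
proof -
  have "2 * s * x \<le> s\<^sup>2 + x\<^sup>2" for x :: real by (rule sum_squares_bound)
  from this[of "norm a"] this[of "norm b"]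
  have "s * (2 * (norm a + norm b)) \<le> s * (2 * s + en a b / s)"
  proof -
    assume 1: "2 * s * norm a \<le> s\<^sup>2 + (norm a)\<^sup>2" "2 * s * norm b \<le> s\<^sup>2 + (norm b)\<^sup>2"
    have "s * (2 * s + en a b / s) = 2 * s\<^sup>2 + (norm a)\<^sup>2 + (norm b)\<^sup>2"
      using assms by (simp add: en_def power2_eq_square algebra_simps add_divide_distrib)
    with 1 show ?thesis by (simp add: algebra_simps)
  qed
  then have "2 * (norm a + norm b) \<le> 2 * s + en a b / s" using assms by (simp only: mult_le_cancel_left_pos)
  moreover have "0 \<le> en a b / s" using assms by simp
  ultimately show ?thesis by argo
qed

lemma mult_le_scaled: assumes "s > 0" shows "(x::real) * y \<le> s * x\<^sup>2 + y\<^sup>2 / s"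
proof -
  have "2 * (s * x) * y \<le> (s * x)\<^sup>2 + y\<^sup>2" by (rule sum_squares_bound)
  moreover have "0 \<le> (s * x)\<^sup>2 + y\<^sup>2" by simp
  ultimately have "s * x * y \<le> (s * x)\<^sup>2 + y\<^sup>2" by (simp only: mult.assoc)
  then show ?thesis using assms by (simp add: field_simps power2_eq_square)
qed

text \<open>A quadratic form changes by a small multiple of itself plus a large multiple of the
  squared perturbation. The right-hand side is the same as in \<open>jac_diff\<close>, so that one
  majorant serves both in \<open>sob_approx\<close>.\<close>

lemma en_diff:
  assumes "s > 0"
  shows "\<bar>en a' b' - en a b\<bar> \<le> 2 * s * en a b + (1 + 2 / s) * en (a' - a) (b' - b)"
proof -
  have *: "\<bar>(norm x')\<^sup>2 - (norm x)\<^sup>2\<bar> \<le> 2 * s * (norm x)\<^sup>2 + (1 + 2 / s) * (norm (x' - x))\<^sup>2" for x x' :: complex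
  proof -
    have "(norm x')\<^sup>2 - (norm x)\<^sup>2 = (norm x' - norm x) * (norm x' - norm x + 2 * norm x)"
      by (simp add: power2_eq_square algebra_simps)
    then have "\<bar>(norm x')\<^sup>2 - (norm x)\<^sup>2\<bar> = \<bar>norm x' - norm x\<bar> * \<bar>norm x' - norm x + 2 * norm x\<bar>"
      by (simp add: abs_mult)
    also have "\<dots> \<le> norm (x' - x) * (norm (x' - x) + 2 * norm x)"
      using norm_triangle_ineq3[of x' x] by (intro mult_mono) auto
    also have "\<dots> = (norm (x' - x))\<^sup>2 + 2 * (norm x * norm (x' - x))"
      by (simp add: power2_eq_square algebra_simps)
    also have "\<dots> \<le> (norm (x' - x))\<^sup>2 + 2 * (s * (norm x)\<^sup>2 + (norm (x' - x))\<^sup>2 / s)"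
      using mult_le_scaled[OF assms, of "norm x" "norm (x' - x)"] by simp
    also have "\<dots> = 2 * s * (norm x)\<^sup>2 + (1 + 2 / s) * (norm (x' - x))\<^sup>2"
      by (simp add: algebra_simps)
    finally show ?thesis .
  qed
  have "\<bar>en a' b' - en a b\<bar> \<le> \<bar>(norm a')\<^sup>2 - (norm a)\<^sup>2\<bar> + \<bar>(norm b')\<^sup>2 - (norm b)\<^sup>2\<bar>"
    unfolding en_def by linarith
  also have "\<dots> \<le> (2 * s * (norm a)\<^sup>2 + (1 + 2 / s) * (norm (a' - a))\<^sup>2) + (2 * s * (norm b)\<^sup>2 + (1 + 2 / s) * (norm (b' - b))\<^sup>2)"
    by (intro add_mono *)
  finally show ?thesis unfolding en_def by (simp add: algebra_simps)
qed

lemma jac_diff: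
  assumes "s > 0"
  shows "\<bar>jac a' b' - jac a b\<bar> \<le> 2 * s * en a b + (1 + 2 / s) * en (a' - a) (b' - b)"
proof -
  have "jac a' b' - jac a b = jac a (b' - b) + jac (a' - a) b + jac (a' - a) (b' - b)"
    by (simp add: jac_def algebra_simps)
  then have "\<bar>jac a' b' - jac a b\<bar> \<le> \<bar>jac a (b' - b)\<bar> + \<bar>jac (a' - a) b\<bar> + \<bar>jac (a' - a) (b' - b)\<bar>"
    by linarith
  also have "\<dots> \<le> norm a * norm (b' - b) + norm b * norm (a' - a) + en (a' - a) (b' - b)"
    using abs_jac_le_mult[of a "b' - b"] abs_jac_le_mult[of "a' - a" b] abs_jac_le[of "a' - a" "b' - b"]
    by (simp add: mult.commute)
  also have "\<dots> \<le> (s * (norm a)\<^sup>2 + (norm (b' - b))\<^sup>2 / s) + (s * (norm b)\<^sup>2 + (norm (a' - a))\<^sup>2 / s) + en (a' - a) (b' - b)"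
    by (intro add_mono mult_le_scaled[OF assms]) simp
  also have "\<dots> = s * en a b + (1 + 1 / s) * en (a' - a) (b' - b)"
    unfolding en_def by (simp add: algebra_simps add_divide_distrib)
  also have "\<dots> \<le> 2 * s * en a b + (1 + 2 / s) * en (a' - a) (b' - b)"
    using assms by (intro add_mono mult_right_mono) (auto simp: divide_right_mono)
  finally show ?thesis .
qed

lemma nn_integral_le_imp:
  fixes f :: "'a \<Rightarrow> real"
  assumes "f \<in> borel_measurable M" "\<And>x. f x \<ge> 0" "(\<integral>\<^sup>+x. ennreal (f x) \<partial>M) \<le> ennreal d" "d \<ge> 0"
  shows "integrable M f" "integral\<^sup>L M f \<le> d"
proof -
  show "integrable M f"
    using assms by (intro integrableI_bounded) (auto simp: le_less_trans[OF _ ennreal_less_top])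
  show "integral\<^sup>L M f \<le> d"
    using assms by (simp add: integral_eq_nn_integral enn2real_leI)
qed

section \<open>Mollification of Sobolev functions\<close>

definition ct :: "complex set \<Rightarrow> (complex \<Rightarrow> complex) \<Rightarrow> (real \<Rightarrow> real) \<Rightarrow> (real \<Rightarrow> real) \<Rightarrow> complex \<Rightarrow> complex" where
  "ct Q f H K z = (LINT w:Q|lborel. tens H K (z - w) *\<^sub>R f w)"

text \<open>Over a compact box, differentiating under the integral asks for joint continuity of the
  differentiated integrand. The derivatives fall on the tensor kernel, so f may be merely
  continuous.\<close>

lemma ct_facts:
  assumes f: "continuous_on Q f" and Q: "Q = cbox p q" and H: "smooth1 H" "smooth1 K"
    and H': "\<And>t. (H has_real_derivative H' t) (at t)" and K': "\<And>t. (K has_real_derivative K' t) (at t)"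
  shows "continuous_on UNIV (ct Q f H K)"
    "((\<lambda>x. ct Q f H K (Complex x y)) has_vector_derivative ct Q f H' K (Complex x y)) (at x)"
    "((\<lambda>y. ct Q f H K (Complex x y)) has_vector_derivative ct Q f H K' (Complex x y)) (at y)"
proof -
  have sm': "smooth1 H'" "smooth1 K'" using smooth1_deriv[OF H(1) H'] smooth1_deriv[OF H(2) K'] by auto
  have eq: "ct Q f A B z = integral (cbox p q) (\<lambda>w. tens A B (z - w) *\<^sub>R f w)"
    and int: "(\<lambda>w. tens A B (z - w) *\<^sub>R f w) integrable_on cbox p q"
    if AB: "smooth1 A" "smooth1 B" for A B z
  proof -
    have c: "continuous_on (cbox p q) (\<lambda>w. tens A B (z - w) *\<^sub>R f w)"
      using f unfolding Q
      by (intro continuous_intros continuous_on_compose2[OF continuous_on_tens[OF AB, of UNIV]]) auto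
    show "ct Q f A B z = integral (cbox p q) (\<lambda>w. tens A B (z - w) *\<^sub>R f w)"
      unfolding ct_def Q using borel_integrable_compact[OF compact_cbox c]
      by (intro set_borel_integral_eq_integral) (simp add: set_integrable_def)
    show "(\<lambda>w. tens A B (z - w) *\<^sub>R f w) integrable_on cbox p q"
      by (rule integrable_continuous[OF c])
  qed
  have cc: "continuous_on (S \<times> cbox p q) (\<lambda>(x, w). tens A B (h x - w) *\<^sub>R f w)"
    if AB: "smooth1 A" "smooth1 B" and h: "continuous_on S h" for A B and S :: "'a::topological_space set" and h :: "'a \<Rightarrow> complex"
    unfolding case_prod_beta'
  proof (intro continuous_on_scaleR)
    show "continuous_on (S \<times> cbox p q) (\<lambda>x. tens A B (h (fst x) - snd x))"
      by (rule continuous_on_compose2[OF continuous_on_tens[OF AB, of UNIV]])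
         (auto intro!: continuous_intros continuous_on_compose2[OF h])
    show "continuous_on (S \<times> cbox p q) (\<lambda>x. f (snd x))"
      by (rule continuous_on_compose2[OF f]) (auto intro!: continuous_intros simp: Q)
  qed
  show "continuous_on UNIV (ct Q f H K)"
    using integral_continuous_on_param[OF cc[OF H continuous_on_id, of UNIV]] eq[OF H] by simp
  show "((\<lambda>x. ct Q f H K (Complex x y)) has_vector_derivative ct Q f H' K (Complex x y)) (at x)"
    unfolding eq[OF H] eq[OF sm'(1) H(2)]
  proof (rule leibniz_rule_vector_derivative[where U = UNIV, simplified])
    fix x w assume "w \<in> cbox p q"
    have "((\<lambda>x. H (x - Re w)) has_real_derivative H' (x - Re w)) (at x)"
    proof -
      have "((\<lambda>x. x - Re w) has_real_derivative 1) (at x)" by (auto intro!: derivative_eq_intros)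
      from DERIV_chain2[OF H' this] show ?thesis by simp
    qed
    then have 1: "((\<lambda>x. H (x - Re w) * K (y - Im w)) has_real_derivative H' (x - Re w) * K (y - Im w)) (at x)"
      by (rule DERIV_cmult_right)
    then have "((\<lambda>x. H (x - Re w) * K (y - Im w)) has_vector_derivative H' (x - Re w) * K (y - Im w)) (at x)"
      by (simp add: has_real_derivative_iff_has_vector_derivative)
    then show "((\<lambda>x. tens H K (Complex x y - w) *\<^sub>R f w) has_vector_derivative tens H' K (Complex x y - w) *\<^sub>R f w) (at x)"
      unfolding tens_def 
      using bounded_linear.has_vector_derivative[OF bounded_linear_scaleR_left] by auto
  next
    show "(\<lambda>w. tens H K (Complex x y - w) *\<^sub>R f w) integrable_on cbox p q" for x
      by (rule int[OF H])
    show "continuous_on (UNIV \<times> cbox p q) (\<lambda>(x, w). tens H' K (Complex x y - w) *\<^sub>R f w)"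
      by (intro cc sm' H continuous_intros)
  qed
  show "((\<lambda>y. ct Q f H K (Complex x y)) has_vector_derivative ct Q f H K' (Complex x y)) (at y)"
    unfolding eq[OF H] eq[OF H(1) sm'(2)]
  proof (rule leibniz_rule_vector_derivative[where U = UNIV, simplified])
    fix y w assume "w \<in> cbox p q"
    have "((\<lambda>y. K (y - Im w)) has_real_derivative K' (y - Im w)) (at y)"
    proof -
      have "((\<lambda>x. x - Im w) has_real_derivative 1) (at y)" by (auto intro!: derivative_eq_intros)
      from DERIV_chain2[OF K' this] show ?thesis by simp
    qed
    then have 1: "((\<lambda>y. H (x - Re w) * K (y - Im w)) has_real_derivative H (x - Re w) * K' (y - Im w)) (at y)"
      by (rule DERIV_cmult)
    then have "((\<lambda>y. H (x - Re w) * K (y - Im w)) has_vector_derivative H (x - Re w) * K' (y - Im w)) (at y)"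
      by (simp add: has_real_derivative_iff_has_vector_derivative)
    then show "((\<lambda>y. tens H K (Complex x y - w) *\<^sub>R f w) has_vector_derivative tens H K' (Complex x y - w) *\<^sub>R f w) (at y)"
      unfolding tens_def 
      using bounded_linear.has_vector_derivative[OF bounded_linear_scaleR_left] by auto
  next
    show "(\<lambda>w. tens H K (Complex x y - w) *\<^sub>R f w) integrable_on cbox p q" for y
      by (rule int[OF H])
    show "continuous_on (UNIV \<times> cbox p q) (\<lambda>(y, w). tens H K' (Complex x y - w) *\<^sub>R f w)"
      by (intro cc sm' H continuous_intros)
  qed
qed

lemma sq_enlarge:
  assumes "open \<Omega>" "sq z0 R \<subseteq> \<Omega>" "R > 0"
  obtains h where "h > 0" "sq z0 (R + h) \<subseteq> \<Omega>"
proof -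
  obtain e where e: "e > 0" "(\<Union>x\<in>sq z0 R. ball x e) \<subseteq> \<Omega>"
    using compact_subset_open_imp_ball_epsilon_subset[OF compact_sq assms(1,2)] by blast
  define h where "h = e / 4"
  have h: "h > 0" using e by (simp add: h_def)
  have "w \<in> \<Omega>" if w: "w \<in> sq z0 (R + h)" for w
  proof -
    \<comment> \<open>Contracting w towards the centre into the smaller square moves it by at most 2
      h, which is less than e.\<close>
    define z where "z = z0 + (R / (R + h)) *\<^sub>R (w - z0)"
    have "norm (w - z0) \<le> 2 * (R + h)" using cmod_le[of "w - z0"] w by (simp add: mem_sq)
    have Rh: "0 < R + h" using assms(3) h by simp
    have l: "R * x / (R + h) \<le> R" if "x \<le> R + h" for x
      using that assms(3) Rh by (simp add: pos_divide_le_eq mult_left_mono)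
    have "\<bar>R * x / (R + h)\<bar> \<le> R" if "\<bar>x\<bar> \<le> R + h" for x
      using l[of "\<bar>x\<bar>"] that assms(3) Rh by (simp add: abs_mult)
    then have zR: "z \<in> sq z0 R"
      using w Rh unfolding mem_sq z_def by (simp add: abs_divide)
    have "w - z = (h / (R + h)) *\<^sub>R (w - z0)"
    proof -
      have "h / (R + h) = 1 - R / (R + h)" using Rh by (simp add: field_simps)
      then have "(h / (R + h)) *\<^sub>R (w - z0) = (w - z0) - (R / (R + h)) *\<^sub>R (w - z0)"
        by (simp only: scaleR_left_diff_distrib scaleR_one)
      then show ?thesis unfolding z_def by simp
    qed
    then have "norm (w - z) = h / (R + h) * norm (w - z0)" using h Rh by simp
    also have "\<dots> \<le> h / (R + h) * (2 * (R + h))"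
      using \<open>norm (w - z0) \<le> _\<close> h Rh by (intro mult_left_mono) auto
    also have "\<dots> = 2 * h" using Rh by (simp add: field_simps)
    also have "\<dots> < e" using e by (simp add: h_def)
    finally have "w \<in> ball z e" by (simp add: dist_norm norm_minus_commute)
    with zR show ?thesis using e(2) by blast
  qed
  with h that show ?thesis by blast
qed

lemma test_moll:
  assumes "e > 0" "sq z e \<subseteq> \<Omega>"
  shows "test_function \<Omega> (\<lambda>w. moll e (z - w))"
proof -
  have "test_function \<Omega> (tens (\<lambda>t. bmp e (Re z - t)) (\<lambda>t. bmp e (Im z - t)))"
    by (rule test_function_tens[OF smooth1_bmp_refl smooth1_bmp_refl bmp_out_refl[OF assms(1)] bmp_out_refl[OF assms(1)]])
       (use assms(2) in \<open>simp_all add: sq_alt\<close>)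
  then show ?thesis by (simp add: bmp_refl_tens)
qed

text \<open>As a function of w the reflected kernel is a test function, and its w-derivative is
  minus the derivative of the kernel. This sign cancels the one in the definition of the weak
  derivative.\<close>

lemma conv_weak_deriv:
  assumes s: "sob \<Omega> f a b" and e: "e > 0" and sub: "sq z e \<subseteq> Q" "Q \<subseteq> \<Omega>"
    and B': "\<And>t. (bmp e has_real_derivative B' t) (at t)"
  shows "ct Q f B' (bmp e) z = conv e (\<lambda>w. indicator Q w *\<^sub>R a w) z"
    "ct Q f (bmp e) B' z = conv e (\<lambda>w. indicator Q w *\<^sub>R b w) z"
proof -
  define \<phi> where "\<phi> = tens (\<lambda>t. bmp e (Re z - t)) (\<lambda>t. bmp e (Im z - t))"
  have \<phi>eq: "\<phi> w = moll e (z - w)" for w unfolding \<phi>_def bmp_refl_tens ..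
  have test: "test_function \<Omega> \<phi>"
    using test_moll[OF e order_trans[OF sub]] unfolding \<phi>_def bmp_refl_tens .
  have d: "((\<lambda>t. bmp e (x - t)) has_real_derivative - B' (x - t)) (at t)" for x t
  proof -
    have "((\<lambda>t. x - t) has_real_derivative -1) (at t)" by (auto intro!: derivative_eq_intros)
    from DERIV_chain2[OF B' this] show ?thesis by simp
  qed
  have dd: "dir_deriv 1 \<phi> w = - tens B' (bmp e) (z - w)" "dir_deriv \<i> \<phi> w = - tens (bmp e) B' (z - w)" for w
    unfolding \<phi>_def dir_deriv_tens[OF d d] by (simp_all add: tens_def)
  have B'out: "B' t = 0" if "\<bar>t\<bar> > e" for t
  proof -
    have ev: "\<forall>\<^sub>F s in nhds t. bmp e s = 0"
    proof -
      have "open {s. \<bar>s\<bar> > e}" by (intro open_Collect_less continuous_intros)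
      from eventually_nhds_in_open[OF this, of t] that show ?thesis
        by (auto elim!: eventually_mono simp: bmp_out[OF e])
    qed
    have "((\<lambda>s. 0) has_real_derivative B' t) (at t)"
      by (rule DERIV_cong_ev[OF refl ev refl, THEN iffD1]) (rule B')
    then show ?thesis using DERIV_unique[OF _ DERIV_const] by blast
  qed
  have out: "tens B' (bmp e) (z - w) = 0" "tens (bmp e) B' (z - w) = 0" if "w \<notin> sq z e" for w
    using that B'out bmp_out[OF e] by (auto simp: tens_def mem_sq)
  \<comment> \<open>Kernel and derivatives vanish off \<open>sq z e\<close>, so integrals over
    \<open>Q\<close> and over \<open>\<Omega>\<close> agree.\<close>
  have i1: "indicator Q w * tens B' (bmp e) (z - w) = indicator \<Omega> w * tens B' (bmp e) (z - w)"
    and i2: "indicator Q w * tens (bmp e) B' (z - w) = indicator \<Omega> w * tens (bmp e) B' (z - w)"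
    and i3: "indicator \<Omega> w *\<^sub>R (\<phi> w *\<^sub>R v) = moll e (z - w) *\<^sub>R (indicator Q w *\<^sub>R v)" for w and v :: complex
    using out[of w] moll_out[OF e, of w z] sub unfolding \<phi>eq
    by (cases "w \<in> sq z e"; auto simp: indicator_def)+
  have "ct Q f B' (bmp e) z = - (LINT w:\<Omega>|lborel. dir_deriv 1 \<phi> w *\<^sub>R f w)"
    unfolding ct_def set_lebesgue_integral_def dd by (simp add: i1)
  also have "\<dots> = (LINT w:\<Omega>|lborel. \<phi> w *\<^sub>R a w)"
    using s test by (simp add: sob_def)
  also have "\<dots> = conv e (\<lambda>w. indicator Q w *\<^sub>R a w) z"
    unfolding conv_def set_lebesgue_integral_def i3 ..
  finally show "ct Q f B' (bmp e) z = conv e (\<lambda>w. indicator Q w *\<^sub>R a w) z" .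
  have "ct Q f (bmp e) B' z = - (LINT w:\<Omega>|lborel. dir_deriv \<i> \<phi> w *\<^sub>R f w)"
    unfolding ct_def set_lebesgue_integral_def dd by (simp add: i2)
  also have "\<dots> = (LINT w:\<Omega>|lborel. \<phi> w *\<^sub>R b w)"
    using s test by (simp add: sob_def)
  also have "\<dots> = conv e (\<lambda>w. indicator Q w *\<^sub>R b w) z"
    unfolding conv_def set_lebesgue_integral_def i3 ..
  finally show "ct Q f (bmp e) B' z = conv e (\<lambda>w. indicator Q w *\<^sub>R b w) z" .
qed

lemma sobD:
  assumes "sob \<Omega> f a b"
  shows "open \<Omega>" "continuous_on \<Omega> f" "f \<in> borel_measurable borel" "a \<in> borel_measurable borel" "b \<in> borel_measurable borel"
    "compact C \<Longrightarrow> C \<subseteq> \<Omega> \<Longrightarrow> set_integrable lborel C (\<lambda>z. en (a z) (b z))"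
  using assms unfolding sob_def by blast+

text \<open>On the given square the gradient of the mollification of f is the mollification of the
  weak gradient cut off to a slightly larger square, and that converges in L^2 on the whole
  plane.\<close>

lemma sob_approx_L2:
  assumes s: "sob \<Omega> f a b" and R: "sq z0 R \<subseteq> \<Omega>" "R > 0" and d: "d > 0"
  obtains g gx gy gxy where "c2 g gx gy gxy" "\<And>z. z \<in> sq z0 R \<Longrightarrow> norm (g z - f z) \<le> d"
    "set_integrable lborel (sq z0 R) (\<lambda>z. en (gx z - a z) (gy z - b z))"
    "(LINT z:sq z0 R|lborel. en (gx z - a z) (gy z - b z)) \<le> d"
proof -
  note sd [measurable] = sobD(3-5)[OF s]
  obtain h where h: "h > 0" "sq z0 (R + h) \<subseteq> \<Omega>" using sq_enlarge[OF sobD(1)[OF s] R] .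
  define Q where "Q = sq z0 (R + h)"
  have Qc: "compact Q" by (simp add: Q_def)
  have [measurable]: "Q \<in> sets borel" by (simp add: Q_def)
  have enQ: "set_integrable lborel Q (\<lambda>z. en (a z) (b z))" using sobD(6)[OF s Qc] h by (simp add: Q_def)
  have fQ: "continuous_on Q f" using sobD(2)[OF s] h continuous_on_subset by (auto simp: Q_def)
  have L: "Lp 2 (\<lambda>w. indicator Q w *\<^sub>R v w)" if [measurable]: "v \<in> borel_measurable borel"
    and le: "\<And>w. (norm (v w))\<^sup>2 \<le> en (a w) (b w)" for v
  proof -
    have "(\<integral>\<^sup>+z. pw 2 (indicator Q z *\<^sub>R v z) \<partial>lborel) \<le> (\<integral>\<^sup>+z. ennreal (indicator Q z *\<^sub>R en (a z) (b z)) \<partial>lborel)"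
      using le by (intro nn_integral_mono ennreal_leI) (simp add: indicator_def)
    also have "\<dots> < \<infinity>"
      using enQ unfolding set_integrable_def by (subst nn_integral_eq_integral) auto
    finally show ?thesis by (simp add: Lp_def)
  qed
  have La: "Lp 2 (\<lambda>w. indicator Q w *\<^sub>R a w)" and Lb: "Lp 2 (\<lambda>w. indicator Q w *\<^sub>R b w)"
    by (rule L; simp add: en_def)+
  obtain e1 where e1: "e1 > 0" "\<And>e. 0 < e \<Longrightarrow> e < e1 \<Longrightarrow>
      (\<integral>\<^sup>+z. pw 2 (conv e (\<lambda>w. indicator Q w *\<^sub>R a w) z - indicator Q z *\<^sub>R a z) \<partial>lborel) \<le> ennreal (d / 2)"
    using conv_tendsto[OF La, of "d / 2"] d by auto
  obtain e2 where e2: "e2 > 0" "\<And>e. 0 < e \<Longrightarrow> e < e2 \<Longrightarrow>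
      (\<integral>\<^sup>+z. pw 2 (conv e (\<lambda>w. indicator Q w *\<^sub>R b w) z - indicator Q z *\<^sub>R b z) \<partial>lborel) \<le> ennreal (d / 2)"
    using conv_tendsto[OF Lb, of "d / 2"] d by auto
  have "uniformly_continuous_on Q f" by (rule compact_uniformly_continuous[OF fQ Qc])
  then obtain e3 where e3: "e3 > 0" "\<And>z w. z \<in> Q \<Longrightarrow> w \<in> Q \<Longrightarrow> dist w z < e3 \<Longrightarrow> dist (f w) (f z) < d"
    using d unfolding uniformly_continuous_on_def by metis
  define e where "e = min (min e1 e2) (min (e3 / 2) h) / 2"
  have e: "e > 0" "e < e1" "e < e2" "2 * e < e3" "e < h" using e1(1) e2(1) e3(1) h(1) by (auto simp: e_def min_def)
  have sub: "sq z e \<subseteq> Q" if "z \<in> sq z0 R" for z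
    unfolding Q_def using that e by (intro sq_subset) (auto simp: mem_sq)
  obtain B' where B': "\<And>t. (bmp e has_real_derivative B' t) (at t)" "smooth1 B'"
    using smooth1_derivE[OF smooth1_bmp[of e]] by blast
  obtain B'' where B'': "\<And>t. (B' has_real_derivative B'' t) (at t)"
    using smooth1_derivE[OF B'(2)] by blast
  note Qcb = Q_def[unfolded sq_def]
  define g where "g = ct Q f (bmp e) (bmp e)"
  define gx where "gx = ct Q f B' (bmp e)"
  define gy where "gy = ct Q f (bmp e) B'"
  define gxy where "gxy = ct Q f B' B'"
  note F = ct_facts[OF fQ Qcb]
  have c2: "c2 g gx gy gxy"
    unfolding c2_def c1_def g_def gx_def gy_def gxy_def
    using F[OF smooth1_bmp smooth1_bmp B'(1) B'(1)] F[OF B'(2) smooth1_bmp B'' B'(1)]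
      F[OF smooth1_bmp B'(2) B'(1) B''] F[OF B'(2) B'(2) B'' B''] by blast
  have gf: "norm (g z - f z) \<le> d" if z: "z \<in> sq z0 R" for z
  proof -
    have "g z = conv e (\<lambda>w. indicator Q w *\<^sub>R f w) z"
      unfolding g_def ct_def conv_def moll_def set_lebesgue_integral_def by (simp add: mult.commute)
    moreover have "norm (conv e (\<lambda>w. indicator Q w *\<^sub>R f w) z - f z) \<le> d"
    proof (rule conv_close[OF e(1)])
      have "set_integrable lborel (sq z e) f"
        unfolding set_integrable_def
        by (intro borel_integrable_compact continuous_on_subset[OF fQ sub[OF z]]) simp
      moreover have "(\<lambda>x. indicat_real (sq z e) x *\<^sub>R f x) = (\<lambda>x. indicat_real (sq z e) x *\<^sub>R indicat_real Q x *\<^sub>R f x)"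
        using sub[OF z] by (auto simp: fun_eq_iff indicator_def)
      ultimately show "set_integrable lborel (sq z e) (\<lambda>w. indicat_real Q w *\<^sub>R f w)"
        unfolding set_integrable_def by simp
      fix w assume w: "w \<in> sq z e"
      have "dist w z \<le> 2 * e" using cmod_le[of "w - z"] w by (simp add: mem_sq dist_norm)
      moreover have "z \<in> Q" "w \<in> Q" using sub[OF z] w e(1) by (auto simp: mem_sq[of z z])
      ultimately show "norm (indicat_real Q w *\<^sub>R f w - f z) \<le> d"
        using e3(2)[of z w] e by (simp add: dist_norm)
    qed (use d in simp)
    ultimately show ?thesis by simp
  qed
  have gxeq: "gx z = conv e (\<lambda>w. indicator Q w *\<^sub>R a w) z" "gy z = conv e (\<lambda>w. indicator Q w *\<^sub>R b w) z" if "z \<in> sq z0 R" for z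
    unfolding gx_def gy_def using conv_weak_deriv[OF s e(1) sub[OF that] _ B'(1)] h by (auto simp: Q_def)
  have RQ: "sq z0 R \<subseteq> Q" unfolding Q_def using h by (intro sq_mono) simp
  have [measurable]: "gx \<in> borel_measurable borel" "gy \<in> borel_measurable borel"
    using c2 by (auto simp: c2_def c1_def intro: borel_measurable_continuous_onI)
  have "(\<integral>\<^sup>+z. ennreal (indicator (sq z0 R) z *\<^sub>R en (gx z - a z) (gy z - b z)) \<partial>lborel)
     \<le> (\<integral>\<^sup>+z. pw 2 (conv e (\<lambda>w. indicator Q w *\<^sub>R a w) z - indicator Q z *\<^sub>R a z) +
        pw 2 (conv e (\<lambda>w. indicator Q w *\<^sub>R b w) z - indicator Q z *\<^sub>R b z) \<partial>lborel)"
  proof (rule nn_integral_mono)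
    fix z
    show "ennreal (indicator (sq z0 R) z *\<^sub>R en (gx z - a z) (gy z - b z)) \<le>
      pw 2 (conv e (\<lambda>w. indicator Q w *\<^sub>R a w) z - indicator Q z *\<^sub>R a z) +
        pw 2 (conv e (\<lambda>w. indicator Q w *\<^sub>R b w) z - indicator Q z *\<^sub>R b z)"
      using gxeq[of z] RQ by (cases "z \<in> sq z0 R") (auto simp: en_def)
  qed
  also have "\<dots> = (\<integral>\<^sup>+z. pw 2 (conv e (\<lambda>w. indicator Q w *\<^sub>R a w) z - indicator Q z *\<^sub>R a z) \<partial>lborel) +
        (\<integral>\<^sup>+z. pw 2 (conv e (\<lambda>w. indicator Q w *\<^sub>R b w) z - indicator Q z *\<^sub>R b z) \<partial>lborel)"
    by (rule nn_integral_add) measurable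
  also have "\<dots> \<le> ennreal (d / 2) + ennreal (d / 2)"
    by (intro add_mono e1(2) e2(2) e)
  also have "\<dots> = ennreal d" using d by (simp add: ennreal_plus[symmetric] del: ennreal_plus)
  finally have nn: "(\<integral>\<^sup>+z. ennreal (indicator (sq z0 R) z *\<^sub>R en (gx z - a z) (gy z - b z)) \<partial>lborel) \<le> ennreal d" .
  have "integrable lborel (\<lambda>z. indicator (sq z0 R) z *\<^sub>R en (gx z - a z) (gy z - b z))"
    "(LINT z|lborel. indicator (sq z0 R) z *\<^sub>R en (gx z - a z) (gy z - b z)) \<le> d"
    by (rule nn_integral_le_imp[OF _ _ nn]; use d in \<open>auto simp: indicator_def\<close>)+
  then show ?thesis
    using that[OF c2 gf] by (simp add: set_integrable_def set_lebesgue_integral_def)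
qed

lemma set_integrable_dominated:
  fixes g :: "complex \<Rightarrow> 'b :: {banach, second_countable_topology}"
  assumes "set_integrable lborel C F" "C \<in> sets borel" "g \<in> borel_measurable borel"
    "\<And>z. z \<in> C \<Longrightarrow> norm (g z) \<le> (F z :: real)"
  shows "set_integrable lborel C g"
  by (rule set_integrable_bound[OF assms(1)])
     (use assms in \<open>auto simp: set_borel_measurable_def intro: order_trans[OF _ abs_ge_self]\<close>)

lemma set_integral_nonneg:
  fixes f :: "'a \<Rightarrow> real"
  assumes "\<And>x. x \<in> A \<Longrightarrow> 0 \<le> f x" shows "0 \<le> (LINT x:A|M. f x)"
  unfolding set_lebesgue_integral_def using assms
  by (intro Bochner_Integration.integral_nonneg) (auto simp: indicator_def)

lemma set_integrable_const_sq: "set_integrable lborel (sq z r) (\<lambda>_. c :: real)"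
  by (rule set_integrable_continuous) auto

lemma set_integral_const_sq: "r \<ge> 0 \<Longrightarrow> (LINT z:sq z0 r|lborel. c) = 4 * r\<^sup>2 * (c::real)"
  using emeasure_sq_finite[of z0 r] by (simp add: set_lebesgue_integral_def measure_sq)

lemma set_integral_lincomb3:
  fixes F G H :: "'a \<Rightarrow> real"
  assumes "set_integrable M C F" "set_integrable M C G" "set_integrable M C H"
  shows "set_integrable M C (\<lambda>z. \<alpha> * F z + (\<beta> * G z + \<gamma> * H z))"
    "(LINT z:C|M. \<alpha> * F z + (\<beta> * G z + \<gamma> * H z)) = \<alpha> * (LINT z:C|M. F z) + (\<beta> * (LINT z:C|M. G z) + \<gamma> * (LINT z:C|M. H z))"
proof -
  have i: "set_integrable M C (\<lambda>z. \<alpha> * F z)" "set_integrable M C (\<lambda>z. \<beta> * G z)" "set_integrable M C (\<lambda>z. \<gamma> * H z)"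
    using assms by auto
  show "set_integrable M C (\<lambda>z. \<alpha> * F z + (\<beta> * G z + \<gamma> * H z))"
    using i by (intro set_integral_add)
  show "(LINT z:C|M. \<alpha> * F z + (\<beta> * G z + \<gamma> * H z)) = \<alpha> * (LINT z:C|M. F z) + (\<beta> * (LINT z:C|M. G z) + \<gamma> * (LINT z:C|M. H z))"
    using i assms by (simp add: set_integral_add)
qed

lemma sob_integrable:
  assumes s: "sob \<Omega> f a b" and C: "sq z0 R \<subseteq> \<Omega>"
  shows "set_integrable lborel (sq z0 R) (\<lambda>z. en (a z) (b z))"
    "set_integrable lborel (sq z0 R) (\<lambda>z. jac (a z) (b z))"
    "set_integrable lborel (sq z0 R) (\<lambda>z. norm (a z) + norm (b z))"
    "set_integrable lborel (sq z0 R) a" "set_integrable lborel (sq z0 R) b"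
proof -
  note sd [measurable] = sobD(3-5)[OF s]
  show e: "set_integrable lborel (sq z0 R) (\<lambda>z. en (a z) (b z))"
    by (rule sobD(6)[OF s compact_sq C])
  show "set_integrable lborel (sq z0 R) (\<lambda>z. jac (a z) (b z))"
    by (rule set_integrable_dominated[OF e]) (auto simp: abs_jac_le)
  have "set_integrable lborel (sq z0 R) (\<lambda>z. 1 + en (a z) (b z))"
    by (rule set_integral_add[OF set_integrable_const_sq e])
  then show n: "set_integrable lborel (sq z0 R) (\<lambda>z. norm (a z) + norm (b z))"
    by (rule set_integrable_dominated) (use le_en[of 1] in auto)
  show "set_integrable lborel (sq z0 R) a" "set_integrable lborel (sq z0 R) b"
    by (rule set_integrable_dominated[OF n]; simp)+
qed

lemma sob_approx:
  assumes s: "sob \<Omega> f a b" and R: "sq z0 R \<subseteq> \<Omega>" "R > 0" and d: "d > 0"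
  obtains g gx gy gxy where "c2 g gx gy gxy" "\<And>z. z \<in> sq z0 R \<Longrightarrow> norm (g z - f z) \<le> d"
    "(LINT z:sq z0 R|lborel. \<bar>jac (gx z) (gy z) - jac (a z) (b z)\<bar>) \<le> d"
    "(LINT z:sq z0 R|lborel. \<bar>en (gx z) (gy z) - en (a z) (b z)\<bar>) \<le> d"
    "(LINT z:sq z0 R|lborel. norm (gx z - a z) + norm (gy z - b z)) \<le> d"
proof -
  note sd [measurable] = sobD(3-5)[OF s]
  let ?Q = "sq z0 R"
  define E where "E = (LINT z:?Q|lborel. en (a z) (b z))"
  have E: "E \<ge> 0" unfolding E_def by (rule set_integral_nonneg) simp
  \<comment> \<open>\<open>t\<close> makes the term with the fixed energy \<open>E\<close> at most d
    / 2, and \<open>t'\<close> does so for the area term. Only then is \<open>\<delta>\<close>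
    chosen, small against both \<open>t\<close> and \<open>t'\<close>.\<close>
  define t where "t = d / (4 * (E + 1))"
  have t: "t > 0" "2 * t * E \<le> d / 2" using d E by (auto simp: t_def field_simps)
  define t' where "t' = d / (2 * (4 * R\<^sup>2 + 1))"
  have R2: "4 * R\<^sup>2 + 1 > 0" by (simp add: add_nonneg_pos)
  have t': "t' > 0" "4 * R\<^sup>2 * t' \<le> d / 2" using d R2 by (auto simp: t'_def field_simps)
  define \<delta> where "\<delta> = min d (min (d / (2 * (1 + 2 / t))) (d * t' / 2))"
  have t2: "1 + 2 / t > 0" using t by (simp add: add_pos_pos)
  have \<delta>: "\<delta> > 0" using d t2 t' by (simp add: \<delta>_def)
  have "\<delta> \<le> d / (2 * (1 + 2 / t))" "\<delta> \<le> d * t' / 2" and \<delta>d: "\<delta> \<le> d"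
    unfolding \<delta>_def by (meson min.cobounded1 min.cobounded2 order_trans)+
  have "2 * (1 + 2 / t) > 0" using t2 by simp
  from pos_le_divide_eq[OF this, THEN iffD1, OF \<open>\<delta> \<le> d / (2 * (1 + 2 / t))\<close>]
  have "\<delta> * (2 * (1 + 2 / t)) \<le> d" .
  moreover have "\<delta> \<le> d / 2 * t'" using \<open>\<delta> \<le> d * t' / 2\<close> by simp
  ultimately have \<delta>2: "(1 + 2 / t) * \<delta> \<le> d / 2" "\<delta> / t' \<le> d / 2" "\<delta> \<le> d"
    using \<delta>d by (simp_all only: pos_divide_le_eq[OF t'(1)]) (simp add: algebra_simps)
  obtain g gx gy gxy where c2: "c2 g gx gy gxy" and gf: "\<And>z. z \<in> ?Q \<Longrightarrow> norm (g z - f z) \<le> \<delta>"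
    and i: "set_integrable lborel ?Q (\<lambda>z. en (gx z - a z) (gy z - b z))"
    and le: "(LINT z:?Q|lborel. en (gx z - a z) (gy z - b z)) \<le> \<delta>"
    using sob_approx_L2[OF s R \<delta>] by blast
  have [measurable]: "gx \<in> borel_measurable borel" "gy \<in> borel_measurable borel"
    using c2 by (auto simp: c2_def c1_def intro: borel_measurable_continuous_onI)
  note ei = sob_integrable(1)[OF s R(1)]
  have dom: "set_integrable lborel ?Q (\<lambda>z. 2 * t * en (a z) (b z) + (1 + 2 / t) * en (gx z - a z) (gy z - b z))"
    using ei i by auto
  have domle: "(LINT z:?Q|lborel. 2 * t * en (a z) (b z) + (1 + 2 / t) * en (gx z - a z) (gy z - b z)) \<le> d"
  proof -
    have "(LINT z:?Q|lborel. 2 * t * en (a z) (b z) + (1 + 2 / t) * en (gx z - a z) (gy z - b z))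
        = 2 * t * E + (1 + 2 / t) * (LINT z:?Q|lborel. en (gx z - a z) (gy z - b z))"
      using ei i by (subst set_integral_add) (auto simp: E_def)
    also have "\<dots> \<le> d / 2 + (1 + 2 / t) * \<delta>"
      using t le t2 by (intro add_mono mult_left_mono) auto
    finally show ?thesis using \<delta>2 by linarith
  qed
  have 1: "(LINT z:?Q|lborel. \<bar>jac (gx z) (gy z) - jac (a z) (b z)\<bar>) \<le> d"
  proof (rule order_trans[OF set_integral_mono domle])
    show "set_integrable lborel ?Q (\<lambda>z. \<bar>jac (gx z) (gy z) - jac (a z) (b z)\<bar>)"
      by (rule set_integrable_dominated[OF dom]) (use jac_diff[OF t(1)] in auto)
  qed (use dom jac_diff[OF t(1)] in auto)
  have 2: "(LINT z:?Q|lborel. \<bar>en (gx z) (gy z) - en (a z) (b z)\<bar>) \<le> d"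
  proof (rule order_trans[OF set_integral_mono domle])
    show "set_integrable lborel ?Q (\<lambda>z. \<bar>en (gx z) (gy z) - en (a z) (b z)\<bar>)"
      by (rule set_integrable_dominated[OF dom]) (use en_diff[OF t(1)] in auto)
  qed (use dom en_diff[OF t(1)] in auto)
  have i': "set_integrable lborel ?Q (\<lambda>z. t' + en (gx z - a z) (gy z - b z) / t')"
    using i set_integrable_const_sq by (intro set_integral_add) auto
  have 3: "(LINT z:?Q|lborel. norm (gx z - a z) + norm (gy z - b z)) \<le> d"
  proof -
    have "(LINT z:?Q|lborel. norm (gx z - a z) + norm (gy z - b z)) \<le> (LINT z:?Q|lborel. t' + en (gx z - a z) (gy z - b z) / t')"
      by (intro set_integral_mono set_integrable_dominated[OF i'] i' le_en t') (use le_en[OF t'(1)] in auto)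
    also have "\<dots> = 4 * R\<^sup>2 * t' + (LINT z:?Q|lborel. en (gx z - a z) (gy z - b z)) / t'"
      using i set_integrable_const_sq R by (subst set_integral_add) (auto simp: set_integral_const_sq)
    also have "\<dots> \<le> d / 2 + \<delta> / t'"
      using t' le by (intro add_mono divide_right_mono) auto
    finally show ?thesis using \<delta>2 by linarith
  qed
  show ?thesis using gf \<delta>2(3) by (intro that[OF c2 _ 1 2 3]) force
qed

section \<open>Local estimates for quasiregular maps\<close>

text \<open>The form of the distortion condition used in all estimates: energy against Jacobian. By
  \<open>qr_algebra\<close> it is equivalent to the inequality between the complex derivatives when
  \<kappa> = K + 1/K.\<close>

definition qr :: "real \<Rightarrow> complex set \<Rightarrow> (complex \<Rightarrow> complex) \<Rightarrow> (complex \<Rightarrow> complex) \<Rightarrow> (complex \<Rightarrow> complex) \<Rightarrow> bool" where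
  "qr \<kappa> \<Omega> f a b \<longleftrightarrow> sob \<Omega> f a b \<and> (AE z in lborel. z \<in> \<Omega> \<longrightarrow> en (a z) (b z) \<le> \<kappa> * jac (a z) (b z))"

lemma qr_jac_nonneg:
  assumes "qr \<kappa> \<Omega> f a b" "\<kappa> > 0"
  shows "AE z in lborel. z \<in> \<Omega> \<longrightarrow> 0 \<le> jac (a z) (b z)"
  using assms(1)[unfolded qr_def, THEN conjunct2]
proof eventually_elim
  case (elim z)
  then show ?case using assms(2) order_trans[OF en_nonneg, of "a z" "b z" "\<kappa> * jac (a z) (b z)"]
    by (auto simp: zero_le_mult_iff)
qed

text \<open>The smooth inequality holds on a rectangle depending on the approximation, about which
  nothing is known except its position between the two squares. Non-negativity of the Jacobian
  allows replacing the inner square by that rectangle.\<close>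

lemma hole_filling:
  assumes q: "qr \<kappa> \<Omega> f a b" and k: "\<kappa> > 0" and r: "r > 0" and sub: "sq z0 (2 * r) \<subseteq> \<Omega>"
  shows "(LINT z:sq z0 r|lborel. jac (a z) (b z)) \<le> 36 * (LINT z:sq z0 (2 * r) - sq z0 r|lborel. en (a z) (b z))"
proof (rule field_le_epsilon)
  fix \<epsilon> :: real assume "\<epsilon> > 0"
  \<comment> \<open>The total error is 36 times 2 d, from the energy bound N + 2 d, plus d from the
    Jacobian.\<close>
  define d where "d = \<epsilon> / 73"
  have d: "d > 0" using \<open>\<epsilon> > 0\<close> by (simp add: d_def)
  have s: "sob \<Omega> f a b" using q by (simp add: qr_def)
  note sd [measurable] = sobD(3-5)[OF s]
  let ?Q = "sq z0 (2 * r)"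
  let ?A = "sq z0 (2 * r) - sq z0 r"
  have r2: "2 * r > 0" using r by simp
  obtain g gx gy gxy where c2: "c2 g gx gy gxy"
    and jd: "(LINT z:?Q|lborel. \<bar>jac (gx z) (gy z) - jac (a z) (b z)\<bar>) \<le> d"
    and ed: "(LINT z:?Q|lborel. \<bar>en (gx z) (gy z) - en (a z) (b z)\<bar>) \<le> d"
    by (rule sob_approx[OF s sub r2 d]) (rule that; assumption)
  have gc: "continuous_on UNIV gx" "continuous_on UNIV gy" using c2 by (auto simp: c2_def c1_def)
  have [measurable]: "gx \<in> borel_measurable borel" "gy \<in> borel_measurable borel"
    using gc by (auto intro: borel_measurable_continuous_onI)
  have eng: "set_integrable lborel ?Q (\<lambda>z. en (gx z) (gy z))"
    unfolding en_def by (intro set_integrable_continuous continuous_intros gc) simp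
  have jg: "set_integrable lborel ?Q (\<lambda>z. jac (gx z) (gy z))"
    unfolding jac_def by (intro set_integrable_continuous continuous_intros gc) simp
  note si = sob_integrable(1,2)[OF s sub]
  have sets: "?A \<in> sets lborel" by simp
  define N where "N = (LINT z:?A|lborel. en (a z) (b z))"
  have N: "N \<ge> 0" unfolding N_def by (rule set_integral_nonneg) simp
  have "(LINT z:?A|lborel. en (gx z) (gy z)) \<le> (LINT z:?A|lborel. en (a z) (b z) + \<bar>en (gx z) (gy z) - en (a z) (b z)\<bar>)"
    by (intro set_integral_mono set_integral_add set_integrable_abs set_integral_diff set_integrable_subset[OF eng]
        set_integrable_subset[OF si(1)]) auto
  also have "\<dots> = N + (LINT z:?A|lborel. \<bar>en (gx z) (gy z) - en (a z) (b z)\<bar>)"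
    unfolding N_def
    by (intro set_integral_add set_integrable_abs set_integral_diff set_integrable_subset[OF eng]
        set_integrable_subset[OF si(1)]) auto
  also have "(LINT z:?A|lborel. \<bar>en (gx z) (gy z) - en (a z) (b z)\<bar>) \<le> (LINT z:?Q|lborel. \<bar>en (gx z) (gy z) - en (a z) (b z)\<bar>)"
    by (intro set_integral_subset_le set_integrable_abs set_integral_diff eng si) auto
  finally have T: "(LINT z:?A|lborel. en (gx z) (gy z)) \<le> N + 2 * d" using ed d by linarith
  have T0: "N + 2 * d > 0" using N d by simp
  obtain p1 p2 p3 p4 where sub1: "sq z0 r \<subseteq> cbox (Complex p1 p3) (Complex p2 p4)"
    and sub2: "cbox (Complex p1 p3) (Complex p2 p4) \<subseteq> ?Q"
    and G: "\<bar>LINT z:cbox (Complex p1 p3) (Complex p2 p4)|lborel. jac (gx z) (gy z)\<bar> \<le> 36 * (N + 2 * d)"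
    by (rule smooth_hole_filling[OF c2 r T0 T]) (rule that; assumption)
  let ?C = "cbox (Complex p1 p3) (Complex p2 p4)"
  have jC: "set_integrable lborel ?C (\<lambda>z. jac (a z) (b z))" "set_integrable lborel ?C (\<lambda>z. jac (gx z) (gy z))"
    using set_integrable_subset[OF si(2) _ sub2] set_integrable_subset[OF jg _ sub2] by simp_all
  \<comment> \<open>Monotonicity in the domain of integration is where quasiregularity enters; the
    remaining steps only compare f with its approximation.\<close>
  have "(LINT z:sq z0 r|lborel. jac (a z) (b z)) \<le> (LINT z:?C|lborel. jac (a z) (b z))"
    by (rule set_integral_subset_le_AE[OF jC(1) _ sub1])
       (use qr_jac_nonneg[OF q k] sub sub2 in \<open>auto elim!: eventually_mono\<close>)
  also have "\<dots> \<le> (LINT z:?C|lborel. jac (gx z) (gy z) + \<bar>jac (gx z) (gy z) - jac (a z) (b z)\<bar>)"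
    by (intro set_integral_mono set_integral_add set_integrable_abs set_integral_diff jC) auto
  also have "\<dots> = (LINT z:?C|lborel. jac (gx z) (gy z)) + (LINT z:?C|lborel. \<bar>jac (gx z) (gy z) - jac (a z) (b z)\<bar>)"
    by (intro set_integral_add set_integrable_abs set_integral_diff jC)
  also have "(LINT z:?C|lborel. \<bar>jac (gx z) (gy z) - jac (a z) (b z)\<bar>) \<le> (LINT z:?Q|lborel. \<bar>jac (gx z) (gy z) - jac (a z) (b z)\<bar>)"
    by (intro set_integral_subset_le set_integrable_abs set_integral_diff jg si sub2) auto
  finally have "(LINT z:sq z0 r|lborel. jac (a z) (b z)) \<le> 36 * (N + 2 * d) + d"
    using G jd by linarith
  then show "(LINT z:sq z0 r|lborel. jac (a z) (b z)) \<le> 36 * (LINT z:?A|lborel. en (a z) (b z)) + \<epsilon>"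
    unfolding N_def d_def by (simp add: algebra_simps)
qed

section \<open>The Jacobian identity and the Caccioppoli inequality\<close>

lemma Green_vanishing:
  assumes g: "c2 g gx gy gxy" and \<eta>: "c1 \<eta> \<eta>x \<eta>y" and R: "R \<ge> 0"
    and van: "\<And>z. z \<in> sq z0 R \<Longrightarrow> \<bar>Re z - Re z0\<bar> = R \<or> \<bar>Im z - Im z0\<bar> = R \<Longrightarrow> \<eta> z = 0"
  shows "(LINT z:sq z0 R|lborel. \<eta> z * (2 * \<i> * jac (gx z) (gy z)) + cnj (g z) * (\<eta>x z * gy z - \<eta>y z * gx z)) = 0"
proof -
  have gc: "continuous_on UNIV g" "continuous_on UNIV gx" "continuous_on UNIV gy" using g by (auto simp: c2_def c1_def)
  have \<eta>c: "continuous_on UNIV \<eta>" "continuous_on UNIV \<eta>x" "continuous_on UNIV \<eta>y" using \<eta> by (auto simp: c1_def)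
  \<comment> \<open>Green's formula with U = \<eta> cnj g and V = g: all boundary terms vanish
    together with \<eta>.\<close>
  define U where "U z = \<eta> z * cnj (g z)" for z
  define Ux where "Ux z = \<eta>x z * cnj (g z) + \<eta> z * cnj (gx z)" for z
  define Uy where "Uy z = \<eta>y z * cnj (g z) + \<eta> z * cnj (gy z)" for z
  have U: "c1 U Ux Uy"
    unfolding c1_def
  proof (intro conjI allI)
    show "continuous_on UNIV U" "continuous_on UNIV Ux" "continuous_on UNIV Uy"
      unfolding U_def Ux_def Uy_def by (intro continuous_intros gc \<eta>c)+
    fix x y
    have 1: "((\<lambda>x. cnj (g (Complex x y))) has_vector_derivative cnj (gx (Complex x y))) (at x)"
      using g by (intro bounded_linear.has_vector_derivative[OF bounded_linear_cnj]) (auto simp: c2_def c1_def)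
    have 2: "((\<lambda>y. cnj (g (Complex x y))) has_vector_derivative cnj (gy (Complex x y))) (at y)"
      using g by (intro bounded_linear.has_vector_derivative[OF bounded_linear_cnj]) (auto simp: c2_def c1_def)
    show "((\<lambda>x. U (Complex x y)) has_vector_derivative Ux (Complex x y)) (at x)"
      unfolding U_def Ux_def using has_vector_derivative_mult[OF _ 1, of "\<lambda>x. \<eta> (Complex x y)" "\<eta>x (Complex x y)"] \<eta>
      by (auto simp: c1_def algebra_simps)
    show "((\<lambda>y. U (Complex x y)) has_vector_derivative Uy (Complex x y)) (at y)"
      unfolding U_def Uy_def using has_vector_derivative_mult[OF _ 2, of "\<lambda>y. \<eta> (Complex x y)" "\<eta>y (Complex x y)"] \<eta>
      by (auto simp: c1_def algebra_simps)
  qed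
  have "(LINT z:sq z0 R|lborel. \<eta> z * (2 * \<i> * jac (gx z) (gy z)) + cnj (g z) * (\<eta>x z * gy z - \<eta>y z * gx z))
     = (LINT z:sq z0 R|lborel. Ux z * gy z - Uy z * gx z)"
    unfolding cnj_jac[symmetric] Ux_def Uy_def by (simp add: algebra_simps)
  also have "\<dots> = integral {Im z0 - R..Im z0 + R} (\<lambda>y. U (Complex (Re z0 + R) y) * gy (Complex (Re z0 + R) y) - U (Complex (Re z0 - R) y) * gy (Complex (Re z0 - R) y))
    - integral {Re z0 - R..Re z0 + R} (\<lambda>x. U (Complex x (Im z0 + R)) * gx (Complex x (Im z0 + R)) - U (Complex x (Im z0 - R)) * gx (Complex x (Im z0 - R)))"
    unfolding sq_alt by (rule Green_rectangle[OF U g]) (use R in auto)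
  also have "integral {Im z0 - R..Im z0 + R} (\<lambda>y. U (Complex (Re z0 + R) y) * gy (Complex (Re z0 + R) y) - U (Complex (Re z0 - R) y) * gy (Complex (Re z0 - R) y))
     = integral {Im z0 - R..Im z0 + R} (\<lambda>y. 0)"
    using van R by (intro integral_cong) (auto simp: U_def mem_sq abs_le_iff)
  also have "integral {Re z0 - R..Re z0 + R} (\<lambda>x. U (Complex x (Im z0 + R)) * gx (Complex x (Im z0 + R)) - U (Complex x (Im z0 - R)) * gx (Complex x (Im z0 - R)))
     = integral {Re z0 - R..Re z0 + R} (\<lambda>x. 0)"
    using van R by (intro integral_cong) (auto simp: U_def mem_sq abs_le_iff)
  finally show ?thesis by simp
qed

lemma continuous_bounded_sq:
  fixes F :: "complex \<Rightarrow> complex"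
  assumes "continuous_on (sq z0 R) F"
  obtains B where "B \<ge> 0" "\<And>z. z \<in> sq z0 R \<Longrightarrow> norm (F z) \<le> B"
proof -
  have "bounded (F ` sq z0 R)" by (intro compact_imp_bounded compact_continuous_image assms compact_sq)
  then show ?thesis using that by (metis bounded_pos imageI less_imp_le)
qed

text \<open>The weighted Jacobian integrates to an expression linear in the gradient, with the map
  itself as coefficient. For smooth maps this is \<open>Green_vanishing\<close>; the passage to f
  uses uniform convergence of the maps and L^1 convergence of gradients and Jacobians.\<close>

lemma jacobian_identity:
  assumes s: "sob \<Omega> f a b" and R: "sq z0 R \<subseteq> \<Omega>" "R > 0" and \<eta>: "c1 \<eta> \<eta>x \<eta>y"
    and van: "\<And>z. z \<in> sq z0 R \<Longrightarrow> \<bar>Re z - Re z0\<bar> = R \<or> \<bar>Im z - Im z0\<bar> = R \<Longrightarrow> \<eta> z = 0"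
  shows "(LINT z:sq z0 R|lborel. \<eta> z * (2 * \<i> * jac (a z) (b z)) + cnj (f z) * (\<eta>x z * b z - \<eta>y z * a z)) = 0"
    "set_integrable lborel (sq z0 R) (\<lambda>z. \<eta> z * (2 * \<i> * jac (a z) (b z)))"
    "set_integrable lborel (sq z0 R) (\<lambda>z. cnj (f z) * (\<eta>x z * b z - \<eta>y z * a z))"
proof -
  note sd [measurable] = sobD(3-5)[OF s]
  let ?Q = "sq z0 R"
  have fc: "continuous_on ?Q f" using sobD(2)[OF s] R(1) continuous_on_subset by blast
  have \<eta>c: "continuous_on UNIV \<eta>" "continuous_on UNIV \<eta>x" "continuous_on UNIV \<eta>y" using \<eta> by (auto simp: c1_def)
  have [measurable]: "\<eta> \<in> borel_measurable borel" "\<eta>x \<in> borel_measurable borel" "\<eta>y \<in> borel_measurable borel"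
    using \<eta>c by (auto intro: borel_measurable_continuous_onI)
  have [measurable]: "(\<lambda>z. cnj (f z)) \<in> borel_measurable borel"
    by (rule measurable_compose[OF sd(1)]) (intro borel_measurable_continuous_onI continuous_intros)
  obtain F where F: "F \<ge> 0" "\<And>z. z \<in> ?Q \<Longrightarrow> norm (f z) \<le> F" using continuous_bounded_sq[OF fc] by blast
  obtain B1 where B1: "B1 \<ge> 0" "\<And>z. z \<in> ?Q \<Longrightarrow> norm (\<eta> z) \<le> B1"
    using continuous_bounded_sq[OF continuous_on_subset[OF \<eta>c(1)]] by blast
  obtain B2 where B2: "B2 \<ge> 0" "\<And>z. z \<in> ?Q \<Longrightarrow> norm (\<eta>x z) \<le> B2"
    using continuous_bounded_sq[OF continuous_on_subset[OF \<eta>c(2)]] by blast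
  obtain B3 where B3: "B3 \<ge> 0" "\<And>z. z \<in> ?Q \<Longrightarrow> norm (\<eta>y z) \<le> B3"
    using continuous_bounded_sq[OF continuous_on_subset[OF \<eta>c(3)]] by blast
  define B where "B = B1 + B2 + B3"
  have B: "B \<ge> 0" "\<And>z. z \<in> ?Q \<Longrightarrow> norm (\<eta> z) \<le> B" "\<And>z. z \<in> ?Q \<Longrightarrow> norm (\<eta>x z) \<le> B" "\<And>z. z \<in> ?Q \<Longrightarrow> norm (\<eta>y z) \<le> B"
    using B1 B2 B3 unfolding B_def by (auto intro: order_trans[OF _ add_increasing] add_increasing2 add_increasing)
  note si = sob_integrable[OF s R(1)]
  have cross: "norm (\<eta>x z * v - \<eta>y z * u) \<le> B * (norm u + norm v)" if "z \<in> ?Q" for z u v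
  proof -
    have "norm (\<eta>x z * v - \<eta>y z * u) \<le> norm (\<eta>x z) * norm v + norm (\<eta>y z) * norm u"
      by (metis norm_mult norm_triangle_ineq4)
    also have "\<dots> \<le> B * norm v + B * norm u" using B that by (intro add_mono mult_right_mono) auto
    finally show ?thesis by (simp add: algebra_simps)
  qed
  have "set_integrable lborel ?Q (\<lambda>z. (2 * B) * en (a z) (b z))" using si(1) by auto
  then show i1: "set_integrable lborel ?Q (\<lambda>z. \<eta> z * (2 * \<i> * jac (a z) (b z)))"
  proof (rule set_integrable_dominated)
    fix z assume z: "z \<in> ?Q"
    have "norm (\<eta> z) * \<bar>jac (a z) (b z)\<bar> \<le> B * en (a z) (b z)"
      using B z abs_jac_le by (intro mult_mono) auto
    then show "norm (\<eta> z * (2 * \<i> * jac (a z) (b z))) \<le> (2 * B) * en (a z) (b z)"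
      by (simp add: norm_mult)
  qed (simp, measurable)
  have "set_integrable lborel ?Q (\<lambda>z. F * B * (norm (a z) + norm (b z)))" using si(3) by auto
  then show i2: "set_integrable lborel ?Q (\<lambda>z. cnj (f z) * (\<eta>x z * b z - \<eta>y z * a z))"
  proof (rule set_integrable_dominated)
    fix z assume z: "z \<in> ?Q"
    have "norm (f z) * norm (\<eta>x z * b z - \<eta>y z * a z) \<le> F * (B * (norm (a z) + norm (b z)))"
      using F cross z by (intro mult_mono) auto
    then show "norm (cnj (f z) * (\<eta>x z * b z - \<eta>y z * a z)) \<le> F * B * (norm (a z) + norm (b z))"
      by (simp add: norm_mult mult.assoc)
  qed (simp, measurable)
  define S where "S = (LINT z:?Q|lborel. norm (a z) + norm (b z))"
  have S: "S \<ge> 0" unfolding S_def by (rule set_integral_nonneg) simp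
  define I where "I = (LINT z:?Q|lborel. \<eta> z * (2 * \<i> * jac (a z) (b z)) + cnj (f z) * (\<eta>x z * b z - \<eta>y z * a z))"
  \<comment> \<open>The error bound is linear in d; the assumption d \<le> 1 absorbs its quadratic
    term.\<close>
  have key: "norm I \<le> (2 * B + B * (S + 1) + F * B) * d" if d: "0 < d" "d \<le> 1" for d
  proof -
    obtain g gx gy gxy where c2: "c2 g gx gy gxy" and gf: "\<And>z. z \<in> ?Q \<Longrightarrow> norm (g z - f z) \<le> d"
      and jd: "(LINT z:?Q|lborel. \<bar>jac (gx z) (gy z) - jac (a z) (b z)\<bar>) \<le> d"
      and nd: "(LINT z:?Q|lborel. norm (gx z - a z) + norm (gy z - b z)) \<le> d"
      by (rule sob_approx[OF s R d(1)]) (rule that; assumption)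
    have gc: "continuous_on UNIV g" "continuous_on UNIV gx" "continuous_on UNIV gy" using c2 by (auto simp: c2_def c1_def)
    have [measurable]: "gx \<in> borel_measurable borel" "gy \<in> borel_measurable borel"
      using gc by (auto intro: borel_measurable_continuous_onI)
    let ?g = "\<lambda>z. \<eta> z * (2 * \<i> * jac (gx z) (gy z)) + cnj (g z) * (\<eta>x z * gy z - \<eta>y z * gx z)"
    let ?f = "\<lambda>z. \<eta> z * (2 * \<i> * jac (a z) (b z)) + cnj (f z) * (\<eta>x z * b z - \<eta>y z * a z)"
    have ig: "set_integrable lborel ?Q ?g"
      unfolding jac_def by (intro set_integrable_continuous continuous_intros gc \<eta>c) simp
    have jg: "set_integrable lborel ?Q (\<lambda>z. jac (gx z) (gy z))"
      unfolding jac_def by (intro set_integrable_continuous continuous_intros gc) simp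
    have igx: "set_integrable lborel ?Q gx" "set_integrable lborel ?Q gy"
      by (intro set_integrable_continuous gc compact_sq)+
    have J: "set_integrable lborel ?Q (\<lambda>z. \<bar>jac (gx z) (gy z) - jac (a z) (b z)\<bar>)"
      by (intro set_integrable_abs set_integral_diff jg si)
    have D: "set_integrable lborel ?Q (\<lambda>z. norm (gx z - a z) + norm (gy z - b z))"
      by (intro set_integral_add set_integrable_norm set_integral_diff igx si)
    have "I = (LINT z:?Q|lborel. ?f z) - (LINT z:?Q|lborel. ?g z)"
      unfolding I_def using Green_vanishing[OF c2 \<eta> _ van] R(2) by simp
    also have "\<dots> = (LINT z:?Q|lborel. ?f z - ?g z)"
      by (rule set_integral_diff(2)[symmetric]) (intro set_integral_add i1 i2 ig)+
    finally have I_eq: "I = (LINT z:?Q|lborel. ?f z - ?g z)" .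
    have "norm I \<le> (LINT z:?Q|lborel. norm (?f z - ?g z))"
      unfolding I_eq by (rule set_integral_norm_bound) (intro set_integral_diff set_integral_add i1 i2 ig)
    also have "\<dots> \<le> (LINT z:?Q|lborel. 2 * B * \<bar>jac (gx z) (gy z) - jac (a z) (b z)\<bar>
        + (d * B * (norm (a z) + norm (b z)) + (d * B + F * B) * (norm (gx z - a z) + norm (gy z - b z))))"
    proof (rule set_integral_mono)
      show "set_integrable lborel ?Q (\<lambda>z. norm (?f z - ?g z))"
        by (intro set_integrable_norm set_integral_diff set_integral_add i1 i2 ig)
      show "set_integrable lborel ?Q (\<lambda>z. 2 * B * \<bar>jac (gx z) (gy z) - jac (a z) (b z)\<bar>
        + (d * B * (norm (a z) + norm (b z)) + (d * B + F * B) * (norm (gx z - a z) + norm (gy z - b z))))"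
        by (rule set_integral_lincomb3[OF J si(3) D])
      fix z assume z: "z \<in> ?Q"
      let ?n = "norm (gx z - a z) + norm (gy z - b z)"
      \<comment> \<open>One factor is exchanged at a time: the Jacobian, then the map, then the
        gradient.\<close>
      have eq: "?f z - ?g z = \<eta> z * (2 * \<i> * complex_of_real (jac (a z) (b z) - jac (gx z) (gy z)))
          + (cnj (f z - g z) * (\<eta>x z * gy z - \<eta>y z * gx z) + cnj (f z) * (\<eta>x z * (b z - gy z) - \<eta>y z * (a z - gx z)))"
        by (simp add: algebra_simps)
      have 1: "norm (\<eta> z * (2 * \<i> * complex_of_real (jac (a z) (b z) - jac (gx z) (gy z)))) \<le> 2 * B * \<bar>jac (gx z) (gy z) - jac (a z) (b z)\<bar>"
      proof -
        have "norm (\<eta> z * (2 * \<i> * complex_of_real (jac (a z) (b z) - jac (gx z) (gy z)))) = norm (\<eta> z) * (2 * \<bar>jac (a z) (b z) - jac (gx z) (gy z)\<bar>)"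
          by (simp add: norm_mult del: of_real_diff)
        also have "\<dots> \<le> B * (2 * \<bar>jac (a z) (b z) - jac (gx z) (gy z)\<bar>)"
          using B z by (intro mult_right_mono) auto
        finally show ?thesis by (simp add: abs_minus_commute)
      qed
      have "norm (gx z) + norm (gy z) \<le> (norm (a z) + norm (b z)) + ?n"
        using norm_triangle_sub[of "gx z" "a z"] norm_triangle_sub[of "gy z" "b z"] by linarith
      then have c1: "norm (\<eta>x z * gy z - \<eta>y z * gx z) \<le> B * ((norm (a z) + norm (b z)) + ?n)"
        using cross[OF z, of "gy z" "gx z"] B(1) by (meson mult_left_mono order_trans)
      have 2: "norm (cnj (f z - g z) * (\<eta>x z * gy z - \<eta>y z * gx z)) \<le> d * (B * ((norm (a z) + norm (b z)) + ?n))"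
        unfolding norm_mult complex_mod_cnj
        using gf[OF z] d c1 by (intro mult_mono) (auto simp: norm_minus_commute)
      have 3: "norm (cnj (f z) * (\<eta>x z * (b z - gy z) - \<eta>y z * (a z - gx z))) \<le> F * (B * ?n)"
        unfolding norm_mult complex_mod_cnj
        using F z cross[OF z, of "b z - gy z" "a z - gx z"] by (intro mult_mono) (auto simp: norm_minus_commute)
      have "norm (?f z - ?g z) \<le> 2 * B * \<bar>jac (gx z) (gy z) - jac (a z) (b z)\<bar>
          + (d * (B * ((norm (a z) + norm (b z)) + ?n)) + F * (B * ?n))"
        unfolding eq by (intro order_trans[OF norm_triangle_ineq] add_mono 1 2 3)
      then show "norm (?f z - ?g z) \<le> 2 * B * \<bar>jac (gx z) (gy z) - jac (a z) (b z)\<bar>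
        + (d * B * (norm (a z) + norm (b z)) + (d * B + F * B) * ?n)"
        by (simp add: algebra_simps)
    qed
    also have "\<dots> = 2 * B * (LINT z:?Q|lborel. \<bar>jac (gx z) (gy z) - jac (a z) (b z)\<bar>)
        + (d * B * S + (d * B + F * B) * (LINT z:?Q|lborel. norm (gx z - a z) + norm (gy z - b z)))"
      unfolding S_def by (rule set_integral_lincomb3[OF J si(3) D])
    also have "\<dots> \<le> 2 * B * d + (d * B * S + (d * B + F * B) * d)"
      using jd nd B F d by (intro add_mono mult_left_mono) auto
    also have "\<dots> \<le> 2 * B * d + (d * B * S + (1 * B + F * B) * d)"
      using B F d by (intro add_left_mono mult_right_mono add_right_mono) auto
    finally show ?thesis by (simp add: algebra_simps)
  qed
  have "norm I \<le> 0"
  proof (rule tendsto_lowerbound)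
    show "((\<lambda>d. (2 * B + B * (S + 1) + F * B) * d) \<longlongrightarrow> 0) (at_right 0)"
      by (auto intro!: tendsto_eq_intros)
    show "\<forall>\<^sub>F d in at_right 0. norm I \<le> (2 * B + B * (S + 1) + F * B) * d"
      using eventually_at_right_real[of 0 1] by (auto elim!: eventually_mono intro!: key)
  qed simp
  then show "(LINT z:?Q|lborel. \<eta> z * (2 * \<i> * jac (a z) (b z)) + cnj (f z) * (\<eta>x z * b z - \<eta>y z * a z)) = 0"
    by (simp add: I_def)
qed

lemma set_integral_mono_AE':
  fixes f g :: "'a \<Rightarrow> real"
  assumes "set_integrable M A f" "set_integrable M A g" "AE x in M. x \<in> A \<longrightarrow> f x \<le> g x"
  shows "(LINT x:A|M. f x) \<le> (LINT x:A|M. g x)"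
  using assms(1,2) unfolding set_lebesgue_integral_def set_integrable_def
  by (intro integral_mono_AE) (use assms(3) in \<open>auto simp: indicator_def elim!: eventually_mono\<close>)

lemma qr_sob: "qr \<kappa> \<Omega> f a b \<Longrightarrow> sob \<Omega> f a b"
  by (simp add: qr_def)

lemma norm_f_integrable:
  assumes s: "sob \<Omega> f a b" and "sq z R \<subseteq> \<Omega>"
  shows "set_integrable lborel (sq z R) (\<lambda>z. (norm (f z))\<^sup>2)" "set_integrable lborel (sq z R) f"
proof -
  have c: "continuous_on (sq z R) f" using sobD(2)[OF s] assms(2) continuous_on_subset by blast
  then have c2: "continuous_on (sq z R) (\<lambda>z. (norm (f z))\<^sup>2)" by (intro continuous_intros)
  show "set_integrable lborel (sq z R) (\<lambda>z. (norm (f z))\<^sup>2)"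
    unfolding set_integrable_def by (rule borel_integrable_compact[OF compact_sq c2])
  show "set_integrable lborel (sq z R) f"
    unfolding set_integrable_def by (rule borel_integrable_compact[OF compact_sq c])
qed

text \<open>The weight is the square of \<theta>, the product of R^2 - x^2 and R^2 - y^2 in centred
  coordinates; a polynomial will do because the weight has to vanish only on the boundary of the
  square. Distortion turns energy into Jacobian, the Jacobian identity moves a derivative onto the
  weight, and half of the weighted energy is absorbed. As both derivatives of \<theta> are at most 2
  R^3, the weighted energy is at most 8 \<kappa>^2 R^6 times the integral of |f|^2. On the half
  square the weight is at least R^8 / 4, which yields 32 \<kappa>^2 / R^2.\<close>

lemma Caccioppoli:
  assumes q: "qr \<kappa> \<Omega> f a b" and k: "\<kappa> > 0" and R: "R > 0" and sub: "sq z0 R \<subseteq> \<Omega>"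
  shows "(LINT z:sq z0 (R / 2)|lborel. en (a z) (b z)) \<le> 32 * \<kappa>\<^sup>2 / R\<^sup>2 * (LINT z:sq z0 R|lborel. (norm (f z))\<^sup>2)"
proof -
  have s: "sob \<Omega> f a b" using q by (rule qr_sob)
  note sd [measurable] = sobD(3-5)[OF s]
  let ?Q = "sq z0 R"
  define p where "p t = R\<^sup>2 - t\<^sup>2" for t :: real
  define \<theta> where "\<theta> z = p (Re z - Re z0) * p (Im z - Im z0)" for z
  define \<theta>x where "\<theta>x z = - (2 * ((Re z - Re z0) * p (Im z - Im z0)))" for z
  define \<theta>y where "\<theta>y z = - (2 * ((Im z - Im z0) * p (Re z - Re z0)))" for z
  define \<eta> where "\<eta> z = complex_of_real ((\<theta> z)\<^sup>2)" for z
  define \<eta>x where "\<eta>x z = complex_of_real (2 * \<theta> z * \<theta>x z)" for z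
  define \<eta>y where "\<eta>y z = complex_of_real (2 * \<theta> z * \<theta>y z)" for z
  have \<theta>c: "continuous_on UNIV \<theta>" "continuous_on UNIV \<theta>x" "continuous_on UNIV \<theta>y"
    unfolding \<theta>_def \<theta>x_def \<theta>y_def p_def by (intro continuous_intros)+
  have [measurable]: "\<theta> \<in> borel_measurable borel" by (rule borel_measurable_continuous_onI[OF \<theta>c(1)])
  have c1: "c1 \<eta> \<eta>x \<eta>y"
    unfolding c1_def
  proof (intro conjI allI)
    show "continuous_on UNIV \<eta>" "continuous_on UNIV \<eta>x" "continuous_on UNIV \<eta>y"
      unfolding \<eta>_def \<eta>x_def \<eta>y_def by (intro continuous_intros \<theta>c)+
    fix x y
    show "((\<lambda>x. \<eta> (Complex x y)) has_vector_derivative \<eta>x (Complex x y)) (at x)"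
      unfolding \<eta>_def \<eta>x_def
      by (rule has_vector_derivative_of_real)
         (auto intro!: derivative_eq_intros simp: \<theta>_def \<theta>x_def p_def power2_eq_square algebra_simps)
    show "((\<lambda>y. \<eta> (Complex x y)) has_vector_derivative \<eta>y (Complex x y)) (at y)"
      unfolding \<eta>_def \<eta>y_def
      by (rule has_vector_derivative_of_real)
         (auto intro!: derivative_eq_intros simp: \<theta>_def \<theta>y_def p_def power2_eq_square algebra_simps)
  qed
  have van: "\<eta> z = 0" if "\<bar>Re z - Re z0\<bar> = R \<or> \<bar>Im z - Im z0\<bar> = R" for z
  proof -
    have "p t = 0" if "\<bar>t\<bar> = R" for t using power2_abs[of t] that by (simp add: p_def)
    then show ?thesis using that by (auto simp: \<eta>_def \<theta>_def)
  qed
  note JI = jacobian_identity[OF s sub R c1 van]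
  have pb: "0 \<le> p t" "p t \<le> R\<^sup>2" if "\<bar>t\<bar> \<le> R" for t
    using that abs_le_square_iff[of t R] R by (auto simp: p_def)
  have \<theta>0: "0 \<le> \<theta> z" if "z \<in> ?Q" for z using that pb by (auto simp: \<theta>_def mem_sq)
  have \<theta>xb: "\<bar>\<theta>x z\<bar> \<le> 2 * R ^ 3" "\<bar>\<theta>y z\<bar> \<le> 2 * R ^ 3" if "z \<in> ?Q" for z
  proof -
    have "\<bar>t\<bar> * \<bar>p u\<bar> \<le> R * R\<^sup>2" if "\<bar>t\<bar> \<le> R" "\<bar>u\<bar> \<le> R" for t u
      using pb[OF that(2)] that R by (intro mult_mono) auto
    then show "\<bar>\<theta>x z\<bar> \<le> 2 * R ^ 3" "\<bar>\<theta>y z\<bar> \<le> 2 * R ^ 3"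
      using that unfolding \<theta>x_def \<theta>y_def mem_sq abs_minus_cancel abs_mult
      by (auto simp: power3_eq_cube power2_eq_square mult.assoc)
  qed
  obtain T where T: "T \<ge> 0" "\<And>z. z \<in> ?Q \<Longrightarrow> norm (\<eta> z) \<le> T"
    using continuous_bounded_sq[OF continuous_on_subset[of UNIV \<eta>]] c1 unfolding c1_def by blast
  note si = sob_integrable[OF s sub]
  have T2: "(\<theta> z)\<^sup>2 \<le> T" if "z \<in> ?Q" for z using T(2)[OF that] by (simp add: \<eta>_def del: of_real_power)
  have ie: "set_integrable lborel ?Q (\<lambda>z. (\<theta> z)\<^sup>2 * en (a z) (b z))"
    by (rule set_integrable_dominated[where F = "\<lambda>z. T * en (a z) (b z)"])
       (use si(1) T2 in \<open>auto simp: abs_mult intro!: mult_right_mono\<close>)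
  have ij: "set_integrable lborel ?Q (\<lambda>z. (\<theta> z)\<^sup>2 * jac (a z) (b z))"
    by (rule set_integrable_dominated[where F = "\<lambda>z. T * en (a z) (b z)"])
       (use si(1) T2 T(1) in \<open>auto simp: abs_mult intro!: mult_mono abs_jac_le\<close>)
  note if2 = norm_f_integrable(1)[OF s sub]
  define E where "E = (LINT z:?Q|lborel. (\<theta> z)\<^sup>2 * en (a z) (b z))"
  define G where "G = (LINT z:?Q|lborel. (norm (f z))\<^sup>2)"
  define X where "X = (LINT z:?Q|lborel. (\<theta> z)\<^sup>2 * jac (a z) (b z))"
  have "E \<le> (LINT z:?Q|lborel. \<kappa> * ((\<theta> z)\<^sup>2 * jac (a z) (b z)))"
    unfolding E_def
  proof (rule set_integral_mono_AE'[OF ie])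
    show "set_integrable lborel ?Q (\<lambda>z. \<kappa> * ((\<theta> z)\<^sup>2 * jac (a z) (b z)))" using ij by auto
    show "AE z in lborel. z \<in> ?Q \<longrightarrow> (\<theta> z)\<^sup>2 * en (a z) (b z) \<le> \<kappa> * ((\<theta> z)\<^sup>2 * jac (a z) (b z))"
      using q[unfolded qr_def, THEN conjunct2]
    proof eventually_elim
      case (elim z)
      show ?case
      proof
        assume "z \<in> ?Q"
        then have "(\<theta> z)\<^sup>2 * en (a z) (b z) \<le> (\<theta> z)\<^sup>2 * (\<kappa> * jac (a z) (b z))"
          using elim sub by (intro mult_left_mono) auto
        then show "(\<theta> z)\<^sup>2 * en (a z) (b z) \<le> \<kappa> * ((\<theta> z)\<^sup>2 * jac (a z) (b z))" by (simp add: algebra_simps)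
      qed
    qed
  qed
  then have EX: "E \<le> \<kappa> * X" by (simp add: X_def)
  have nrm: "norm A = norm B" if "A + B = 0" for A B :: complex
    using that by (metis add_eq_0_iff norm_minus_cancel)
  have "(LINT z:?Q|lborel. \<eta> z * (2 * \<i> * jac (a z) (b z))) + (LINT z:?Q|lborel. cnj (f z) * (\<eta>x z * b z - \<eta>y z * a z)) = 0"
    using JI by (simp add: set_integral_add)
  then have "norm (LINT z:?Q|lborel. \<eta> z * (2 * \<i> * jac (a z) (b z))) = norm (LINT z:?Q|lborel. cnj (f z) * (\<eta>x z * b z - \<eta>y z * a z))"
    by (rule nrm)
  also have "(LINT z:?Q|lborel. \<eta> z * (2 * \<i> * jac (a z) (b z))) = 2 * \<i> * complex_of_real X"
    unfolding X_def set_integral_mult_of_real[symmetric] by (simp add: \<eta>_def algebra_simps)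
  also have "norm \<dots> = 2 * \<bar>X\<bar>" by (simp add: norm_mult)
  finally have "\<kappa> * X \<le> \<kappa> / 2 * norm (LINT z:?Q|lborel. cnj (f z) * (\<eta>x z * b z - \<eta>y z * a z))"
    using k by (simp add: mult_left_mono)
  also have "\<dots> \<le> \<kappa> / 2 * (LINT z:?Q|lborel. norm (cnj (f z) * (\<eta>x z * b z - \<eta>y z * a z)))"
    using JI k by (intro mult_left_mono set_integral_norm_bound) auto
  also have "\<dots> = (LINT z:?Q|lborel. \<kappa> / 2 * norm (cnj (f z) * (\<eta>x z * b z - \<eta>y z * a z)))"
    by simp
  \<comment> \<open>The coefficient 1/2 is what permits absorption into \<open>E\<close>. The zero
    summand merely brings the integrand into the three-term shape of
    \<open>set_integral_lincomb3\<close>.\<close>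
  also have "\<dots> \<le> (LINT z:?Q|lborel. (1 / 2) * ((\<theta> z)\<^sup>2 * en (a z) (b z)) + ((4 * \<kappa>\<^sup>2 * R ^ 6) * (norm (f z))\<^sup>2 + 0 * (norm (f z))\<^sup>2))"
  proof (rule set_integral_mono)
    show "set_integrable lborel ?Q (\<lambda>z. \<kappa> / 2 * norm (cnj (f z) * (\<eta>x z * b z - \<eta>y z * a z)))"
      by (intro set_integrable_mult_right set_integrable_norm JI)
    show "set_integrable lborel ?Q (\<lambda>z. (1 / 2) * ((\<theta> z)\<^sup>2 * en (a z) (b z)) + ((4 * \<kappa>\<^sup>2 * R ^ 6) * (norm (f z))\<^sup>2 + 0 * (norm (f z))\<^sup>2))"
      by (rule set_integral_lincomb3[OF ie if2 if2])
    fix z assume z: "z \<in> ?Q"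
    define Y where "Y = 2 * \<kappa> * R ^ 3 * norm (f z)"
    have Yb: "norm (\<eta>x z * b z - \<eta>y z * a z) \<le> 4 * R ^ 3 * \<theta> z * (norm (a z) + norm (b z))"
    proof -
      have "norm (\<eta>x z * b z - \<eta>y z * a z) \<le> norm (\<eta>x z) * norm (b z) + norm (\<eta>y z) * norm (a z)"
        by (metis norm_mult norm_triangle_ineq4)
      also have "norm (\<eta>x z) = 2 * \<theta> z * \<bar>\<theta>x z\<bar>" using \<theta>0[OF z] by (simp add: \<eta>x_def norm_mult abs_mult)
      also have "norm (\<eta>y z) = 2 * \<theta> z * \<bar>\<theta>y z\<bar>" using \<theta>0[OF z] by (simp add: \<eta>y_def norm_mult abs_mult)
      also have "2 * \<theta> z * \<bar>\<theta>x z\<bar> * norm (b z) + 2 * \<theta> z * \<bar>\<theta>y z\<bar> * norm (a z)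
          \<le> 2 * \<theta> z * (2 * R ^ 3) * norm (b z) + 2 * \<theta> z * (2 * R ^ 3) * norm (a z)"
        using \<theta>0[OF z] \<theta>xb[OF z] by (intro add_mono mult_right_mono mult_left_mono) auto
      finally show ?thesis by (simp add: algebra_simps)
    qed
    have "\<kappa> / 2 * norm (cnj (f z) * (\<eta>x z * b z - \<eta>y z * a z)) \<le> \<kappa> / 2 * (norm (f z) * (4 * R ^ 3 * \<theta> z * (norm (a z) + norm (b z))))"
      unfolding norm_mult complex_mod_cnj using Yb k by (intro mult_left_mono) auto
    also have "\<dots> = Y * (\<theta> z * norm (a z)) + Y * (\<theta> z * norm (b z))" by (simp add: Y_def algebra_simps)
    also have "\<dots> \<le> (Y\<^sup>2 + (\<theta> z * norm (a z))\<^sup>2) / 2 + (Y\<^sup>2 + (\<theta> z * norm (b z))\<^sup>2) / 2"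
      using sum_squares_bound[of Y "\<theta> z * norm (a z)"] sum_squares_bound[of Y "\<theta> z * norm (b z)"]
      by (intro add_mono) simp_all
    also have "\<dots> = (1 / 2) * ((\<theta> z)\<^sup>2 * en (a z) (b z)) + Y\<^sup>2"
      by (simp add: en_def power_mult_distrib algebra_simps add_divide_distrib)
    also have "Y\<^sup>2 = (4 * \<kappa>\<^sup>2 * R ^ 6) * (norm (f z))\<^sup>2"
      by (simp add: Y_def power_mult_distrib power_mult[symmetric])
    finally show "\<kappa> / 2 * norm (cnj (f z) * (\<eta>x z * b z - \<eta>y z * a z)) \<le> (1 / 2) * ((\<theta> z)\<^sup>2 * en (a z) (b z)) + ((4 * \<kappa>\<^sup>2 * R ^ 6) * (norm (f z))\<^sup>2 + 0 * (norm (f z))\<^sup>2)"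
      by simp
  qed
  also have "\<dots> = (1 / 2) * E + (4 * \<kappa>\<^sup>2 * R ^ 6) * G"
    unfolding E_def G_def set_integral_lincomb3(2)[OF ie if2 if2] by simp
  finally have EG: "E \<le> 8 * \<kappa>\<^sup>2 * R ^ 6 * G" using EX by linarith
  have "R ^ 8 / 4 * (LINT z:sq z0 (R / 2)|lborel. en (a z) (b z)) = (LINT z:sq z0 (R / 2)|lborel. R ^ 8 / 4 * en (a z) (b z))"
    by simp
  also have "\<dots> \<le> (LINT z:sq z0 (R / 2)|lborel. (\<theta> z)\<^sup>2 * en (a z) (b z))"
  proof (rule set_integral_mono)
    have sub': "sq z0 (R / 2) \<subseteq> ?Q" using R by (intro sq_mono) simp
    show "set_integrable lborel (sq z0 (R / 2)) (\<lambda>z. R ^ 8 / 4 * en (a z) (b z))"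
      using set_integrable_subset[OF si(1) _ sub'] by auto
    show "set_integrable lborel (sq z0 (R / 2)) (\<lambda>z. (\<theta> z)\<^sup>2 * en (a z) (b z))"
      using set_integrable_subset[OF ie _ sub'] by auto
    fix z assume z: "z \<in> sq z0 (R / 2)"
    have pl: "3 / 4 * R\<^sup>2 \<le> p t" if "\<bar>t\<bar> \<le> R / 2" for t
      using abs_le_square_iff[of t "R / 2"] that R by (auto simp: p_def power_divide)
    have "(3 / 4 * R\<^sup>2) * (3 / 4 * R\<^sup>2) \<le> \<theta> z"
      unfolding \<theta>_def using z by (intro mult_mono pl order_trans[OF _ pl]) (auto simp: mem_sq)
    then have m: "((3 / 4 * R\<^sup>2) * (3 / 4 * R\<^sup>2))\<^sup>2 \<le> (\<theta> z)\<^sup>2" by (intro power_mono) auto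
    \<comment> \<open>Each factor of \<theta> is at least 3/4 R^2 here, and the square of 9/16 is
      81/256, which exceeds 1/4.\<close>
    have "R ^ 8 / 4 \<le> 81 / 256 * R ^ 8" using R by simp
    also have "\<dots> = ((3 / 4 * R\<^sup>2) * (3 / 4 * R\<^sup>2))\<^sup>2"
      by (simp add: power_mult_distrib power_mult[symmetric] power2_eq_square eval_nat_numeral)
    also note m
    finally show "R ^ 8 / 4 * en (a z) (b z) \<le> (\<theta> z)\<^sup>2 * en (a z) (b z)"
      by (intro mult_right_mono) auto
  qed
  also have "\<dots> \<le> E"
    unfolding E_def by (rule set_integral_subset_le[OF ie]) (use R in \<open>auto intro!: sq_mono simp: sq_mono[THEN subsetD]\<close>)
  also have "\<dots> \<le> 8 * \<kappa>\<^sup>2 * R ^ 6 * G" by (rule EG)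
  finally have "R ^ 8 / 4 * (LINT z:sq z0 (R / 2)|lborel. en (a z) (b z)) \<le> R ^ 8 / 4 * (32 * \<kappa>\<^sup>2 / R\<^sup>2 * G)"
    using R by (simp add: power2_eq_square eval_nat_numeral algebra_simps)
  then show ?thesis unfolding G_def using R by (subst (asm) mult_le_cancel_left_pos) auto
qed

section \<open>Geometric decay of the energy\<close>

definition dec :: "real \<Rightarrow> real" where "dec \<kappa> = 36 * \<kappa> / (1 + 36 * \<kappa>)"

lemma dec_bounds: "\<kappa> > 0 \<Longrightarrow> 0 < dec \<kappa>" "\<kappa> > 0 \<Longrightarrow> dec \<kappa> < 1"
  by (auto simp: dec_def)

text \<open>Hole filling and distortion give J(r) \<le> 36 \<kappa> (J(2r) - J(r)). Adding 36
  \<kappa> J(r) to both sides fills the hole and produces the factor \<open>dec \<kappa>\<close>,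
  which is less than 1.\<close>

lemma jac_decay:
  assumes q: "qr \<kappa> \<Omega> f a b" and k: "\<kappa> > 0" and r: "r > 0" and sub: "sq z0 (2 * r) \<subseteq> \<Omega>"
  shows "(LINT z:sq z0 r|lborel. jac (a z) (b z)) \<le> dec \<kappa> * (LINT z:sq z0 (2 * r)|lborel. jac (a z) (b z))"
proof -
  let ?A = "sq z0 (2 * r) - sq z0 r"
  note si = sob_integrable[OF qr_sob[OF q] sub]
  have sr: "sq z0 r \<subseteq> sq z0 (2 * r)" using r by (intro sq_mono) simp
  define J where "J s = (LINT z:sq z0 s|lborel. jac (a z) (b z))" for s
  have iA: "set_integrable lborel ?A (\<lambda>z. en (a z) (b z))" "set_integrable lborel ?A (\<lambda>z. jac (a z) (b z))"
    by (rule set_integrable_subset[OF si(1)] set_integrable_subset[OF si(2)]; auto)+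
  have "J r \<le> 36 * (LINT z:?A|lborel. en (a z) (b z))" unfolding J_def by (rule hole_filling[OF q k r sub])
  also have "(LINT z:?A|lborel. en (a z) (b z)) \<le> (LINT z:?A|lborel. \<kappa> * jac (a z) (b z))"
    by (rule set_integral_mono_AE'[OF iA(1)])
       (use iA(2) q sub in \<open>auto simp: qr_def elim!: eventually_mono\<close>)
  also have "\<dots> = \<kappa> * (J (2 * r) - J r)"
  proof -
    have "J (2 * r) = (LINT z:?A \<union> sq z0 r|lborel. jac (a z) (b z))"
      unfolding J_def using sr by (simp add: Un_absorb2)
    also have "\<dots> = (LINT z:?A|lborel. jac (a z) (b z)) + J r"
      unfolding J_def by (rule set_integral_Un[OF _ iA(2) set_integrable_subset[OF si(2) _ sr]]) auto
    finally show ?thesis by (simp add: algebra_simps)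
  qed
  finally have "J r \<le> 36 * (\<kappa> * (J (2 * r) - J r))" by simp
  then have "(1 + 36 * \<kappa>) * J r \<le> 36 * \<kappa> * J (2 * r)" by (simp add: algebra_simps)
  then have "J r \<le> 36 * \<kappa> * J (2 * r) / (1 + 36 * \<kappa>)" using k by (simp add: pos_le_divide_eq mult.commute)
  then show ?thesis by (simp add: J_def dec_def)
qed

text \<open>What decays at every halving is the Jacobian integral. Energy is compared with it only
  at the two ends, by distortion at the smallest scale and by \<open>abs_jac_le\<close> at the
  largest, so \<kappa> is lost once and not at every step.\<close>

lemma energy_decay:
  assumes q: "qr \<kappa> \<Omega> f a b" and k: "\<kappa> > 0" and r: "r > 0" and sub: "sq z0 r \<subseteq> \<Omega>"
  shows "(LINT z:sq z0 (r / 2 ^ n)|lborel. en (a z) (b z)) \<le> \<kappa> * dec \<kappa> ^ n * (LINT z:sq z0 r|lborel. en (a z) (b z))"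
proof -
  define J where "J s = (LINT z:sq z0 s|lborel. jac (a z) (b z))" for s
  have sub': "sq z0 (r / 2 ^ n) \<subseteq> sq z0 r" for n using r by (intro sq_mono) (simp add: divide_le_eq)
  have J: "J (r / 2 ^ n) \<le> dec \<kappa> ^ n * J r"
  proof (induction n)
    case (Suc n)
    have "2 * (r / 2 ^ Suc n) = r / 2 ^ n" by simp
    then have "J (r / 2 ^ Suc n) \<le> dec \<kappa> * J (r / 2 ^ n)"
      unfolding J_def using jac_decay[OF q k, of "r / 2 ^ Suc n" z0] sub'[of n] sub r by simp
    also have "\<dots> \<le> dec \<kappa> * (dec \<kappa> ^ n * J r)" using Suc dec_bounds(1)[OF k] by (intro mult_left_mono) auto
    finally show ?case by simp
  qed simp
  note s = qr_sob[OF q]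
  note sn = order_trans[OF sub' sub, of n]
  have "(LINT z:sq z0 (r / 2 ^ n)|lborel. en (a z) (b z)) \<le> (LINT z:sq z0 (r / 2 ^ n)|lborel. \<kappa> * jac (a z) (b z))"
    by (rule set_integral_mono_AE'[OF sob_integrable(1)[OF s sn]])
       (use sob_integrable(2)[OF s sn] sn q in \<open>auto simp: qr_def elim!: eventually_mono\<close>)
  also have "\<dots> = \<kappa> * J (r / 2 ^ n)" by (simp add: J_def)
  also have "\<dots> \<le> \<kappa> * (dec \<kappa> ^ n * J r)" using J k by (intro mult_left_mono) auto
  also have "\<dots> \<le> \<kappa> * (dec \<kappa> ^ n * (LINT z:sq z0 r|lborel. en (a z) (b z)))"
    unfolding J_def using k dec_bounds(1)[OF k] sob_integrable[OF s sub] abs_jac_le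
    by (intro mult_left_mono set_integral_mono) (auto intro: order_trans[OF abs_ge_self])
  finally show ?thesis by (simp add: mult.assoc)
qed

section \<open>Morrey's comparison of averages\<close>

lemma bump_bound_exists: "\<exists>B>0. \<forall>t. bump t \<le> B"
proof -
  have "bounded (bump ` {-1..1})"
    by (intro compact_imp_bounded compact_continuous_image smooth1_continuous_on smooth1_bump) auto
  then obtain B where B: "B > 0" "\<And>t. t \<in> {-1..1} \<Longrightarrow> \<bar>bump t\<bar> \<le> B"
    unfolding bounded_pos by auto
  have "bump t \<le> B" for t
  proof (cases "\<bar>t\<bar> \<ge> 1")
    case False
    then have "t \<in> {-1..1}" by auto
    from B(2)[OF this] show ?thesis by linarith
  qed (use B(1) bump_out in simp)
  with B(1) show ?thesis by blast
qed

text \<open>One fixed bound of the bump, so that the constants below refer to no map and no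
  scale.\<close>

definition bmax :: real where "bmax = (SOME B. B > 0 \<and> (\<forall>t. bump t \<le> B))"

lemma bmax: "bmax > 0" "bump t \<le> bmax"
  using someI_ex[OF bump_bound_exists] unfolding bmax_def by auto

lemma bmp_le: "e > 0 \<Longrightarrow> bmp e t \<le> bmax / e"
  by (simp add: bmp_def bmax divide_right_mono)

lemma moll_le: "e > 0 \<Longrightarrow> moll e z \<le> (bmax / e)\<^sup>2"
  unfolding moll_def tens_def power2_eq_square by (intro mult_mono bmp_le bmp_nonneg) (auto simp: bmax less_imp_le)

lemma tens_mult_integrable:
  assumes H: "smooth1 H" "smooth1 K" and out: "\<And>w. w \<notin> sq z s \<Longrightarrow> tens H K w = 0"
    and [measurable]: "v \<in> borel_measurable borel" and v: "set_integrable lborel (sq z s) v"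
  shows "integrable lborel (\<lambda>w. tens H K w *\<^sub>R (v w :: complex))"
proof -
  have c: "continuous_on UNIV (tens H K)" by (rule continuous_on_tens[OF H])
  have [measurable]: "tens H K \<in> borel_measurable borel" by (rule borel_measurable_continuous_onI[OF c])
  have "bounded (tens H K ` sq z s)"
    by (intro compact_imp_bounded compact_continuous_image continuous_on_subset[OF c] compact_sq) simp
  then obtain B where B: "\<And>w. w \<in> sq z s \<Longrightarrow> \<bar>tens H K w\<bar> \<le> B" unfolding bounded_iff by auto
  have "set_integrable lborel (sq z s) (\<lambda>w. tens H K w *\<^sub>R v w)"
    by (rule set_integrable_dominated[where F = "\<lambda>w. B * norm (v w)"])
       (use v B in \<open>auto intro!: mult_right_mono set_integrable_norm\<close>)
  moreover have "(\<lambda>w. indicator (sq z s) w *\<^sub>R tens H K w *\<^sub>R v w) = (\<lambda>w. tens H K w *\<^sub>R v w)"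
    using out by (auto simp: fun_eq_iff indicator_def)
  ultimately show ?thesis unfolding set_integrable_def by simp
qed

text \<open>Write p and q for the one-variable bumps at scales s and s/2. The kernels differ by (p -
  q)(x) p(y) + q(x) (p - q)(y). Since p and q have equal mass, p - q has a compactly supported
  antiderivative, so the difference is the x-derivative of one test function plus the y-derivative
  of another. The weak derivative identity then replaces f by its gradient, integrated against
  weights of size at most 2 bmax / s.\<close>

lemma Morrey_step:
  assumes sb: "sob \<Omega> f a b" and s: "s > 0" and sub: "sq z s \<subseteq> \<Omega>" and \<tau>: "\<tau> > 0"
    and E: "(LINT w:sq z s|lborel. en (a w) (b w)) \<le> \<tau>\<^sup>2"
  shows "norm (conv s f z - conv (s / 2) f z) \<le> 10 * bmax * \<tau>"
proof -
  note sd [measurable] = sobD(3-5)[OF sb]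
  have s2: "s / 2 > 0" using s by simp
  define Q where "Q = sq z s"
  \<comment> \<open>Both antiderivatives run from the same constant to the same constant, so their
    difference vanishes outside the larger of the two supports.\<close>
  define S where "S x t = - step ((x - t) / s) - - step ((x - t) / (s / 2))" for x t
  define S' where "S' x t = bmp s (x - t) - bmp (s / 2) (x - t)" for x t
  have Sd: "(S x has_real_derivative S' x t) (at t)" for x t
    unfolding S_def S'_def by (intro DERIV_diff bmp_refl_antideriv s s2)
  have S's: "smooth1 (S' x)" for x
  proof -
    have "smooth1 (\<lambda>t. bmp s (x - t) + (-1) * bmp (s / 2) (x - t))"
      by (rule smooth1_add[OF smooth1_bmp_refl smooth1_mult[OF smooth1_const smooth1_bmp_refl]])
    then show ?thesis by (simp add: S'_def[abs_def])
  qed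
  have Ss: "smooth1 (S x)" for x by (rule smooth1I[OF Sd S's])
  have Sout: "S x t = 0" if "t \<notin> {x - s..x + s}" for x t
  proof (cases "t < x - s")
    case True
    then have "1 \<le> (x - t) / s" "1 \<le> (x - t) / (s / 2)" using s by (auto simp: field_simps)
    then show ?thesis by (simp add: S_def step_right)
  next
    case False
    then have "t > x + s" using that by auto
    then have "(x - t) / s \<le> -1" "(x - t) / (s / 2) \<le> -1" using s by (auto simp: field_simps)
    then show ?thesis by (simp add: S_def step_left)
  qed
  have S'out: "S' x t = 0" if "t \<notin> {x - s..x + s}" for x t
    unfolding S'_def using that s by (auto simp: bmp_out)
  have Sb: "\<bar>S x t\<bar> \<le> 1" for x t
    unfolding S_def using step_bounds[of "(x - t) / s"] step_bounds[of "(x - t) / (s / 2)"] by (simp only: abs_le_iff) linarith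
  define \<beta> where "\<beta> x t = bmp s (x - t)" for x t
  define \<gamma> where "\<gamma> x t = bmp (s / 2) (x - t)" for x t
  have bs: "smooth1 (\<beta> x)" "smooth1 (\<gamma> x)" for x unfolding \<beta>_def[abs_def] \<gamma>_def[abs_def] by (rule smooth1_bmp_refl)+
  have bo: "\<beta> x t = 0" "\<gamma> x t = 0" if "t \<notin> {x - s..x + s}" for x t
    using that s by (auto simp: \<beta>_def \<gamma>_def bmp_out)
  obtain \<beta>' where \<beta>': "\<And>t. (\<beta> (Im z) has_real_derivative \<beta>' t) (at t)" using smooth1_derivE[OF bs(1)] by blast
  obtain \<gamma>' where \<gamma>': "\<And>t. (\<gamma> (Re z) has_real_derivative \<gamma>' t) (at t)" using smooth1_derivE[OF bs(2)] by blast
  define \<phi>1 where "\<phi>1 = tens (S (Re z)) (\<beta> (Im z))"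
  define \<phi>2 where "\<phi>2 = tens (\<gamma> (Re z)) (S (Im z))"
  have sub': "cbox (Complex (Re z - s) (Im z - s)) (Complex (Re z + s) (Im z + s)) \<subseteq> \<Omega>" using sub by (simp add: sq_alt)
  have t1: "test_function \<Omega> \<phi>1" unfolding \<phi>1_def by (rule test_function_tens[OF Ss bs(1) Sout bo(1) sub'])
  have t2: "test_function \<Omega> \<phi>2" unfolding \<phi>2_def by (rule test_function_tens[OF bs(2) Ss bo(2) Sout sub'])
  have dd1: "dir_deriv 1 \<phi>1 = tens (S' (Re z)) (\<beta> (Im z))" unfolding \<phi>1_def by (rule dir_deriv_tens(1)[OF Sd \<beta>'])
  have dd2: "dir_deriv \<i> \<phi>2 = tens (\<gamma> (Re z)) (S' (Im z))" unfolding \<phi>2_def by (rule dir_deriv_tens(2)[OF \<gamma>' Sd])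
  have split: "moll s (z - w) - moll (s / 2) (z - w) = dir_deriv 1 \<phi>1 w + dir_deriv \<i> \<phi>2 w" for w
    unfolding dd1 dd2 bmp_refl_tens by (simp add: tens_def S'_def \<beta>_def \<gamma>_def algebra_simps)
  have o1: "tens (S' (Re z)) (\<beta> (Im z)) w = 0" "tens (\<gamma> (Re z)) (S' (Im z)) w = 0"
      "\<phi>1 w = 0" "\<phi>2 w = 0" if "w \<notin> Q" for w
    using that S'out[of "Re w" "Re z"] S'out[of "Im w" "Im z"] bo(1)[of "Im w" "Im z"] bo(2)[of "Re w" "Re z"]
      Sout[of "Re w" "Re z"] Sout[of "Im w" "Im z"]
    unfolding Q_def mem_sq tens_def \<phi>1_def \<phi>2_def by (auto simp: abs_le_iff)
  have fi: "set_integrable lborel (sq z s) f" by (rule norm_f_integrable(2)[OF sb sub])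
  have fi2: "set_integrable lborel (sq z (s / 2)) f"
    by (rule set_integrable_subset[OF fi]) (use s in \<open>auto intro!: sq_mono simp: sq_mono[THEN subsetD]\<close>)
  note si = sob_integrable[OF sb sub]
  have indf: "(LINT w:\<Omega>|lborel. \<phi> w *\<^sub>R v w) = (LINT w|lborel. \<phi> w *\<^sub>R v w)"
    if "\<And>w. w \<notin> Q \<Longrightarrow> \<phi> w = (0::real)" for \<phi> and v :: "complex \<Rightarrow> complex"
    unfolding set_lebesgue_integral_def
  proof (rule Bochner_Integration.integral_cong[OF refl])
    fix w show "indicator \<Omega> w *\<^sub>R (\<phi> w *\<^sub>R v w) = \<phi> w *\<^sub>R v w"
      using that[of w] sub by (cases "w \<in> Q") (auto simp: Q_def)
  qed
  have i1: "integrable lborel (\<lambda>w. dir_deriv 1 \<phi>1 w *\<^sub>R f w)" "integrable lborel (\<lambda>w. dir_deriv \<i> \<phi>2 w *\<^sub>R f w)"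
    unfolding dd1 dd2 by (rule tens_mult_integrable[OF _ _ _ _ fi]; use S's bs o1 in \<open>simp add: Q_def\<close>)+
  have i2: "integrable lborel (\<lambda>w. \<phi>1 w *\<^sub>R a w)"
    unfolding \<phi>1_def by (rule tens_mult_integrable[OF Ss bs(1) _ _ si(4)]) (use o1(3) in \<open>auto simp: Q_def \<phi>1_def\<close>)
  have i3: "integrable lborel (\<lambda>w. \<phi>2 w *\<^sub>R b w)"
    unfolding \<phi>2_def by (rule tens_mult_integrable[OF bs(2) Ss _ _ si(5)]) (use o1(4) in \<open>auto simp: Q_def \<phi>2_def\<close>)
  have "conv s f z - conv (s / 2) f z = (LINT w|lborel. (moll s (z - w) - moll (s / 2) (z - w)) *\<^sub>R f w)"
    unfolding conv_def scaleR_diff_left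
    by (rule Bochner_Integration.integral_diff[symmetric]) (intro moll_mult_integrable s s2 fi fi2)+
  also have "\<dots> = (LINT w|lborel. dir_deriv 1 \<phi>1 w *\<^sub>R f w) + (LINT w|lborel. dir_deriv \<i> \<phi>2 w *\<^sub>R f w)"
    unfolding split scaleR_add_left by (rule Bochner_Integration.integral_add[OF i1])
  also have "(LINT w|lborel. dir_deriv 1 \<phi>1 w *\<^sub>R f w) = (LINT w:\<Omega>|lborel. dir_deriv 1 \<phi>1 w *\<^sub>R f w)"
    unfolding dd1 by (rule indf[symmetric]) (rule o1(1))
  also have "(LINT w|lborel. dir_deriv \<i> \<phi>2 w *\<^sub>R f w) = (LINT w:\<Omega>|lborel. dir_deriv \<i> \<phi>2 w *\<^sub>R f w)"
    unfolding dd2 by (rule indf[symmetric]) (rule o1(2))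
  also have "(LINT w:\<Omega>|lborel. dir_deriv 1 \<phi>1 w *\<^sub>R f w) = - (LINT w|lborel. \<phi>1 w *\<^sub>R a w)"
    using sb t1 indf[of \<phi>1 a, OF o1(3)] unfolding sob_def by simp
  also have "(LINT w:\<Omega>|lborel. dir_deriv \<i> \<phi>2 w *\<^sub>R f w) = - (LINT w|lborel. \<phi>2 w *\<^sub>R b w)"
    using sb t2 indf[of \<phi>2 b, OF o1(4)] unfolding sob_def by simp
  also have "- (LINT w|lborel. \<phi>1 w *\<^sub>R a w) + - (LINT w|lborel. \<phi>2 w *\<^sub>R b w) = - (LINT w|lborel. \<phi>1 w *\<^sub>R a w + \<phi>2 w *\<^sub>R b w)"
    using Bochner_Integration.integral_add[OF i2 i3] by simp
  also have "norm \<dots> \<le> (LINT w|lborel. indicator Q w *\<^sub>R (2 * bmax / s * (norm (a w) + norm (b w))))"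
    unfolding norm_minus_cancel
  proof (rule Bochner_Integration.integral_norm_bound_integral)
    show "integrable lborel (\<lambda>w. \<phi>1 w *\<^sub>R a w + \<phi>2 w *\<^sub>R b w)" using i2 i3 by (rule Bochner_Integration.integrable_add)
    show "integrable lborel (\<lambda>w. indicator Q w *\<^sub>R (2 * bmax / s * (norm (a w) + norm (b w))))"
    proof -
      have "set_integrable lborel Q (\<lambda>w. 2 * bmax / s * (norm (a w) + norm (b w)))"
        unfolding Q_def by (rule set_integrable_mult_right) (rule si(3))
      then show ?thesis by (simp only: set_integrable_def)
    qed
    fix w
    show "norm (\<phi>1 w *\<^sub>R a w + \<phi>2 w *\<^sub>R b w) \<le> indicator Q w *\<^sub>R (2 * bmax / s * (norm (a w) + norm (b w)))"
    proof (cases "w \<in> Q")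
      case True
      have "\<bar>\<phi>1 w\<bar> \<le> 1 * (2 * bmax / s)"
        unfolding \<phi>1_def tens_def abs_mult
      proof (intro mult_mono Sb)
        have "\<bar>\<beta> (Im z) (Im w)\<bar> \<le> bmax / s" using bmp_le[OF s] bmp_nonneg[OF s] by (simp add: \<beta>_def)
        also have "\<dots> \<le> 2 * bmax / s" using bmax(1) s by (simp add: divide_right_mono)
        finally show "\<bar>\<beta> (Im z) (Im w)\<bar> \<le> 2 * bmax / s" .
      qed auto
      moreover have "\<bar>\<phi>2 w\<bar> \<le> (2 * bmax / s) * 1"
        unfolding \<phi>2_def tens_def abs_mult
      proof (intro mult_mono Sb)
        show "\<bar>\<gamma> (Re z) (Re w)\<bar> \<le> 2 * bmax / s" using bmp_le[OF s2] bmp_nonneg[OF s2] by (simp add: \<gamma>_def mult.commute)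
      qed (use bmax(1) s in auto)
      ultimately have "\<bar>\<phi>1 w\<bar> * norm (a w) + \<bar>\<phi>2 w\<bar> * norm (b w) \<le> 2 * bmax / s * norm (a w) + 2 * bmax / s * norm (b w)"
        by (intro add_mono mult_right_mono) auto
      moreover have "norm (\<phi>1 w *\<^sub>R a w + \<phi>2 w *\<^sub>R b w) \<le> \<bar>\<phi>1 w\<bar> * norm (a w) + \<bar>\<phi>2 w\<bar> * norm (b w)"
        using norm_triangle_ineq[of "\<phi>1 w *\<^sub>R a w" "\<phi>2 w *\<^sub>R b w"] by simp
      ultimately show ?thesis using True by (simp add: distrib_left)
    qed (simp add: o1)
  qed
  also have "\<dots> = (LINT w:Q|lborel. 2 * bmax / s * (norm (a w) + norm (b w)))"
    by (simp only: set_lebesgue_integral_def)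
  also have "\<dots> = 2 * bmax / s * (LINT w:Q|lborel. norm (a w) + norm (b w))"
    by (rule set_integral_mult_right)
  also have "\<dots> \<le> 2 * bmax / s * (5 * s * \<tau>)"
  proof (rule mult_left_mono)
    \<comment> \<open>This choice balances the area term 4 s^2 t against \<tau>^2 / t; together they
      give 5 s \<tau>.\<close>
    define t where "t = \<tau> / s"
    have t: "t > 0" using \<tau> s by (simp add: t_def)
    have i: "set_integrable lborel Q (\<lambda>w. t)" "set_integrable lborel Q (\<lambda>w. en (a w) (b w) / t)"
      unfolding Q_def using set_integrable_const_sq si(1) by auto
    have "(LINT w:Q|lborel. norm (a w) + norm (b w)) \<le> (LINT w:Q|lborel. t + en (a w) (b w) / t)"
    proof (rule set_integral_mono)
      show "set_integrable lborel Q (\<lambda>w. norm (a w) + norm (b w))" unfolding Q_def by (rule si(3))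
      show "set_integrable lborel Q (\<lambda>w. t + en (a w) (b w) / t)" by (intro set_integral_add i)
    qed (rule le_en[OF t])
    also have "\<dots> = 4 * s\<^sup>2 * t + (LINT w:Q|lborel. en (a w) (b w)) / t"
      using i s by (simp add: set_integral_add set_integral_const_sq Q_def)
    also have "\<dots> \<le> 4 * s\<^sup>2 * t + \<tau>\<^sup>2 / t"
      using E t by (intro add_mono divide_right_mono) (auto simp: Q_def)
    also have "\<dots> = 5 * s * \<tau>" using s \<tau> by (simp add: t_def power2_eq_square)
    finally show "(LINT w:Q|lborel. norm (a w) + norm (b w)) \<le> 5 * s * \<tau>" .
  qed (use bmax(1) s in simp)
  also have "\<dots> = 10 * bmax * \<tau>" using s by simp
  finally show ?thesis .
qed

lemma sq_subset_ball:
  assumes "open \<Omega>" "z \<in> \<Omega>"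
  obtains r where "r > 0" "sq z r \<subseteq> \<Omega>"
proof -
  obtain e where e: "e > 0" "ball z e \<subseteq> \<Omega>" using assms open_contains_ball by blast
  have "sq z (e / 3) \<subseteq> ball z e"
  proof
    fix w assume "w \<in> sq z (e / 3)"
    then have "norm (w - z) \<le> 2 * (e / 3)" using cmod_le[of "w - z"] by (simp add: mem_sq)
    also have "\<dots> < e" using e(1) by simp
    finally show "w \<in> ball z e" by (simp add: dist_norm norm_minus_commute)
  qed
  with e that[of "e / 3"] show ?thesis by auto
qed

lemma conv_dyadic_tendsto:
  assumes sb: "sob \<Omega> f a b" and s: "s > 0" and sub: "sq z s \<subseteq> \<Omega>"
  shows "(\<lambda>n. conv (s / 2 ^ n) f z) \<longlonglongrightarrow> f z"
proof (rule LIMSEQ_I)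
  fix \<epsilon> :: real assume \<epsilon>: "\<epsilon> > 0"
  have z: "z \<in> \<Omega>" using sub s by (auto simp: mem_sq)
  have "continuous (at z) f" using sobD(1,2)[OF sb] z continuous_on_eq_continuous_at by blast
  then obtain \<delta> where \<delta>: "\<delta> > 0" "\<And>w. dist w z < \<delta> \<Longrightarrow> dist (f w) (f z) < \<epsilon> / 2"
    unfolding continuous_at_eps_delta using \<epsilon> by (metis half_gt_zero)
  have "(\<lambda>n. s / 2 ^ n) \<longlonglongrightarrow> 0" using LIMSEQ_divide_realpow_zero[of 2 s] by simp
  then have "\<forall>\<^sub>F n in sequentially. s / 2 ^ n < \<delta> / 2" by (rule order_tendstoD) (use \<delta> in simp)
  then obtain N where N: "\<And>n. n \<ge> N \<Longrightarrow> s / 2 ^ n < \<delta> / 2" unfolding eventually_sequentially by blast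
  have "norm (conv (s / 2 ^ n) f z - f z) < \<epsilon>" if "n \<ge> N" for n
  proof -
    have sn: "s / 2 ^ n > 0" "s / 2 ^ n \<le> s" using s by (auto simp: divide_le_eq)
    have sub': "sq z (s / 2 ^ n) \<subseteq> \<Omega>" using sq_mono[OF sn(2)] sub by blast
    have "norm (conv (s / 2 ^ n) f z - f z) \<le> \<epsilon> / 2"
    proof (rule conv_close[OF sn(1) norm_f_integrable(2)[OF sb sub']])
      fix w assume "w \<in> sq z (s / 2 ^ n)"
      then have "dist w z \<le> 2 * (s / 2 ^ n)" using cmod_le[of "w - z"] by (simp add: mem_sq dist_norm)
      also have "\<dots> < \<delta>" using N[OF that] by (simp add: mult.commute)
      finally show "norm (f w - f z) \<le> \<epsilon> / 2" using \<delta>(2)[of w] by (simp add: dist_norm)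
    qed (use \<epsilon> in simp)
    then show ?thesis using \<epsilon> by simp
  qed
  then show "\<exists>N. \<forall>n\<ge>N. norm (conv (s / 2 ^ n) f z - f z) < \<epsilon>" by blast
qed

text \<open>The sum of the geometric series of Morrey steps: halving the scale multiplies the energy
  bound by \<open>dec \<kappa>\<close>, and a step is linear in the root of the energy.\<close>

definition morc :: "real \<Rightarrow> real" where "morc \<kappa> = 10 * bmax * sqrt \<kappa> / (1 - sqrt (dec \<kappa>))"

lemma morc_pos: "\<kappa> > 0 \<Longrightarrow> morc \<kappa> > 0"
  using dec_bounds[of \<kappa>] bmax(1) unfolding morc_def by (auto intro!: divide_pos_pos mult_pos_pos)

text \<open>The averages at scales s / 2^n converge to the value at the centre by continuity, and
  their consecutive differences are dominated by a geometric series.\<close>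

lemma Morrey:
  assumes q: "qr \<kappa> \<Omega> f a b" and k: "\<kappa> > 0" and s: "s > 0" and sub: "sq z s \<subseteq> \<Omega>" and \<tau>: "\<tau> > 0"
    and E: "(LINT w:sq z s|lborel. en (a w) (b w)) \<le> \<tau>\<^sup>2"
  shows "norm (f z - conv s f z) \<le> morc \<kappa> * \<tau>"
proof -
  define \<mu> where "\<mu> = sqrt (dec \<kappa>)"
  have \<mu>: "0 < \<mu>" "\<mu> < 1" "\<mu>\<^sup>2 = dec \<kappa>" using dec_bounds[OF k] by (auto simp: \<mu>_def)
  define C where "C = 10 * bmax * (sqrt \<kappa> * \<tau>)"
  have C: "C > 0" using bmax(1) k \<tau> by (simp add: C_def)
  note sb = qr_sob[OF q]
  have step: "norm (conv (s / 2 ^ n) f z - conv (s / 2 ^ Suc n) f z) \<le> C * \<mu> ^ n" for n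
  proof -
    have sn: "s / 2 ^ n > 0" "s / 2 ^ n \<le> s" using s by (auto simp: divide_le_eq)
    have sub': "sq z (s / 2 ^ n) \<subseteq> \<Omega>" using sq_mono[OF sn(2)] sub by blast
    have "(LINT w:sq z (s / 2 ^ n)|lborel. en (a w) (b w)) \<le> \<kappa> * dec \<kappa> ^ n * (LINT w:sq z s|lborel. en (a w) (b w))"
      by (rule energy_decay[OF q k s sub])
    also have "\<dots> \<le> \<kappa> * dec \<kappa> ^ n * \<tau>\<^sup>2"
      using E k dec_bounds(1)[OF k] by (intro mult_left_mono) auto
    also have "\<dots> = (sqrt \<kappa> * \<mu> ^ n * \<tau>)\<^sup>2"
      using k \<mu>(3) by (simp add: power_mult_distrib power_mult[symmetric] mult.commute[of n 2]) (simp add: power_mult)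
    finally have "norm (conv (s / 2 ^ n) f z - conv (s / 2 ^ n / 2) f z) \<le> 10 * bmax * (sqrt \<kappa> * \<mu> ^ n * \<tau>)"
      using k \<mu> \<tau> by (intro Morrey_step[OF sb sn(1) sub']) auto
    then show ?thesis by (simp add: C_def mult_ac)
  qed
  have sum: "norm (conv s f z - conv (s / 2 ^ n) f z) \<le> C * (1 - \<mu> ^ n) / (1 - \<mu>)" for n
  proof (induction n)
    case (Suc n)
    have "norm (conv s f z - conv (s / 2 ^ Suc n) f z) \<le> norm (conv s f z - conv (s / 2 ^ n) f z)
        + norm (conv (s / 2 ^ n) f z - conv (s / 2 ^ Suc n) f z)"
      using norm_triangle_ineq[of "conv s f z - conv (s / 2 ^ n) f z" "conv (s / 2 ^ n) f z - conv (s / 2 ^ Suc n) f z"] by simp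
    also have "\<dots> \<le> C * (1 - \<mu> ^ n) / (1 - \<mu>) + C * \<mu> ^ n" by (intro add_mono Suc step)
    also have "\<dots> = C * (1 - \<mu> ^ Suc n) / (1 - \<mu>)" using \<mu> by (simp add: field_simps)
    finally show ?case .
  qed simp
  have le: "norm (conv s f z - conv (s / 2 ^ n) f z) \<le> C / (1 - \<mu>)" for n
  proof -
    have "C * (1 - \<mu> ^ n) / (1 - \<mu>) \<le> C * 1 / (1 - \<mu>)"
      using C \<mu> by (intro divide_right_mono mult_left_mono) auto
    then show ?thesis using sum[of n] by simp
  qed
  have "(\<lambda>n. norm (conv s f z - conv (s / 2 ^ n) f z)) \<longlonglongrightarrow> norm (conv s f z - f z)"
    by (intro tendsto_intros conv_dyadic_tendsto[OF sb s sub])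
  then have "norm (conv s f z - f z) \<le> C / (1 - \<mu>)"
    by (rule LIMSEQ_le_const2) (use le in blast)
  then show ?thesis by (simp add: norm_minus_commute morc_def C_def \<mu>_def mult_ac)
qed

section \<open>Sup bounds\<close>

definition supc :: "real \<Rightarrow> real" where "supc \<kappa> = bmax + 3 * \<kappa> * morc \<kappa>"

lemma supc_pos: "\<kappa> > 0 \<Longrightarrow> supc \<kappa> > 0"
  using morc_pos[of \<kappa>] bmax(1) unfolding supc_def by (simp add: add_pos_pos)

text \<open>Jensen's inequality with the kernel bounded by the square of bmax / s. Normalising the
  L^2 mass by s^2 makes the bound independent of the scale.\<close>

lemma conv_L2_bound:
  assumes sb: "sob \<Omega> f a b" and s: "s > 0" and sub: "sq z s \<subseteq> \<Omega>" and m: "m \<ge> 0"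
    and L: "(LINT w:sq z s|lborel. (norm (f w))\<^sup>2) \<le> m\<^sup>2 * s\<^sup>2"
  shows "norm (conv s f z) \<le> bmax * m"
proof -
  note sd [measurable] = sobD(3-5)[OF sb]
  note i = norm_f_integrable(1)[OF sb sub]
  have "pw 2 (conv s f z) \<le> (\<integral>\<^sup>+w. ennreal (moll s (z - w)) * pw 2 (f w) \<partial>lborel)"
    by (rule conv_pointwise[OF s]) auto
  also have "\<dots> \<le> (\<integral>\<^sup>+w. ennreal ((bmax / s)\<^sup>2 * (indicator (sq z s) w *\<^sub>R (norm (f w))\<^sup>2)) \<partial>lborel)"
  proof (rule nn_integral_mono)
    fix w
    show "ennreal (moll s (z - w)) * pw 2 (f w) \<le> ennreal ((bmax / s)\<^sup>2 * (indicator (sq z s) w *\<^sub>R (norm (f w))\<^sup>2))"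
    proof (cases "w \<in> sq z s")
      case True
      have "moll s (z - w) * (norm (f w))\<^sup>2 \<le> (bmax / s)\<^sup>2 * (norm (f w))\<^sup>2"
        by (intro mult_right_mono moll_le s) auto
      then show ?thesis using True moll_nonneg[OF s] by (simp add: ennreal_mult[symmetric] ennreal_leI)
    qed (simp add: moll_out[OF s])
  qed
  also have "\<dots> = ennreal (LINT w|lborel. (bmax / s)\<^sup>2 * (indicator (sq z s) w *\<^sub>R (norm (f w))\<^sup>2))"
    using i unfolding set_integrable_def by (intro nn_integral_eq_integral integrable_mult_right) auto
  also have "(LINT w|lborel. (bmax / s)\<^sup>2 * (indicator (sq z s) w *\<^sub>R (norm (f w))\<^sup>2)) = (bmax / s)\<^sup>2 * (LINT w:sq z s|lborel. (norm (f w))\<^sup>2)"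
    unfolding set_lebesgue_integral_def by (rule integral_mult_right_zero)
  also have "ennreal \<dots> \<le> ennreal ((bmax / s)\<^sup>2 * (m\<^sup>2 * s\<^sup>2))"
    using L by (intro ennreal_leI mult_left_mono) auto
  also have "(bmax / s)\<^sup>2 * (m\<^sup>2 * s\<^sup>2) = (bmax * m)\<^sup>2" using s by (simp add: power_mult_distrib power_divide)
  finally have "(norm (conv s f z))\<^sup>2 \<le> (bmax * m)\<^sup>2" by (simp add: ennreal_le_iff)
  then show ?thesis by (rule power2_le_imp_le) (use m bmax(1) in simp)
qed

text \<open>Half of the radius is spent on Caccioppoli, which bounds the energy by 8 \<kappa>^2 m^2,
  at most the square of 3 \<kappa> m, at every scale. The two summands of \<open>supc\<close> come
  from the average and from its Morrey distance to the value at the centre.\<close>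

lemma sup_L2:
  assumes q: "qr \<kappa> \<Omega> f a b" and k: "\<kappa> > 0" and s: "s > 0" and sub: "sq z (2 * s) \<subseteq> \<Omega>" and m: "m > 0"
    and L: "(LINT w:sq z (2 * s)|lborel. (norm (f w))\<^sup>2) \<le> m\<^sup>2 * s\<^sup>2"
  shows "norm (f z) \<le> supc \<kappa> * m"
proof -
  note sb = qr_sob[OF q]
  have sub': "sq z s \<subseteq> sq z (2 * s)" using s by (intro sq_mono) simp
  have "(LINT w:sq z (2 * s / 2)|lborel. en (a w) (b w)) \<le> 32 * \<kappa>\<^sup>2 / (2 * s)\<^sup>2 * (LINT w:sq z (2 * s)|lborel. (norm (f w))\<^sup>2)"
    by (rule Caccioppoli[OF q k _ sub]) (use s in simp)
  also have "\<dots> \<le> 32 * \<kappa>\<^sup>2 / (2 * s)\<^sup>2 * (m\<^sup>2 * s\<^sup>2)"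
    using L by (intro mult_left_mono) auto
  also have "\<dots> = 8 * \<kappa>\<^sup>2 * m\<^sup>2" using s by (simp add: power_mult_distrib)
  also have "\<dots> \<le> (3 * \<kappa> * m)\<^sup>2" by (simp add: power_mult_distrib)
  finally have E: "(LINT w:sq z s|lborel. en (a w) (b w)) \<le> (3 * \<kappa> * m)\<^sup>2" by simp
  have 1: "norm (f z - conv s f z) \<le> morc \<kappa> * (3 * \<kappa> * m)"
    by (rule Morrey[OF q k s order_trans[OF sub' sub] _ E]) (use k m in simp)
  have "(LINT w:sq z s|lborel. (norm (f w))\<^sup>2) \<le> (LINT w:sq z (2 * s)|lborel. (norm (f w))\<^sup>2)"
    by (rule set_integral_subset_le[OF norm_f_integrable(1)[OF sb sub] _ sub']) auto
  then have 2: "norm (conv s f z) \<le> bmax * m"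
    using L m by (intro conv_L2_bound[OF sb s order_trans[OF sub' sub]]) auto
  have "norm (f z) \<le> norm (f z - conv s f z) + norm (conv s f z)"
    using norm_triangle_ineq[of "f z - conv s f z" "conv s f z"] by simp
  also have "\<dots> \<le> supc \<kappa> * m" using 1 2 by (simp add: supc_def algebra_simps)
  finally show ?thesis .
qed

text \<open>The exponent below 2 is handled by maximising \<open>|f z| d(z) powr (2 / p)\<close>, where \<open>d\<close> is the
  distance to the boundary of the square: at the maximum, \<open>f\<close> is controlled on a comparable square by
  its value at the centre.\<close>
lemma sup_Lp:
  assumes q: "qr \<kappa> \<Omega> f a b" and k: "\<kappa> > 0" and R: "R > 0" and sub: "sq z0 R \<subseteq> \<Omega>" and p: "0 < p" "p \<le> 2"
    and i: "set_integrable lborel (sq z0 R) (\<lambda>z. norm (f z) powr p)"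
    and L: "(LINT z:sq z0 R|lborel. norm (f z) powr p) \<le> X"
  shows "norm (f z0) powr p * R\<^sup>2 \<le> 16 * (supc \<kappa>)\<^sup>2 * (2 powr (2 / p)) powr (2 - p) * X"
proof (cases "f z0 = 0")
  case True
  have "0 \<le> (LINT z:sq z0 R|lborel. norm (f z) powr p)" by (rule set_integral_nonneg) simp
  then have "X \<ge> 0" using L by simp
  then show ?thesis using True by (simp add: supc_def)
next
  case False
  note sb = qr_sob[OF q]
  let ?Q = "sq z0 R"
  define d where "d z = R - max \<bar>Re z - Re z0\<bar> \<bar>Im z - Im z0\<bar>" for z
  define \<Phi> where "\<Phi> z = norm (f z) * d z powr (2 / p)" for z
  have dQ: "d z \<ge> 0" if "z \<in> ?Q" for z using that by (simp add: d_def mem_sq)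
  have dc: "continuous_on ?Q d" unfolding d_def by (intro continuous_intros)
  have fc: "continuous_on ?Q f" using sobD(2)[OF sb] sub continuous_on_subset by blast
  have "continuous_on ?Q \<Phi>"
    unfolding \<Phi>_def
    by (intro continuous_on_mult continuous_on_norm fc continuous_on_powr' dc continuous_on_const)
       (use dQ p in auto)
  moreover have z0Q: "z0 \<in> ?Q" using R by (simp add: mem_sq)
  ultimately obtain z1 where z1: "z1 \<in> ?Q" and max: "\<And>z. z \<in> ?Q \<Longrightarrow> \<Phi> z \<le> \<Phi> z1"
    using continuous_attains_sup[of ?Q \<Phi>] compact_sq by blast
  define A where "A = norm (f z1)"
  define D where "D = d z1"
  define c where "c = (2::real) powr (2 / p)"
  have "0 < \<Phi> z0" using False R by (simp add: \<Phi>_def d_def)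
  also have le0: "\<Phi> z0 \<le> \<Phi> z1" by (rule max[OF z0Q])
  finally have "0 < \<Phi> z1" .
  then have AD: "A > 0" "D > 0"
    using dQ[OF z1] unfolding \<Phi>_def A_def D_def by (auto simp: zero_less_mult_iff less_le)
  \<comment> \<open>On \<open>sq z1 (2 * s)\<close> the distance to the boundary is still at least D
    / 2, so maximality at \<open>z1\<close> bounds |f| there by A up to the factor
    \<open>c\<close>.\<close>
  define s where "s = D / 4"
  have s: "s > 0" using AD by (simp add: s_def)
  have sub1: "sq z1 (2 * s) \<subseteq> ?Q"
  proof (rule sq_subset)
    have "max \<bar>Re z1 - Re z0\<bar> \<bar>Im z1 - Im z0\<bar> + D = R" by (simp add: D_def d_def)
    then show "\<bar>Re z1 - Re z0\<bar> + 2 * s \<le> R" "\<bar>Im z1 - Im z0\<bar> + 2 * s \<le> R"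
      using AD by (auto simp: s_def max_def split: if_splits)
  qed
  have bound: "norm (f w) \<le> c * A" if w: "w \<in> sq z1 (2 * s)" for w
  proof -
    have dw: "D / 2 \<le> d w"
    proof -
      have "max \<bar>Re w - Re z0\<bar> \<bar>Im w - Im z0\<bar> \<le> max \<bar>Re z1 - Re z0\<bar> \<bar>Im z1 - Im z0\<bar> + 2 * s"
        using w by (auto simp: mem_sq max_def)
      moreover have "(R - x) / 2 \<le> R - y" if "y \<le> x + 2 * ((R - x) / 4)" for x y :: real
        using that by (simp add: field_simps)
      ultimately show ?thesis unfolding d_def D_def s_def by blast
    qed
    have "norm (f w) * (D / 2) powr (2 / p) \<le> \<Phi> w"
      unfolding \<Phi>_def using dw AD p by (intro mult_left_mono powr_mono2) auto
    also have "\<dots> \<le> \<Phi> z1" using w sub1 by (intro max) auto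
    also have "\<dots> = A * D powr (2 / p)" by (simp add: \<Phi>_def A_def D_def)
    also have "\<dots> = c * A * (D / 2) powr (2 / p)"
      using AD by (simp add: powr_divide c_def)
    finally show ?thesis using AD by (simp add: mult_le_cancel_right)
  qed
  have cA: "c * A > 0" using AD by (simp add: c_def)
  \<comment> \<open>The surplus power 2 - p is paid with the pointwise bound c A. The resulting
    power of A stays below A^2 and is divided out at the end, leaving A to the power p.\<close>
  have sq2: "(norm (f w))\<^sup>2 \<le> (c * A) powr (2 - p) * norm (f w) powr p" if w: "w \<in> sq z1 (2 * s)" for w
  proof (cases "f w = 0")
    case False
    have "(norm (f w))\<^sup>2 = norm (f w) powr (2 - p) * norm (f w) powr p"
      using False by (simp add: powr_add[symmetric])
    also have "\<dots> \<le> (c * A) powr (2 - p) * norm (f w) powr p"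
      using bound[OF w] p by (intro mult_right_mono powr_mono2) auto
    finally show ?thesis .
  qed simp
  have "(LINT w:sq z1 (2 * s)|lborel. (norm (f w))\<^sup>2) \<le> (LINT w:sq z1 (2 * s)|lborel. (c * A) powr (2 - p) * norm (f w) powr p)"
    by (intro set_integral_mono norm_f_integrable(1)[OF sb] order_trans[OF sub1 sub] sq2 set_integrable_mult_right
        set_integrable_subset[OF i _ sub1]) auto
  also have "\<dots> = (c * A) powr (2 - p) * (LINT w:sq z1 (2 * s)|lborel. norm (f w) powr p)" by (rule set_integral_mult_right)
  also have "\<dots> \<le> (c * A) powr (2 - p) * X"
    using set_integral_subset_le[OF i _ sub1] L by (intro mult_left_mono) force+
  finally have L2: "(LINT w:sq z1 (2 * s)|lborel. (norm (f w))\<^sup>2) \<le> (c * A) powr (2 - p) * X" .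
  \<comment> \<open>\<open>sup_L2\<close> takes positive m only, so X = 0 must be excluded first:
    then f would have no L^2 mass around \<open>z1\<close>, and a small m contradicts A > 0.\<close>
  have X0: "0 < X"
  proof (rule ccontr)
    assume "\<not> 0 < X"
    then have "(c * A) powr (2 - p) * X \<le> 0" by (intro mult_nonneg_nonpos) auto
    then have le: "(LINT w:sq z1 (2 * s)|lborel. (norm (f w))\<^sup>2) \<le> 0" using L2 by linarith
    have "A \<le> supc \<kappa> * m" if "m > 0" for m
      unfolding A_def by (rule sup_L2[OF q k s order_trans[OF sub1 sub] that]) (use le that in \<open>auto intro: order_trans\<close>)
    from this[of "A / (2 * supc \<kappa>)"] show False using AD supc_pos[OF k] by simp
  qed
  define m where "m = sqrt ((c * A) powr (2 - p) * X) / s"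
  have "0 < (c * A) powr (2 - p)" unfolding powr_gt_zero using cA by (rule less_imp_neq[symmetric])
  then have m: "m > 0" unfolding m_def by (intro divide_pos_pos real_sqrt_gt_zero mult_pos_pos X0 s)
  have m2: "m\<^sup>2 * s\<^sup>2 = (c * A) powr (2 - p) * X" using X0 s by (simp add: m_def power_divide)
  from L2 have "(LINT w:sq z1 (2 * s)|lborel. (norm (f w))\<^sup>2) \<le> m\<^sup>2 * s\<^sup>2" by (simp add: m2)
  then have "A \<le> supc \<kappa> * m" unfolding A_def by (rule sup_L2[OF q k s order_trans[OF sub1 sub] m])
  then have "A\<^sup>2 \<le> (supc \<kappa> * m)\<^sup>2" using AD by (intro power_mono) auto
  also have "\<dots> = (supc \<kappa>)\<^sup>2 * ((c * A) powr (2 - p) * X) / s\<^sup>2"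
    using m2 s by (simp add: power_mult_distrib field_simps)
  also have "\<dots> = 16 * (supc \<kappa>)\<^sup>2 * c powr (2 - p) * A powr (2 - p) * X / D\<^sup>2"
    using AD by (simp add: s_def power_divide powr_mult c_def)
  finally have A2: "A\<^sup>2 \<le> 16 * (supc \<kappa>)\<^sup>2 * c powr (2 - p) * A powr (2 - p) * X / D\<^sup>2" .
  have "A\<^sup>2 = A powr (2 - p) * A powr p" using AD by (simp add: powr_add[symmetric])
  with A2 have "A powr (2 - p) * (A powr p) \<le> A powr (2 - p) * (16 * (supc \<kappa>)\<^sup>2 * c powr (2 - p) * X / D\<^sup>2)"
    by (simp add: mult_ac)
  then have "A powr p \<le> 16 * (supc \<kappa>)\<^sup>2 * c powr (2 - p) * X / D\<^sup>2"
    using AD by (subst (asm) mult_le_cancel_left_pos) auto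
  then have A3: "A powr p * D\<^sup>2 \<le> 16 * (supc \<kappa>)\<^sup>2 * c powr (2 - p) * X" using AD by (simp add: pos_le_divide_eq)
  \<comment> \<open>The weight exponent 2 / p is chosen so that the p-th power turns the distance
    into its square, which is how area scales.\<close>
  have pw': "(x * y powr (2 / p)) powr p = x powr p * y\<^sup>2" if "x \<ge> 0" "y > 0" for x y :: real
    using that p by (simp add: powr_mult powr_powr)
  have "norm (f z0) powr p * R\<^sup>2 = \<Phi> z0 powr p" unfolding \<Phi>_def using pw' R by (simp add: d_def)
  also have "\<dots> \<le> \<Phi> z1 powr p" using le0 \<open>0 < \<Phi> z0\<close> p by (intro powr_mono2) auto
  also have "\<dots> = A powr p * D\<^sup>2" unfolding \<Phi>_def using pw' AD by (simp add: A_def D_def)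
  finally show ?thesis using A3 by (simp add: c_def)
qed

section \<open>Equicontinuity\<close>

lemma moll_equicontinuity:
  assumes s: "s > 0" and e: "e > 0"
  obtains \<delta> where "\<delta> > 0" "\<And>z z' w. z \<in> sq z0 R \<Longrightarrow> z' \<in> sq z0 R \<Longrightarrow> norm (z - z') < \<delta> \<Longrightarrow> w \<in> sq z0 (2 * R) \<Longrightarrow>
    \<bar>moll s (z - w) - moll s (z' - w)\<bar> < e"
proof -
  have "uniformly_continuous_on (sq 0 (3 * R)) (moll s)"
    by (intro compact_uniformly_continuous continuous_on_moll compact_sq)
  then obtain \<delta> where \<delta>: "\<delta> > 0" "\<And>x y. x \<in> sq 0 (3 * R) \<Longrightarrow> y \<in> sq 0 (3 * R) \<Longrightarrow> dist y x < \<delta> \<Longrightarrow> dist (moll s y) (moll s x) < e"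
    using e unfolding uniformly_continuous_on_def by metis
  show ?thesis
  proof (rule that[OF \<delta>(1)])
    fix z z' w assume "z \<in> sq z0 R" "z' \<in> sq z0 R" "norm (z - z') < \<delta>" "w \<in> sq z0 (2 * R)"
    moreover from this have "z - w \<in> sq 0 (3 * R)" "z' - w \<in> sq 0 (3 * R)"
      by (auto simp: mem_sq abs_le_iff)
    ultimately show "\<bar>moll s (z - w) - moll s (z' - w)\<bar> < e"
      using \<delta>(2)[of "z' - w" "z - w"] by (simp add: dist_norm)
  qed
qed

text \<open>\<open>\<delta>\<close> is fixed before the domain and the map. A sup bound gives an
  energy bound by Caccioppoli, so by decay and Morrey |f - conv s f| is uniformly small at some
  fixed scale s. At that scale \<open>conv s f\<close> depends on the point only through the
  uniformly continuous kernel.\<close>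

lemma equicontinuity:
  assumes k: "\<kappa> > 0" and R: "R > 0" and B: "B > 0" and \<epsilon>: "\<epsilon> > 0"
  obtains \<delta> where "\<delta> > 0" "\<And>\<Omega> f a b z z'. qr \<kappa> \<Omega> f a b \<Longrightarrow> sq z0 (2 * R) \<subseteq> \<Omega> \<Longrightarrow>
    (\<And>w. w \<in> sq z0 (2 * R) \<Longrightarrow> norm (f w) \<le> B) \<Longrightarrow> z \<in> sq z0 R \<Longrightarrow> z' \<in> sq z0 R \<Longrightarrow> norm (z - z') < \<delta> \<Longrightarrow>
    norm (f z - f z') \<le> \<epsilon>"
proof -
  define \<mu> where "\<mu> = sqrt (dec \<kappa>)"
  have \<mu>: "0 < \<mu>" "\<mu> < 1" "\<mu>\<^sup>2 = dec \<kappa>" using dec_bounds[OF k] by (auto simp: \<mu>_def)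
  \<comment> \<open>A bound for the root of the energy at scale R / 2^(n+1). Caccioppoli gives 128
    \<kappa>^2 B^2 at scale R / 2, which is at most the square of 12 \<kappa> B; then follow n
    halvings.\<close>
  define T where "T n = sqrt \<kappa> * \<mu> ^ n * (12 * \<kappa> * B)" for n :: nat
  have T: "T n > 0" for n using k \<mu> B by (simp add: T_def)
  have "(\<lambda>n. morc \<kappa> * T n) \<longlonglongrightarrow> morc \<kappa> * (sqrt \<kappa> * 0 * (12 * \<kappa> * B))"
    unfolding T_def by (intro tendsto_intros LIMSEQ_realpow_zero) (use \<mu> in auto)
  then have "\<forall>\<^sub>F n in sequentially. morc \<kappa> * T n < \<epsilon> / 3" by (rule order_tendstoD) (use \<epsilon> in simp)
  then obtain n where n: "morc \<kappa> * T n < \<epsilon> / 3" using eventually_happens' sequentially_bot by blast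
  define s where "s = (R / 2) / 2 ^ n"
  have s: "s > 0" "s \<le> R / 2" using R by (auto simp: s_def divide_le_eq)
  \<comment> \<open>16 R^2 is the area of \<open>sq z0 (2 * R)\<close>, over which the difference of
    the kernels is integrated.\<close>
  define e where "e = \<epsilon> / (3 * (B * (16 * R\<^sup>2)))"
  have e: "e > 0" using \<epsilon> B R by (simp add: e_def)
  obtain \<delta> where \<delta>: "\<delta> > 0" "\<And>z z' w. z \<in> sq z0 R \<Longrightarrow> z' \<in> sq z0 R \<Longrightarrow> norm (z - z') < \<delta> \<Longrightarrow> w \<in> sq z0 (2 * R) \<Longrightarrow>
    \<bar>moll s (z - w) - moll s (z' - w)\<bar> < e"
    using moll_equicontinuity[OF s(1) e, of z0 R] by blast
  show ?thesis
  proof (rule that[OF \<delta>(1)])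
    fix \<Omega> f a b z z'
    assume q: "qr \<kappa> \<Omega> f a b" and sub: "sq z0 (2 * R) \<subseteq> \<Omega>" and fB: "\<And>w. w \<in> sq z0 (2 * R) \<Longrightarrow> norm (f w) \<le> B"
      and z: "z \<in> sq z0 R" "z' \<in> sq z0 R" "norm (z - z') < \<delta>"
    note sb = qr_sob[OF q]
    note sd [measurable] = sobD(3-5)[OF sb]
    have sq1: "sq x R \<subseteq> sq z0 (2 * R)" if "x \<in> sq z0 R" for x
      using that by (intro sq_subset) (auto simp: mem_sq)
    have sq2: "sq x s \<subseteq> sq x R" for x using s R by (intro sq_mono) simp
    have near: "norm (f x - conv s f x) \<le> \<epsilon> / 3" if x: "x \<in> sq z0 R" for x
    proof -
      have subR: "sq x R \<subseteq> \<Omega>" using sq1[OF x] sub by blast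
      have sub2: "sq x (R / 2) \<subseteq> \<Omega>" using sq_mono[of "R / 2" R x] subR R by auto
      have "(LINT w:sq x R|lborel. (norm (f w))\<^sup>2) \<le> (LINT w:sq x R|lborel. B\<^sup>2)"
        by (intro set_integral_mono norm_f_integrable(1)[OF sb subR] set_integrable_const_sq power_mono fB)
           (use sq1[OF x] in auto)
      also have "\<dots> = 4 * R\<^sup>2 * B\<^sup>2" using R by (simp add: set_integral_const_sq)
      finally have L2: "(LINT w:sq x R|lborel. (norm (f w))\<^sup>2) \<le> 4 * R\<^sup>2 * B\<^sup>2" .
      have "(LINT w:sq x (R / 2)|lborel. en (a w) (b w)) \<le> 32 * \<kappa>\<^sup>2 / R\<^sup>2 * (LINT w:sq x R|lborel. (norm (f w))\<^sup>2)"
        by (rule Caccioppoli[OF q k R subR])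
      also have "\<dots> \<le> 32 * \<kappa>\<^sup>2 / R\<^sup>2 * (4 * R\<^sup>2 * B\<^sup>2)" using L2 by (intro mult_left_mono) auto
      also have "\<dots> \<le> (12 * \<kappa> * B)\<^sup>2" using R by (simp add: power_mult_distrib)
      finally have E: "(LINT w:sq x (R / 2)|lborel. en (a w) (b w)) \<le> (12 * \<kappa> * B)\<^sup>2" .
      have "(LINT w:sq x s|lborel. en (a w) (b w)) \<le> \<kappa> * dec \<kappa> ^ n * (LINT w:sq x (R / 2)|lborel. en (a w) (b w))"
        unfolding s_def by (rule energy_decay[OF q k _ sub2]) (use R in simp)
      also have "\<dots> \<le> \<kappa> * dec \<kappa> ^ n * (12 * \<kappa> * B)\<^sup>2"
        using E k dec_bounds(1)[OF k] by (intro mult_left_mono) auto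
      also have "\<dots> = (T n)\<^sup>2"
        using k \<mu>(3) unfolding T_def power_mult_distrib by (simp add: power_mult[symmetric] mult.commute[of n 2]) (simp add: power_mult)
      finally have "norm (f x - conv s f x) \<le> morc \<kappa> * T n"
        by (rule Morrey[OF q k s(1) order_trans[OF sq2 subR] T])
      then show ?thesis using n by simp
    qed
    have fi: "set_integrable lborel (sq z0 (2 * R)) f" by (rule norm_f_integrable(2)[OF sb sub])
    have mi: "integrable lborel (\<lambda>w. moll s (x - w) *\<^sub>R f w)" if x: "x \<in> sq z0 R" for x
      by (rule moll_mult_integrable[OF s(1) set_integrable_subset[OF fi]]) (use sq1[OF x] sq2 in auto)
    have "norm (conv s f z - conv s f z') = norm (LINT w|lborel. (moll s (z - w) - moll s (z' - w)) *\<^sub>R f w)"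
      unfolding conv_def scaleR_diff_left using mi z by simp
    also have "\<dots> \<le> (LINT w|lborel. indicator (sq z0 (2 * R)) w *\<^sub>R (e * B))"
    proof (rule Bochner_Integration.integral_norm_bound_integral)
      show "integrable lborel (\<lambda>w. (moll s (z - w) - moll s (z' - w)) *\<^sub>R f w)"
        unfolding scaleR_diff_left using mi z by (intro Bochner_Integration.integrable_diff)
      show "integrable lborel (\<lambda>w. indicator (sq z0 (2 * R)) w *\<^sub>R (e * B))"
        using set_integrable_const_sq[of z0 "2 * R" "e * B"] by (simp add: set_integrable_def)
      fix w
      show "norm ((moll s (z - w) - moll s (z' - w)) *\<^sub>R f w) \<le> indicator (sq z0 (2 * R)) w *\<^sub>R (e * B)"
      proof (cases "w \<in> sq z0 (2 * R)")
        case True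
        have "\<bar>moll s (z - w) - moll s (z' - w)\<bar> * norm (f w) \<le> e * B"
          using \<delta>(2)[OF z True] fB[OF True] e by (intro mult_mono) auto
        then show ?thesis using True by simp
      next
        case False
        then have "w \<notin> sq z s" "w \<notin> sq z' s" using sq1[OF z(1)] sq1[OF z(2)] sq2 by blast+
        then show ?thesis using False by (simp add: moll_out[OF s(1)])
      qed
    qed
    also have "\<dots> = 4 * (2 * R)\<^sup>2 * (e * B)"
      using set_integral_const_sq[of "2 * R" z0 "e * B"] R by (simp add: set_lebesgue_integral_def)
    also have "\<dots> = \<epsilon> / 3" using B R by (simp add: e_def power_mult_distrib)
    finally have mid: "norm (conv s f z - conv s f z') \<le> \<epsilon> / 3" .
    have "f z - f z' = (f z - conv s f z) + (conv s f z - conv s f z') - (f z' - conv s f z')" by simp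
    then have "norm (f z - f z') \<le> norm (f z - conv s f z) + norm (conv s f z - conv s f z') + norm (f z' - conv s f z')"
      by (metis norm_triangle_ineq4 norm_triangle_ineq add_right_mono order_trans)
    then show "norm (f z - f z') \<le> \<epsilon>" using near[OF z(1)] near[OF z(2)] mid by linarith
  qed
qed

section \<open>Weak derivatives with Borel representatives\<close>

text \<open>The squared moduli of a + i b and a - i b are en - 2 jac and en + 2 jac. Squaring the
  inequality and clearing the denominator leaves 4 K en \<le> 4 (K^2 + 1) jac, which is the origin
  of K + 1/K.\<close>

lemma qr_algebra:
  assumes "K \<ge> 1"
  shows "cmod ((a + \<i> * b) / 2) \<le> (K - 1) / (K + 1) * cmod ((a - \<i> * b) / 2) \<longleftrightarrow> en a b \<le> (K + 1 / K) * jac a b"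
proof -
  have 1: "(cmod (a + \<i> * b))\<^sup>2 = en a b - 2 * jac a b" and 2: "(cmod (a - \<i> * b))\<^sup>2 = en a b + 2 * jac a b"
    unfolding en_def cmod_power2 jac_def by (simp_all add: power2_eq_square algebra_simps)
  define k where "k = (K - 1) / (K + 1)"
  have k: "k \<ge> 0" using assms by (simp add: k_def)
  have "cmod ((a + \<i> * b) / 2) \<le> k * cmod ((a - \<i> * b) / 2) \<longleftrightarrow> cmod (a + \<i> * b) \<le> k * cmod (a - \<i> * b)"
    by (simp add: norm_divide)
  also have "\<dots> \<longleftrightarrow> (cmod (a + \<i> * b))\<^sup>2 \<le> (k * cmod (a - \<i> * b))\<^sup>2"
    using abs_le_square_iff[of "cmod (a + \<i> * b)" "k * cmod (a - \<i> * b)"] k by simp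
  also have "\<dots> \<longleftrightarrow> en a b - 2 * jac a b \<le> k\<^sup>2 * (en a b + 2 * jac a b)"
    by (simp add: power_mult_distrib 1 2)
  also have "\<dots> \<longleftrightarrow> (en a b - 2 * jac a b) * (K + 1)\<^sup>2 \<le> (K - 1)\<^sup>2 * (en a b + 2 * jac a b)"
    using assms by (simp add: k_def power_divide pos_le_divide_eq)
  also have "\<dots> \<longleftrightarrow> 4 * (K * en a b) \<le> 4 * ((K\<^sup>2 + 1) * jac a b)"
    by (simp add: power2_eq_square algebra_simps)
  also have "(K\<^sup>2 + 1) * jac a b = K * ((K + 1 / K) * jac a b)"
    using assms by (simp add: power2_eq_square field_simps)
  also have "4 * (K * en a b) \<le> 4 * (K * ((K + 1 / K) * jac a b)) \<longleftrightarrow> K * en a b \<le> K * ((K + 1 / K) * jac a b)"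
    by (rule mult_le_cancel_left_pos) simp
  also have "\<dots> \<longleftrightarrow> en a b \<le> (K + 1 / K) * jac a b"
    using assms by (subst mult_le_cancel_left_pos) auto
  finally show ?thesis by (simp add: k_def)
qed

lemma complex_borel_representative:
  fixes g :: "complex \<Rightarrow> complex"
  assumes g: "g \<in> borel_measurable lebesgue"
  obtains g' where "g' \<in> borel_measurable borel" "AE z in lborel. g z = g' z"
proof -
  have "(\<lambda>z. Re (g z)) \<in> borel_measurable (completion lborel)" "(\<lambda>z. Im (g z)) \<in> borel_measurable (completion lborel)"
    using g by measurable
  from this[THEN completion_ex_borel_measurable_real]
  obtain u v where [measurable]: "u \<in> borel_measurable lborel" "v \<in> borel_measurable lborel"
    and ae: "AE z in lborel. Re (g z) = u z" "AE z in lborel. Im (g z) = v z" by auto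
  have [measurable]: "u \<in> borel_measurable borel" "v \<in> borel_measurable borel" by simp_all
  show ?thesis
  proof (rule that)
    show "(\<lambda>z. complex_of_real (u z) + \<i> * complex_of_real (v z)) \<in> borel_measurable borel" by measurable
    show "AE z in lborel. g z = complex_of_real (u z) + \<i> * complex_of_real (v z)"
      using ae by eventually_elim (simp add: complex_eq_iff)
  qed
qed

lemma test_function_continuous:
  assumes "test_function \<Omega> \<phi>"
  shows "continuous_on UNIV \<phi>" "continuous_on UNIV (dir_deriv 1 \<phi>)" "continuous_on UNIV (dir_deriv \<i> \<phi>)"
proof -
  have s: "smooth \<phi>" using assms by (simp add: test_function_def)
  have "foldr dir_deriv es \<phi> differentiable (at z)" if "set es \<subseteq> {1, \<i>}" for es z
    using s that unfolding smooth_def by blast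
  from this[of "[]"] this[of "[1]"] this[of "[\<i>]"]
  show "continuous_on UNIV \<phi>" "continuous_on UNIV (dir_deriv 1 \<phi>)" "continuous_on UNIV (dir_deriv \<i> \<phi>)"
    by (simp_all add: continuous_at_imp_continuous_on differentiable_imp_continuous_within)
qed

lemma test_function_supp:
  assumes "test_function \<Omega> \<phi>"
  obtains C where "compact C" "C \<subseteq> \<Omega>" "\<And>z. z \<notin> C \<Longrightarrow> \<phi> z = 0"
    "\<And>z. z \<notin> C \<Longrightarrow> dir_deriv 1 \<phi> z = 0" "\<And>z. z \<notin> C \<Longrightarrow> dir_deriv \<i> \<phi> z = 0"
proof -
  define C where "C = closure {z. \<phi> z \<noteq> 0}"
  have C: "compact C" "C \<subseteq> \<Omega>" using assms by (auto simp: test_function_def C_def)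
  have out: "\<phi> z = 0" if "z \<notin> C" for z using that subsetD[OF closure_subset, of z "{z. \<phi> z \<noteq> 0}"] unfolding C_def by auto
  have d: "dir_deriv e \<phi> z = 0" if z: "z \<notin> C" for e z
  proof -
    have "open (- C)" unfolding C_def by (intro open_Compl closed_closure)
    have "((\<lambda>_. 0) has_derivative (\<lambda>_. 0)) (at z)" by simp
    then have "(\<phi> has_derivative (\<lambda>_. 0)) (at z)"
      by (rule has_derivative_transform_within_open[OF _ \<open>open (- C)\<close>]) (use z out in auto)
    from frechet_derivative_at[OF this] have "frechet_derivative \<phi> (at z) = (\<lambda>_. 0)" by (rule sym)
    then show ?thesis by (simp add: dir_deriv_def)
  qed
  show ?thesis by (rule that[OF C out d d])
qed

lemma set_integral_lebesgue_lborel: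
  fixes h :: "complex \<Rightarrow> complex"
  assumes "h \<in> borel_measurable borel" "S \<in> sets borel"
  shows "(LINT z:S|lebesgue. h z) = (LINT z:S|lborel. h z)"
  unfolding set_lebesgue_integral_def using assms
  by (intro integral_completion) auto

text \<open>Lebesgue measurable derivatives are exchanged for Borel ones once and for all. The last
  clause carries over integrals against continuous multipliers, such as the test function in the
  weak derivative identity.\<close>

lemma L2_loc_representative:
  assumes \<Omega>: "open \<Omega>" and L: "L2_loc \<Omega> u"
  obtains a where "a \<in> borel_measurable borel" "AE z in lborel. z \<in> \<Omega> \<longrightarrow> u z = a z"
    "\<And>C. compact C \<Longrightarrow> C \<subseteq> \<Omega> \<Longrightarrow> set_integrable lborel C (\<lambda>z. (cmod (a z))\<^sup>2)"
    "\<And>\<phi>. continuous_on UNIV \<phi> \<Longrightarrow> (LINT z:\<Omega>|lebesgue. \<phi> z *\<^sub>R u z) = (LINT z:\<Omega>|lborel. \<phi> z *\<^sub>R a z)"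
proof -
  have m: "(\<lambda>z. indicator \<Omega> z *\<^sub>R u z) \<in> borel_measurable lebesgue"
    using L by (simp add: L2_loc_def set_borel_measurable_def)
  obtain a where a [measurable]: "a \<in> borel_measurable borel" and ae: "AE z in lborel. indicator \<Omega> z *\<^sub>R u z = a z"
    using complex_borel_representative[OF m] by blast
  have \<Omega>b [measurable]: "\<Omega> \<in> sets borel" using \<Omega> by simp
  show ?thesis
  proof (rule that[OF a])
    show "AE z in lborel. z \<in> \<Omega> \<longrightarrow> u z = a z" using ae by eventually_elim auto
    fix C assume C: "compact C" "C \<subseteq> \<Omega>"
    have Cb [measurable]: "C \<in> sets borel" using C by (simp add: compact_imp_closed)
    have i1: "integrable lebesgue (\<lambda>z. indicator C z *\<^sub>R (cmod (u z))\<^sup>2)"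
      using L C unfolding L2_loc_def set_integrable_def by blast
    have ae1: "AE z in lebesgue. indicator C z *\<^sub>R (cmod (u z))\<^sup>2 = indicator C z *\<^sub>R (cmod (a z))\<^sup>2"
      using AE_completion[OF ae] by eventually_elim (use C in \<open>auto simp: indicator_def\<close>)
    have m: "(\<lambda>z. indicator C z *\<^sub>R (cmod (a z))\<^sup>2) \<in> borel_measurable lborel" by measurable
    have "integrable lebesgue (\<lambda>z. indicator C z *\<^sub>R (cmod (a z))\<^sup>2)"
      by (rule integrable_cong_AE_imp[OF i1 measurable_completion[OF m] ae1])
    then show "set_integrable lborel C (\<lambda>z. (cmod (a z))\<^sup>2)"
      unfolding set_integrable_def using integrable_completion[OF m] by simp
  next
    fix \<phi> :: "complex \<Rightarrow> real" assume "continuous_on UNIV \<phi>"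
    then have [measurable]: "\<phi> \<in> borel_measurable borel" by (rule borel_measurable_continuous_onI)
    have \<phi>l: "\<phi> \<in> borel_measurable lebesgue" by (rule measurable_completion) simp
    have "(LINT z:\<Omega>|lebesgue. \<phi> z *\<^sub>R u z) = (LINT z|lebesgue. \<phi> z *\<^sub>R (indicator \<Omega> z *\<^sub>R u z))"
      unfolding set_lebesgue_integral_def by (simp add: mult.commute)
    also have "\<dots> = (LINT z|lebesgue. \<phi> z *\<^sub>R (indicator \<Omega> z *\<^sub>R a z))"
    proof (rule integral_cong_AE)
      show "(\<lambda>z. \<phi> z *\<^sub>R (indicator \<Omega> z *\<^sub>R u z)) \<in> borel_measurable lebesgue"
        by (rule borel_measurable_scaleR[OF \<phi>l m])
      show "(\<lambda>z. \<phi> z *\<^sub>R (indicator \<Omega> z *\<^sub>R a z)) \<in> borel_measurable lebesgue"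
        by (rule measurable_completion) simp
      show "AE z in lebesgue. \<phi> z *\<^sub>R (indicator \<Omega> z *\<^sub>R u z) = \<phi> z *\<^sub>R (indicator \<Omega> z *\<^sub>R a z)"
        using AE_completion[OF ae]
      proof eventually_elim
        case (elim z)
        then show ?case by (cases "z \<in> \<Omega>") auto
      qed
    qed
    also have "\<dots> = (LINT z|lborel. \<phi> z *\<^sub>R (indicator \<Omega> z *\<^sub>R a z))"
      by (rule integral_completion) simp
    also have "\<dots> = (LINT z:\<Omega>|lborel. \<phi> z *\<^sub>R a z)"
      unfolding set_lebesgue_integral_def by (simp add: mult.commute)
    finally show "(LINT z:\<Omega>|lebesgue. \<phi> z *\<^sub>R u z) = (LINT z:\<Omega>|lborel. \<phi> z *\<^sub>R a z)" .
  qed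
qed

text \<open>A map that is continuous on an open set is Borel on the plane once it is zero elsewhere;
  with arbitrary outside values it need not be.\<close>

abbreviation ext0 :: "complex set \<Rightarrow> (complex \<Rightarrow> complex) \<Rightarrow> complex \<Rightarrow> complex" where
  "ext0 \<Omega> f \<equiv> \<lambda>z. indicator \<Omega> z *\<^sub>R f z"

lemma ext0_facts:
  assumes "open \<Omega>" "continuous_on \<Omega> f"
  shows "ext0 \<Omega> f \<in> borel_measurable borel" "continuous_on \<Omega> (ext0 \<Omega> f)"
proof -
  show "ext0 \<Omega> f \<in> borel_measurable borel"
    using borel_measurable_continuous_on_indicator[of \<Omega> f] assms by simp
  show "continuous_on \<Omega> (ext0 \<Omega> f)"
    using assms(2) by (rule continuous_on_eq) simp
qed

lemma quasiregular_on_imp_qr: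
  assumes \<Omega>: "open \<Omega>" and K: "K \<ge> 1" and q: "quasiregular_on K \<Omega> f"
  obtains a b where "qr (K + 1 / K) \<Omega> (ext0 \<Omega> f) a b"
proof -
  have c: "continuous_on \<Omega> f" using q by (simp add: quasiregular_on_def)
  obtain fx fy where W: "W12_loc_partials \<Omega> f fx fy"
    and ae: "AE z in lebesgue. z \<in> \<Omega> \<longrightarrow> cmod ((fx z + \<i> * fy z) / 2) \<le> (K - 1) / (K + 1) * cmod ((fx z - \<i> * fy z) / 2)"
    using q unfolding quasiregular_on_def by blast
  have L: "L2_loc \<Omega> fx" "L2_loc \<Omega> fy" "weak_deriv \<Omega> 1 f fx" "weak_deriv \<Omega> \<i> f fy"
    using W by (auto simp: W12_loc_partials_def)
  obtain a where a [measurable]: "a \<in> borel_measurable borel" and aea: "AE z in lborel. z \<in> \<Omega> \<longrightarrow> fx z = a z"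
    and ia: "\<And>C. compact C \<Longrightarrow> C \<subseteq> \<Omega> \<Longrightarrow> set_integrable lborel C (\<lambda>z. (cmod (a z))\<^sup>2)"
    and wa: "\<And>\<phi>. continuous_on UNIV \<phi> \<Longrightarrow> (LINT z:\<Omega>|lebesgue. \<phi> z *\<^sub>R fx z) = (LINT z:\<Omega>|lborel. \<phi> z *\<^sub>R a z)"
    by (rule L2_loc_representative[OF \<Omega> L(1)]) (rule that; assumption)
  obtain b where b [measurable]: "b \<in> borel_measurable borel" and aeb: "AE z in lborel. z \<in> \<Omega> \<longrightarrow> fy z = b z"
    and ib: "\<And>C. compact C \<Longrightarrow> C \<subseteq> \<Omega> \<Longrightarrow> set_integrable lborel C (\<lambda>z. (cmod (b z))\<^sup>2)"
    and wb: "\<And>\<phi>. continuous_on UNIV \<phi> \<Longrightarrow> (LINT z:\<Omega>|lebesgue. \<phi> z *\<^sub>R fy z) = (LINT z:\<Omega>|lborel. \<phi> z *\<^sub>R b z)"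
    by (rule L2_loc_representative[OF \<Omega> L(2)]) (rule that; assumption)
  note e = ext0_facts[OF \<Omega> c]
  have \<Omega>b [measurable]: "\<Omega> \<in> sets borel" using \<Omega> by simp
  have wf: "(LINT z:\<Omega>|lebesgue. \<psi> z *\<^sub>R f z) = (LINT z:\<Omega>|lborel. \<psi> z *\<^sub>R ext0 \<Omega> f z)"
    if "continuous_on UNIV \<psi>" for \<psi> :: "complex \<Rightarrow> real"
  proof -
    have [measurable]: "\<psi> \<in> borel_measurable borel" using that by (rule borel_measurable_continuous_onI)
    note e(1) [measurable]
    have "(LINT z:\<Omega>|lebesgue. \<psi> z *\<^sub>R f z) = (LINT z:\<Omega>|lebesgue. \<psi> z *\<^sub>R ext0 \<Omega> f z)"
      unfolding set_lebesgue_integral_def by (intro Bochner_Integration.integral_cong) (auto simp: indicator_def)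
    also have "\<dots> = (LINT z:\<Omega>|lborel. \<psi> z *\<^sub>R ext0 \<Omega> f z)"
      by (rule set_integral_lebesgue_lborel[OF borel_measurable_scaleR[OF _ e(1)] \<Omega>b]) simp
    finally show ?thesis .
  qed
  have "sob \<Omega> (ext0 \<Omega> f) a b"
    unfolding sob_def
  proof (intro conjI allI impI \<Omega> e a b)
    fix C assume "compact C \<and> C \<subseteq> \<Omega>"
    then show "set_integrable lborel C (\<lambda>z. en (a z) (b z))"
      unfolding en_def using ia ib by (intro set_integral_add) auto
  next
    fix \<phi> assume t: "test_function \<Omega> \<phi>"
    note tc = test_function_continuous[OF t]
    show "(LINT z:\<Omega>|lborel. dir_deriv 1 \<phi> z *\<^sub>R ext0 \<Omega> f z) = - (LINT z:\<Omega>|lborel. \<phi> z *\<^sub>R a z)"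
      unfolding wf[OF tc(2), symmetric] wa[OF tc(1), symmetric] using L(3) t by (simp add: weak_deriv_def)
    show "(LINT z:\<Omega>|lborel. dir_deriv \<i> \<phi> z *\<^sub>R ext0 \<Omega> f z) = - (LINT z:\<Omega>|lborel. \<phi> z *\<^sub>R b z)"
      unfolding wf[OF tc(3), symmetric] wb[OF tc(1), symmetric] using L(4) t by (simp add: weak_deriv_def)
  qed
  moreover have "AE z in lborel. z \<in> \<Omega> \<longrightarrow> en (a z) (b z) \<le> (K + 1 / K) * jac (a z) (b z)"
    using ae[unfolded AE_completion_iff] aea aeb
    by eventually_elim (use qr_algebra[OF K] in auto)
  ultimately show ?thesis using that by (simp add: qr_def)
qed

lemma qr_imp_quasiregular_on:
  assumes \<Omega>: "open \<Omega>" and K: "K \<ge> 1" and c: "continuous_on \<Omega> f" and q: "qr (K + 1 / K) \<Omega> (ext0 \<Omega> f) a b"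
  shows "quasiregular_on K \<Omega> f"
proof -
  have sb: "sob \<Omega> (ext0 \<Omega> f) a b" using q by (simp add: qr_def)
  note sd [measurable] = sobD(3-5)[OF sb]
  have \<Omega>b [measurable]: "\<Omega> \<in> sets borel" using \<Omega> by simp
  have L2: "L2_loc \<Omega> v" if vm: "ext0 \<Omega> v \<in> borel_measurable borel"
    and vi: "\<And>C. compact C \<Longrightarrow> C \<subseteq> \<Omega> \<Longrightarrow> set_integrable lborel C (\<lambda>z. (cmod (v z))\<^sup>2)" for v
    unfolding L2_loc_def set_borel_measurable_def set_integrable_def
  proof (intro conjI allI impI)
    show "ext0 \<Omega> v \<in> borel_measurable lebesgue" by (rule measurable_completion) (use vm in simp)
    fix C assume C: "compact C \<and> C \<subseteq> \<Omega>"
    then have i: "integrable lborel (\<lambda>z. indicator C z *\<^sub>R (cmod (v z))\<^sup>2)"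
      using vi[of C] unfolding set_integrable_def by blast
    show "integrable lebesgue (\<lambda>z. indicator C z *\<^sub>R (cmod (v z))\<^sup>2)"
      using integrable_completion[OF borel_measurable_integrable[OF i]] i by simp
  qed
  have Lf: "L2_loc \<Omega> f"
  proof (rule L2)
    fix C assume C: "compact C" "C \<subseteq> \<Omega>"
    have "continuous_on C (\<lambda>z. (cmod (f z))\<^sup>2)" using continuous_on_subset[OF c C(2)] by (intro continuous_intros)
    then show "set_integrable lborel C (\<lambda>z. (cmod (f z))\<^sup>2)"
      unfolding set_integrable_def by (rule borel_integrable_compact[OF C(1)])
  qed (rule sd(1))
  have dom: "set_integrable lborel C (\<lambda>z. (cmod (v z))\<^sup>2)"
    if "compact C" "C \<subseteq> \<Omega>" "v \<in> borel_measurable borel" "\<And>z. (cmod (v z))\<^sup>2 \<le> en (a z) (b z)" for C v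
  proof (rule set_integrable_dominated[OF sobD(6)[OF sb that(1,2)]])
    show "C \<in> sets borel" using that(1) by (simp add: compact_imp_closed)
    show "(\<lambda>z. (cmod (v z))\<^sup>2) \<in> borel_measurable borel" using that(3) by measurable
  qed (use that in auto)
  have em: "ext0 \<Omega> v \<in> borel_measurable borel" if [measurable]: "v \<in> borel_measurable borel" for v
    by measurable
  have La: "L2_loc \<Omega> a" by (rule L2[OF em[OF sd(2)] dom[OF _ _ sd(2)]]) (simp_all add: en_def)
  have Lb: "L2_loc \<Omega> b" by (rule L2[OF em[OF sd(3)] dom[OF _ _ sd(3)]]) (simp_all add: en_def)
  have tr: "(LINT z:\<Omega>|lebesgue. \<psi> z *\<^sub>R v z) = (LINT z:\<Omega>|lborel. \<psi> z *\<^sub>R v z)"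
    if "continuous_on UNIV \<psi>" "v \<in> borel_measurable borel" for \<psi> :: "complex \<Rightarrow> real" and v :: "complex \<Rightarrow> complex"
  proof (rule set_integral_lebesgue_lborel[OF _ \<Omega>b])
    show "(\<lambda>z. \<psi> z *\<^sub>R v z) \<in> borel_measurable borel"
      by (rule borel_measurable_scaleR[OF borel_measurable_continuous_onI[OF that(1)] that(2)])
  qed
  have ef: "(LINT z:\<Omega>|lebesgue. \<psi> z *\<^sub>R f z) = (LINT z:\<Omega>|lebesgue. \<psi> z *\<^sub>R ext0 \<Omega> f z)" for \<psi> :: "complex \<Rightarrow> real"
    unfolding set_lebesgue_integral_def by (intro Bochner_Integration.integral_cong) (auto simp: indicator_def)
  have "weak_deriv \<Omega> 1 f a"
    unfolding weak_deriv_def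
  proof (intro allI impI)
    fix \<phi> assume t: "test_function \<Omega> \<phi>"
    show "(LINT z:\<Omega>|lebesgue. dir_deriv 1 \<phi> z *\<^sub>R f z) = - (LINT z:\<Omega>|lebesgue. \<phi> z *\<^sub>R a z)"
      unfolding ef tr[OF test_function_continuous(2)[OF t] sd(1)] tr[OF test_function_continuous(1)[OF t] sd(2)]
      using sb t unfolding sob_def by blast
  qed
  moreover have "weak_deriv \<Omega> \<i> f b"
    unfolding weak_deriv_def
  proof (intro allI impI)
    fix \<phi> assume t: "test_function \<Omega> \<phi>"
    show "(LINT z:\<Omega>|lebesgue. dir_deriv \<i> \<phi> z *\<^sub>R f z) = - (LINT z:\<Omega>|lebesgue. \<phi> z *\<^sub>R b z)"
      unfolding ef tr[OF test_function_continuous(3)[OF t] sd(1)] tr[OF test_function_continuous(1)[OF t] sd(3)]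
      using sb t unfolding sob_def by blast
  qed
  moreover have "AE z in lebesgue. z \<in> \<Omega> \<longrightarrow> cmod ((a z + \<i> * b z) / 2) \<le> (K - 1) / (K + 1) * cmod ((a z - \<i> * b z) / 2)"
    unfolding qr_algebra[OF K] by (rule AE_completion) (use q in \<open>simp add: qr_def\<close>)
  ultimately show ?thesis
    unfolding quasiregular_on_def W12_loc_partials_def using c Lf La Lb by blast
qed

section \<open>Weak compactness in the space of square-integrable functions\<close>

text \<open>A dyadic substitute for the convex hull. The parallelogram law involves only midpoints,
  and every linear identity or convex inequality valid on the set extends to the hull by a two-case
  induction, without sums of weights.\<close>

inductive_set mid :: "('a \<Rightarrow> 'b::real_vector) set \<Rightarrow> ('a \<Rightarrow> 'b) set" for S where
  base: "x \<in> S \<Longrightarrow> x \<in> mid S"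
| half: "x \<in> mid S \<Longrightarrow> y \<in> mid S \<Longrightarrow> (\<lambda>z. (1 / 2) *\<^sub>R (x z + y z)) \<in> mid S"

lemma mid_mono: "S \<subseteq> T \<Longrightarrow> mid S \<subseteq> mid T"
proof
  fix x assume "S \<subseteq> T" "x \<in> mid S"
  from this(2) show "x \<in> mid T"
    by induction (use \<open>S \<subseteq> T\<close> in \<open>auto intro: mid.intros\<close>)
qed

lemma parallelogram_half:
  fixes x y :: "'b::real_inner"
  shows "(norm (x - y))\<^sup>2 + 4 * (norm ((1 / 2) *\<^sub>R (x + y)))\<^sup>2 = 2 * (norm x)\<^sup>2 + 2 * (norm y)\<^sup>2"
  unfolding power2_norm_eq_inner by (simp add: inner_diff inner_add inner_commute algebra_simps)

lemma norm_half_le: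
  fixes x y :: "'b::real_inner"
  shows "(norm ((1 / 2) *\<^sub>R (x + y)))\<^sup>2 \<le> (1 / 2) * (norm x)\<^sup>2 + (1 / 2) * (norm y)\<^sup>2"
  using parallelogram_half[of x y] zero_le_power2[of "norm (x - y)"] by linarith

text \<open>The factor 2^j is affordable because the squared increments integrate to at most 4^(-j).
  It forces the increments to decay geometrically at almost every point, so the sequence converges
  there; Fatou's lemma then gives the rate.\<close>

lemma Riesz_Fischer_L2:
  fixes k :: "nat \<Rightarrow> 'a \<Rightarrow> 'b::euclidean_space"
  assumes [measurable]: "\<And>j. k j \<in> borel_measurable M"
    and C: "\<And>i j. i \<ge> j \<Longrightarrow> (\<integral>\<^sup>+z. ennreal ((norm (k i z - k j z))\<^sup>2) \<partial>M) \<le> ennreal ((1 / 4) ^ j)"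
  obtains l where "l \<in> borel_measurable M" "\<And>j. (\<integral>\<^sup>+z. ennreal ((norm (l z - k j z))\<^sup>2) \<partial>M) \<le> ennreal ((1 / 4) ^ j)"
proof -
  define l where "l z = lim (\<lambda>j. k j z)" for z
  have [measurable]: "l \<in> borel_measurable M" unfolding l_def by measurable
  define D where "D j z = ennreal (2 ^ j * (norm (k (Suc j) z - k j z))\<^sup>2)" for j z
  have [measurable]: "D j \<in> borel_measurable M" for j unfolding D_def by measurable
  have "(\<integral>\<^sup>+z. (\<Sum>j. D j z) \<partial>M) = (\<Sum>j. \<integral>\<^sup>+z. D j z \<partial>M)" by (rule nn_integral_suminf) simp
  also have "\<dots> \<le> (\<Sum>j. ennreal ((1 / 2) ^ j))"
  proof (intro suminf_le)
    fix j
    have "(\<integral>\<^sup>+z. D j z \<partial>M) = ennreal (2 ^ j) * (\<integral>\<^sup>+z. ennreal ((norm (k (Suc j) z - k j z))\<^sup>2) \<partial>M)"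
      unfolding D_def by (subst nn_integral_cmult[symmetric]) (auto simp: ennreal_mult)
    also have "\<dots> \<le> ennreal (2 ^ j) * ennreal ((1 / 4) ^ j)" by (intro mult_left_mono C) auto
    also have "\<dots> = ennreal ((1 / 2) ^ j)"
      by (simp add: ennreal_mult[symmetric] power_mult_distrib[symmetric])
    finally show "(\<integral>\<^sup>+z. D j z \<partial>M) \<le> ennreal ((1 / 2) ^ j)" .
  qed auto
  also have "\<dots> = ennreal (\<Sum>j. (1 / 2) ^ j)"
    by (rule suminf_ennreal2) (simp, rule summable_geometric, simp)
  also have "\<dots> < \<infinity>" by simp
  finally have "AE z in M. (\<Sum>j. D j z) \<noteq> \<infinity>" by (intro nn_integral_PInf_AE) auto
  then have conv: "AE z in M. (\<lambda>j. k j z) \<longlonglongrightarrow> l z"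
  proof eventually_elim
    case (elim z)
    define G where "G = enn2real (\<Sum>j. D j z)"
    have G: "(\<Sum>j. D j z) = ennreal G" using elim by (simp add: G_def less_top)
    have le: "norm (k (Suc j) z - k j z) \<le> sqrt G * (sqrt (1 / 2)) ^ j" for j
    proof -
      have "D j z \<le> (\<Sum>j. D j z)" using sum_le_suminf[of "\<lambda>j. D j z" "{j}"] by simp
      then have "ennreal (2 ^ j * (norm (k (Suc j) z - k j z))\<^sup>2) \<le> ennreal G"
        unfolding G by (simp only: D_def)
      moreover have "0 \<le> G" by (simp add: G_def)
      ultimately have "2 ^ j * (norm (k (Suc j) z - k j z))\<^sup>2 \<le> G" by (simp only: ennreal_le_iff)
      then have "(norm (k (Suc j) z - k j z))\<^sup>2 \<le> G * (1 / 2) ^ j" by (simp add: field_simps)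
      then have "sqrt ((norm (k (Suc j) z - k j z))\<^sup>2) \<le> sqrt (G * (1 / 2) ^ j)" by (rule real_sqrt_le_mono)
      then show ?thesis by (simp add: real_sqrt_mult real_sqrt_power)
    qed
    have sm: "summable (\<lambda>j. sqrt G * (sqrt (1 / 2)) ^ j)"
      by (intro summable_mult summable_geometric) (simp add: real_sqrt_divide)
    have "summable (\<lambda>j. k (Suc j) z - k j z)"
      by (rule summable_comparison_test'[where N = 0, OF sm]) (rule le)
    then have "convergent (\<lambda>n. \<Sum>j<n. k (Suc j) z - k j z)" by (simp add: summable_iff_convergent)
    then have "convergent (\<lambda>n. k n z - k 0 z)" using sum_lessThan_telescope[of "\<lambda>j. k j z"] by simp
    from convergent_add[OF this convergent_const[of "k 0 z"]] have "convergent (\<lambda>n. k n z)" by simp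
    then show ?case unfolding l_def by (simp add: convergent_LIMSEQ_iff)
  qed
  show ?thesis
  proof (rule that)
    fix j
    have "(\<integral>\<^sup>+z. ennreal ((norm (l z - k j z))\<^sup>2) \<partial>M) = (\<integral>\<^sup>+z. liminf (\<lambda>i. ennreal ((norm (k i z - k j z))\<^sup>2)) \<partial>M)"
    proof (rule nn_integral_cong_AE)
      show "AE z in M. ennreal ((norm (l z - k j z))\<^sup>2) = liminf (\<lambda>i. ennreal ((norm (k i z - k j z))\<^sup>2))"
        using conv
      proof eventually_elim
        case (elim z)
        have "(\<lambda>i. ennreal ((norm (k i z - k j z))\<^sup>2)) \<longlonglongrightarrow> ennreal ((norm (l z - k j z))\<^sup>2)"
          by (intro tendsto_intros tendsto_ennrealI elim)
        from lim_imp_Liminf[OF sequentially_bot this] show ?case by (rule sym)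
      qed
    qed
    also have "\<dots> \<le> liminf (\<lambda>i. \<integral>\<^sup>+z. ennreal ((norm (k i z - k j z))\<^sup>2) \<partial>M)"
      by (rule nn_integral_liminf) measurable
    also have "\<dots> \<le> ennreal ((1 / 4) ^ j)"
      by (rule Liminf_le) (use C in \<open>auto simp: eventually_sequentially\<close>)
    finally show "(\<integral>\<^sup>+z. ennreal ((norm (l z - k j z))\<^sup>2) \<partial>M) \<le> ennreal ((1 / 4) ^ j)" .
  qed simp
qed

text \<open>The least squared norm over the hull of a tail increases with the tail and stays
  bounded, hence converges. Two almost minimal elements of late hulls have a midpoint in a late
  hull, whose norm cannot be much smaller, so the parallelogram law forces them to be close.\<close>

lemma L2_midpoint_limit:
  fixes h :: "nat \<Rightarrow> 'a \<Rightarrow> 'b::euclidean_space"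
  assumes hm: "\<And>n. h n \<in> borel_measurable M" and B: "\<And>n. (\<integral>\<^sup>+z. ennreal ((norm (h n z))\<^sup>2) \<partial>M) \<le> ennreal B"
  obtains k l where "\<And>j. k j \<in> mid {h m |m. m \<ge> j}" "l \<in> borel_measurable M"
    "\<And>j. (\<integral>\<^sup>+z. ennreal ((norm (l z - k j z))\<^sup>2) \<partial>M) \<le> ennreal ((1 / 4) ^ j)"
proof -
  define S where "S n = {h m |m. m \<ge> n}" for n :: nat
  define q where "q x = (LINT z|M. (norm (x z))\<^sup>2)" for x :: "'a \<Rightarrow> 'b"
  have B0: "(\<integral>\<^sup>+z. ennreal ((norm (h n z))\<^sup>2) \<partial>M) \<le> ennreal (max B 0)" for n
    using B[of n] by (rule order_trans) (intro ennreal_leI, simp)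
  have m: "x \<in> borel_measurable M \<and> integrable M (\<lambda>z. (norm (x z))\<^sup>2) \<and> q x \<le> max B 0" if "x \<in> mid (S n)" for x n
    using that
  proof induction
    case (base x)
    then obtain m where x: "x = h m" by (auto simp: S_def)
    have "integrable M (\<lambda>z. (norm (h m z))\<^sup>2)" "(LINT z|M. (norm (h m z))\<^sup>2) \<le> max B 0"
      by (rule nn_integral_le_imp[OF _ _ B0]; use hm in simp)+
    then show ?case unfolding x q_def using hm by simp
  next
    case (half x y)
    then have [measurable]: "x \<in> borel_measurable M" "y \<in> borel_measurable M" by auto
    have i: "integrable M (\<lambda>z. (1 / 2) * (norm (x z))\<^sup>2 + (1 / 2) * (norm (y z))\<^sup>2)" using half by auto
    have i2: "integrable M (\<lambda>z. (norm ((1 / 2) *\<^sub>R (x z + y z)))\<^sup>2)"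
      by (rule Bochner_Integration.integrable_bound[OF i]) (use norm_half_le in auto)
    have "q (\<lambda>z. (1 / 2) *\<^sub>R (x z + y z)) \<le> (LINT z|M. (1 / 2) * (norm (x z))\<^sup>2 + (1 / 2) * (norm (y z))\<^sup>2)"
      unfolding q_def by (intro integral_mono i i2 norm_half_le)
    also have "\<dots> = (1 / 2) * q x + (1 / 2) * q y" unfolding q_def using half by (subst Bochner_Integration.integral_add) auto
    also have "\<dots> \<le> max B 0" using half by linarith
    finally show ?case using i2 by simp
  qed
  have q0: "q x \<ge> 0" for x unfolding q_def by simp
  have ne: "mid (S n) \<noteq> {}" for n using mid.base[of "h n" "S n"] by (auto simp: S_def)
  have bb: "bdd_below (q ` mid (S n))" for n using q0 by (intro bdd_belowI2[of _ 0]) auto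
  define d where "d n = (INF x\<in>mid (S n). q x)" for n
  have dle: "d n \<le> q x" if "x \<in> mid (S n)" for n x unfolding d_def by (rule cINF_lower[OF bb that])
  have dmono: "d n \<le> d n'" if "n \<le> n'" for n n'
  proof -
    have "S n' \<subseteq> S n" using that unfolding S_def by (auto intro: order_trans)
    then show ?thesis unfolding d_def by (intro cINF_superset_mono ne bb mid_mono) auto
  qed
  have dB: "d n \<le> max B 0" for n using ne[of n] dle m by (meson ex_in_conv order_trans)
  have "incseq d" using dmono by (simp add: incseq_def)
  moreover have "bdd_above (range d)" using dB by (intro bdd_aboveI2)
  ultimately have lim: "d \<longlonglongrightarrow> (SUP n. d n)" by (intro LIMSEQ_incseq_SUP)
  define D where "D = (SUP n. d n)"
  have dD: "d n \<le> D" for n unfolding D_def by (rule cSUP_upper[OF _ \<open>bdd_above (range d)\<close>]) simp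
  \<comment> \<open>The parallelogram law costs 2 (D + \<epsilon>) + 2 (D + \<epsilon>) - 4 (D -
    \<epsilon>) = 8 \<epsilon>, hence the division by 8.\<close>
  define \<epsilon> where "\<epsilon> j = (1 / 4 :: real) ^ j / 8" for j :: nat
  have \<epsilon>: "\<epsilon> j > 0" for j by (simp add: \<epsilon>_def)
  have \<epsilon>mono: "\<epsilon> i \<le> \<epsilon> j" if "j \<le> i" for i j using that by (simp add: \<epsilon>_def power_decreasing)
  have "\<exists>n\<ge>j. D - \<epsilon> j < d n" for j
  proof -
    have "\<forall>\<^sub>F n in sequentially. D - \<epsilon> j < d n"
      using order_tendstoD(1)[OF lim, of "D - \<epsilon> j"] \<epsilon>[of j] by (simp add: D_def)
    then show ?thesis unfolding eventually_sequentially by (metis nle_le)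
  qed
  then obtain N where N: "\<And>j. N j \<ge> j" "\<And>j. D - \<epsilon> j < d (N j)" by metis
  have "\<exists>x\<in>mid (S (N j)). q x < d (N j) + \<epsilon> j" for j
    using cInf_lessD[of "q ` mid (S (N j))" "d (N j) + \<epsilon> j"] ne[of "N j"] \<epsilon>[of j] by (auto simp: d_def)
  then obtain k where k: "\<And>j. k j \<in> mid (S (N j))" "\<And>j. q (k j) < d (N j) + \<epsilon> j" by metis
  have km [measurable]: "k j \<in> borel_measurable M" and ki: "integrable M (\<lambda>z. (norm (k j z))\<^sup>2)" for j
    using m[OF k(1)] by auto
  have "(\<integral>\<^sup>+z. ennreal ((norm (k i z - k j z))\<^sup>2) \<partial>M) \<le> ennreal ((1 / 4) ^ j)" if ij: "i \<ge> j" for i j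
  proof -
    \<comment> \<open>\<open>N\<close> need not be monotone. Both elements lie in the hull of the
      longer tail, whose infimum already exceeds D - \<epsilon>.\<close>
    define n where "n = min (N i) (N j)"
    have "mid (S (N i)) \<subseteq> mid (S n)" "mid (S (N j)) \<subseteq> mid (S n)"
      by (rule mid_mono; auto simp: S_def n_def)+
    then have h: "(\<lambda>z. (1 / 2) *\<^sub>R (k i z + k j z)) \<in> mid (S n)" using k(1) by (intro mid.half) auto
    have dn: "D - \<epsilon> j < d n" using N(2)[of i] N(2)[of j] \<epsilon>mono[OF ij] by (auto simp: n_def min_def)
    have hi: "integrable M (\<lambda>z. (norm ((1 / 2) *\<^sub>R (k i z + k j z)))\<^sup>2)" using m[OF h] by simp
    have eq: "(norm (k i z - k j z))\<^sup>2 = 2 * (norm (k i z))\<^sup>2 + 2 * (norm (k j z))\<^sup>2 - 4 * (norm ((1 / 2) *\<^sub>R (k i z + k j z)))\<^sup>2" for z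
      using parallelogram_half[of "k i z" "k j z"] by linarith
    have i: "integrable M (\<lambda>z. (norm (k i z - k j z))\<^sup>2)" unfolding eq using ki hi by (intro Bochner_Integration.integrable_diff Bochner_Integration.integrable_add integrable_mult_right)
    have "(LINT z|M. (norm (k i z - k j z))\<^sup>2) = 2 * q (k i) + 2 * q (k j) - 4 * q (\<lambda>z. (1 / 2) *\<^sub>R (k i z + k j z))"
      unfolding eq q_def using ki hi by (subst Bochner_Integration.integral_diff) (auto simp del: norm_scaleR scaleR_half_double)
    also have "\<dots> \<le> 2 * (D + \<epsilon> j) + 2 * (D + \<epsilon> j) - 4 * (D - \<epsilon> j)"
    proof -
      have "2 * u + 2 * v - 4 * w \<le> 2 * (D + \<epsilon> j) + 2 * (D + \<epsilon> j) - 4 * (D - \<epsilon> j)"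
        if "u < D + \<epsilon> j" "v < D + \<epsilon> j" "D - \<epsilon> j < w" for u v w
        using that by argo
      moreover have "q (k i) < D + \<epsilon> j" "q (k j) < D + \<epsilon> j"
        using k(2)[of i] k(2)[of j] dD[of "N i"] dD[of "N j"] \<epsilon>mono[OF ij] by linarith+
      moreover have "D - \<epsilon> j < q (\<lambda>z. (1 / 2) *\<^sub>R (k i z + k j z))" using dn dle[OF h] by (rule less_le_trans)
      ultimately show ?thesis by blast
    qed
    also have "\<dots> = (1 / 4) ^ j" by (simp add: \<epsilon>_def)
    finally have "(LINT z|M. (norm (k i z - k j z))\<^sup>2) \<le> (1 / 4) ^ j" .
    then show ?thesis using i by (subst nn_integral_eq_integral) (auto intro: ennreal_leI)
  qed
  then obtain l where l: "l \<in> borel_measurable M" "\<And>j. (\<integral>\<^sup>+z. ennreal ((norm (l z - k j z))\<^sup>2) \<partial>M) \<le> ennreal ((1 / 4) ^ j)"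
    using Riesz_Fischer_L2[of k M] km by blast
  have "k j \<in> mid {h m |m. m \<ge> j}" for j
  proof -
    have "mid (S (N j)) \<subseteq> mid {h m |m. m \<ge> j}" using N(1)[of j] by (intro mid_mono) (auto simp: S_def)
    then show ?thesis using k(1) by blast
  qed
  with l that show ?thesis by blast
qed

section \<open>Limits of quasiregular maps\<close>

lemma norm_eq_en: "(norm p)\<^sup>2 = en (fst p) (snd p)" for p :: "complex \<times> complex"
  by (simp add: norm_prod_def en_def)

text \<open>The gradient is treated as a single vector-valued function whose squared norm is the
  energy, so that one sequence of midpoints works for both partial derivatives.\<close>

definition L2loc :: "complex set \<Rightarrow> (complex \<Rightarrow> complex \<times> complex) \<Rightarrow> bool" where
  "L2loc \<Omega> x \<longleftrightarrow> x \<in> borel_measurable borel \<and>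
     (\<forall>C. compact C \<and> C \<subseteq> \<Omega> \<longrightarrow> set_integrable lborel C (\<lambda>z. (norm (x z))\<^sup>2))"

lemma compact_sets_borel: "compact (C :: complex set) \<Longrightarrow> C \<in> sets borel"
  by (simp add: compact_imp_closed)

lemma set_integrable_const_compact: "compact C \<Longrightarrow> set_integrable lborel (C :: complex set) (\<lambda>_. c :: real)"
  by (rule set_integrable_continuous) auto

lemma L2locD:
  assumes "L2loc \<Omega> x" "compact C" "C \<subseteq> \<Omega>"
  shows "set_integrable lborel C (\<lambda>z. (norm (x z))\<^sup>2)" "set_integrable lborel C (\<lambda>z. norm (x z))"
proof -
  show i: "set_integrable lborel C (\<lambda>z. (norm (x z))\<^sup>2)" using assms by (simp add: L2loc_def)
  have [measurable]: "x \<in> borel_measurable borel" using assms by (simp add: L2loc_def)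
  have i': "set_integrable lborel C (\<lambda>z. 1 + (norm (x z))\<^sup>2)"
    by (rule set_integral_add[OF set_integrable_const_compact[OF assms(2)] i])
  show "set_integrable lborel C (\<lambda>z. norm (x z))"
  proof (rule set_integrable_dominated[OF i' compact_sets_borel[OF assms(2)]])
    fix z
    have "norm (x z) \<le> 2 * 1 * norm (x z)" by simp
    also have "\<dots> \<le> 1 + (norm (x z))\<^sup>2" using sum_squares_bound[of 1 "norm (x z)"] by simp
    finally show "norm (norm (x z)) \<le> 1 + (norm (x z))\<^sup>2" by simp
  qed measurable
qed

lemma L2loc_half:
  assumes "L2loc \<Omega> x" "L2loc \<Omega> y"
  shows "L2loc \<Omega> (\<lambda>z. (1 / 2) *\<^sub>R (x z + y z))"
  unfolding L2loc_def
proof (intro conjI allI impI)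
  have [measurable]: "x \<in> borel_measurable borel" "y \<in> borel_measurable borel" using assms by (auto simp: L2loc_def)
  show m: "(\<lambda>z. (1 / 2) *\<^sub>R (x z + y z)) \<in> borel_measurable borel" by measurable
  fix C assume C: "compact C \<and> C \<subseteq> \<Omega>"
  have i: "set_integrable lborel C (\<lambda>z. (1 / 2) * (norm (x z))\<^sup>2 + (1 / 2) * (norm (y z))\<^sup>2)"
    using L2locD(1)[OF assms(1)] L2locD(1)[OF assms(2)] C by (intro set_integral_add) auto
  show "set_integrable lborel C (\<lambda>z. (norm ((1 / 2) *\<^sub>R (x z + y z)))\<^sup>2)"
  proof (rule set_integrable_dominated[OF i])
    show "C \<in> sets borel" using C compact_sets_borel by blast
    show "(\<lambda>z. (norm ((1 / 2) *\<^sub>R (x z + y z)))\<^sup>2) \<in> borel_measurable borel" using m by measurable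
    fix z show "norm ((norm ((1 / 2) *\<^sub>R (x z + y z)))\<^sup>2) \<le> (1 / 2) * (norm (x z))\<^sup>2 + (1 / 2) * (norm (y z))\<^sup>2"
      using norm_half_le[of "x z" "y z"] by (simp only: real_norm_def abs_power2)
  qed
qed

lemma L2loc_mid: "x \<in> mid S \<Longrightarrow> (\<And>y. y \<in> S \<Longrightarrow> L2loc \<Omega> y) \<Longrightarrow> L2loc \<Omega> x"
  by (induction rule: mid.induct) (auto intro: L2loc_half)

text \<open>Local bounds become one global bound for the measure with density w, the sum of the
  indicators of an exhaustion weighted by c_j = 2^(-j) / (1 + |B_j|). This replaces a diagonal
  argument. On a compact subset of the N-th exhausting set the density is at least c_N, so the rate
  of convergence survives there with the constant 1 / c_N.\<close>

lemma local_weak_limit: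
  assumes \<Omega>: "open \<Omega>" and h: "\<And>n. L2loc \<Omega> (h n)"
    and EB: "\<And>C. compact C \<Longrightarrow> C \<subseteq> \<Omega> \<Longrightarrow> \<exists>B. \<forall>n. (LINT z:C|lborel. (norm (h n z))\<^sup>2) \<le> B"
  obtains k l where "\<And>j. k j \<in> mid {h m |m. m \<ge> j}" "L2loc \<Omega> l"
    "\<And>C. compact C \<Longrightarrow> C \<subseteq> \<Omega> \<Longrightarrow> \<exists>c. c \<ge> 0 \<and> (\<forall>j. set_integrable lborel C (\<lambda>z. (norm (l z - k j z))\<^sup>2) \<and>
       (LINT z:C|lborel. (norm (l z - k j z))\<^sup>2) \<le> c * (1 / 4) ^ j)"
proof -
  obtain K :: "nat \<Rightarrow> complex set" where K: "\<And>n. compact (K n)" "\<And>n. K n \<subseteq> \<Omega>"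
    and KC: "\<And>C. compact C \<Longrightarrow> C \<subseteq> \<Omega> \<Longrightarrow> \<exists>N. \<forall>n\<ge>N. C \<subseteq> K n"
  proof (rule open_Union_compact_subsets[OF \<Omega>])
    fix C :: "nat \<Rightarrow> complex set"
    assume C: "\<And>n. compact (C n)" "\<And>n. C n \<subseteq> \<Omega>" "\<And>K. compact K \<Longrightarrow> K \<subseteq> \<Omega> \<Longrightarrow> \<exists>N. \<forall>n\<ge>N. K \<subseteq> C n"
    show thesis by (rule that[of C]) (fact C)+
  qed
  have hm [measurable]: "h n \<in> borel_measurable borel" for n using h by (simp add: L2loc_def)
  have Km [measurable]: "K n \<in> sets borel" for n by (rule compact_sets_borel[OF K(1)])
  obtain B where B: "\<And>j n. (LINT z:K j|lborel. (norm (h n z))\<^sup>2) \<le> B j"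
    using EB[OF K] by metis
  define c where "c j = (1 / 2) ^ j / (1 + \<bar>B j\<bar>)" for j
  have c: "c j > 0" for j by (simp add: c_def add_pos_nonneg)
  define w where "w z = (\<Sum>j. ennreal (c j) * indicator (K j) z)" for z
  have [measurable]: "w \<in> borel_measurable borel" unfolding w_def by measurable
  define M where "M = density lborel w"
  have dens: "(\<integral>\<^sup>+z. X z \<partial>M) = (\<integral>\<^sup>+z. w z * X z \<partial>lborel)" if "X \<in> borel_measurable borel" for X
    unfolding M_def using that by (subst nn_integral_density) auto
  have "(\<integral>\<^sup>+z. ennreal ((norm (h n z))\<^sup>2) \<partial>M) \<le> ennreal (\<Sum>j. (1 / 2) ^ j)" for n
  proof -
    have "(\<integral>\<^sup>+z. ennreal ((norm (h n z))\<^sup>2) \<partial>M) = (\<integral>\<^sup>+z. (\<Sum>j. ennreal (c j) * indicator (K j) z * ennreal ((norm (h n z))\<^sup>2)) \<partial>lborel)"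
      by (subst dens) (auto simp: w_def)
    also have "\<dots> = (\<Sum>j. \<integral>\<^sup>+z. ennreal (c j) * indicator (K j) z * ennreal ((norm (h n z))\<^sup>2) \<partial>lborel)"
      by (rule nn_integral_suminf) measurable
    also have "\<dots> \<le> (\<Sum>j. ennreal ((1 / 2) ^ j))"
    proof (intro suminf_le)
      fix j
      have i: "set_integrable lborel (K j) (\<lambda>z. (norm (h n z))\<^sup>2)" by (rule L2locD(1)[OF h K])
      have "(\<integral>\<^sup>+z. ennreal (c j) * indicator (K j) z * ennreal ((norm (h n z))\<^sup>2) \<partial>lborel)
          = (\<integral>\<^sup>+z. ennreal (c j * (indicator (K j) z *\<^sub>R (norm (h n z))\<^sup>2)) \<partial>lborel)"
        using c[of j] by (intro nn_integral_cong) (auto simp: indicator_def ennreal_mult[symmetric])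
      also have "\<dots> = ennreal (LINT z|lborel. c j * (indicator (K j) z *\<^sub>R (norm (h n z))\<^sup>2))"
        using i c[of j] unfolding set_integrable_def by (intro nn_integral_eq_integral integrable_mult_right) auto
      also have "(LINT z|lborel. c j * (indicator (K j) z *\<^sub>R (norm (h n z))\<^sup>2)) = c j * (LINT z:K j|lborel. (norm (h n z))\<^sup>2)"
        unfolding set_lebesgue_integral_def by (rule integral_mult_right_zero)
      also have "\<dots> \<le> c j * (1 + \<bar>B j\<bar>)" using B[of j n] c[of j] by (intro mult_left_mono) auto
      also have "\<dots> = (1 / 2) ^ j" by (simp add: c_def)
      finally show "(\<integral>\<^sup>+z. ennreal (c j) * indicator (K j) z * ennreal ((norm (h n z))\<^sup>2) \<partial>lborel) \<le> ennreal ((1 / 2) ^ j)"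
        by (simp add: ennreal_leI)
    qed auto
    also have "\<dots> = ennreal (\<Sum>j. (1 / 2) ^ j)"
      by (rule suminf_ennreal2) (simp, rule summable_geometric, simp)
    finally show ?thesis .
  qed
  then obtain k l where k: "\<And>j. k j \<in> mid {h m |m. m \<ge> j}" and lm: "l \<in> borel_measurable M"
    and lk: "\<And>j. (\<integral>\<^sup>+z. ennreal ((norm (l z - k j z))\<^sup>2) \<partial>M) \<le> ennreal ((1 / 4) ^ j)"
    using L2_midpoint_limit[of h M "\<Sum>j. (1 / 2) ^ j"] by (auto simp: M_def)
  have lm' [measurable]: "l \<in> borel_measurable borel" using lm by (simp add: M_def)
  have kL: "L2loc \<Omega> (k j)" for j by (rule L2loc_mid[OF k]) (use h in auto)
  have km [measurable]: "k j \<in> borel_measurable borel" for j using kL by (simp add: L2loc_def)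
  have bound: "\<exists>c. c \<ge> 0 \<and> (\<forall>j. set_integrable lborel C (\<lambda>z. (norm (l z - k j z))\<^sup>2) \<and>
       (LINT z:C|lborel. (norm (l z - k j z))\<^sup>2) \<le> c * (1 / 4) ^ j)" if C: "compact C" "C \<subseteq> \<Omega>" for C
  proof -
    obtain N where N: "C \<subseteq> K N" using KC[OF C] by blast
    have [measurable]: "C \<in> sets borel" by (rule compact_sets_borel[OF C(1)])
    have w: "ennreal (c N) * indicator C z \<le> w z" for z
    proof -
      have "ennreal (c N) * indicator C z \<le> ennreal (c N) * indicator (K N) z"
        using N by (intro mult_left_mono) (auto simp: indicator_def)
      also have "\<dots> \<le> w z"
      proof -
        have "F N \<le> suminf F" for F :: "nat \<Rightarrow> ennreal" using sum_le_suminf[of F "{N}"] by simp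
        then show ?thesis unfolding w_def .
      qed
      finally show ?thesis .
    qed
    have *: "set_integrable lborel C (\<lambda>z. (norm (l z - k j z))\<^sup>2) \<and> (LINT z:C|lborel. (norm (l z - k j z))\<^sup>2) \<le> (1 / c N) * (1 / 4) ^ j" for j
    proof -
      have "(\<integral>\<^sup>+z. ennreal (indicator C z *\<^sub>R (norm (l z - k j z))\<^sup>2) \<partial>lborel)
          = (\<integral>\<^sup>+z. ennreal (1 / c N) * (ennreal (c N) * indicator C z * ennreal ((norm (l z - k j z))\<^sup>2)) \<partial>lborel)"
        using c[of N] by (intro nn_integral_cong) (auto simp: indicator_def ennreal_mult[symmetric])
      also have "\<dots> = ennreal (1 / c N) * (\<integral>\<^sup>+z. ennreal (c N) * indicator C z * ennreal ((norm (l z - k j z))\<^sup>2) \<partial>lborel)"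
        by (rule nn_integral_cmult) measurable
      also have "\<dots> \<le> ennreal (1 / c N) * (\<integral>\<^sup>+z. w z * ennreal ((norm (l z - k j z))\<^sup>2) \<partial>lborel)"
        by (intro mult_left_mono nn_integral_mono mult_right_mono w) auto
      also have "\<dots> \<le> ennreal (1 / c N) * ennreal ((1 / 4) ^ j)"
        using lk[of j] by (subst (asm) dens) (auto intro: mult_left_mono)
      also have "\<dots> = ennreal ((1 / c N) * (1 / 4) ^ j)"
        using c[of N] by (intro ennreal_mult[symmetric]) auto
      finally have nn: "(\<integral>\<^sup>+z. ennreal (indicator C z *\<^sub>R (norm (l z - k j z))\<^sup>2) \<partial>lborel) \<le> ennreal ((1 / c N) * (1 / 4) ^ j)" .
      have m: "(\<lambda>z. indicator C z *\<^sub>R (norm (l z - k j z))\<^sup>2) \<in> borel_measurable lborel" by measurable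
      have d: "0 \<le> (1 / c N) * (1 / 4) ^ j" using c[of N] by simp
      show ?thesis unfolding set_integrable_def set_lebesgue_integral_def
        using nn_integral_le_imp[OF m _ nn d] by simp
    qed
    show ?thesis using * c[of N] by (intro exI[of _ "1 / c N"]) auto
  qed
  have "L2loc \<Omega> l"
    unfolding L2loc_def
  proof (intro conjI allI impI lm')
    fix C assume C: "compact C \<and> C \<subseteq> \<Omega>"
    then have i1: "set_integrable lborel C (\<lambda>z. (norm (l z - k 0 z))\<^sup>2)" using bound[of C] by blast
    have i2: "set_integrable lborel C (\<lambda>z. (norm (k 0 z))\<^sup>2)" using L2locD(1)[OF kL] C by blast
    have i: "set_integrable lborel C (\<lambda>z. 2 * (norm (l z - k 0 z))\<^sup>2 + 2 * (norm (k 0 z))\<^sup>2)"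
      using i1 i2 by (intro set_integral_add) auto
    show "set_integrable lborel C (\<lambda>z. (norm (l z))\<^sup>2)"
    proof (rule set_integrable_dominated[OF i])
      show "C \<in> sets borel" using C compact_sets_borel by blast
      fix z
      have "(norm (l z))\<^sup>2 \<le> (norm (l z - k 0 z) + norm (k 0 z))\<^sup>2"
        using norm_triangle_ineq[of "l z - k 0 z" "k 0 z"] by (intro power_mono) auto
      also have "\<dots> \<le> 2 * (norm (l z - k 0 z))\<^sup>2 + 2 * (norm (k 0 z))\<^sup>2"
        using sum_squares_bound[of "norm (l z - k 0 z)" "norm (k 0 z)"] by (simp add: power2_sum)
      finally show "norm ((norm (l z))\<^sup>2) \<le> 2 * (norm (l z - k 0 z))\<^sup>2 + 2 * (norm (k 0 z))\<^sup>2" by simp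
    qed measurable
  qed
  with k bound that show ?thesis by blast
qed

text \<open>Both sides of the closing argument, the weak derivative identity and the integrated
  Jacobian, are functionals of this shape: compatible with midpoints and continuous for local L^2
  convergence when u and v are bounded.\<close>

definition lin :: "complex set \<Rightarrow> (complex \<Rightarrow> complex) \<Rightarrow> (complex \<Rightarrow> complex) \<Rightarrow> (complex \<Rightarrow> complex \<times> complex) \<Rightarrow> complex" where
  "lin C u v x = (LINT z:C|lborel. u z * fst (x z) + v z * snd (x z))"

lemma lin_integrable:
  assumes x: "L2loc \<Omega> x" and C: "compact C" "C \<subseteq> \<Omega>" and m: "u \<in> borel_measurable borel" "v \<in> borel_measurable borel"
    and b: "\<And>z. z \<in> C \<Longrightarrow> norm (u z) \<le> B" "\<And>z. z \<in> C \<Longrightarrow> norm (v z) \<le> B"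
  shows "set_integrable lborel C (\<lambda>z. u z * fst (x z) + v z * snd (x z))"
    "norm (lin C u v x) \<le> 2 * B * (LINT z:C|lborel. norm (x z))"
proof -
  note [measurable] = m
  have [measurable]: "x \<in> borel_measurable borel" using x by (simp add: L2loc_def)
  have [measurable]: "(\<lambda>z. fst (x z)) \<in> borel_measurable borel" "(\<lambda>z. snd (x z)) \<in> borel_measurable borel"
    by (rule measurable_compose[of x borel borel]; simp add: borel_measurable_continuous_onI continuous_on_fst continuous_on_snd)+
  have le: "norm (u z * fst (x z) + v z * snd (x z)) \<le> 2 * B * norm (x z)" if z: "z \<in> C" for z
  proof -
    have "norm (u z * fst (x z) + v z * snd (x z)) \<le> norm (u z) * norm (fst (x z)) + norm (v z) * norm (snd (x z))"
      by (metis norm_mult norm_triangle_ineq)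
    also have "\<dots> \<le> B * norm (x z) + B * norm (x z)"
      using b[OF z] norm_fst_le[of "fst (x z)" "snd (x z)"] norm_snd_le[of "snd (x z)" "fst (x z)"]
      by (intro add_mono mult_mono) (auto intro: order_trans[OF norm_ge_zero])
    finally show ?thesis by simp
  qed
  have i: "set_integrable lborel C (\<lambda>z. 2 * B * norm (x z))" using L2locD(2)[OF x C] by auto
  show ii: "set_integrable lborel C (\<lambda>z. u z * fst (x z) + v z * snd (x z))"
    by (rule set_integrable_dominated[OF i compact_sets_borel[OF C(1)] _ le]) measurable
  have "norm (lin C u v x) \<le> (LINT z:C|lborel. norm (u z * fst (x z) + v z * snd (x z)))"
    unfolding lin_def by (rule set_integral_norm_bound[OF ii])
  also have "\<dots> \<le> (LINT z:C|lborel. 2 * B * norm (x z))"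
    by (rule set_integral_mono[OF set_integrable_norm[OF ii] i le])
  also have "\<dots> = 2 * B * (LINT z:C|lborel. norm (x z))" by (rule set_integral_mult_right)
  finally show "norm (lin C u v x) \<le> 2 * B * (LINT z:C|lborel. norm (x z))" .
qed

lemma lin_half:
  assumes x: "L2loc \<Omega> x" "L2loc \<Omega> y" and C: "compact C" "C \<subseteq> \<Omega>" and m: "u \<in> borel_measurable borel" "v \<in> borel_measurable borel"
    and b: "\<And>z. z \<in> C \<Longrightarrow> norm (u z) \<le> B" "\<And>z. z \<in> C \<Longrightarrow> norm (v z) \<le> B"
  shows "lin C u v (\<lambda>z. (1 / 2) *\<^sub>R (x z + y z)) = (1 / 2) * lin C u v x + (1 / 2) * lin C u v y"
proof -
  note i = lin_integrable(1)[OF x(1) C m b] lin_integrable(1)[OF x(2) C m b]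
  have "lin C u v (\<lambda>z. (1 / 2) *\<^sub>R (x z + y z)) = (LINT z:C|lborel. (1 / 2) * (u z * fst (x z) + v z * snd (x z)) + (1 / 2) * (u z * fst (y z) + v z * snd (y z)))"
    unfolding lin_def
    by (intro arg_cong[where f = "\<lambda>F. set_lebesgue_integral lborel C F"] ext) (simp add: scaleR_conv_of_real algebra_simps)
  also have "\<dots> = (LINT z:C|lborel. (1 / 2) * (u z * fst (x z) + v z * snd (x z))) + (LINT z:C|lborel. (1 / 2) * (u z * fst (y z) + v z * snd (y z)))"
    by (intro set_integral_add set_integrable_mult_right i)
  also have "\<dots> = (1 / 2) * lin C u v x + (1 / 2) * lin C u v y"
    unfolding lin_def set_integral_mult_right ..
  finally show ?thesis .
qed

lemma lin_diff:
  assumes x: "L2loc \<Omega> x" "L2loc \<Omega> y" "L2loc \<Omega> (\<lambda>z. x z - y z)" and C: "compact C" "C \<subseteq> \<Omega>" and m: "u \<in> borel_measurable borel" "v \<in> borel_measurable borel"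
    and b: "\<And>z. z \<in> C \<Longrightarrow> norm (u z) \<le> B" "\<And>z. z \<in> C \<Longrightarrow> norm (v z) \<le> B"
  shows "norm (lin C u v x - lin C u v y) \<le> 2 * B * (LINT z:C|lborel. norm (x z - y z))"
proof -
  note i = lin_integrable(1)[OF x(1) C m b] lin_integrable(1)[OF x(2) C m b]
  have "lin C u v x - lin C u v y = (LINT z:C|lborel. (u z * fst (x z) + v z * snd (x z)) - (u z * fst (y z) + v z * snd (y z)))"
    unfolding lin_def by (rule set_integral_diff(2)[OF i, symmetric])
  also have "\<dots> = lin C u v (\<lambda>z. x z - y z)"
    unfolding lin_def by (intro arg_cong[where f = "\<lambda>F. set_lebesgue_integral lborel C F"] ext) (simp add: algebra_simps)
  finally show ?thesis using lin_integrable(2)[OF x(3) C m b] by simp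
qed

lemma L2loc_diff:
  assumes "L2loc \<Omega> x" "L2loc \<Omega> y"
  shows "L2loc \<Omega> (\<lambda>z. x z - y z)"
  unfolding L2loc_def
proof (intro conjI allI impI)
  have [measurable]: "x \<in> borel_measurable borel" "y \<in> borel_measurable borel" using assms by (auto simp: L2loc_def)
  show m: "(\<lambda>z. x z - y z) \<in> borel_measurable borel" by measurable
  fix C assume C: "compact C \<and> C \<subseteq> \<Omega>"
  have i: "set_integrable lborel C (\<lambda>z. 2 * (norm (x z))\<^sup>2 + 2 * (norm (y z))\<^sup>2)"
    using L2locD(1)[OF assms(1)] L2locD(1)[OF assms(2)] C by (intro set_integral_add) auto
  show "set_integrable lborel C (\<lambda>z. (norm (x z - y z))\<^sup>2)"
  proof (rule set_integrable_dominated[OF i])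
    show "C \<in> sets borel" using C compact_sets_borel by blast
    show "(\<lambda>z. (norm (x z - y z))\<^sup>2) \<in> borel_measurable borel" using m by measurable
    fix z
    have "(norm (x z - y z))\<^sup>2 \<le> (norm (x z) + norm (y z))\<^sup>2"
      by (intro power_mono norm_triangle_ineq4) auto
    also have "\<dots> \<le> 2 * (norm (x z))\<^sup>2 + 2 * (norm (y z))\<^sup>2"
      using sum_squares_bound[of "norm (x z)" "norm (y z)"] by (simp add: power2_sum)
    finally show "norm ((norm (x z - y z))\<^sup>2) \<le> 2 * (norm (x z))\<^sup>2 + 2 * (norm (y z))\<^sup>2" by simp
  qed
qed

text \<open>\<open>t\<close> is free: it is chosen first to make the area term small, and then the
  L^2 norm is made small against it.\<close>

lemma L1_from_L2:
  assumes x: "L2loc \<Omega> x" and C: "compact C" "C \<subseteq> \<Omega>" and t: "t > 0"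
  shows "(LINT z:C|lborel. norm (x z)) \<le> t * measure lborel C + (LINT z:C|lborel. (norm (x z))\<^sup>2) / t"
proof -
  note i = L2locD[OF x C]
  have c: "set_integrable lborel C (\<lambda>_. t)" by (rule set_integrable_const_compact[OF C(1)])
  have "(LINT z:C|lborel. norm (x z)) \<le> (LINT z:C|lborel. t + (norm (x z))\<^sup>2 / t)"
  proof (rule set_integral_mono[OF i(2)])
    show "set_integrable lborel C (\<lambda>z. t + (norm (x z))\<^sup>2 / t)" using i c by (intro set_integral_add) auto
    fix z
    have "2 * t * norm (x z) \<le> t\<^sup>2 + (norm (x z))\<^sup>2" by (rule sum_squares_bound)
    moreover have "0 \<le> t * norm (x z)" using t by simp
    ultimately have "t * norm (x z) \<le> t\<^sup>2 + (norm (x z))\<^sup>2" unfolding mult.assoc by linarith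
    then show "norm (x z) \<le> t + (norm (x z))\<^sup>2 / t" using t by (simp add: field_simps power2_eq_square)
  qed
  also have "\<dots> = (LINT z:C|lborel. t) + (LINT z:C|lborel. (norm (x z))\<^sup>2 / t)"
    using i c by (intro set_integral_add) auto
  also have "(LINT z:C|lborel. t) = t * measure lborel C"
    using emeasure_bounded_finite[OF compact_imp_bounded[OF C(1)]] compact_sets_borel[OF C(1)]
    by (simp add: set_lebesgue_integral_def mult.commute)
  finally show ?thesis by simp
qed

lemma bounded_on_compact:
  fixes F :: "complex \<Rightarrow> 'b::real_normed_vector"
  assumes "continuous_on C F" "compact C"
  obtains B where "B > 0" "\<And>z. z \<in> C \<Longrightarrow> norm (F z) \<le> B"
proof -
  have "bounded (F ` C)" by (intro compact_imp_bounded compact_continuous_image assms)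
  then show ?thesis using that unfolding bounded_pos by blast
qed

lemma geometric_small:
  fixes c \<epsilon> :: real assumes "\<epsilon> > 0"
  obtains N where "\<And>j. j \<ge> N \<Longrightarrow> c * (1 / 4) ^ j < \<epsilon>"
proof -
  have "(\<lambda>j. c * (1 / 4 :: real) ^ j) \<longlonglongrightarrow> c * 0"
    by (intro tendsto_intros LIMSEQ_realpow_zero) auto
  then have "\<forall>\<^sub>F j in sequentially. c * (1 / 4) ^ j < \<epsilon>" by (rule order_tendstoD) (use assms in simp)
  then show ?thesis using that unfolding eventually_sequentially by blast
qed

lemma set_integral_supp:
  fixes v :: "complex \<Rightarrow> complex" and \<phi> :: "complex \<Rightarrow> real"
  assumes "C \<subseteq> \<Omega>" "\<And>z. z \<notin> C \<Longrightarrow> \<phi> z = 0"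
  shows "(LINT z:\<Omega>|lborel. \<phi> z *\<^sub>R v z) = (LINT z:C|lborel. \<phi> z *\<^sub>R v z)"
  unfolding set_lebesgue_integral_def
proof (rule Bochner_Integration.integral_cong[OF refl])
  fix z show "indicator \<Omega> z *\<^sub>R (\<phi> z *\<^sub>R v z) = indicator C z *\<^sub>R (\<phi> z *\<^sub>R v z)"
    using assms by (cases "z \<in> C") auto
qed

text \<open>The midpoint hulls converge strongly, so linear quantities pass to the limit.\<close>
lemma lin_limit:
  assumes k: "\<And>j. k j \<in> mid {h m |m. m \<ge> j}" and h: "\<And>n. L2loc \<Omega> (h n)" and l: "L2loc \<Omega> l"
    and C: "compact C" "C \<subseteq> \<Omega>" and c: "\<And>j. (LINT z:C|lborel. (norm (l z - k j z))\<^sup>2) \<le> c * (1 / 4) ^ j"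
    and m: "u \<in> borel_measurable borel" "v \<in> borel_measurable borel"
    and b: "\<And>z. z \<in> C \<Longrightarrow> norm (u z) \<le> B" "\<And>z. z \<in> C \<Longrightarrow> norm (v z) \<le> B" and \<epsilon>: "\<epsilon> > 0"
  obtains N where "\<And>j. j \<ge> N \<Longrightarrow> norm (lin C u v l - lin C u v (k j)) < \<epsilon>"
proof -
  have kL: "L2loc \<Omega> (k j)" for j by (rule L2loc_mid[OF k]) (use h in auto)
  define B' where "B' = \<bar>B\<bar> + 1"
  have B': "B' > 0" "B \<le> B'" by (auto simp: B'_def)
  define t where "t = \<epsilon> / (4 * B' * (measure lborel C + 1))"
  have mC: "measure lborel C + 1 > 0" by (simp add: add_nonneg_pos)
  have t: "t > 0" using \<epsilon> B' mC by (simp add: t_def)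
  have tm: "2 * B' * (t * measure lborel C) \<le> \<epsilon> / 2"
  proof -
    have "2 * B' * (t * measure lborel C) \<le> 2 * B' * (t * (measure lborel C + 1))"
      using B' t by (intro mult_left_mono) auto
    also have "\<dots> = \<epsilon> / 2" using B' mC by (simp add: t_def)
    finally show ?thesis .
  qed
  obtain N where N: "\<And>j. j \<ge> N \<Longrightarrow> (2 * B' / t * c) * (1 / 4) ^ j < \<epsilon> / 2"
    using geometric_small[of "\<epsilon> / 2" "2 * B' / t * c"] \<epsilon> by auto
  show ?thesis
  proof (rule that)
    fix j assume j: "j \<ge> N"
    note D = L2loc_diff[OF l kL[of j]]
    have b': "\<And>z. z \<in> C \<Longrightarrow> norm (u z) \<le> B'" "\<And>z. z \<in> C \<Longrightarrow> norm (v z) \<le> B'" using b B'(2) by (meson order_trans)+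
    have "norm (lin C u v l - lin C u v (k j)) \<le> 2 * B' * (LINT z:C|lborel. norm (l z - k j z))"
      by (rule lin_diff[OF l kL D C m b'])
    also have "\<dots> \<le> 2 * B' * (t * measure lborel C + (LINT z:C|lborel. (norm (l z - k j z))\<^sup>2) / t)"
      using B' by (intro mult_left_mono L1_from_L2[OF D C t]) auto
    also have "\<dots> \<le> 2 * B' * (t * measure lborel C + c * (1 / 4) ^ j / t)"
      using B' t c[of j] by (intro mult_left_mono add_left_mono divide_right_mono) auto
    also have "\<dots> = 2 * B' * (t * measure lborel C) + (2 * B' / t * c) * (1 / 4) ^ j"
      by (simp add: algebra_simps)
    also have "\<dots> < \<epsilon>" using tm N[OF j] by linarith
    finally show "norm (lin C u v l - lin C u v (k j)) < \<epsilon>" .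
  qed
qed

lemma uniform_limit_eventually_le:
  assumes "uniform_limit C f g sequentially" "(\<epsilon>::real) > 0"
  obtains N where "\<And>n z. n \<ge> N \<Longrightarrow> z \<in> C \<Longrightarrow> norm (f n z - g z) \<le> \<epsilon>"
  using uniform_limitD[OF assms] unfolding eventually_sequentially dist_norm by (meson less_imp_le that)

text \<open>For each approximating map the identity equates a functional of its gradient with an
  integral of the map, and the latter converges uniformly. The values of the functional on the tail
  are therefore within \<epsilon> of one number; so are those on the midpoint hull, and the strong
  limit inherits this for every \<epsilon>.\<close>

lemma weak_limit_sob:
  assumes \<Omega>: "open \<Omega>" and s: "\<And>n. sob \<Omega> (f n) (a n) (b n)"
    and gc: "continuous_on \<Omega> g" and gm: "g \<in> borel_measurable borel"
    and U: "\<And>C. compact C \<Longrightarrow> C \<subseteq> \<Omega> \<Longrightarrow> uniform_limit C f g sequentially"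
    and h: "\<And>n. L2loc \<Omega> (\<lambda>z. (a n z, b n z))" and l: "L2loc \<Omega> l"
    and k: "\<And>j. k j \<in> mid {(\<lambda>z. (a m z, b m z)) |m. m \<ge> j}"
    and kl: "\<And>C. compact C \<Longrightarrow> C \<subseteq> \<Omega> \<Longrightarrow> \<exists>c. c \<ge> 0 \<and> (\<forall>j. set_integrable lborel C (\<lambda>z. (norm (l z - k j z))\<^sup>2) \<and>
       (LINT z:C|lborel. (norm (l z - k j z))\<^sup>2) \<le> c * (1 / 4) ^ j)"
  shows "sob \<Omega> g (\<lambda>z. fst (l z)) (\<lambda>z. snd (l z))"
proof -
  let ?h = "\<lambda>n z. (a n z, b n z)"
  have lm: "l \<in> borel_measurable borel" using l by (simp add: L2loc_def)
  have lm2: "(\<lambda>z. fst (l z)) \<in> borel_measurable borel" "(\<lambda>z. snd (l z)) \<in> borel_measurable borel"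
    by (rule measurable_compose[OF lm]; simp add: borel_measurable_continuous_onI continuous_on_fst continuous_on_snd)+
  have key: "(LINT z:C|lborel. \<psi> z *\<^sub>R g z) = - lin C u v l"
    if C: "compact C" "C \<subseteq> \<Omega>" and \<psi>: "continuous_on UNIV \<psi>"
      and uv: "continuous_on UNIV u" "continuous_on UNIV v"
      and id: "\<And>n. (LINT z:C|lborel. \<psi> z *\<^sub>R f n z) = - lin C u v (?h n)"
    for C and \<psi> :: "complex \<Rightarrow> real" and u v :: "complex \<Rightarrow> complex"
  proof -
    have Cm: "C \<in> sets borel" by (rule compact_sets_borel[OF C(1)])
    obtain P where P: "P > 0" "\<And>z. z \<in> C \<Longrightarrow> norm (\<psi> z) \<le> P"
      using bounded_on_compact[OF continuous_on_subset[OF \<psi>] C(1)] by blast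
    obtain B1 where B1: "B1 > 0" "\<And>z. z \<in> C \<Longrightarrow> norm (u z) \<le> B1"
      using bounded_on_compact[OF continuous_on_subset[OF uv(1)] C(1)] by blast
    obtain B2 where B2: "B2 > 0" "\<And>z. z \<in> C \<Longrightarrow> norm (v z) \<le> B2"
      using bounded_on_compact[OF continuous_on_subset[OF uv(2)] C(1)] by blast
    define B where "B = B1 + B2"
    have B: "\<And>z. z \<in> C \<Longrightarrow> norm (u z) \<le> B" "\<And>z. z \<in> C \<Longrightarrow> norm (v z) \<le> B"
      using B1 B2 unfolding B_def by (meson add_increasing2 add_increasing less_imp_le)+
    have m: "u \<in> borel_measurable borel" "v \<in> borel_measurable borel"
      using uv by (auto intro: borel_measurable_continuous_onI)
    have fi: "set_integrable lborel C (\<lambda>z. \<psi> z *\<^sub>R F z)" if "continuous_on \<Omega> F" for F :: "complex \<Rightarrow> complex"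
      unfolding set_integrable_def
      by (intro borel_integrable_compact C continuous_on_scaleR continuous_on_subset[OF \<psi>] continuous_on_subset[OF that]) auto
    define G where "G = (LINT z:C|lborel. \<psi> z *\<^sub>R g z)"
    obtain c where c: "\<And>j. (LINT z:C|lborel. (norm (l z - k j z))\<^sup>2) \<le> c * (1 / 4) ^ j" using kl[OF C] by blast
    have small: "norm (lin C u v l + G) \<le> \<epsilon>" if \<epsilon>: "\<epsilon> > 0" for \<epsilon>
    proof -
      define mC where "mC = measure lborel C + 1"
      have mC: "mC > 0" by (simp add: mC_def add_nonneg_pos)
      define \<delta> where "\<delta> = \<epsilon> / (2 * P * mC)"
      have \<delta>: "\<delta> > 0" using \<epsilon> P mC by (simp add: \<delta>_def)
      obtain N where N: "\<And>n z. n \<ge> N \<Longrightarrow> z \<in> C \<Longrightarrow> norm (f n z - g z) \<le> \<delta>"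
        using uniform_limit_eventually_le[OF U[OF C] \<delta>] by blast
      have close: "norm (lin C u v (?h n) + G) \<le> \<epsilon> / 2" if n: "n \<ge> N" for n
      proof -
        have fc: "continuous_on \<Omega> (f n)" using s by (simp add: sob_def)
        have "lin C u v (?h n) + G = (LINT z:C|lborel. \<psi> z *\<^sub>R g z) - (LINT z:C|lborel. \<psi> z *\<^sub>R f n z)"
          using id[of n] by (simp add: G_def)
        also have "\<dots> = (LINT z:C|lborel. \<psi> z *\<^sub>R g z - \<psi> z *\<^sub>R f n z)"
          by (rule set_integral_diff(2)[OF fi[OF gc] fi[OF fc], symmetric])
        finally have e: "lin C u v (?h n) + G = (LINT z:C|lborel. \<psi> z *\<^sub>R g z - \<psi> z *\<^sub>R f n z)" .
        have di: "set_integrable lborel C (\<lambda>z. \<psi> z *\<^sub>R g z - \<psi> z *\<^sub>R f n z)" by (rule set_integral_diff(1)[OF fi[OF gc] fi[OF fc]])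
        have "norm (lin C u v (?h n) + G) \<le> (LINT z:C|lborel. norm (\<psi> z *\<^sub>R g z - \<psi> z *\<^sub>R f n z))"
          unfolding e by (rule set_integral_norm_bound[OF di])
        also have "\<dots> \<le> (LINT z:C|lborel. P * \<delta>)"
        proof (rule set_integral_mono[OF set_integrable_norm[OF di] set_integrable_const_compact[OF C(1)]])
          fix z assume z: "z \<in> C"
          have "norm (\<psi> z *\<^sub>R g z - \<psi> z *\<^sub>R f n z) = norm (\<psi> z) * norm (f n z - g z)"
            by (simp add: scaleR_diff_right[symmetric] norm_minus_commute)
          also have "\<dots> \<le> P * \<delta>" using P z N[OF n z] by (intro mult_mono) auto
          finally show "norm (\<psi> z *\<^sub>R g z - \<psi> z *\<^sub>R f n z) \<le> P * \<delta>" .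
        qed
        also have "\<dots> = measure lborel C * (P * \<delta>)"
          using emeasure_bounded_finite[OF compact_imp_bounded[OF C(1)]] Cm by (simp add: set_lebesgue_integral_def)
        also have "\<dots> \<le> mC * (P * \<delta>)" using P \<delta> by (intro mult_right_mono) (auto simp: mC_def)
        also have "\<dots> = \<epsilon> / 2" using P mC by (simp add: \<delta>_def)
        finally show ?thesis .
      qed
      \<comment> \<open>Distance from a fixed number is convex under midpoints, so the estimate
        spreads from the tail to its hull, which contains the late \<open>k j\<close>.\<close>
      have midclose: "L2loc \<Omega> x \<and> norm (lin C u v x + G) \<le> \<epsilon> / 2" if "x \<in> mid {?h m |m. m \<ge> N}" for x
        using that
      proof induction
        case (base x)
        then show ?case using close h by auto
      next
        case (half x y)
        have "lin C u v (\<lambda>z. (1 / 2) *\<^sub>R (x z + y z)) + G = (1 / 2) * (lin C u v x + G) + (1 / 2) * (lin C u v y + G)"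
          using lin_half[OF _ _ C m B, of x y] half by (simp add: algebra_simps)
        then have "norm (lin C u v (\<lambda>z. (1 / 2) *\<^sub>R (x z + y z)) + G) \<le> norm ((1 / 2) * (lin C u v x + G)) + norm ((1 / 2) * (lin C u v y + G))"
          by (simp only: norm_triangle_ineq)
        also have "\<dots> \<le> \<epsilon> / 2" unfolding norm_mult using half by simp
        finally show ?case using half L2loc_half by blast
      qed
      obtain N' where N': "\<And>j. j \<ge> N' \<Longrightarrow> norm (lin C u v l - lin C u v (k j)) < \<epsilon> / 2"
        using lin_limit[OF k h l C c m B, of "\<epsilon> / 2"] \<epsilon> by auto
      define j where "j = max N N'"
      have "k j \<in> mid {?h m |m. m \<ge> N}"
        using k[of j] mid_mono[of "{?h m |m. m \<ge> j}" "{?h m |m. m \<ge> N}"] by (auto simp: j_def)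
      then have "norm (lin C u v (k j) + G) \<le> \<epsilon> / 2" using midclose by blast
      moreover have "norm (lin C u v l - lin C u v (k j)) < \<epsilon> / 2" by (rule N') (simp add: j_def)
      ultimately show ?thesis
        using norm_triangle_ineq[of "lin C u v l - lin C u v (k j)" "lin C u v (k j) + G"] by simp
    qed
    have "norm (lin C u v l + G) \<le> 0" by (rule field_le_epsilon) (simp add: small)
    then have "lin C u v l + G = 0" by simp
    then have "G = - lin C u v l" by (rule minus_unique[symmetric])
    then show ?thesis unfolding G_def .
  qed
  show ?thesis
    unfolding sob_def
  proof (intro conjI allI impI \<Omega> gc gm lm2)
    fix C assume "compact C \<and> C \<subseteq> \<Omega>"
    then show "set_integrable lborel C (\<lambda>z. en (fst (l z)) (snd (l z)))"
      using L2locD(1)[OF l] by (simp add: norm_eq_en)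
  next
    fix \<phi> assume t: "test_function \<Omega> \<phi>"
    obtain C where C: "compact C" "C \<subseteq> \<Omega>" and o: "\<And>z. z \<notin> C \<Longrightarrow> \<phi> z = 0"
      "\<And>z. z \<notin> C \<Longrightarrow> dir_deriv 1 \<phi> z = 0" "\<And>z. z \<notin> C \<Longrightarrow> dir_deriv \<i> \<phi> z = 0"
      by (rule test_function_supp[OF t]) (rule that; assumption)
    note tc = test_function_continuous[OF t]
    have sup1: "(LINT z:\<Omega>|lborel. \<phi> z *\<^sub>R v z) = (LINT z:C|lborel. \<phi> z *\<^sub>R v z)"
      and sup2: "(LINT z:\<Omega>|lborel. dir_deriv 1 \<phi> z *\<^sub>R v z) = (LINT z:C|lborel. dir_deriv 1 \<phi> z *\<^sub>R v z)"
      and sup3: "(LINT z:\<Omega>|lborel. dir_deriv \<i> \<phi> z *\<^sub>R v z) = (LINT z:C|lborel. dir_deriv \<i> \<phi> z *\<^sub>R v z)"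
      for v :: "complex \<Rightarrow> complex"
      by (rule set_integral_supp[OF C(2)], rule o, assumption)+
    have pc: "continuous_on UNIV (\<lambda>z. complex_of_real (\<phi> z))" using tc(1) by (intro continuous_intros)
    have l1: "lin C (\<lambda>z. complex_of_real (\<phi> z)) (\<lambda>z. 0) x = (LINT z:C|lborel. \<phi> z *\<^sub>R fst (x z))"
      and l2: "lin C (\<lambda>z. 0) (\<lambda>z. complex_of_real (\<phi> z)) x = (LINT z:C|lborel. \<phi> z *\<^sub>R snd (x z))" for x
      by (simp_all add: lin_def scaleR_conv_of_real)
    have e: "(LINT z:\<Omega>|lborel. dir_deriv 1 \<phi> z *\<^sub>R f n z) = - (LINT z:\<Omega>|lborel. \<phi> z *\<^sub>R a n z)"
      "(LINT z:\<Omega>|lborel. dir_deriv \<i> \<phi> z *\<^sub>R f n z) = - (LINT z:\<Omega>|lborel. \<phi> z *\<^sub>R b n z)" for n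
      using s[of n, unfolded sob_def] t by blast+
    have e1: "(LINT z:C|lborel. dir_deriv 1 \<phi> z *\<^sub>R f n z) = - (LINT z:C|lborel. \<phi> z *\<^sub>R a n z)"
      and e2: "(LINT z:C|lborel. dir_deriv \<i> \<phi> z *\<^sub>R f n z) = - (LINT z:C|lborel. \<phi> z *\<^sub>R b n z)" for n
      using e(1)[of n, unfolded sup1[of "a n"] sup2[of "f n"]] e(2)[of n, unfolded sup1[of "b n"] sup3[of "f n"]] by blast+
    show "(LINT z:\<Omega>|lborel. dir_deriv 1 \<phi> z *\<^sub>R g z) = - (LINT z:\<Omega>|lborel. \<phi> z *\<^sub>R fst (l z))"
      unfolding sup1[of "\<lambda>z. fst (l z)"] sup2[of g] l1[symmetric] by (rule key[OF C tc(2) pc continuous_on_const]) (simp only: e1 l1 fst_conv)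
    show "(LINT z:\<Omega>|lborel. dir_deriv \<i> \<phi> z *\<^sub>R g z) = - (LINT z:\<Omega>|lborel. \<phi> z *\<^sub>R snd (l z))"
      unfolding sup1[of "\<lambda>z. snd (l z)"] sup3[of g] l2[symmetric] by (rule key[OF C tc(3) continuous_on_const pc]) (simp only: e2 l2 snd_conv)
  qed
qed

section \<open>The distortion inequality in the limit\<close>

lemma moll_c1:
  assumes e: "e > 0"
  obtains \<eta>x \<eta>y where "c1 (\<lambda>w. complex_of_real (moll e (z0 - w))) \<eta>x \<eta>y"
proof -
  obtain B' where B': "\<And>t. (bmp e has_real_derivative B' t) (at t)" "smooth1 B'"
    using smooth1_derivE[OF smooth1_bmp[of e]] by blast
  have r: "((\<lambda>t. bmp e (x - t)) has_real_derivative - B' (x - t)) (at t)" for x t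
  proof -
    have "((\<lambda>t. x - t) has_real_derivative -1) (at t)" by (auto intro!: derivative_eq_intros)
    from DERIV_chain2[OF B'(1) this] show ?thesis by simp
  qed
  have c: "continuous_on UNIV (\<lambda>w. F (z0 - w))" if "continuous_on UNIV F" for F :: "complex \<Rightarrow> real"
    by (rule continuous_on_compose2[OF that]) (auto intro!: continuous_intros)
  define \<eta>x where "\<eta>x w = complex_of_real (- tens B' (bmp e) (z0 - w))" for w
  define \<eta>y where "\<eta>y w = complex_of_real (- tens (bmp e) B' (z0 - w))" for w
  have "c1 (\<lambda>w. complex_of_real (moll e (z0 - w))) \<eta>x \<eta>y"
    unfolding c1_def \<eta>x_def \<eta>y_def
  proof (intro conjI allI)
    show "continuous_on UNIV (\<lambda>w. complex_of_real (moll e (z0 - w)))"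
      by (intro continuous_on_of_real c continuous_on_moll)
    show "continuous_on UNIV (\<lambda>w. complex_of_real (- tens B' (bmp e) (z0 - w)))"
      by (intro continuous_on_of_real continuous_on_minus c continuous_on_tens B' smooth1_bmp)
    show "continuous_on UNIV (\<lambda>w. complex_of_real (- tens (bmp e) B' (z0 - w)))"
      by (intro continuous_on_of_real continuous_on_minus c continuous_on_tens B' smooth1_bmp)
    fix x y
    have "((\<lambda>x. moll e (z0 - Complex x y)) has_real_derivative - tens B' (bmp e) (z0 - Complex x y)) (at x)"
      using DERIV_cmult_right[OF r[of "Re z0" x], of "bmp e (Im z0 - y)"] by (simp add: moll_def tens_def)
    then show "((\<lambda>x. complex_of_real (moll e (z0 - Complex x y))) has_vector_derivative
        complex_of_real (- tens B' (bmp e) (z0 - Complex x y))) (at x)"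
      by (rule has_vector_derivative_of_real)
    have "((\<lambda>y. moll e (z0 - Complex x y)) has_real_derivative - tens (bmp e) B' (z0 - Complex x y)) (at y)"
      using DERIV_cmult[OF r[of "Im z0" y], of "bmp e (Re z0 - x)"] by (simp add: moll_def tens_def)
    then show "((\<lambda>y. complex_of_real (moll e (z0 - Complex x y))) has_vector_derivative
        complex_of_real (- tens (bmp e) B' (z0 - Complex x y))) (at y)"
      by (rule has_vector_derivative_of_real)
  qed
  then show ?thesis by (rule that)
qed

text \<open>By Lindelof countably many of the neighbourhoods have the same union, and countably many
  null sets may be combined.\<close>

lemma AE_locally:
  assumes "\<And>z. z \<in> \<Omega> \<Longrightarrow> \<exists>U. open U \<and> z \<in> U \<and> (AE x in lborel. x \<in> U \<longrightarrow> P x)"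
  shows "AE x in (lborel :: complex measure). x \<in> \<Omega> \<longrightarrow> P x"
proof -
  define F where "F = {U. open U \<and> (AE x in (lborel :: complex measure). x \<in> U \<longrightarrow> P x)}"
  have "\<And>S. S \<in> F \<Longrightarrow> open S" by (simp add: F_def)
  then obtain F' where F': "F' \<subseteq> F" "countable F'" "\<Union>F' = \<Union>F" using Lindelof by blast
  have "AE x in lborel. \<forall>U\<in>F'. x \<in> U \<longrightarrow> P x"
    unfolding AE_ball_countable[OF F'(2)] using F'(1) by (auto simp: F_def)
  moreover have "\<Omega> \<subseteq> \<Union>F'" unfolding F'(3) using assms by (auto simp: F_def)
  ultimately show ?thesis by (auto elim!: eventually_mono)
qed

text \<open>The key to averaging: with the weight fixed, a quadratic expression in the gradient
  becomes linear in it, the coefficients coming from the map and the weight. It is used for each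
  \<open>f n\<close>, and once more in the opposite direction for the limit.\<close>

lemma jac_lin:
  assumes s: "sob \<Omega> f a b" and e: "e > 0" and sub: "sq z0 e \<subseteq> \<Omega>"
    and \<eta>: "c1 (\<lambda>w. complex_of_real (moll e (z0 - w))) \<eta>x \<eta>y"
  shows "2 * (LINT w:sq z0 e|lborel. moll e (z0 - w) * jac (a w) (b w))
    = - Im (lin (sq z0 e) (\<lambda>w. - (cnj (f w) * \<eta>y w)) (\<lambda>w. cnj (f w) * \<eta>x w) (\<lambda>w. (a w, b w)))"
proof -
  let ?Q = "sq z0 e"
  have van: "complex_of_real (moll e (z0 - w)) = 0" if "\<bar>Re w - Re z0\<bar> = e \<or> \<bar>Im w - Im z0\<bar> = e" for w
    using that e by (auto simp: moll_def tens_def bmp_out abs_minus_commute)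
  note JI = jacobian_identity[OF s sub e \<eta> van]
  define X where "X = (LINT w:?Q|lborel. moll e (z0 - w) * jac (a w) (b w))"
  have 1: "(LINT w:?Q|lborel. complex_of_real (moll e (z0 - w)) * (2 * \<i> * jac (a w) (b w))) = 2 * \<i> * complex_of_real X"
    unfolding X_def set_integral_mult_of_real[symmetric]
    by (intro arg_cong[where f = "\<lambda>F. set_lebesgue_integral lborel ?Q F"] ext) simp
  have 2: "(LINT w:?Q|lborel. cnj (f w) * (\<eta>x w * b w - \<eta>y w * a w))
     = lin ?Q (\<lambda>w. - (cnj (f w) * \<eta>y w)) (\<lambda>w. cnj (f w) * \<eta>x w) (\<lambda>w. (a w, b w))"
    unfolding lin_def by (intro arg_cong[where f = "\<lambda>F. set_lebesgue_integral lborel ?Q F"] ext) (simp add: algebra_simps)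
  have "2 * \<i> * complex_of_real X + lin ?Q (\<lambda>w. - (cnj (f w) * \<eta>y w)) (\<lambda>w. cnj (f w) * \<eta>x w) (\<lambda>w. (a w, b w)) = 0"
    unfolding 1[symmetric] 2[symmetric] using set_integral_add(2)[OF JI(2,3)] JI(1) by simp
  then have "Im (2 * \<i> * complex_of_real X + lin ?Q (\<lambda>w. - (cnj (f w) * \<eta>y w)) (\<lambda>w. cnj (f w) * \<eta>x w) (\<lambda>w. (a w, b w))) = 0"
    by simp
  moreover have "Im (2 * \<i> * complex_of_real X) = 2 * X" by simp
  ultimately show ?thesis unfolding X_def[symmetric] plus_complex.sel by linarith
qed

definition wen :: "real \<Rightarrow> complex \<Rightarrow> (complex \<Rightarrow> complex \<times> complex) \<Rightarrow> real" where
  "wen e z0 x = (LINT w:sq z0 e|lborel. moll e (z0 - w) * (norm (x w))\<^sup>2)"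

lemma wen_integrable:
  assumes e: "e > 0" and sub: "sq z0 e \<subseteq> \<Omega>" and x: "L2loc \<Omega> x"
  shows "set_integrable lborel (sq z0 e) (\<lambda>w. moll e (z0 - w) * (norm (x w))\<^sup>2)"
proof -
  have [measurable]: "x \<in> borel_measurable borel" using x by (simp add: L2loc_def)
  have i: "set_integrable lborel (sq z0 e) (\<lambda>w. (bmax / e)\<^sup>2 * (norm (x w))\<^sup>2)"
    using L2locD(1)[OF x compact_sq sub] by auto
  show ?thesis
    by (rule set_integrable_dominated[OF i])
       (use moll_le[OF e] moll_nonneg[OF e] in \<open>auto simp: abs_mult intro!: mult_right_mono\<close>)
qed

text \<open>Convexity of the weighted energy, with the inequality in the direction that suits the
  left side of the distortion inequality.\<close>

lemma wen_half:
  assumes e: "e > 0" and sub: "sq z0 e \<subseteq> \<Omega>" and x: "L2loc \<Omega> x" "L2loc \<Omega> y"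
  shows "wen e z0 (\<lambda>w. (1 / 2) *\<^sub>R (x w + y w)) \<le> (1 / 2) * wen e z0 x + (1 / 2) * wen e z0 y"
proof -
  note i = wen_integrable[OF e sub]
  have i2: "set_integrable lborel (sq z0 e) (\<lambda>w. (1 / 2) * (moll e (z0 - w) * (norm (x w))\<^sup>2))"
    "set_integrable lborel (sq z0 e) (\<lambda>w. (1 / 2) * (moll e (z0 - w) * (norm (y w))\<^sup>2))"
    by (intro set_integrable_mult_right i x)+
  have "wen e z0 (\<lambda>w. (1 / 2) *\<^sub>R (x w + y w)) \<le> (LINT w:sq z0 e|lborel. (1 / 2) * (moll e (z0 - w) * (norm (x w))\<^sup>2) + (1 / 2) * (moll e (z0 - w) * (norm (y w))\<^sup>2))"
    unfolding wen_def
  proof (rule set_integral_mono[OF i[OF L2loc_half[OF x]] set_integral_add(1)[OF i2]])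
    fix w
    have "moll e (z0 - w) * (norm ((1 / 2) *\<^sub>R (x w + y w)))\<^sup>2 \<le> moll e (z0 - w) * ((1 / 2) * (norm (x w))\<^sup>2 + (1 / 2) * (norm (y w))\<^sup>2)"
      by (intro mult_left_mono norm_half_le moll_nonneg e)
    then show "moll e (z0 - w) * (norm ((1 / 2) *\<^sub>R (x w + y w)))\<^sup>2 \<le> (1 / 2) * (moll e (z0 - w) * (norm (x w))\<^sup>2) + (1 / 2) * (moll e (z0 - w) * (norm (y w))\<^sup>2)"
      by (simp only: distrib_left mult.left_commute)
  qed
  also have "\<dots> = (1 / 2) * wen e z0 x + (1 / 2) * wen e z0 y"
    unfolding wen_def set_integral_add(2)[OF i2] set_integral_mult_right ..
  finally show ?thesis .
qed

text \<open>Strong continuity with a free parameter: t is fixed first by the energy of x, and then y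
  is taken so close to x that the factor 1 + 2 / t does no harm.\<close>

lemma wen_diff:
  assumes e: "e > 0" and sub: "sq z0 e \<subseteq> \<Omega>" and x: "L2loc \<Omega> x" "L2loc \<Omega> y" and t: "t > 0"
  shows "wen e z0 x \<le> wen e z0 y + (bmax / e)\<^sup>2 * (2 * t * (LINT w:sq z0 e|lborel. (norm (x w))\<^sup>2) + (1 + 2 / t) * (LINT w:sq z0 e|lborel. (norm (x w - y w))\<^sup>2))"
proof -
  let ?Q = "sq z0 e"
  note i = wen_integrable[OF e sub]
  note ix = L2locD(1)[OF x(1) compact_sq sub]
  note id = L2locD(1)[OF L2loc_diff[OF x] compact_sq sub]
  define b where "b = (bmax / e)\<^sup>2"
  have "wen e z0 x \<le> (LINT w:?Q|lborel. 1 * (moll e (z0 - w) * (norm (y w))\<^sup>2) + ((b * (2 * t)) * (norm (x w))\<^sup>2 + (b * (1 + 2 / t)) * (norm (x w - y w))\<^sup>2))"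
    unfolding wen_def
  proof (rule set_integral_mono[OF i[OF x(1)] set_integral_lincomb3(1)[OF i[OF x(2)] ix id]])
    fix w
    have "\<bar>(norm (y w))\<^sup>2 - (norm (x w))\<^sup>2\<bar> \<le> 2 * t * (norm (x w))\<^sup>2 + (1 + 2 / t) * (norm (y w - x w))\<^sup>2"
      unfolding norm_eq_en fst_diff snd_diff by (rule en_diff[OF t])
    then have le: "(norm (x w))\<^sup>2 - (norm (y w))\<^sup>2 \<le> 2 * t * (norm (x w))\<^sup>2 + (1 + 2 / t) * (norm (x w - y w))\<^sup>2"
      unfolding norm_minus_commute[of "y w" "x w"] abs_le_iff by linarith
    define r where "r = 2 * t * (norm (x w))\<^sup>2 + (1 + 2 / t) * (norm (x w - y w))\<^sup>2"
    have r: "r \<ge> 0" using t by (simp add: r_def add_nonneg_nonneg)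
    have "moll e (z0 - w) * ((norm (x w))\<^sup>2 - (norm (y w))\<^sup>2) \<le> moll e (z0 - w) * r"
      using le by (intro mult_left_mono moll_nonneg e) (simp add: r_def)
    also have "\<dots> \<le> b * r" unfolding b_def by (intro mult_right_mono moll_le e r)
    finally show "moll e (z0 - w) * (norm (x w))\<^sup>2 \<le> 1 * (moll e (z0 - w) * (norm (y w))\<^sup>2) + ((b * (2 * t)) * (norm (x w))\<^sup>2 + (b * (1 + 2 / t)) * (norm (x w - y w))\<^sup>2)"
      by (simp add: r_def algebra_simps)
  qed
  also have "\<dots> = 1 * wen e z0 y + ((b * (2 * t)) * (LINT w:?Q|lborel. (norm (x w))\<^sup>2) + (b * (1 + 2 / t)) * (LINT w:?Q|lborel. (norm (x w - y w))\<^sup>2))"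
    unfolding wen_def by (rule set_integral_lincomb3(2)[OF i[OF x(2)] ix id])
  finally have fin: "wen e z0 x \<le> 1 * wen e z0 y + ((b * (2 * t)) * (LINT w:?Q|lborel. (norm (x w))\<^sup>2) + (b * (1 + 2 / t)) * (LINT w:?Q|lborel. (norm (x w - y w))\<^sup>2))" .
  have "1 * W + ((b * (2 * t)) * A + (b * (1 + 2 / t)) * D) = W + b * (2 * t * A + (1 + 2 / t) * D)" for A D W
    by (simp add: algebra_simps)
  then show ?thesis using fin unfolding b_def by metis
qed

lemma weighted_energy_le:
  assumes q: "qr \<kappa> \<Omega> f a b" and e: "e > 0" and sub: "sq z0 e \<subseteq> \<Omega>" and h: "L2loc \<Omega> (\<lambda>w. (a w, b w))"
  shows "wen e z0 (\<lambda>w. (a w, b w)) \<le> \<kappa> * (LINT w:sq z0 e|lborel. moll e (z0 - w) * jac (a w) (b w))"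
proof -
  note s = qr_sob[OF q]
  note sd [measurable] = sobD(3-5)[OF s]
  note i = wen_integrable[OF e sub h]
  have ij: "set_integrable lborel (sq z0 e) (\<lambda>w. moll e (z0 - w) * jac (a w) (b w))"
    by (rule set_integrable_dominated[OF i])
       (use moll_nonneg[OF e] abs_jac_le in \<open>auto simp: abs_mult norm_eq_en intro!: mult_left_mono\<close>)
  have "wen e z0 (\<lambda>w. (a w, b w)) \<le> (LINT w:sq z0 e|lborel. \<kappa> * (moll e (z0 - w) * jac (a w) (b w)))"
    unfolding wen_def
  proof (rule set_integral_mono_AE'[OF i set_integrable_mult_right[OF ij]])
    show "AE w in lborel. w \<in> sq z0 e \<longrightarrow> moll e (z0 - w) * (norm (a w, b w))\<^sup>2 \<le> \<kappa> * (moll e (z0 - w) * jac (a w) (b w))"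
      using q[unfolded qr_def, THEN conjunct2]
    proof eventually_elim
      case (elim w)
      show ?case
      proof
        assume "w \<in> sq z0 e"
        then have "en (a w) (b w) \<le> \<kappa> * jac (a w) (b w)" using elim sub by blast
        then have "moll e (z0 - w) * en (a w) (b w) \<le> moll e (z0 - w) * (\<kappa> * jac (a w) (b w))"
          by (intro mult_left_mono moll_nonneg e)
        then show "moll e (z0 - w) * (norm (a w, b w))\<^sup>2 \<le> \<kappa> * (moll e (z0 - w) * jac (a w) (b w))"
          by (simp add: norm_eq_en mult.left_commute)
      qed
    qed
  qed
  also have "\<dots> = \<kappa> * (LINT w:sq z0 e|lborel. moll e (z0 - w) * jac (a w) (b w))" by (rule set_integral_mult_right)
  finally show ?thesis .
qed

text \<open>The distortion inequality of each \<open>f n\<close> is written as energy against the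
  linear functional of \<open>jac_lin\<close>. Its coefficients contain the map; replacing
  \<open>f n\<close> by g there costs little by uniform convergence and bounded energies. What
  remains is convex on the left and affine on the right, so it extends to the midpoint hull and to
  its strong limit l, where \<open>jac_lin\<close> for g restores the Jacobian.\<close>

lemma limit_weighted_energy:
  assumes k0: "\<kappa> > 0" and q: "\<And>n. qr \<kappa> \<Omega> (f n) (a n) (b n)" and sg: "sob \<Omega> g (\<lambda>z. fst (l z)) (\<lambda>z. snd (l z))"
    and U: "\<And>C. compact C \<Longrightarrow> C \<subseteq> \<Omega> \<Longrightarrow> uniform_limit C f g sequentially"
    and h: "\<And>n. L2loc \<Omega> (\<lambda>z. (a n z, b n z))" and l: "L2loc \<Omega> l"
    and EB: "\<And>C. compact C \<Longrightarrow> C \<subseteq> \<Omega> \<Longrightarrow> \<exists>B. \<forall>n. (LINT z:C|lborel. (norm (a n z, b n z))\<^sup>2) \<le> B"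
    and k: "\<And>j. k j \<in> mid {(\<lambda>z. (a m z, b m z)) |m. m \<ge> j}"
    and kl: "\<And>C. compact C \<Longrightarrow> C \<subseteq> \<Omega> \<Longrightarrow> \<exists>c. c \<ge> 0 \<and> (\<forall>j. set_integrable lborel C (\<lambda>z. (norm (l z - k j z))\<^sup>2) \<and>
       (LINT z:C|lborel. (norm (l z - k j z))\<^sup>2) \<le> c * (1 / 4) ^ j)"
    and e: "e > 0" and sub: "sq z0 e \<subseteq> \<Omega>"
  shows "wen e z0 l \<le> \<kappa> * (LINT w:sq z0 e|lborel. moll e (z0 - w) * jac (fst (l w)) (snd (l w)))"
proof -
  let ?h = "\<lambda>n z. (a n z, b n z)"
  let ?Q = "sq z0 e"
  obtain \<eta>x \<eta>y where \<eta>: "c1 (\<lambda>w. complex_of_real (moll e (z0 - w))) \<eta>x \<eta>y" using moll_c1[OF e] by blast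
  have \<eta>c: "continuous_on UNIV \<eta>x" "continuous_on UNIV \<eta>y" using \<eta> by (auto simp: c1_def)
  have \<eta>m [measurable]: "\<eta>x \<in> borel_measurable borel" "\<eta>y \<in> borel_measurable borel"
    using \<eta>c by (auto intro: borel_measurable_continuous_onI)
  have cm: "(\<lambda>w. cnj (F w)) \<in> borel_measurable borel" if "F \<in> borel_measurable borel" for F :: "complex \<Rightarrow> complex"
    by (rule measurable_compose[OF that]) (intro borel_measurable_continuous_onI continuous_intros)
  obtain B1 where B1: "B1 > 0" "\<And>z. z \<in> ?Q \<Longrightarrow> norm (\<eta>x z) \<le> B1"
    using bounded_on_compact[OF continuous_on_subset[OF \<eta>c(1)] compact_sq] by blast
  obtain B2 where B2: "B2 > 0" "\<And>z. z \<in> ?Q \<Longrightarrow> norm (\<eta>y z) \<le> B2"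
    using bounded_on_compact[OF continuous_on_subset[OF \<eta>c(2)] compact_sq] by blast
  define B where "B = B1 + B2"
  have B0: "B > 0" using B1 B2 by (simp add: B_def)
  have B: "norm (\<eta>x z) \<le> B" "norm (\<eta>y z) \<le> B" if "z \<in> ?Q" for z
    using B1(1) B2(1) B1(2)[OF that] B2(2)[OF that] unfolding B_def by linarith+
  define u where "u F = (\<lambda>w. - (cnj (F w) * \<eta>y w))" for F
  define v where "v F = (\<lambda>w. cnj (F w) * \<eta>x w)" for F
  have uvm: "u F \<in> borel_measurable borel" "v F \<in> borel_measurable borel" if "F \<in> borel_measurable borel" for F
    using cm[OF that] unfolding u_def v_def by measurable
  have uvb: "norm (u F z) \<le> D * B" "norm (v F z) \<le> D * B" if "z \<in> ?Q" "norm (F z) \<le> D" for F D z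
    using that B[OF that(1)] unfolding u_def v_def norm_minus_cancel norm_mult complex_mod_cnj
    by (intro mult_mono; auto intro: order_trans[OF norm_ge_zero])+
  have gm: "g \<in> borel_measurable borel" by (rule sobD(3)[OF sg])
  have fm: "f n \<in> borel_measurable borel" for n by (rule sobD(3)[OF qr_sob[OF q]])
  have "continuous_on ?Q g" using sobD(2)[OF sg] sub continuous_on_subset by blast
  then obtain G where G: "G > 0" "\<And>z. z \<in> ?Q \<Longrightarrow> norm (g z) \<le> G" using bounded_on_compact[OF _ compact_sq] by blast
  define \<Lambda> where "\<Lambda> x = lin ?Q (u g) (v g) x" for x
  have J: "2 * (LINT w:?Q|lborel. moll e (z0 - w) * jac (fst (l w)) (snd (l w))) = - Im (\<Lambda> l)"
    using jac_lin[OF sg e sub \<eta>] unfolding \<Lambda>_def u_def v_def prod.collapse .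
  obtain S where S: "\<And>n. (LINT z:?Q|lborel. (norm (?h n z))\<^sup>2) \<le> S" using EB[OF compact_sq sub] by blast
  define S' where "S' = \<bar>S\<bar> + measure lborel ?Q + 1"
  have S'0: "S' > 0" by (simp add: S'_def add_nonneg_pos)
  have S': "(LINT z:?Q|lborel. norm (?h n z)) \<le> S'" for n
  proof -
    have "(LINT z:?Q|lborel. norm (?h n z)) \<le> 1 * measure lborel ?Q + (LINT z:?Q|lborel. (norm (?h n z))\<^sup>2) / 1"
      by (rule L1_from_L2[OF h compact_sq sub]) simp
    then show ?thesis using S[of n] unfolding S'_def by simp
  qed
  obtain c where c: "\<And>j. (LINT z:?Q|lborel. (norm (l z - k j z))\<^sup>2) \<le> c * (1 / 4) ^ j" using kl[OF compact_sq sub] by blast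
  have kL: "L2loc \<Omega> (k j)" for j by (rule L2loc_mid[OF k]) (use h in auto)
  have "wen e z0 l \<le> - \<kappa> / 2 * Im (\<Lambda> l) + \<epsilon>" if \<epsilon>: "\<epsilon> > 0" for \<epsilon>
  proof -
    \<comment> \<open>Budget for \<epsilon>: a quarter for exchanging the coefficients, a quarter
      for the functional at \<open>k j\<close> against l, and two quarters for the two error terms
      of \<open>wen_diff\<close>.\<close>
    define \<delta> where "\<delta> = \<epsilon> / (4 * \<kappa> * B * S')"
    have \<delta>: "\<delta> > 0" using \<epsilon> k0 B0 S'0 by (simp add: \<delta>_def)
    obtain N where N: "\<And>n z. n \<ge> N \<Longrightarrow> z \<in> ?Q \<Longrightarrow> norm (f n z - g z) \<le> \<delta>"
      using uniform_limit_eventually_le[OF U[OF compact_sq sub] \<delta>] by blast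
    \<comment> \<open>With the coefficients frozen at g the functional is the same for all n, which
      is what makes the inequality stable under midpoints.\<close>
    have base: "wen e z0 (?h n) \<le> - \<kappa> / 2 * Im (\<Lambda> (?h n)) + \<epsilon> / 4" if n: "n \<ge> N" for n
    proof -
      have fc: "continuous_on ?Q (f n)" using sobD(2)[OF qr_sob[OF q]] sub continuous_on_subset by blast
      obtain Fb where Fb: "Fb > 0" "\<And>z. z \<in> ?Q \<Longrightarrow> norm (f n z) \<le> Fb" using bounded_on_compact[OF fc compact_sq] by blast
      define \<Lambda>' where "\<Lambda>' = lin ?Q (u (f n)) (v (f n)) (?h n)"
      have "wen e z0 (?h n) \<le> \<kappa> * (LINT w:?Q|lborel. moll e (z0 - w) * jac (a n w) (b n w))"
        by (rule weighted_energy_le[OF q e sub h])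
      also have "\<dots> = \<kappa> / 2 * (2 * (LINT w:?Q|lborel. moll e (z0 - w) * jac (a n w) (b n w)))" by simp
      also have "2 * (LINT w:?Q|lborel. moll e (z0 - w) * jac (a n w) (b n w)) = - Im \<Lambda>'"
        unfolding \<Lambda>'_def u_def v_def by (rule jac_lin[OF qr_sob[OF q] e sub \<eta>])
      also have "\<kappa> / 2 * (- Im \<Lambda>') = - \<kappa> / 2 * Im \<Lambda>'" by simp
      finally have 1: "wen e z0 (?h n) \<le> - \<kappa> / 2 * Im \<Lambda>'" .
      have "\<Lambda>' - \<Lambda> (?h n) = lin ?Q (u (\<lambda>w. f n w - g w)) (v (\<lambda>w. f n w - g w)) (?h n)"
      proof -
        have i1: "set_integrable lborel ?Q (\<lambda>z. u (f n) z * fst (?h n z) + v (f n) z * snd (?h n z))"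
          by (rule lin_integrable(1)[OF h compact_sq sub uvm[OF fm] uvb(1)[where F = "f n", OF _ Fb(2)] uvb(2)[where F = "f n", OF _ Fb(2)]])
        have i2: "set_integrable lborel ?Q (\<lambda>z. u g z * fst (?h n z) + v g z * snd (?h n z))"
          by (rule lin_integrable(1)[OF h compact_sq sub uvm[OF gm] uvb(1)[where F = g, OF _ G(2)] uvb(2)[where F = g, OF _ G(2)]])
        show ?thesis
          unfolding \<Lambda>'_def \<Lambda>_def lin_def set_integral_diff(2)[OF i1 i2, symmetric]
          by (intro arg_cong[where f = "\<lambda>F. set_lebesgue_integral lborel ?Q F"] ext) (simp add: u_def v_def algebra_simps)
      qed
      also have "norm \<dots> \<le> 2 * (\<delta> * B) * (LINT z:?Q|lborel. norm (?h n z))"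
      proof (rule lin_integrable(2)[OF h compact_sq sub])
        show "u (\<lambda>w. f n w - g w) \<in> borel_measurable borel" "v (\<lambda>w. f n w - g w) \<in> borel_measurable borel"
          by (intro uvm borel_measurable_diff fm gm)+
        show "norm (u (\<lambda>w. f n w - g w) z) \<le> \<delta> * B" "norm (v (\<lambda>w. f n w - g w) z) \<le> \<delta> * B" if "z \<in> ?Q" for z
          using uvb[OF that, of "\<lambda>w. f n w - g w" \<delta>] N[OF n that] by auto
      qed
      also have "\<dots> \<le> 2 * (\<delta> * B) * S'" using S' \<delta> B0 by (intro mult_left_mono) auto
      finally have "norm (\<Lambda>' - \<Lambda> (?h n)) \<le> 2 * (\<delta> * B) * S'" .
      then have "\<bar>Im \<Lambda>' - Im (\<Lambda> (?h n))\<bar> \<le> 2 * (\<delta> * B) * S'"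
        using abs_Im_le_cmod[of "\<Lambda>' - \<Lambda> (?h n)"] by simp
      then have "\<kappa> / 2 * (Im (\<Lambda> (?h n)) - Im \<Lambda>') \<le> \<kappa> / 2 * (2 * (\<delta> * B) * S')"
        using k0 by (intro mult_left_mono) auto
      also have "\<dots> = \<epsilon> / 4" using k0 B0 S'0 by (simp add: \<delta>_def)
      finally have "\<kappa> / 2 * (Im (\<Lambda> (?h n)) - Im \<Lambda>') \<le> \<epsilon> / 4" .
      then show ?thesis using 1 by (simp add: algebra_simps)
    qed
    have mid: "L2loc \<Omega> x \<and> wen e z0 x \<le> - \<kappa> / 2 * Im (\<Lambda> x) + \<epsilon> / 4" if "x \<in> mid {?h m |m. m \<ge> N}" for x
      using that
    proof induction
      case (base x)
      then show ?case using \<open>\<And>n. n \<ge> N \<Longrightarrow> _\<close> h by auto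
    next
      case (half x y)
      have "\<Lambda> (\<lambda>z. (1 / 2) *\<^sub>R (x z + y z)) = (1 / 2) * \<Lambda> x + (1 / 2) * \<Lambda> y"
        unfolding \<Lambda>_def using half by (intro lin_half[OF _ _ compact_sq sub uvm[OF gm] uvb(1)[where F = g, OF _ G(2)] uvb(2)[where F = g, OF _ G(2)]]) auto
      then have "Im (\<Lambda> (\<lambda>z. (1 / 2) *\<^sub>R (x z + y z))) = (1 / 2) * Im (\<Lambda> x) + (1 / 2) * Im (\<Lambda> y)" by simp
      moreover have "wen e z0 (\<lambda>z. (1 / 2) *\<^sub>R (x z + y z)) \<le> (1 / 2) * wen e z0 x + (1 / 2) * wen e z0 y"
        using half by (intro wen_half[OF e sub]) auto
      ultimately have "wen e z0 (\<lambda>z. (1 / 2) *\<^sub>R (x z + y z)) \<le> - \<kappa> / 2 * Im (\<Lambda> (\<lambda>z. (1 / 2) *\<^sub>R (x z + y z))) + \<epsilon> / 4"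
        using half by (simp add: algebra_simps)
      then show ?case using half L2loc_half by blast
    qed
    define El where "El = (LINT w:?Q|lborel. (norm (l w))\<^sup>2)"
    have El: "El \<ge> 0" unfolding El_def by (rule set_integral_nonneg) simp
    define bb where "bb = (bmax / e)\<^sup>2"
    have bb: "bb > 0" using bmax(1) e by (simp add: bb_def)
    define t where "t = \<epsilon> / (8 * bb * (El + 1))"
    have t: "t > 0" using \<epsilon> bb El by (simp add: t_def)
    have t2: "bb * (2 * t * El) \<le> \<epsilon> / 4"
    proof -
      have "bb * (2 * t * El) \<le> bb * (2 * t * (El + 1))" using bb t by (intro mult_left_mono) auto
      also have "\<dots> = \<epsilon> / 4" using bb El by (simp add: t_def)
      finally show ?thesis .
    qed
    obtain N1 where N1: "\<And>j. j \<ge> N1 \<Longrightarrow> norm (\<Lambda> l - \<Lambda> (k j)) < \<epsilon> / (2 * \<kappa>)"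
      unfolding \<Lambda>_def
      using lin_limit[OF k h l compact_sq sub c uvm[OF gm] uvb(1)[where F = g, OF _ G(2)] uvb(2)[where F = g, OF _ G(2)], of "\<epsilon> / (2 * \<kappa>)"] \<epsilon> k0 by auto
    obtain N2 where N2: "\<And>j. j \<ge> N2 \<Longrightarrow> (bb * (1 + 2 / t) * c) * (1 / 4) ^ j < \<epsilon> / 4"
      using geometric_small[of "\<epsilon> / 4" "bb * (1 + 2 / t) * c"] \<epsilon> by auto
    define j where "j = max N (max N1 N2)"
    have kj: "k j \<in> mid {?h m |m. m \<ge> N}"
      using k[of j] mid_mono[of "{?h m |m. m \<ge> j}" "{?h m |m. m \<ge> N}"] by (auto simp: j_def)
    have 1: "wen e z0 (k j) \<le> - \<kappa> / 2 * Im (\<Lambda> (k j)) + \<epsilon> / 4" using mid[OF kj] by blast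
    have jN: "N1 \<le> j" "N2 \<le> j" by (auto simp: j_def)
    have "\<bar>Im (\<Lambda> l) - Im (\<Lambda> (k j))\<bar> \<le> \<epsilon> / (2 * \<kappa>)"
      using N1[OF jN(1)] abs_Im_le_cmod[of "\<Lambda> l - \<Lambda> (k j)"] unfolding minus_complex.sel by linarith
    then have "\<kappa> / 2 * (Im (\<Lambda> l) - Im (\<Lambda> (k j))) \<le> \<kappa> / 2 * (\<epsilon> / (2 * \<kappa>))"
      using k0 by (intro mult_left_mono) auto
    also have "\<dots> = \<epsilon> / 4" using k0 by simp
    finally have 2: "\<kappa> / 2 * Im (\<Lambda> l) - \<kappa> / 2 * Im (\<Lambda> (k j)) \<le> \<epsilon> / 4" by (simp add: algebra_simps)
    have "wen e z0 l \<le> wen e z0 (k j) + bb * (2 * t * El + (1 + 2 / t) * (LINT w:?Q|lborel. (norm (l w - k j w))\<^sup>2))"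
      unfolding bb_def El_def by (rule wen_diff[OF e sub l kL t])
    also have "\<dots> \<le> wen e z0 (k j) + bb * (2 * t * El + (1 + 2 / t) * (c * (1 / 4) ^ j))"
      using bb t c[of j] by (intro add_left_mono mult_left_mono) (auto simp: add_nonneg_nonneg)
    also have "\<dots> = wen e z0 (k j) + bb * (2 * t * El) + (bb * (1 + 2 / t) * c) * (1 / 4) ^ j"
      by (simp add: algebra_simps)
    also have "\<dots> \<le> wen e z0 (k j) + \<epsilon> / 4 + \<epsilon> / 4" using t2 N2[OF jN(2)] by linarith
    finally have 3: "wen e z0 l \<le> wen e z0 (k j) + \<epsilon> / 4 + \<epsilon> / 4" .
    have "- \<kappa> / 2 * Im (\<Lambda> x) = - (\<kappa> / 2 * Im (\<Lambda> x))" for x by simp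
    then show ?thesis using 1 2 3 by linarith
  qed
  then have "wen e z0 l \<le> - \<kappa> / 2 * Im (\<Lambda> l)" by (rule field_le_epsilon)
  also have "\<dots> = \<kappa> / 2 * (- Im (\<Lambda> l))" by simp
  also have "\<dots> = \<kappa> / 2 * (2 * (LINT w:?Q|lborel. moll e (z0 - w) * jac (fst (l w)) (snd (l w))))"
    unfolding J ..
  also have "\<dots> = \<kappa> * (LINT w:?Q|lborel. moll e (z0 - w) * jac (fst (l w)) (snd (l w)))" by simp
  finally show ?thesis .
qed

text \<open>The hypothesis says that all mollifications of the defect h, Jacobian times \<kappa>
  minus energy, are non-negative. Where h is negative its absolute value is thus at most the
  distance from h to its mollification, and that distance tends to 0 in L^1. Hence the negative part
  of h vanishes almost everywhere locally, and \<open>AE_locally\<close> collects the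
  neighbourhoods.\<close>

lemma qr_from_weighted_energy:
  assumes \<Omega>: "open \<Omega>" and k0: "\<kappa> > 0" and s: "sob \<Omega> g a b"
    and W: "\<And>z0 e. e > 0 \<Longrightarrow> sq z0 e \<subseteq> \<Omega> \<Longrightarrow> (LINT w:sq z0 e|lborel. moll e (z0 - w) * en (a w) (b w))
       \<le> \<kappa> * (LINT w:sq z0 e|lborel. moll e (z0 - w) * jac (a w) (b w))"
  shows "qr \<kappa> \<Omega> g a b"
  unfolding qr_def
proof (intro conjI s AE_locally)
  note sd [measurable] = sobD(3-5)[OF s]
  fix z0 assume "z0 \<in> \<Omega>"
  then obtain r where r: "r > 0" "sq z0 r \<subseteq> \<Omega>" using sq_subset_ball[OF \<Omega>] by blast
  define h where "h z = \<kappa> * jac (a z) (b z) - en (a z) (b z)" for z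
  define v where "v z = indicator (sq z0 r) z *\<^sub>R complex_of_real (h z)" for z
  have hm [measurable]: "h \<in> borel_measurable borel" unfolding h_def by measurable
  have vm [measurable]: "v \<in> borel_measurable borel" unfolding v_def by measurable
  note si = sob_integrable[OF s r(2)]
  have hi: "set_integrable lborel (sq z0 r) h"
    unfolding h_def using si by (intro set_integral_diff) auto
  have vi: "integrable lborel v"
  proof -
    have "integrable lborel (\<lambda>z. complex_of_real (indicator (sq z0 r) z *\<^sub>R h z))"
      using hi unfolding set_integrable_def by (rule integrable_of_real)
    moreover have "(\<lambda>z. complex_of_real (indicator (sq z0 r) z *\<^sub>R h z)) = v"
      by (auto simp: v_def fun_eq_iff indicator_def)
    ultimately show ?thesis by simp
  qed
  have Lp: "Lp 1 v" unfolding Lp_def using vm vi[unfolded integrable_iff_bounded] by simp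
  define X where "X z = ennreal (indicator (sq z0 (r / 2)) z * max 0 (- h z))" for z
  have Xm [measurable]: "X \<in> borel_measurable borel" unfolding X_def by measurable
  have "(\<integral>\<^sup>+z. X z \<partial>lborel) \<le> 0 + ennreal d" if d: "d > 0" for d
  proof -
    obtain e0 where e0: "e0 > 0" "\<And>e. 0 < e \<Longrightarrow> e < e0 \<Longrightarrow> (\<integral>\<^sup>+z. pw 1 (conv e v z - v z) \<partial>lborel) \<le> ennreal d"
      using conv_tendsto[OF Lp _ d] by auto
    define e where "e = min (e0 / 2) (r / 2)"
    have e: "e > 0" "e < e0" "e \<le> r / 2" using e0(1) r(1) by (auto simp: e_def)
    have "(\<integral>\<^sup>+z. X z \<partial>lborel) \<le> (\<integral>\<^sup>+z. pw 1 (conv e v z - v z) \<partial>lborel)"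
    proof (rule nn_integral_mono)
      fix z
      show "X z \<le> pw 1 (conv e v z - v z)"
      proof (cases "z \<in> sq z0 (r / 2)")
        case True
        have subQ: "sq z e \<subseteq> sq z0 r" using True e(3) by (intro sq_subset) (auto simp: mem_sq)
        have zr: "z \<in> sq z0 r" using True r(1) by (auto simp: mem_sq)
        have sub: "sq z e \<subseteq> \<Omega>" using subQ r(2) by blast
        note siz = sob_integrable[OF s sub]
        have m1: "set_integrable lborel (sq z e) (\<lambda>w. moll e (z - w) * en (a w) (b w))"
          by (rule set_integrable_dominated[where F = "\<lambda>w. (bmax / e)\<^sup>2 * en (a w) (b w)"])
             (use siz(1) moll_le[OF e(1)] moll_nonneg[OF e(1)] in \<open>auto simp: abs_mult intro!: mult_right_mono\<close>)
        have m2: "set_integrable lborel (sq z e) (\<lambda>w. moll e (z - w) * jac (a w) (b w))"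
          by (rule set_integrable_dominated[OF m1])
             (use moll_nonneg[OF e(1)] abs_jac_le in \<open>auto simp: abs_mult intro!: mult_left_mono\<close>)
        have "conv e v z = (LINT w|lborel. complex_of_real (indicator (sq z e) w *\<^sub>R (moll e (z - w) * h w)))"
          unfolding conv_def
        proof (rule Bochner_Integration.integral_cong[OF refl])
          fix w show "moll e (z - w) *\<^sub>R v w = complex_of_real (indicator (sq z e) w *\<^sub>R (moll e (z - w) * h w))"
            using subQ moll_out[OF e(1), of w z] by (cases "w \<in> sq z e") (auto simp: v_def scaleR_conv_of_real)
        qed
        also have "\<dots> = complex_of_real (LINT w:sq z e|lborel. moll e (z - w) * h w)"
          unfolding set_lebesgue_integral_def by (rule integral_complex_of_real)
        finally have c: "Re (conv e v z) = (LINT w:sq z e|lborel. moll e (z - w) * h w)" by simp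
        have "(LINT w:sq z e|lborel. moll e (z - w) * h w) = (LINT w:sq z e|lborel. \<kappa> * (moll e (z - w) * jac (a w) (b w)) - moll e (z - w) * en (a w) (b w))"
          by (intro arg_cong[where f = "\<lambda>F. set_lebesgue_integral lborel (sq z e) F"] ext) (simp add: h_def algebra_simps)
        also have "\<dots> = (LINT w:sq z e|lborel. \<kappa> * (moll e (z - w) * jac (a w) (b w))) - (LINT w:sq z e|lborel. moll e (z - w) * en (a w) (b w))"
          by (rule set_integral_diff(2)[OF set_integrable_mult_right[OF m2] m1])
        also have "(LINT w:sq z e|lborel. \<kappa> * (moll e (z - w) * jac (a w) (b w))) = \<kappa> * (LINT w:sq z e|lborel. moll e (z - w) * jac (a w) (b w))"
          by (rule set_integral_mult_right)
        finally have "Re (conv e v z) \<ge> 0" using W[OF e(1) sub] c by simp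
        moreover have "Re (v z) = h z" using zr by (simp add: v_def)
        ultimately have "- h z \<le> norm (conv e v z - v z)"
          using complex_Re_le_cmod[of "conv e v z - v z"] by simp
        then show ?thesis using True by (simp add: X_def ennreal_leI)
      qed (simp add: X_def)
    qed
    also have "\<dots> \<le> ennreal d" by (rule e0(2)[OF e(1,2)])
    finally show ?thesis by simp
  qed
  then have "(\<integral>\<^sup>+z. X z \<partial>lborel) \<le> 0" by (rule ennreal_le_epsilon)
  then have "(\<integral>\<^sup>+z. X z \<partial>lborel) = 0" by simp
  then have "AE z in lborel. X z = 0" by (subst (asm) nn_integral_0_iff_AE) auto
  then have ae: "AE z in lborel. z \<in> ball z0 (r / 2) \<longrightarrow> en (a z) (b z) \<le> \<kappa> * jac (a z) (b z)"
  proof eventually_elim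
    case (elim z)
    show ?case
    proof
      assume "z \<in> ball z0 (r / 2)"
      then have "z \<in> sq z0 (r / 2)"
        using abs_Re_le_cmod[of "z - z0"] abs_Im_le_cmod[of "z - z0"] by (simp add: mem_sq dist_norm norm_minus_commute)
      then have "max 0 (- h z) \<le> 0" using elim by (simp add: X_def ennreal_eq_0_iff)
      then show "en (a z) (b z) \<le> \<kappa> * jac (a z) (b z)" by (simp add: h_def)
    qed
  qed
  show "\<exists>U. open U \<and> z0 \<in> U \<and> (AE z in lborel. z \<in> U \<longrightarrow> en (a z) (b z) \<le> \<kappa> * jac (a z) (b z))"
    using ae r(1) by (intro exI[of _ "ball z0 (r / 2)"]) simp
qed

theorem qr_closed:
  assumes \<Omega>: "open \<Omega>" and k0: "\<kappa> > 0" and q: "\<And>n. qr \<kappa> \<Omega> (f n) (a n) (b n)"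
    and gc: "continuous_on \<Omega> g" and gm: "g \<in> borel_measurable borel"
    and U: "\<And>C. compact C \<Longrightarrow> C \<subseteq> \<Omega> \<Longrightarrow> uniform_limit C f g sequentially"
    and EB: "\<And>C. compact C \<Longrightarrow> C \<subseteq> \<Omega> \<Longrightarrow> \<exists>B. \<forall>n. (LINT z:C|lborel. en (a n z) (b n z)) \<le> B"
  obtains a' b' where "qr \<kappa> \<Omega> g a' b'"
proof -
  have h: "L2loc \<Omega> (\<lambda>z. (a n z, b n z))" for n
    unfolding L2loc_def norm_eq_en fst_conv snd_conv
    using sobD(4-6)[OF qr_sob[OF q]] by (auto intro!: borel_measurable_Pair)
  have EB': "\<exists>B. \<forall>n. (LINT z:C|lborel. (norm (a n z, b n z))\<^sup>2) \<le> B" if "compact C" "C \<subseteq> \<Omega>" for C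
    using EB[OF that] unfolding norm_eq_en by simp
  obtain k l where k: "\<And>j. k j \<in> mid {(\<lambda>z. (a m z, b m z)) |m. m \<ge> j}" and l: "L2loc \<Omega> l"
    and kl: "\<And>C. compact C \<Longrightarrow> C \<subseteq> \<Omega> \<Longrightarrow> \<exists>c. c \<ge> 0 \<and> (\<forall>j. set_integrable lborel C (\<lambda>z. (norm (l z - k j z))\<^sup>2) \<and>
       (LINT z:C|lborel. (norm (l z - k j z))\<^sup>2) \<le> c * (1 / 4) ^ j)"
    by (rule local_weak_limit[OF \<Omega> h EB']) (assumption | rule that)+
  have sg: "sob \<Omega> g (\<lambda>z. fst (l z)) (\<lambda>z. snd (l z))"
    by (rule weak_limit_sob[OF \<Omega> qr_sob[OF q] gc gm U h l k kl])
  have "qr \<kappa> \<Omega> g (\<lambda>z. fst (l z)) (\<lambda>z. snd (l z))"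
  proof (rule qr_from_weighted_energy[OF \<Omega> k0 sg])
    fix z0 e assume "(e::real) > 0" "sq z0 e \<subseteq> \<Omega>"
    from limit_weighted_energy[OF k0 q sg U h l EB' k kl this]
    show "(LINT w:sq z0 e|lborel. moll e (z0 - w) * en (fst (l w)) (snd (l w)))
       \<le> \<kappa> * (LINT w:sq z0 e|lborel. moll e (z0 - w) * jac (fst (l w)) (snd (l w)))"
      unfolding wen_def norm_eq_en .
  qed
  then show ?thesis by (rule that)
qed

section \<open>Normal families\<close>

lemma ball_subset_sq: "ball z r \<subseteq> sq z r"
proof
  fix w assume "w \<in> ball z r"
  then show "w \<in> sq z r"
    using abs_Re_le_cmod[of "w - z"] abs_Im_le_cmod[of "w - z"] by (simp add: mem_sq dist_norm norm_minus_commute)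
qed

lemma finite_subcover_bound:
  fixes Q :: "'i \<Rightarrow> complex \<Rightarrow> real"
  assumes C: "compact C" and loc: "\<And>z. z \<in> C \<Longrightarrow> \<exists>U B. open U \<and> z \<in> U \<and> (\<forall>i\<in>I. \<forall>x\<in>U. Q i x \<le> B)"
  shows "\<exists>B>0. \<forall>i\<in>I. \<forall>x\<in>C. Q i x \<le> B"
proof -
  obtain U B where U: "\<And>z. z \<in> C \<Longrightarrow> open (U z)" "\<And>z. z \<in> C \<Longrightarrow> z \<in> U z"
    and B: "\<And>z i x. z \<in> C \<Longrightarrow> i \<in> I \<Longrightarrow> x \<in> U z \<Longrightarrow> Q i x \<le> B z"
    using loc by metis
  obtain D where D: "D \<subseteq> C" "finite D" "C \<subseteq> (\<Union>c\<in>D. U c)"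
    using compactE_image[OF C, of C U] U by blast
  have "Q i x \<le> (\<Sum>d\<in>D. \<bar>B d\<bar>) + 1" if "i \<in> I" "x \<in> C" for i x
  proof -
    obtain d where d: "d \<in> D" "x \<in> U d" using D(3) \<open>x \<in> C\<close> by blast
    have "Q i x \<le> B d" using B d D(1) \<open>i \<in> I\<close> by blast
    also have "\<dots> \<le> \<bar>B d\<bar>" by simp
    also have "\<dots> \<le> (\<Sum>d\<in>D. \<bar>B d\<bar>)" using member_le_sum[of d D "\<lambda>d. \<bar>B d\<bar>"] d(1) D(2) by simp
    finally show ?thesis by simp
  qed
  moreover have "(\<Sum>d\<in>D. \<bar>B d\<bar>) + 1 > 0" by (simp add: sum_nonneg add_nonneg_pos)
  ultimately show ?thesis by blast
qed

text \<open>Caccioppoli converts the sup bound into an energy bound on small squares. Finitely many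
  of them cover the compact set, and overlaps only enlarge the sum.\<close>

lemma energy_bound_compact:
  assumes \<Omega>: "open \<Omega>" and k0: "\<kappa> > 0" and q: "\<And>n. qr \<kappa> \<Omega> (f n) (a n) (b n)"
    and sup: "\<And>C. compact C \<Longrightarrow> C \<subseteq> \<Omega> \<Longrightarrow> \<exists>B>0. \<forall>n. \<forall>x\<in>C. norm (f n x) \<le> B"
    and C: "compact C" "C \<subseteq> \<Omega>"
  shows "\<exists>B. \<forall>n. (LINT z:C|lborel. en (a n z) (b n z)) \<le> B"
proof -
  have "\<exists>r B. r > 0 \<and> sq z r \<subseteq> \<Omega> \<and> (\<forall>n. (LINT w:sq z r|lborel. en (a n w) (b n w)) \<le> B)" if z: "z \<in> \<Omega>" for z
  proof -
    obtain r where r: "r > 0" "sq z r \<subseteq> \<Omega>" using sq_subset_ball[OF \<Omega> z] by blast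
    obtain B where B: "B > 0" "\<And>n x. x \<in> sq z r \<Longrightarrow> norm (f n x) \<le> B" using sup[OF compact_sq r(2)] by blast
    have "(LINT w:sq z (r / 2)|lborel. en (a n w) (b n w)) \<le> 32 * \<kappa>\<^sup>2 / r\<^sup>2 * (4 * r\<^sup>2 * B\<^sup>2)" for n
    proof -
      have "(LINT w:sq z (r / 2)|lborel. en (a n w) (b n w)) \<le> 32 * \<kappa>\<^sup>2 / r\<^sup>2 * (LINT w:sq z r|lborel. (norm (f n w))\<^sup>2)"
        by (rule Caccioppoli[OF q k0 r])
      also have "\<dots> \<le> 32 * \<kappa>\<^sup>2 / r\<^sup>2 * (LINT w:sq z r|lborel. B\<^sup>2)"
        by (intro mult_left_mono set_integral_mono norm_f_integrable(1)[OF qr_sob[OF q] r(2)] set_integrable_const_sq power_mono B) auto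
      also have "(LINT w:sq z r|lborel. B\<^sup>2) = 4 * r\<^sup>2 * B\<^sup>2" using r(1) by (simp add: set_integral_const_sq)
      finally show ?thesis .
    qed
    moreover have "sq z (r / 2) \<subseteq> \<Omega>" using sq_mono[of "r / 2" r z] r by auto
    ultimately show ?thesis using half_gt_zero[OF r(1)] by blast
  qed
  then obtain r B where r: "\<And>z. z \<in> \<Omega> \<Longrightarrow> r z > 0" "\<And>z. z \<in> \<Omega> \<Longrightarrow> sq z (r z) \<subseteq> \<Omega>"
    and B: "\<And>z n. z \<in> \<Omega> \<Longrightarrow> (LINT w:sq z (r z)|lborel. en (a n w) (b n w)) \<le> B z" by metis
  have "C \<subseteq> (\<Union>c\<in>C. ball c (r c))" using r(1) C(2) by force
  then obtain D where D: "D \<subseteq> C" "finite D" "C \<subseteq> (\<Union>c\<in>D. ball c (r c))"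
    using compactE_image[OF C(1), of C "\<lambda>c. ball c (r c)"] by auto
  have "(LINT z:C|lborel. en (a n z) (b n z)) \<le> (\<Sum>d\<in>D. B d)" for n
  proof -
    note sb = qr_sob[OF q[of n]]
    have iC: "integrable lborel (\<lambda>z. indicator C z *\<^sub>R en (a n z) (b n z))"
      using sobD(6)[OF sb C] by (simp add: set_integrable_def)
    have iD: "integrable lborel (\<lambda>z. indicator (sq d (r d)) z *\<^sub>R en (a n z) (b n z))" if "d \<in> D" for d
      using sob_integrable(1)[OF sb r(2)] that D(1) C(2) by (auto simp: set_integrable_def)
    have "(LINT z:C|lborel. en (a n z) (b n z)) \<le> (LINT z|lborel. (\<Sum>d\<in>D. indicator (sq d (r d)) z *\<^sub>R en (a n z) (b n z)))"
      unfolding set_lebesgue_integral_def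
    proof (rule integral_mono[OF iC])
      show "integrable lborel (\<lambda>z. \<Sum>d\<in>D. indicator (sq d (r d)) z *\<^sub>R en (a n z) (b n z))"
        by (rule Bochner_Integration.integrable_sum[OF iD])
      fix z
      have nn: "0 \<le> (\<Sum>d\<in>D. indicator (sq d (r d)) z *\<^sub>R en (a n z) (b n z))" by (intro sum_nonneg) auto
      show "indicator C z *\<^sub>R en (a n z) (b n z) \<le> (\<Sum>d\<in>D. indicator (sq d (r d)) z *\<^sub>R en (a n z) (b n z))"
      proof (cases "z \<in> C")
        case True
        then obtain d where d: "d \<in> D" "z \<in> sq d (r d)" using D(3) ball_subset_sq by blast
        have "indicator C z *\<^sub>R en (a n z) (b n z) = indicator (sq d (r d)) z *\<^sub>R en (a n z) (b n z)" using True d by simp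
        also have "\<dots> \<le> (\<Sum>d\<in>D. indicator (sq d (r d)) z *\<^sub>R en (a n z) (b n z))"
          by (rule member_le_sum[OF d(1) _ D(2)]) auto
        finally show ?thesis .
      qed (use nn in simp)
    qed
    also have "\<dots> = (\<Sum>d\<in>D. LINT z:sq d (r d)|lborel. en (a n z) (b n z))"
      unfolding set_lebesgue_integral_def by (rule Bochner_Integration.integral_sum[OF iD])
    also have "\<dots> \<le> (\<Sum>d\<in>D. B d)" using B D(1) C(2) by (intro sum_mono) auto
    finally show ?thesis .
  qed
  then show ?thesis by blast
qed

section \<open>Uniform bounds and convergent subsequences\<close>

lemma powr_min_le:
  fixes x p :: real assumes "x \<ge> 0" "p > 0"
  shows "x powr (min p 2) \<le> 1 + x powr p"
proof (cases "x \<le> 1")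
  case True
  then have "x powr (min p 2) \<le> 1" using assms by (intro powr_le1) auto
  then show ?thesis using powr_ge_zero[of x p] by linarith
next
  case False
  then have "x powr (min p 2) \<le> x powr p" by (intro powr_mono) auto
  then show ?thesis by linarith
qed

lemma Lp_bound_lborel:
  assumes \<Omega>: "open \<Omega>" and c: "continuous_on \<Omega> f" and p: "p > 0"
    and i: "set_integrable lebesgue \<Omega> (\<lambda>z. cmod (f z) powr p)"
    and L: "(LINT z:\<Omega>|lebesgue. cmod (f z) powr p) powr (1 / p) \<le> M"
  shows "integrable lborel (\<lambda>z. cmod (ext0 \<Omega> f z) powr p)" "(LINT z|lborel. cmod (ext0 \<Omega> f z) powr p) \<le> M powr p"
proof -
  note em [measurable] = ext0_facts(1)[OF \<Omega> c]
  have eq: "(\<lambda>z. indicator \<Omega> z *\<^sub>R cmod (f z) powr p) = (\<lambda>z. cmod (ext0 \<Omega> f z) powr p)"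
    by (auto simp: fun_eq_iff indicator_def)
  have m: "(\<lambda>z. cmod (ext0 \<Omega> f z) powr p) \<in> borel_measurable lborel" by measurable
  show "integrable lborel (\<lambda>z. cmod (ext0 \<Omega> f z) powr p)"
    using i integrable_completion[OF m] unfolding set_integrable_def eq by simp
  define I where "I = (LINT z|lborel. cmod (ext0 \<Omega> f z) powr p)"
  have I0: "I \<ge> 0" by (simp add: I_def)
  have "(LINT z:\<Omega>|lebesgue. cmod (f z) powr p) = I"
    unfolding set_lebesgue_integral_def eq I_def by (rule integral_completion[OF m])
  then have "I powr (1 / p) \<le> M" using L by simp
  then have "(I powr (1 / p)) powr p \<le> M powr p" using p by (intro powr_mono2) auto
  then show "(LINT z|lborel. cmod (ext0 \<Omega> f z) powr p) \<le> M powr p"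
    using p I0 unfolding I_def[symmetric] by (simp add: powr_powr)
qed

text \<open>\<open>sup_Lp\<close> asks for an exponent of at most 2, so p is lowered to
  \<open>min p 2\<close>, at the cost of adding the area of the square to the integral. The bound is
  fixed before domain, map and centre, hence common to the whole family.\<close>

lemma local_sup_bound:
  assumes k0: "\<kappa> > 0" and p: "p > 0" and R: "R > 0"
  obtains B where "\<And>\<Omega> f a b z. qr \<kappa> \<Omega> f a b \<Longrightarrow> sq z R \<subseteq> \<Omega> \<Longrightarrow> integrable lborel (\<lambda>w. cmod (f w) powr p) \<Longrightarrow>
    (LINT w|lborel. cmod (f w) powr p) \<le> M \<Longrightarrow> cmod (f z) \<le> B"
proof -
  define p' where "p' = min p 2"
  have p': "0 < p'" "p' \<le> 2" using p by (auto simp: p'_def)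
  define Y where "Y = 16 * (supc \<kappa>)\<^sup>2 * (2 powr (2 / p')) powr (2 - p') * (4 * R\<^sup>2 + M)"
  show ?thesis
  proof (rule that)
    fix \<Omega> f a b z
    assume q: "qr \<kappa> \<Omega> f a b" and sub: "sq z R \<subseteq> \<Omega>" and i: "integrable lborel (\<lambda>w. cmod (f w) powr p)"
      and L: "(LINT w|lborel. cmod (f w) powr p) \<le> M"
    have fm [measurable]: "f \<in> borel_measurable borel" using sobD(3)[OF qr_sob[OF q]] .
    have ip: "set_integrable lborel (sq z R) (\<lambda>w. cmod (f w) powr p)"
      using i unfolding set_integrable_def by (intro integrable_mult_indicator) auto
    have i1: "set_integrable lborel (sq z R) (\<lambda>w. 1 + cmod (f w) powr p)"
      by (rule set_integral_add(1)[OF set_integrable_const_sq ip])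
    have i2: "set_integrable lborel (sq z R) (\<lambda>w. cmod (f w) powr p')"
      by (rule set_integrable_dominated[OF i1]) (use powr_min_le[OF _ p] in \<open>auto simp: p'_def\<close>)
    have "(LINT w:sq z R|lborel. cmod (f w) powr p') \<le> (LINT w:sq z R|lborel. 1 + cmod (f w) powr p)"
      by (rule set_integral_mono[OF i2 i1]) (use powr_min_le[OF _ p] in \<open>auto simp: p'_def\<close>)
    also have "\<dots> = 4 * R\<^sup>2 * 1 + (LINT w:sq z R|lborel. cmod (f w) powr p)"
      using set_integral_add(2)[OF set_integrable_const_sq ip, of 1] set_integral_const_sq[of R z 1] R by simp
    also have "(LINT w:sq z R|lborel. cmod (f w) powr p) \<le> (LINT w|lborel. cmod (f w) powr p)"
      unfolding set_lebesgue_integral_def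
      by (rule integral_mono[OF ip[unfolded set_integrable_def] i]) (auto simp: indicator_def)
    finally have L': "(LINT w:sq z R|lborel. cmod (f w) powr p') \<le> 4 * R\<^sup>2 + M" using L by simp
    have "cmod (f z) powr p' * R\<^sup>2 \<le> Y"
      unfolding Y_def by (rule sup_Lp[OF q k0 R sub p' i2 L'])
    then have "cmod (f z) powr p' \<le> Y / R\<^sup>2" using R by (simp add: pos_le_divide_eq)
    then have "(cmod (f z) powr p') powr (1 / p') \<le> (Y / R\<^sup>2) powr (1 / p')" using p' by (intro powr_mono2) auto
    then show "cmod (f z) \<le> (Y / R\<^sup>2) powr (1 / p')" using p' by (simp add: powr_powr)
  qed
qed

text \<open>A diagonal subsequence converges on a countable dense set. Near each point of the domain
  a finite net of such points and equicontinuity upgrade this to a uniform Cauchy condition on a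
  ball, so one subsequence serves the whole open set.\<close>

lemma subsequence_locally_uniform:
  fixes f :: "nat \<Rightarrow> complex \<Rightarrow> complex"
  assumes \<Omega>: "open \<Omega>" and B: "\<And>z. z \<in> \<Omega> \<Longrightarrow> \<exists>B>0. \<forall>n. norm (f n z) \<le> B"
    and eq: "\<And>z. z \<in> \<Omega> \<Longrightarrow> \<exists>R>0. ball z R \<subseteq> \<Omega> \<and> (\<forall>\<epsilon>>0. \<exists>\<delta>>0. \<forall>n. \<forall>x\<in>ball z R. \<forall>y\<in>ball z R. norm (x - y) < \<delta> \<longrightarrow> norm (f n x - f n y) \<le> \<epsilon>)"
  obtains r g where "strict_mono (r :: nat \<Rightarrow> nat)" "\<And>z. z \<in> \<Omega> \<Longrightarrow> \<exists>U. open U \<and> z \<in> U \<and> U \<subseteq> \<Omega> \<and> uniform_limit U (f \<circ> r) g sequentially"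
proof -
  obtain D :: "complex set" where D: "countable D" "\<And>X. open X \<Longrightarrow> X \<noteq> {} \<Longrightarrow> \<exists>d\<in>D. d \<in> X"
    using countable_dense_setE by metis
  obtain b where b: "\<And>z. z \<in> \<Omega> \<Longrightarrow> b z > 0" "\<And>z n. z \<in> \<Omega> \<Longrightarrow> norm (f n z) \<le> b z" using B by metis
  \<comment> \<open>Dividing by the pointwise bound brings all values into the unit disc, since the
    diagonal argument takes one bound for all points.\<close>
  define F where "F n z = (1 / b z) *\<^sub>R f n z" for n z
  have F1: "norm (F n z) \<le> 1" if "z \<in> D \<inter> \<Omega>" for n z
    using b(1)[of z] b(2)[of z n] that by (simp add: F_def divide_le_eq)
  have cD: "countable (D \<inter> \<Omega>)" using D(1) by blast
  obtain r :: "nat \<Rightarrow> nat" where r: "strict_mono r" "\<And>z. z \<in> D \<inter> \<Omega> \<Longrightarrow> \<exists>l. (\<lambda>n. F (r n) z) \<longlonglongrightarrow> l"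
    using function_convergent_subsequence[OF cD, of F 1, OF F1] by blast
  have conv: "Cauchy (\<lambda>n. f (r n) z)" if z: "z \<in> D \<inter> \<Omega>" for z
  proof -
    obtain l where l: "(\<lambda>n. F (r n) z) \<longlonglongrightarrow> l" using r(2)[OF z] by blast
    have eq: "b z *\<^sub>R F n z = f n z" for n using b(1)[of z] z by (simp add: F_def)
    have "(\<lambda>n. b z *\<^sub>R F (r n) z) \<longlonglongrightarrow> b z *\<^sub>R l" by (rule tendsto_scaleR[OF tendsto_const l])
    then have "(\<lambda>n. f (r n) z) \<longlonglongrightarrow> b z *\<^sub>R l" unfolding eq .
    then show ?thesis by (rule LIMSEQ_imp_Cauchy)
  qed
  \<comment> \<open>The limit is defined pointwise once, so the limits on overlapping balls agree
    automatically.\<close>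
  define g where "g z = lim (\<lambda>n. f (r n) z)" for z
  show ?thesis
  proof (rule that[OF r(1)])
    fix z assume "z \<in> \<Omega>"
    then obtain R where R: "R > 0" "ball z R \<subseteq> \<Omega>"
      and E: "\<And>\<epsilon>. \<epsilon> > 0 \<Longrightarrow> \<exists>\<delta>>0. \<forall>n. \<forall>x\<in>ball z R. \<forall>y\<in>ball z R. norm (x - y) < \<delta> \<longrightarrow> norm (f n x - f n y) \<le> \<epsilon>"
      using eq by meson
    have "uniformly_Cauchy_on (ball z (R / 2)) (\<lambda>n. f (r n))"
    proof (rule uniformly_Cauchy_onI)
      fix \<epsilon> :: real assume \<epsilon>: "\<epsilon> > 0"
      obtain \<delta> where \<delta>: "\<delta> > 0" "\<And>n x y. x \<in> ball z R \<Longrightarrow> y \<in> ball z R \<Longrightarrow> norm (x - y) < \<delta> \<Longrightarrow> norm (f n x - f n y) \<le> \<epsilon> / 4"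
        using E[of "\<epsilon> / 4"] \<epsilon> by auto
      \<comment> \<open>The closed half ball supplies compactness; the centres of the net may lie
        outside it but stay in \<open>ball z R\<close>, where equicontinuity is available.\<close>
      have "cball z (R / 2) \<subseteq> (\<Union>c\<in>D \<inter> ball z R. ball c \<delta>)"
      proof
        fix x assume x: "x \<in> cball z (R / 2)"
        have "x \<in> ball x \<delta> \<inter> ball z R" using x R(1) \<delta>(1) by (auto simp: dist_commute)
        then obtain d where "d \<in> D" "d \<in> ball x \<delta> \<inter> ball z R" using D(2)[of "ball x \<delta> \<inter> ball z R"] by blast
        then show "x \<in> (\<Union>c\<in>D \<inter> ball z R. ball c \<delta>)" by (auto simp: dist_commute)
      qed
      then obtain T where T: "T \<subseteq> D \<inter> ball z R" "finite T" "cball z (R / 2) \<subseteq> (\<Union>c\<in>T. ball c \<delta>)"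
        using compactE_image[OF compact_cball, of "D \<inter> ball z R" "\<lambda>c. ball c \<delta>" z "R / 2"] by auto
      have "\<exists>M. \<forall>m\<ge>M. \<forall>n\<ge>M. dist (f (r m) c) (f (r n) c) < \<epsilon> / 4" if "c \<in> T" for c
        using conv[of c] that T(1) R(2) \<epsilon> unfolding Cauchy_def by (metis (no_types, lifting) IntE IntI divide_pos_pos subsetD zero_less_numeral)
      then obtain M where M: "\<And>c m n. c \<in> T \<Longrightarrow> m \<ge> M c \<Longrightarrow> n \<ge> M c \<Longrightarrow> dist (f (r m) c) (f (r n) c) < \<epsilon> / 4" by metis
      define N where "N = Max (insert 0 (M ` T))"
      have N: "M c \<le> N" if "c \<in> T" for c using T(2) that by (simp add: N_def)
      have "dist (f (r m) x) (f (r n) x) < \<epsilon>" if x: "x \<in> ball z (R / 2)" and mn: "m \<ge> N" "n \<ge> N" for x m n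
      proof -
        obtain c where c: "c \<in> T" "x \<in> ball c \<delta>" using T(3) x by force
        have xR: "x \<in> ball z R" using x R(1) by simp
        have cR: "c \<in> ball z R" using c T(1) by blast
        have d: "norm (x - c) < \<delta>" using c(2) by (simp add: dist_norm norm_minus_commute)
        have "dist (f (r m) x) (f (r n) x) \<le> dist (f (r m) x) (f (r m) c) + dist (f (r m) c) (f (r n) c) + dist (f (r n) c) (f (r n) x)"
          by metric
        also have "dist (f (r m) x) (f (r m) c) \<le> \<epsilon> / 4" using \<delta>(2)[OF xR cR d] by (simp add: dist_norm)
        also have "dist (f (r n) c) (f (r n) x) \<le> \<epsilon> / 4" using \<delta>(2)[OF xR cR d] by (simp add: dist_norm norm_minus_commute)
        also have "dist (f (r m) c) (f (r n) c) < \<epsilon> / 4" using M[OF c(1)] N[OF c(1)] mn by (meson order_trans)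
        finally show ?thesis using \<epsilon> by simp
      qed
      then show "\<exists>M. \<forall>x\<in>ball z (R / 2). \<forall>m\<ge>M. \<forall>n\<ge>M. dist (f (r m) x) (f (r n) x) < \<epsilon>" by blast
    qed
    then have "uniformly_convergent_on (ball z (R / 2)) (\<lambda>n. f (r n))" by (rule Cauchy_uniformly_convergent)
    then have "uniform_limit (ball z (R / 2)) (\<lambda>n. f (r n)) g sequentially"
      unfolding uniformly_convergent_uniform_limit_iff g_def .
    then have "uniform_limit (ball z (R / 2)) (f \<circ> r) g sequentially" by (simp add: o_def)
    then show "\<exists>U. open U \<and> z \<in> U \<and> U \<subseteq> \<Omega> \<and> uniform_limit U (f \<circ> r) g sequentially"
      using R by (intro exI[of _ "ball z (R / 2)"]) auto
  qed
qed

lemma loc_uniform_limit_compact: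
  assumes L: "loc_uniform_limit \<Omega> s g" and C: "compact C" "C \<subseteq> \<Omega>"
  shows "uniform_limit C s g sequentially"
proof -
  obtain U where U: "\<And>z. z \<in> C \<Longrightarrow> open (U z) \<and> z \<in> U z \<and> uniform_limit (U z) s g sequentially"
    using L C(2) unfolding loc_uniform_limit_def by (metis subsetD)
  have "C \<subseteq> (\<Union>c\<in>C. U c)" using U by blast
  then obtain D where D: "D \<subseteq> C" "finite D" "C \<subseteq> (\<Union>c\<in>D. U c)"
    using compactE_image[OF C(1), of C U] U by blast
  show ?thesis
  proof (rule uniform_limitI)
    fix e :: real assume "e > 0"
    have "\<forall>\<^sub>F n in sequentially. \<forall>c\<in>D. \<forall>x\<in>U c. dist (s n x) (g x) < e"
      using D(1) U \<open>e > 0\<close> by (intro eventually_ball_finite[OF D(2)] ballI uniform_limitD) auto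
    then show "\<forall>\<^sub>F n in sequentially. \<forall>x\<in>C. dist (s n x) (g x) < e"
      by eventually_elim (use D(3) in blast)
  qed
qed

lemma loc_uniform_limit_continuous:
  assumes L: "loc_uniform_limit \<Omega> s g" and c: "\<And>n. continuous_on \<Omega> (s n)"
  shows "continuous_on \<Omega> g"
proof -
  have "isCont g z" if z: "z \<in> \<Omega>" for z
  proof -
    obtain U where U: "open U" "z \<in> U" "U \<subseteq> \<Omega>" "uniform_limit U s g sequentially"
      using L z unfolding loc_uniform_limit_def by blast
    have "continuous_on U g"
      by (rule uniform_limit_theorem[OF _ U(4)]) (use continuous_on_subset[OF c U(3)] in auto)
    then show ?thesis using U continuous_on_eq_continuous_at by blast
  qed
  then show ?thesis by (simp add: continuous_at_imp_continuous_on)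
qed

theorem theorem1:
  fixes \<Omega> :: "complex set" and p K M :: real and F :: "(complex \<Rightarrow> complex) set"
  assumes "open \<Omega>" and "connected \<Omega>" and "\<Omega> \<noteq> {}"
    and "p > 0" and "K \<ge> 1"
    and "\<And>f. f \<in> F \<Longrightarrow> quasiregular_on K \<Omega> f"
    and "\<And>f. f \<in> F \<Longrightarrow> set_integrable lebesgue \<Omega> (\<lambda>z. cmod (f z) powr p) \<and>
           (LINT z:\<Omega>|lebesgue. cmod (f z) powr p) powr (1 / p) \<le> M"
  shows "\<forall>s :: nat \<Rightarrow> complex \<Rightarrow> complex. range s \<subseteq> F \<longrightarrow>
           (\<exists>r g. strict_mono r \<and> loc_uniform_limit \<Omega> (s \<circ> r) g) \<and>
           (\<forall>r g. strict_mono r \<and> loc_uniform_limit \<Omega> (s \<circ> r) g \<longrightarrow> quasiregular_on K \<Omega> g)"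
proof (intro allI impI)
  fix s :: "nat \<Rightarrow> complex \<Rightarrow> complex"
  assume "range s \<subseteq> F"
  then have sF: "s n \<in> F" for n by auto
  define \<kappa> where "\<kappa> = K + 1 / K"
  have k0: "\<kappa> > 0" using assms(5) by (simp add: \<kappa>_def add_pos_pos)
  note \<Omega> = assms(1)
  have sc: "continuous_on \<Omega> (s n)" for n using assms(6)[OF sF[of n]] by (simp add: quasiregular_on_def)
  \<comment> \<open>Values of the maps outside the domain are unconstrained, so the estimates are
    run on the extensions by zero.\<close>
  define f where "f n = ext0 \<Omega> (s n)" for n
  have fs: "f n z = s n z" if "z \<in> \<Omega>" for n z using that by (simp add: f_def)
  have "\<exists>a b. qr \<kappa> \<Omega> (f n) a b" for n
    unfolding f_def \<kappa>_def using quasiregular_on_imp_qr[OF \<Omega> assms(5) assms(6)[OF sF]] by metis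
  then obtain a b where q: "\<And>n. qr \<kappa> \<Omega> (f n) (a n) (b n)" by metis
  have Lp: "integrable lborel (\<lambda>z. cmod (f n z) powr p)" "(LINT z|lborel. cmod (f n z) powr p) \<le> M powr p" for n
    unfolding f_def using Lp_bound_lborel[OF \<Omega> sc assms(4)] assms(7)[OF sF] by blast+
  have sup: "\<exists>B>0. \<forall>n. \<forall>x\<in>C. norm (f n x) \<le> B" if C: "compact C" "C \<subseteq> \<Omega>" for C
  proof -
    have "\<exists>B>0. \<forall>n\<in>UNIV. \<forall>x\<in>C. norm (f n x) \<le> B"
    proof (rule finite_subcover_bound[OF C(1)])
      fix z assume "z \<in> C"
      then obtain r where r: "r > 0" "sq z r \<subseteq> \<Omega>" using sq_subset_ball[OF \<Omega>] C(2) by blast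
      have r2: "r / 2 > 0" using r by simp
      obtain B where B: "\<And>\<Omega> f a b z. qr \<kappa> \<Omega> f a b \<Longrightarrow> sq z (r / 2) \<subseteq> \<Omega> \<Longrightarrow> integrable lborel (\<lambda>w. cmod (f w) powr p) \<Longrightarrow>
          (LINT w|lborel. cmod (f w) powr p) \<le> M powr p \<Longrightarrow> cmod (f z) \<le> B"
        using local_sup_bound[OF k0 assms(4) r2, of "M powr p"] by metis
      have "norm (f n x) \<le> B" if x: "x \<in> ball z (r / 2)" for n x
      proof (rule B[OF q _ Lp])
        have "x \<in> sq z (r / 2)" using x ball_subset_sq by blast
        then have "sq x (r / 2) \<subseteq> sq z r" by (intro sq_subset) (auto simp: mem_sq)
        then show "sq x (r / 2) \<subseteq> \<Omega>" using r(2) by blast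
      qed
      then show "\<exists>U B. open U \<and> z \<in> U \<and> (\<forall>n\<in>UNIV. \<forall>x\<in>U. norm (f n x) \<le> B)"
        using r2 by (intro exI[of _ "ball z (r / 2)"] exI[of _ B]) auto
    qed
    then show ?thesis by simp
  qed
  have equi: "\<exists>R>0. ball z R \<subseteq> \<Omega> \<and> (\<forall>\<epsilon>>0. \<exists>\<delta>>0. \<forall>n. \<forall>x\<in>ball z R. \<forall>y\<in>ball z R. norm (x - y) < \<delta> \<longrightarrow> norm (s n x - s n y) \<le> \<epsilon>)"
    if z: "z \<in> \<Omega>" for z
  proof -
    obtain r where r: "r > 0" "sq z r \<subseteq> \<Omega>" using sq_subset_ball[OF \<Omega> z] by blast
    define R where "R = r / 2"
    have R: "R > 0" "sq z (2 * R) \<subseteq> \<Omega>" using r by (auto simp: R_def)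
    obtain B where B: "B > 0" "\<And>n x. x \<in> sq z (2 * R) \<Longrightarrow> norm (f n x) \<le> B" using sup[OF compact_sq R(2)] by blast
    have bR: "ball z R \<subseteq> sq z R" "sq z R \<subseteq> \<Omega>" using ball_subset_sq sq_mono[of R "2 * R" z] R by auto
    have "\<exists>\<delta>>0. \<forall>n. \<forall>x\<in>ball z R. \<forall>y\<in>ball z R. norm (x - y) < \<delta> \<longrightarrow> norm (s n x - s n y) \<le> \<epsilon>" if \<epsilon>: "\<epsilon> > 0" for \<epsilon>
    proof -
      obtain \<delta> where \<delta>: "\<delta> > 0" "\<And>\<Omega> f a b x y. qr \<kappa> \<Omega> f a b \<Longrightarrow> sq z (2 * R) \<subseteq> \<Omega> \<Longrightarrow>
          (\<And>w. w \<in> sq z (2 * R) \<Longrightarrow> norm (f w) \<le> B) \<Longrightarrow> x \<in> sq z R \<Longrightarrow> y \<in> sq z R \<Longrightarrow> norm (x - y) < \<delta> \<Longrightarrow>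
          norm (f x - f y) \<le> \<epsilon>"
        using equicontinuity[OF k0 R(1) B(1) \<epsilon>, of z] by metis
      have "norm (s n x - s n y) \<le> \<epsilon>" if "x \<in> ball z R" "y \<in> ball z R" "norm (x - y) < \<delta>" for n x y
      proof -
        have sq: "x \<in> sq z R" "y \<in> sq z R" using that bR(1) by blast+
        then have "s n x = f n x" "s n y = f n y" using bR(2) fs by auto
        then show ?thesis using \<delta>(2)[OF q R(2) B(2) sq that(3)] by simp
      qed
      then show ?thesis using \<delta>(1) by blast
    qed
    then show ?thesis using R(1) bR by blast
  qed
  have pt: "\<exists>B>0. \<forall>n. norm (s n z) \<le> B" if "z \<in> \<Omega>" for z
    using sup[of "{z}"] that fs by auto
  obtain r g where rg: "strict_mono (r :: nat \<Rightarrow> nat)" "\<And>z. z \<in> \<Omega> \<Longrightarrow> \<exists>U. open U \<and> z \<in> U \<and> U \<subseteq> \<Omega> \<and> uniform_limit U (s \<circ> r) g sequentially"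
    using subsequence_locally_uniform[OF \<Omega> pt equi] by blast
  show "(\<exists>r g. strict_mono r \<and> loc_uniform_limit \<Omega> (s \<circ> r) g) \<and>
           (\<forall>r g. strict_mono r \<and> loc_uniform_limit \<Omega> (s \<circ> r) g \<longrightarrow> quasiregular_on K \<Omega> g)"
  proof (intro conjI allI impI)
    show "\<exists>r g. strict_mono r \<and> loc_uniform_limit \<Omega> (s \<circ> r) g"
      using rg unfolding loc_uniform_limit_def by blast
  next
    \<comment> \<open>Every locally uniform limit of a subsequence is treated here, not just the
      constructed one. Only its values on the domain are determined, hence the extension of g by
      zero below.\<close>
    fix r :: "nat \<Rightarrow> nat" and g
    assume "strict_mono r \<and> loc_uniform_limit \<Omega> (s \<circ> r) g"
    then have L: "loc_uniform_limit \<Omega> (s \<circ> r) g" by blast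
    have gc: "continuous_on \<Omega> g" by (rule loc_uniform_limit_continuous[OF L]) (simp add: sc)
    note ge = ext0_facts[OF \<Omega> gc]
    have U: "uniform_limit C (\<lambda>n. f (r n)) (ext0 \<Omega> g) sequentially" if C: "compact C" "C \<subseteq> \<Omega>" for C
    proof -
      have "uniform_limit C (s \<circ> r) g sequentially" by (rule loc_uniform_limit_compact[OF L C])
      moreover have "(s \<circ> r) n x = f (r n) x" "g x = ext0 \<Omega> g x" if "x \<in> C" for n x
        using that C(2) fs by auto
      ultimately show ?thesis by (subst uniform_limit_cong'[symmetric, where f = "s \<circ> r" and h = g]) auto
    qed
    have EB: "\<exists>B. \<forall>n. (LINT z:C|lborel. en (a (r n) z) (b (r n) z)) \<le> B" if "compact C" "C \<subseteq> \<Omega>" for C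
      using energy_bound_compact[OF \<Omega> k0 q sup that] by meson
    obtain a' b' where "qr \<kappa> \<Omega> (ext0 \<Omega> g) a' b'"
      using qr_closed[OF \<Omega> k0 q ge(2,1) U EB] by blast
    then show "quasiregular_on K \<Omega> g"
      unfolding \<kappa>_def by (rule qr_imp_quasiregular_on[OF \<Omega> assms(5) gc])
  qed
qed

end
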